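(* Let $P$ be a subsemigroup of a countable discrete group $G$. If $G \ltimes \widehat{E}$ or $G \ltimes \Omega_P$ is amenable, then $\lambda : C^*(P) \to C^*_{\lambda}(P)$ is an isomorphism if and only if $P$ is independent.
   Context: $C^*_\lambda(P)\subseteq \mathcal{L}(\ell^2 P)$ is the C*-algebra generated by the isometries $V_p\delta_x = \delta_{px}$ ($p\in P$). $S = I_l(P)$ is the inverse semigroup of partial bijections of $P$ generated by the maps $p : P \to pP$, $x\mapsto px$ ($p \in P$), together with the empty map $0$. Its semilattice of idempotents $E$ is identified with the set $\mathcal{J} = \{p_1^{-1}q_1\cdots p_n^{-1}q_nP : p_i,q_i\in P\}\cup\{\emptyset\}$ of constructible right ideals of $P$ under intersection (here $qX=\{qx : x\in X\}$, $p^{-1}X = \{y \in P : py\in X\}$). Put $S^\times = S\setminus\{0\}$; for $s \in S^\times$ there is a unique $\sigma(s)\in G$ with $s(x) = \sigma(s)x$ for all $x$ in the domain of $s$. $\widehat{E}$ is the space of non-zero maps $\chi : \mathcal{J}\to\{0,1\}$ with $\chi(X\cap Y) = \chi(X)\chi(Y)$ and $\chi(\emptyset) = 0$, with the topology of pointwise convergence. $G$ acts partially on $\widehat{E}$: $g\in G$ has domain $U_{g^{-1}} = \{\chi : \chi(\mathrm{dom}(s)) = 1 \text{ for some } s\in S^\times \text{ with } \sigma(s) = g\}$, and $(g.\chi)(X) = \chi(s^{-1}(X\cap\mathrm{im}(s)))$ for such $s$. $\Omega_P = \mathrm{Spec}(C^*_\lambda(P)\cap\ell^\infty(P))$ is identified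 with the closed $G$-invariant subspace of all $\chi\in\widehat{E}$ such that whenever $X,X_1,\dots,X_n\in\mathcal{J}$, $X = \bigcup_{i=1}^n X_i$ and $\chi(X) = 1$, then $\chi(X_i) = 1$ for some $i$. For a partial action of $G$ on $Y$ with domains $U_{g^{-1}}$, the transformation groupoid is $G\ltimes Y = \{(g,y) : y\in U_{g^{-1}}\}\subseteq G\times Y$ with $s(g,y) = y$, $r(g,y) = g.y$, $(g_1,g_2.y)(g_2,y) = (g_1g_2,y)$. Amenable means topologically amenable as an étale groupoid. $C^*(P) := C^*(S)$ is the universal C*-algebra for $*$-representations of $S$ by partial isometries in which $0\in S$ is sent to $0$. $\lambda : C^*(P)\to C^*_\lambda(P)$ is the canonical surjection, sending the generator corresponding to $p\in P$ to $V_p$. $P$ is called independent if $\mathcal{J}$ is independent: for all $X,X_1,\dots,X_n\in\mathcal{J}$, $X = \bigcup_{i=1}^n X_i$ implies $X = X_i$ for some $1\le i\le n$. *)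

theory Defs
  imports "HOL-Analysis.Analysis" "HOL-Algebra.Group"
begin

section \<open>Algebras of operators\<close>

text \<open>
  The Hilbert space of square-summable functions on a set \<open>X\<close>. The carrier consists of total
  functions vanishing outside \<open>X\<close>; the inner product is conjugate-linear in the first argument.
\<close>

definition ell2 :: "'x set \<Rightarrow> ('x \<Rightarrow> complex) set" where
  "ell2 X = {f. (\<forall>x. x \<notin> X \<longrightarrow> f x = 0) \<and> (\<lambda>x. (cmod (f x))\<^sup>2) summable_on X}"

definition ell2_inner :: "'x set \<Rightarrow> ('x \<Rightarrow> complex) \<Rightarrow> ('x \<Rightarrow> complex) \<Rightarrow> complex" where
  "ell2_inner X f g = (\<Sum>\<^sub>\<infinity>x\<in>X. cnj (f x) * g x)"

definition ell2_norm :: "'x set \<Rightarrow> ('x \<Rightarrow> complex) \<Rightarrow> real" where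
  "ell2_norm X f = sqrt (\<Sum>\<^sub>\<infinity>x\<in>X. (cmod (f x))\<^sup>2)"

definition delta :: "'x \<Rightarrow> 'x \<Rightarrow> complex" where
  "delta x = (\<lambda>y. if y = x then 1 else 0)"

type_synonym 'x ell2_op = "('x \<Rightarrow> complex) \<Rightarrow> ('x \<Rightarrow> complex)"

text \<open>
  Operators are extensional functions (equal to \<open>undefined\<close> off the Hilbert space), so that
  equality of functions is equality of operators.
\<close>

definition bounded_ops :: "'x set \<Rightarrow> 'x ell2_op set" where
  "bounded_ops X = {T \<in> ell2 X \<rightarrow>\<^sub>E ell2 X.
     (\<forall>f\<in>ell2 X. \<forall>g\<in>ell2 X. T (\<lambda>x. f x + g x) = (\<lambda>x. T f x + T g x)) \<and>
     (\<forall>c. \<forall>f\<in>ell2 X. T (\<lambda>x. c * f x) = (\<lambda>x. c * T f x)) \<and>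
     (\<exists>K. \<forall>f\<in>ell2 X. ell2_norm X (T f) \<le> K * ell2_norm X f)}"

definition op_norm :: "'x set \<Rightarrow> 'x ell2_op \<Rightarrow> real" where
  "op_norm X T = (SUP f\<in>{f \<in> ell2 X. ell2_norm X f \<le> 1}. ell2_norm X (T f))"

definition op_adjoint :: "'x set \<Rightarrow> 'x ell2_op \<Rightarrow> 'x ell2_op" where
  "op_adjoint X T = (THE S. S \<in> bounded_ops X \<and>
     (\<forall>f\<in>ell2 X. \<forall>g\<in>ell2 X. ell2_inner X (S f) g = ell2_inner X f (T g)))"

text \<open>The algebras need not be unital, hence there is no field for a unit.\<close>

record 'a star_algebra =
  elems :: "'a set"
  azero :: 'a
  aadd :: "'a \<Rightarrow> 'a \<Rightarrow> 'a"
  ascale :: "complex \<Rightarrow> 'a \<Rightarrow> 'a"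
  amult :: "'a \<Rightarrow> 'a \<Rightarrow> 'a"
  astar :: "'a \<Rightarrow> 'a"
  anorm :: "'a \<Rightarrow> real"

definition bounded_op_algebra :: "'x set \<Rightarrow> 'x ell2_op star_algebra" where
  "bounded_op_algebra X = \<lparr>
     elems = bounded_ops X,
     azero = (\<lambda>f\<in>ell2 X. \<lambda>x. 0),
     aadd = (\<lambda>S T. \<lambda>f\<in>ell2 X. \<lambda>x. S f x + T f x),
     ascale = (\<lambda>c T. \<lambda>f\<in>ell2 X. \<lambda>x. c * T f x),
     amult = (\<lambda>S T. \<lambda>f\<in>ell2 X. S (T f)),
     astar = op_adjoint X,
     anorm = op_norm X\<rparr>"

text \<open>The \<open>\<ell>\<^sup>\<infinity>\<close>-product of copies of \<open>A\<close> indexed by \<open>I\<close>.\<close>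

definition bounded_families :: "'i set \<Rightarrow> 'a star_algebra \<Rightarrow> ('i \<Rightarrow> 'a) star_algebra" where
  "bounded_families I A = \<lparr>
     elems = {a \<in> I \<rightarrow>\<^sub>E elems A. bdd_above ((\<lambda>i. anorm A (a i)) ` I)},
     azero = (\<lambda>i\<in>I. azero A),
     aadd = (\<lambda>a b. \<lambda>i\<in>I. aadd A (a i) (b i)),
     ascale = (\<lambda>c a. \<lambda>i\<in>I. ascale A c (a i)),
     amult = (\<lambda>a b. \<lambda>i\<in>I. amult A (a i) (b i)),
     astar = (\<lambda>a. \<lambda>i\<in>I. astar A (a i)),
     anorm = (\<lambda>a. SUP i\<in>I. anorm A (a i))\<rparr>"

definition closed_star_subalgebra :: "'a star_algebra \<Rightarrow> 'a set \<Rightarrow> bool" where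
  "closed_star_subalgebra A B \<longleftrightarrow>
     B \<subseteq> elems A \<and> azero A \<in> B \<and>
     (\<forall>a\<in>B. \<forall>b\<in>B. aadd A a b \<in> B) \<and>
     (\<forall>c. \<forall>a\<in>B. ascale A c a \<in> B) \<and>
     (\<forall>a\<in>B. \<forall>b\<in>B. amult A a b \<in> B) \<and>
     (\<forall>a\<in>B. astar A a \<in> B) \<and>
     (\<forall>a\<in>elems A.
        (\<forall>\<epsilon>>0. \<exists>b\<in>B. anorm A (aadd A a (ascale A (-1) b)) < \<epsilon>) \<longrightarrow> a \<in> B)"

definition generated_cstar_algebra :: "'a star_algebra \<Rightarrow> 'a set \<Rightarrow> 'a star_algebra" where
  "generated_cstar_algebra A M =
     A\<lparr>elems := \<Inter>{B. closed_star_subalgebra A B \<and> M \<subseteq> B}\<rparr>"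

definition star_hom :: "'a star_algebra \<Rightarrow> 'b star_algebra \<Rightarrow> ('a \<Rightarrow> 'b) \<Rightarrow> bool" where
  "star_hom A B \<phi> \<longleftrightarrow>
     \<phi> \<in> elems A \<rightarrow> elems B \<and>
     (\<forall>a\<in>elems A. \<forall>b\<in>elems A. \<phi> (aadd A a b) = aadd B (\<phi> a) (\<phi> b)) \<and>
     (\<forall>c. \<forall>a\<in>elems A. \<phi> (ascale A c a) = ascale B c (\<phi> a)) \<and>
     (\<forall>a\<in>elems A. \<forall>b\<in>elems A. \<phi> (amult A a b) = amult B (\<phi> a) (\<phi> b)) \<and>
     (\<forall>a\<in>elems A. \<phi> (astar A a) = astar B (\<phi> a))"

definition star_iso :: "'a star_algebra \<Rightarrow> 'b star_algebra \<Rightarrow> ('a \<Rightarrow> 'b) \<Rightarrow> bool" where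
  "star_iso A B \<phi> \<longleftrightarrow> star_hom A B \<phi> \<and> bij_betw \<phi> (elems A) (elems B)"


section \<open>The left inverse hull and its universal C*-algebra\<close>

definition subsemigroup :: "('g, 'b) monoid_scheme \<Rightarrow> 'g set \<Rightarrow> bool" where
  "subsemigroup G P \<longleftrightarrow> P \<subseteq> carrier G \<and> (\<forall>p\<in>P. \<forall>q\<in>P. p \<otimes>\<^bsub>G\<^esub> q \<in> P)"

text \<open>
  Partial bijections are represented by their graphs. Hence the inverse of \<open>s\<close> is \<open>s\<inverse>\<close>, its
  domain and image are \<open>Domain s\<close> and \<open>Range s\<close>, the empty map is \<open>{}\<close>, and the product
  \<open>s t\<close> (first \<open>t\<close>, then \<open>s\<close>) is \<open>t O s\<close>.
\<close>

definition left_mult :: "('g, 'b) monoid_scheme \<Rightarrow> 'g set \<Rightarrow> 'g \<Rightarrow> ('g \<times> 'g) set" where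
  "left_mult G P p = {(x, p \<otimes>\<^bsub>G\<^esub> x) | x. x \<in> P}"

inductive_set left_inverse_hull :: "('g, 'b) monoid_scheme \<Rightarrow> 'g set \<Rightarrow> ('g \<times> 'g) set set"
  for G :: "('g, 'b) monoid_scheme" and P :: "'g set" where
  gen: "p \<in> P \<Longrightarrow> left_mult G P p \<in> left_inverse_hull G P"
| zero: "{} \<in> left_inverse_hull G P"
| inverse: "s \<in> left_inverse_hull G P \<Longrightarrow> s\<inverse> \<in> left_inverse_hull G P"
| product: "s \<in> left_inverse_hull G P \<Longrightarrow> t \<in> left_inverse_hull G P \<Longrightarrow>
    t O s \<in> left_inverse_hull G P"

definition group_label :: "('g, 'b) monoid_scheme \<Rightarrow> ('g \<times> 'g) set \<Rightarrow> 'g" where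
  "group_label G s = (THE g. g \<in> carrier G \<and> (\<forall>(x, y)\<in>s. y = g \<otimes>\<^bsub>G\<^esub> x))"

definition partial_isometry_reps ::
    "('g \<times> 'g) set set \<Rightarrow> 'a star_algebra \<Rightarrow> (('g \<times> 'g) set \<Rightarrow> 'a) set" where
  "partial_isometry_reps S A = {\<rho> \<in> S \<rightarrow>\<^sub>E elems A.
     (\<forall>s\<in>S. amult A (amult A (\<rho> s) (astar A (\<rho> s))) (\<rho> s) = \<rho> s) \<and>
     (\<forall>s\<in>S. \<forall>t\<in>S. \<rho> (t O s) = amult A (\<rho> s) (\<rho> t)) \<and>
     (\<forall>s\<in>S. \<rho> (s\<inverse>) = astar A (\<rho> s)) \<and>
     \<rho> {} = azero A}"

text \<open>
  The universal C*-algebra is realised as the C*-algebra generated by the direct sum of all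
  representations on \<open>\<ell>\<^sup>2(\<nat>)\<close>. Representations are not required to be
  nondegenerate. For countable \<open>S\<close> (in particular for the left inverse hull of a subsemigroup of
  a countable group) these suffice: every representation of \<open>S\<close> is a direct sum of
  representations on separable Hilbert spaces, and a separable Hilbert space embeds into
  \<open>\<ell>\<^sup>2(\<nat>)\<close>, the representation being extended by \<open>0\<close> on the orthogonal complement.
\<close>

abbreviation reps_on_ell2_nat :: "('g \<times> 'g) set set \<Rightarrow> (('g \<times> 'g) set \<Rightarrow> nat ell2_op) set" where
  "reps_on_ell2_nat S \<equiv> partial_isometry_reps S (bounded_op_algebra (UNIV :: nat set))"

definition universal_gen ::
    "('g \<times> 'g) set set \<Rightarrow> ('g \<times> 'g) set \<Rightarrow> (('g \<times> 'g) set \<Rightarrow> nat ell2_op) \<Rightarrow> nat ell2_op" where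
  "universal_gen S s = (\<lambda>\<rho>\<in>reps_on_ell2_nat S. \<rho> s)"

definition universal_cstar_algebra ::
    "('g \<times> 'g) set set \<Rightarrow> ((('g \<times> 'g) set \<Rightarrow> nat ell2_op) \<Rightarrow> nat ell2_op) star_algebra" where
  "universal_cstar_algebra S =
     generated_cstar_algebra
       (bounded_families (reps_on_ell2_nat S) (bounded_op_algebra UNIV))
       (universal_gen S ` S)"


section \<open>The full and the reduced semigroup C*-algebra\<close>

abbreviation full_semigroup_cstar where
  "full_semigroup_cstar G P \<equiv> universal_cstar_algebra (left_inverse_hull G P)"

definition left_regular_isometry :: "('g, 'b) monoid_scheme \<Rightarrow> 'g set \<Rightarrow> 'g \<Rightarrow> 'g ell2_op" where
  "left_regular_isometry G P p = (\<lambda>f\<in>ell2 P. \<lambda>y.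
     if \<exists>x\<in>P. y = p \<otimes>\<^bsub>G\<^esub> x then f (inv\<^bsub>G\<^esub> p \<otimes>\<^bsub>G\<^esub> y) else 0)"

lemma delta_in_ell2: "x \<in> X \<Longrightarrow> delta x \<in> ell2 X"
proof -
  assume "x \<in> X"
  have "(\<lambda>y. (cmod (delta x y))\<^sup>2) summable_on X"
    by (rule finite_nonzero_values_imp_summable_on, rule finite_subset[of _ "{x}"])
      (auto simp: delta_def)
  with \<open>x \<in> X\<close> show ?thesis
    by (auto simp: ell2_def delta_def)
qed

lemma left_regular_isometry_delta:
  assumes "group G" "subsemigroup G P" "p \<in> P" "x \<in> P"
  shows "left_regular_isometry G P p (delta x) = delta (p \<otimes>\<^bsub>G\<^esub> x)"
proof -
  interpret group G by fact
  have sub: "P \<subseteq> carrier G" using assms(2) by (simp add: subsemigroup_def)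
  have "inv\<^bsub>G\<^esub> p \<otimes>\<^bsub>G\<^esub> (p \<otimes>\<^bsub>G\<^esub> z) = z" if "z \<in> P" for z
    using that sub assms(3) by (simp add: m_assoc [symmetric] subset_eq)
  moreover have "z = x" if "z \<in> P" "p \<otimes>\<^bsub>G\<^esub> x = p \<otimes>\<^bsub>G\<^esub> z" for z
    using that sub assms(3,4) by (simp add: subset_eq)
  ultimately show ?thesis
    using assms(4) delta_in_ell2[OF assms(4)]
    by (auto simp: left_regular_isometry_def delta_def fun_eq_iff)
qed

definition reduced_semigroup_cstar :: "('g, 'b) monoid_scheme \<Rightarrow> 'g set \<Rightarrow> 'g ell2_op star_algebra" where
  "reduced_semigroup_cstar G P =
     generated_cstar_algebra (bounded_op_algebra P) (left_regular_isometry G P ` P)"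

text \<open>
  The canonical map is the unique continuous *-homomorphism with the prescribed values on the
  generators. The explicit contractivity clause is automatic for *-homomorphisms between
  C*-algebras.
\<close>

definition canonical_hom where
  "canonical_hom G P = (THE \<phi>.
     \<phi> \<in> extensional (elems (full_semigroup_cstar G P)) \<and>
     star_hom (full_semigroup_cstar G P) (reduced_semigroup_cstar G P) \<phi> \<and>
     (\<forall>a\<in>elems (full_semigroup_cstar G P).
        anorm (reduced_semigroup_cstar G P) (\<phi> a) \<le> anorm (full_semigroup_cstar G P) a) \<and>
     (\<forall>p\<in>P. \<phi> (universal_gen (left_inverse_hull G P) (left_mult G P p)) =
        left_regular_isometry G P p))"


section \<open>Constructible right ideals\<close>

inductive_set constructible_ideals :: "('g, 'b) monoid_scheme \<Rightarrow> 'g set \<Rightarrow> 'g set set"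
  for G :: "('g, 'b) monoid_scheme" and P :: "'g set" where
  empty: "{} \<in> constructible_ideals G P"
| top: "P \<in> constructible_ideals G P"
| step: "p \<in> P \<Longrightarrow> q \<in> P \<Longrightarrow> X \<in> constructible_ideals G P \<Longrightarrow>
    {y \<in> P. p \<otimes>\<^bsub>G\<^esub> y \<in> (\<lambda>x. q \<otimes>\<^bsub>G\<^esub> x) ` X} \<in> constructible_ideals G P"

text \<open>
  Finite nonempty sets \<open>F\<close> play the role of the families \<open>X\<^sub>1, \<dots>, X\<^sub>n\<close> with \<open>n \<ge> 1\<close>.
\<close>

definition independent_semigroup :: "('g, 'b) monoid_scheme \<Rightarrow> 'g set \<Rightarrow> bool" where
  "independent_semigroup G P \<longleftrightarrow>
     (\<forall>X\<in>constructible_ideals G P. \<forall>F. F \<subseteq> constructible_ideals G P \<and> finite F \<and> F \<noteq> {} \<and>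
        X = \<Union>F \<longrightarrow> X \<in> F)"


section \<open>The spaces of characters\<close>

text \<open>Characters are extensional functions on the semilattice of constructible ideals.\<close>

type_synonym 'g ideal_char = "'g set \<Rightarrow> nat"

definition characters :: "('g, 'b) monoid_scheme \<Rightarrow> 'g set \<Rightarrow> 'g ideal_char set" where
  "characters G P = {\<omega> \<in> constructible_ideals G P \<rightarrow>\<^sub>E {0, 1}.
     (\<exists>X\<in>constructible_ideals G P. \<omega> X \<noteq> 0) \<and>
     (\<forall>X\<in>constructible_ideals G P. \<forall>Y\<in>constructible_ideals G P. \<omega> (X \<inter> Y) = \<omega> X * \<omega> Y) \<and>
     \<omega> {} = 0}"

definition character_space :: "('g, 'b) monoid_scheme \<Rightarrow> 'g set \<Rightarrow> 'g ideal_char topology" where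
  "character_space G P =
     subtopology (product_topology (\<lambda>_. discrete_topology {0, 1}) (constructible_ideals G P))
       (characters G P)"

definition Omega_space :: "('g, 'b) monoid_scheme \<Rightarrow> 'g set \<Rightarrow> 'g ideal_char topology" where
  "Omega_space G P = subtopology (character_space G P)
     {\<omega>. \<forall>X\<in>constructible_ideals G P. \<forall>F. F \<subseteq> constructible_ideals G P \<and> finite F \<and> F \<noteq> {} \<and>
        X = \<Union>F \<and> \<omega> X = 1 \<longrightarrow> (\<exists>Y\<in>F. \<omega> Y = 1)}"

definition implements_at ::
    "('g, 'b) monoid_scheme \<Rightarrow> 'g set \<Rightarrow> 'g \<Rightarrow> 'g ideal_char \<Rightarrow> ('g \<times> 'g) set \<Rightarrow> bool" where
  "implements_at G P g \<omega> s \<longleftrightarrow>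
     s \<in> left_inverse_hull G P \<and> s \<noteq> {} \<and> group_label G s = g \<and> \<omega> (Domain s) = 1"

text \<open>\<open>act_domain G P g\<close> is the domain of the partial homeomorphism given by \<open>g\<close>, that is \<open>U\<close>
  indexed by the inverse of \<open>g\<close>.\<close>

definition act_domain :: "('g, 'b) monoid_scheme \<Rightarrow> 'g set \<Rightarrow> 'g \<Rightarrow> 'g ideal_char set" where
  "act_domain G P g = {\<omega> \<in> characters G P. \<exists>s. implements_at G P g \<omega> s}"

definition act :: "('g, 'b) monoid_scheme \<Rightarrow> 'g set \<Rightarrow> 'g \<Rightarrow> 'g ideal_char \<Rightarrow> 'g ideal_char" where
  "act G P g \<omega> = (let s = (SOME s. implements_at G P g \<omega> s) in
     (\<lambda>X\<in>constructible_ideals G P. \<omega> (s\<inverse> `` (X \<inter> Range s))))"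


section \<open>Transformation groupoids and amenability\<close>

record ('a, 'u) top_groupoid =
  arrows :: "'a topology"
  units :: "'u topology"
  src :: "'a \<Rightarrow> 'u"
  rng :: "'a \<Rightarrow> 'u"
  gcomp :: "'a \<Rightarrow> 'a \<Rightarrow> 'a"

definition transformation_groupoid ::
    "('g, 'b) monoid_scheme \<Rightarrow> ('g \<Rightarrow> 'y set) \<Rightarrow> ('g \<Rightarrow> 'y \<Rightarrow> 'y) \<Rightarrow> 'y topology \<Rightarrow>
     ('g \<times> 'y, 'y) top_groupoid" where
  "transformation_groupoid G D \<alpha> Y = \<lparr>
     arrows = subtopology (prod_topology (discrete_topology (carrier G)) Y) {(g, y). y \<in> D g},
     units = Y,
     src = (\<lambda>(g, y). y),
     rng = (\<lambda>(g, y). \<alpha> g y),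
     gcomp = (\<lambda>(g1, y1) (g2, y2). (g1 \<otimes>\<^bsub>G\<^esub> g2, y2))\<rparr>"

text \<open>
  Topological amenability of a locally compact Hausdorff etale groupoid (Anantharaman-Delaroche
  and Renault; Brown and Ozawa): there is a net of nonnegative functions in \<open>C\<^sub>c\<close> whose sums over
  the range fibres tend to \<open>1\<close> uniformly on compact sets of units, and which are asymptotically
  invariant under left translation, uniformly on compact sets of arrows. The net is indexed by
  the compact sets and the tolerance. The infinite sums have finite support, because the range
  fibres are closed and discrete.
\<close>

definition etale_amenable :: "('a, 'u) top_groupoid \<Rightarrow> bool" where
  "etale_amenable \<G> \<longleftrightarrow>
     (\<forall>L K. \<forall>\<epsilon>>0. compactin (units \<G>) L \<and> compactin (arrows \<G>) K \<longrightarrow>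
       (\<exists>f :: 'a \<Rightarrow> real.
          continuous_map (arrows \<G>) euclideanreal f \<and>
          (\<forall>\<gamma>\<in>topspace (arrows \<G>). f \<gamma> \<ge> 0) \<and>
          (\<exists>C. compactin (arrows \<G>) C \<and> (\<forall>\<gamma>\<in>topspace (arrows \<G>) - C. f \<gamma> = 0)) \<and>
          (\<forall>x\<in>L. \<bar>(\<Sum>\<^sub>\<infinity>\<beta>\<in>{\<beta>\<in>topspace (arrows \<G>). rng \<G> \<beta> = x}. f \<beta>) - 1\<bar> < \<epsilon>) \<and>
          (\<forall>\<gamma>\<in>K. (\<Sum>\<^sub>\<infinity>\<beta>\<in>{\<beta>\<in>topspace (arrows \<G>). rng \<G> \<beta> = src \<G> \<gamma>}.
                     \<bar>f (gcomp \<G> \<gamma> \<beta>) - f \<beta>\<bar>) < \<epsilon>)))"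

end

theory Submission
  imports Defs
begin

text \<open>
  If \<open>X\<close> is the union of finitely many constructible ideals \<open>X\<^sub>i \<noteq> X\<close>, then the product of the
  differences of the idempotents of \<open>X\<close> and of the \<open>X\<^sub>i\<close> vanishes on \<open>\<ell>\<^sup>2 P\<close>, but not in the
  representation of the inverse hull on the nonempty constructible ideals. Hence injectivity of the
  canonical map forces independence, without amenability.

  Conversely, it suffices to bound the norm of a finite linear combination in an arbitrary
  representation \<open>\<rho>\<close> by its norm in the regular representation. Independence makes the indicator
  functions of nonempty constructible ideals linearly independent, so \<open>\<rho>\<close> extends to a functional
  calculus for simple functions on \<open>P\<close>. Splitting vectors along the atoms of a finite family of ideals
  shows that \<open>\<rho>\<close> tensored with the regular representation of the group is dominated by the regular
  representation of \<open>P\<close>. Evaluating the functions provided by amenability at the characters of points of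
  \<open>P\<close> and making them simple gives, via the functional calculus applied to their square roots, almost
  isometric maps which almost intertwine \<open>\<rho>\<close> with this tensor product. No disintegration of \<open>\<rho>\<close> or
  comparison of the two spaces of characters is needed.
\<close>

section \<open>Square-summable functions\<close>

text \<open>A bound over all representations suffices because finite combinations are dense in the
  universal algebra: once the canonical map is isometric on them it is isometric everywhere, and
  completeness makes its image closed. Two features shape the estimate. The representation
  \<open>\<rho>\<close> may be degenerate, so the constant function 1 acts as the projection
  \<open>proj P\<close> rather than as the identity operator. And \<open>\<rho>\<close> tensored
  with the regular representation of the group is controlled only on combinations of vectors
  \<rho>(s) z placed at the group coordinate that labels s. Hence the functions at coordinate g must
  be supported in the ranges of finitely many elements of the hull with label g; this is what
  compact support on the groupoid provides. Square roots are taken because a family of functions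
  whose squares sum to nearly 1 acts as a nearly isometric map, and (sqrt a - sqrt b)^2 \<le> |a -
  b| turns invariance of sums of absolute values into invariance in the Hilbert norm.\<close>

lemma L2_set_sq: "(L2_set f A)\<^sup>2 = (\<Sum>i\<in>A. (f i)\<^sup>2)"
  by (simp add: L2_set_def sum_nonneg)

lemma ell2_outside: "f \<in> ell2 X \<Longrightarrow> x \<notin> X \<Longrightarrow> f x = 0"
  by (simp add: ell2_def)

lemma ell2_summable: "f \<in> ell2 X \<Longrightarrow> (\<lambda>x. (cmod (f x))\<^sup>2) summable_on X"
  by (simp add: ell2_def)

lemma ell2_norm_nonneg [simp]: "0 \<le> ell2_norm X f"
  by (simp add: ell2_norm_def infsum_nonneg)

lemma ell2_norm_sq: "(ell2_norm X f)\<^sup>2 = (\<Sum>\<^sub>\<infinity>x\<in>X. (cmod (f x))\<^sup>2)"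
  by (simp add: ell2_norm_def infsum_nonneg)

lemma L2_set_le_ell2_norm:
  assumes "f \<in> ell2 X" "finite F" "F \<subseteq> X"
  shows "L2_set (\<lambda>x. cmod (f x)) F \<le> ell2_norm X f"
proof -
  have "(\<Sum>x\<in>F. (cmod (f x))\<^sup>2) \<le> (\<Sum>\<^sub>\<infinity>x\<in>X. (cmod (f x))\<^sup>2)"
    using assms by (intro finite_sum_le_infsum ell2_summable) auto
  then show ?thesis by (simp add: L2_set_def ell2_norm_def)
qed

text \<open>Square-summability and the norm bound both follow from the finite partial sums. Later
  estimates are therefore made for \<open>L2_set\<close> on finite sets, where the triangle and
  Cauchy-Schwarz inequalities are available.\<close>

lemma ell2_bound:
  assumes "\<And>x. x \<notin> X \<Longrightarrow> f x = 0" "0 \<le> C"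
    and le: "\<And>F. finite F \<Longrightarrow> F \<subseteq> X \<Longrightarrow> L2_set (\<lambda>x. cmod (f x)) F \<le> C"
  shows "f \<in> ell2 X" "ell2_norm X f \<le> C"
proof -
  have *: "(\<Sum>x\<in>F. (cmod (f x))\<^sup>2) \<le> C\<^sup>2" if "finite F" "F \<subseteq> X" for F
    using power_mono[OF le[OF that] L2_set_nonneg, of 2] by (simp add: L2_set_sq)
  have s: "(\<lambda>x. (cmod (f x))\<^sup>2) summable_on X"
    by (rule nonneg_bdd_above_summable_on) (auto intro!: bdd_aboveI2[of _ _ "C\<^sup>2"] *)
  then show "f \<in> ell2 X" using assms(1) by (simp add: ell2_def)
  have "(\<Sum>\<^sub>\<infinity>x\<in>X. (cmod (f x))\<^sup>2) \<le> C\<^sup>2"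
    by (rule infsum_le_finite_sums[OF s *])
  then show "ell2_norm X f \<le> C"
    using assms(2) by (simp add: ell2_norm_def real_le_lsqrt)
qed

lemma cmod_le_ell2_norm:
  assumes "f \<in> ell2 X" shows "cmod (f x) \<le> ell2_norm X f"
proof (cases "x \<in> X")
  case True
  then show ?thesis using L2_set_le_ell2_norm[OF assms, of "{x}"] by (simp add: L2_set_def)
qed (use ell2_outside[OF assms] in simp)

lemma ell2_zero [simp]: "(\<lambda>x. 0) \<in> ell2 X" "ell2_norm X (\<lambda>x. 0) = 0"
  by (auto simp: ell2_def ell2_norm_def)

lemma ell2_norm_eq_0:
  assumes "f \<in> ell2 X" "ell2_norm X f = 0" shows "f = (\<lambda>x. 0)"
  using cmod_le_ell2_norm[OF assms(1)] assms(2) by auto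

lemma ell2_add:
  assumes "f \<in> ell2 X" "g \<in> ell2 X"
  shows "(\<lambda>x. f x + g x) \<in> ell2 X" "ell2_norm X (\<lambda>x. f x + g x) \<le> ell2_norm X f + ell2_norm X g"
proof -
  have "L2_set (\<lambda>x. cmod (f x + g x)) F \<le> ell2_norm X f + ell2_norm X g" if "finite F" "F \<subseteq> X" for F
  proof -
    have "L2_set (\<lambda>x. cmod (f x + g x)) F \<le> L2_set (\<lambda>x. cmod (f x) + cmod (g x)) F"
      by (intro L2_set_mono norm_triangle_ineq) auto
    also have "\<dots> \<le> L2_set (\<lambda>x. cmod (f x)) F + L2_set (\<lambda>x. cmod (g x)) F"
      by (rule L2_set_triangle_ineq)
    also have "\<dots> \<le> ell2_norm X f + ell2_norm X g"
      using assms that by (intro add_mono L2_set_le_ell2_norm)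
    finally show ?thesis .
  qed
  moreover have "f x + g x = 0" if "x \<notin> X" for x using assms that by (simp add: ell2_outside)
  ultimately show "(\<lambda>x. f x + g x) \<in> ell2 X"
    "ell2_norm X (\<lambda>x. f x + g x) \<le> ell2_norm X f + ell2_norm X g"
    using ell2_bound[of X "\<lambda>x. f x + g x" "ell2_norm X f + ell2_norm X g"] by auto
qed

lemma ell2_scale:
  assumes "f \<in> ell2 X"
  shows "(\<lambda>x. c * f x) \<in> ell2 X" "ell2_norm X (\<lambda>x. c * f x) = cmod c * ell2_norm X f"
proof -
  show "(\<lambda>x. c * f x) \<in> ell2 X" using assms
    by (auto simp: ell2_def norm_mult power_mult_distrib intro: summable_on_cmult_right)
  show "ell2_norm X (\<lambda>x. c * f x) = cmod c * ell2_norm X f"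
    by (simp add: ell2_norm_def norm_mult power_mult_distrib infsum_cmult_right' real_sqrt_mult)
qed

lemma ell2_diff:
  assumes "f \<in> ell2 X" "g \<in> ell2 X"
  shows "(\<lambda>x. f x - g x) \<in> ell2 X" "ell2_norm X (\<lambda>x. f x - g x) \<le> ell2_norm X f + ell2_norm X g"
  using ell2_add[OF assms(1) ell2_scale(1)[OF assms(2), of "-1"]] ell2_scale(2)[OF assms(2), of "-1"]
  by auto

lemma ell2_norm_minus_commute: "ell2_norm X (\<lambda>x. f x - g x) = ell2_norm X (\<lambda>x. g x - f x)"
  by (simp add: ell2_norm_def norm_minus_commute)

lemma ell2_norm_diff_triangle:
  assumes "f \<in> ell2 X" "g \<in> ell2 X" "h \<in> ell2 X"
  shows "ell2_norm X (\<lambda>x. f x - h x) \<le> ell2_norm X (\<lambda>x. f x - g x) + ell2_norm X (\<lambda>x. g x - h x)"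
  using ell2_add(2)[OF ell2_diff(1)[OF assms(1,2)] ell2_diff(1)[OF assms(2,3)]] by simp

lemma ell2_sum:
  assumes "\<And>i. i \<in> I \<Longrightarrow> f i \<in> ell2 X"
  shows "(\<lambda>x. \<Sum>i\<in>I. f i x) \<in> ell2 X"
    and "ell2_norm X (\<lambda>x. \<Sum>i\<in>I. f i x) \<le> (\<Sum>i\<in>I. ell2_norm X (f i))"
proof -
  have "(\<lambda>x. \<Sum>i\<in>I. f i x) \<in> ell2 X \<and>
      ell2_norm X (\<lambda>x. \<Sum>i\<in>I. f i x) \<le> (\<Sum>i\<in>I. ell2_norm X (f i))"
    using assms
  proof (induction I rule: infinite_finite_induct)
    case (insert i I)
    then show ?case
      using ell2_add[of "f i" X "\<lambda>x. \<Sum>i\<in>I. f i x"] by auto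
  qed auto
  then show "(\<lambda>x. \<Sum>i\<in>I. f i x) \<in> ell2 X"
    "ell2_norm X (\<lambda>x. \<Sum>i\<in>I. f i x) \<le> (\<Sum>i\<in>I. ell2_norm X (f i))" by auto
qed

text \<open>Fatou's lemma for counting measure: a finite partial norm is continuous in its finitely
  many values, so a bound valid from \<open>N\<close> on survives the pointwise limit. Completeness
  of the bounded operators rests on it.\<close>

lemma ell2_pointwise_limit:
  assumes lim: "\<And>x. (\<lambda>n. f n x) \<longlonglongrightarrow> g x"
    and f: "\<And>n. f n \<in> ell2 X" and C: "\<And>n. n \<ge> N \<Longrightarrow> ell2_norm X (f n) \<le> C"
  shows "g \<in> ell2 X" "ell2_norm X g \<le> C"
proof -
  have "0 \<le> C" using C[of N] ell2_norm_nonneg[of X "f N"] by linarith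
  have z: "g x = 0" if "x \<notin> X" for x
  proof -
    have "(\<lambda>n. f n x) = (\<lambda>n. 0)" using ell2_outside[OF f that] by auto
    then show ?thesis using lim[of x] LIMSEQ_unique[OF tendsto_const] by metis
  qed
  have b: "L2_set (\<lambda>x. cmod (g x)) F \<le> C" if F: "finite F" "F \<subseteq> X" for F
  proof (rule LIMSEQ_le_const2)
    show "(\<lambda>n. L2_set (\<lambda>x. cmod (f n x)) F) \<longlonglongrightarrow> L2_set (\<lambda>x. cmod (g x)) F"
      unfolding L2_set_def by (intro tendsto_intros lim)
    show "\<exists>N. \<forall>n\<ge>N. L2_set (\<lambda>x. cmod (f n x)) F \<le> C"
      using order_trans[OF L2_set_le_ell2_norm[OF f F] C] by blast
  qed
  show "g \<in> ell2 X" "ell2_norm X g \<le> C"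
    using ell2_bound[of X g C] z \<open>0 \<le> C\<close> b by auto
qed

section \<open>Inner products, the Cauchy-Schwarz inequality and truncation\<close>

lemma inner_summable:
  assumes "f \<in> ell2 X" "g \<in> ell2 X"
  shows "(\<lambda>x. norm (cnj (f x) * g x)) summable_on X"
proof (rule Infinite_Sum.abs_summable_on_comparison_test)
  have "(\<lambda>x. (cmod (f x))\<^sup>2 + (cmod (g x))\<^sup>2) summable_on X"
    using assms by (intro summable_on_add ell2_summable)
  then show "(\<lambda>x. norm ((cmod (f x))\<^sup>2 + (cmod (g x))\<^sup>2)) summable_on X"
    by simp
  show "norm (cnj (f x) * g x) \<le> norm ((cmod (f x))\<^sup>2 + (cmod (g x))\<^sup>2)" for x
  proof -
    have "2 * (cmod (f x) * cmod (g x)) \<le> (cmod (f x))\<^sup>2 + (cmod (g x))\<^sup>2"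
      using sum_squares_bound[of "cmod (f x)" "cmod (g x)"] by (simp add: mult_ac)
    moreover have "0 \<le> cmod (f x) * cmod (g x)" by simp
    ultimately have "cmod (f x) * cmod (g x) \<le> (cmod (f x))\<^sup>2 + (cmod (g x))\<^sup>2" by linarith
    then show ?thesis by (simp add: norm_mult)
  qed
qed

lemma inner_summable':
  assumes "f \<in> ell2 X" "g \<in> ell2 X"
  shows "(\<lambda>x. cnj (f x) * g x) summable_on X"
  using abs_summable_summable[OF inner_summable[OF assms]] .

lemma inner_add_right:
  assumes "f \<in> ell2 X" "g \<in> ell2 X" "h \<in> ell2 X"
  shows "ell2_inner X f (\<lambda>x. g x + h x) = ell2_inner X f g + ell2_inner X f h"
  using inner_summable'[OF assms(1,2)] inner_summable'[OF assms(1,3)]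
  by (simp add: ell2_inner_def distrib_left infsum_add)

lemma inner_scale_right: "ell2_inner X f (\<lambda>x. c * g x) = c * ell2_inner X f g"
  by (simp add: ell2_inner_def infsum_cmult_right'[symmetric] mult_ac)

lemma inner_cnj: "ell2_inner X g f = cnj (ell2_inner X f g)"
  by (simp add: ell2_inner_def infsum_cnj[symmetric] mult.commute del: infsum_cnj)

lemma inner_add_left:
  assumes "f \<in> ell2 X" "g \<in> ell2 X" "h \<in> ell2 X"
  shows "ell2_inner X (\<lambda>x. g x + h x) f = ell2_inner X g f + ell2_inner X h f"
  using inner_add_right[OF assms] by (subst (1 2 3) inner_cnj) simp

lemma inner_scale_left: "ell2_inner X (\<lambda>x. c * g x) f = cnj c * ell2_inner X g f"
  by (subst (1 2) inner_cnj) (simp add: inner_scale_right)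

lemma inner_zero [simp]: "ell2_inner X f (\<lambda>x. 0) = 0" "ell2_inner X (\<lambda>x. 0) f = 0"
  by (simp_all add: ell2_inner_def)

lemma inner_sum_right:
  assumes "f \<in> ell2 X" "\<And>i. i \<in> I \<Longrightarrow> g i \<in> ell2 X"
  shows "ell2_inner X f (\<lambda>x. \<Sum>i\<in>I. g i x) = (\<Sum>i\<in>I. ell2_inner X f (g i))"
  using assms
proof (induction I rule: infinite_finite_induct)
  case (insert i I)
  then show ?case
    using inner_add_right[of f X "g i" "\<lambda>x. \<Sum>i\<in>I. g i x"] ell2_sum(1)[of I g X] by auto
qed auto

lemma inner_sum_left:
  assumes "f \<in> ell2 X" "\<And>i. i \<in> I \<Longrightarrow> g i \<in> ell2 X"
  shows "ell2_inner X (\<lambda>x. \<Sum>i\<in>I. g i x) f = (\<Sum>i\<in>I. ell2_inner X (g i) f)"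
proof -
  have "ell2_inner X (\<lambda>x. \<Sum>i\<in>I. g i x) f = cnj (\<Sum>i\<in>I. ell2_inner X f (g i))"
    by (subst inner_cnj) (simp add: inner_sum_right[OF assms])
  also have "\<dots> = (\<Sum>i\<in>I. ell2_inner X (g i) f)"
    by (simp add: inner_cnj[of X _ f])
  finally show ?thesis .
qed

lemma inner_self: "f \<in> ell2 X \<Longrightarrow> ell2_inner X f f = of_real ((ell2_norm X f)\<^sup>2)"
proof -
  assume "f \<in> ell2 X"
  then have "((\<lambda>x. (cmod (f x))\<^sup>2) has_sum (ell2_norm X f)\<^sup>2) X"
    by (simp add: ell2_norm_sq ell2_summable)
  then have "((\<lambda>x. complex_of_real ((cmod (f x))\<^sup>2)) has_sum of_real ((ell2_norm X f)\<^sup>2)) X"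
    by (rule has_sum_of_real)
  moreover have "complex_of_real ((cmod (f x))\<^sup>2) = cnj (f x) * f x" for x
    by (subst complex_norm_square) (rule mult.commute)
  ultimately have "((\<lambda>x. cnj (f x) * f x) has_sum of_real ((ell2_norm X f)\<^sup>2)) X" by simp
  then show ?thesis unfolding ell2_inner_def by (rule infsumI)
qed

lemma Cauchy_Schwarz_ell2:
  assumes "f \<in> ell2 X" "g \<in> ell2 X"
  shows "cmod (ell2_inner X f g) \<le> ell2_norm X f * ell2_norm X g"
proof -
  have "cmod (ell2_inner X f g) \<le> (\<Sum>\<^sub>\<infinity>x\<in>X. cmod (cnj (f x) * g x))"
    unfolding ell2_inner_def by (rule norm_infsum_bound[OF inner_summable[OF assms]])
  also have "\<dots> \<le> ell2_norm X f * ell2_norm X g"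
  proof (rule infsum_le_finite_sums[OF inner_summable[OF assms]])
    fix F assume F: "finite F" "F \<subseteq> X"
    have "(\<Sum>x\<in>F. cmod (cnj (f x) * g x)) = (\<Sum>x\<in>F. \<bar>cmod (f x)\<bar> * \<bar>cmod (g x)\<bar>)"
      by (simp add: norm_mult)
    also have "\<dots> \<le> L2_set (\<lambda>x. cmod (f x)) F * L2_set (\<lambda>x. cmod (g x)) F"
      by (rule L2_set_mult_ineq)
    also have "\<dots> \<le> ell2_norm X f * ell2_norm X g"
      using assms F by (intro mult_mono L2_set_le_ell2_norm) auto
    finally show "(\<Sum>x\<in>F. cmod (cnj (f x) * g x)) \<le> ell2_norm X f * ell2_norm X g" .
  qed
  finally show ?thesis .
qed

lemma inner_delta: "x \<in> X \<Longrightarrow> ell2_inner X (delta x) f = f x"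
proof -
  assume "x \<in> X"
  then have "ell2_inner X (delta x) f = (\<Sum>\<^sub>\<infinity>y\<in>{x}. cnj (delta x y) * f y)"
    unfolding ell2_inner_def by (intro infsum_cong_neutral) (auto simp: delta_def)
  then show ?thesis by (simp add: delta_def)
qed

text \<open>Testing against \<open>delta x\<close> reads off the coordinate at a point of
  \<open>X\<close>; outside \<open>X\<close> both functions vanish.\<close>

lemma ell2_eqI:
  assumes "f \<in> ell2 X" "g \<in> ell2 X" "\<And>h. h \<in> ell2 X \<Longrightarrow> ell2_inner X h f = ell2_inner X h g"
  shows "f = g"
proof
  fix x
  show "f x = g x"
    using assms(3)[OF delta_in_ell2, of x] inner_delta[of x X] ell2_outside[OF assms(1), of x]
      ell2_outside[OF assms(2), of x] by (cases "x \<in> X") auto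
qed

definition truncate :: "'x set \<Rightarrow> ('x \<Rightarrow> complex) \<Rightarrow> 'x \<Rightarrow> complex" where
  "truncate F f = (\<lambda>x. if x \<in> F then f x else 0)"

lemma ell2_norm_finite_support:
  assumes "finite F" "F \<subseteq> X" "\<And>x. x \<notin> F \<Longrightarrow> f x = 0"
  shows "f \<in> ell2 X" "ell2_norm X f = L2_set (\<lambda>x. cmod (f x)) F"
proof -
  show 1: "f \<in> ell2 X"
  proof -
    have "{x \<in> X. (cmod (f x))\<^sup>2 \<noteq> 0} \<subseteq> F" using assms(3) by auto
    then have "finite {x \<in> X. (cmod (f x))\<^sup>2 \<noteq> 0}" using finite_subset assms(1) by blast
    moreover have "f x = 0" if "x \<notin> X" for x using that assms(2,3) by blast
    ultimately show ?thesis
      using finite_nonzero_values_imp_summable_on[of X "\<lambda>x. (cmod (f x))\<^sup>2"]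
      by (simp add: ell2_def)
  qed
  have "(\<Sum>\<^sub>\<infinity>x\<in>X. (cmod (f x))\<^sup>2) = (\<Sum>\<^sub>\<infinity>x\<in>F. (cmod (f x))\<^sup>2)"
    using assms by (intro infsum_cong_neutral) auto
  then show "ell2_norm X f = L2_set (\<lambda>x. cmod (f x)) F"
    using assms by (simp add: ell2_norm_def L2_set_def)
qed

lemma truncate_eq_sum:
  "finite F \<Longrightarrow> truncate F f = (\<lambda>y. \<Sum>x\<in>F. f x * delta x y)"
  by (auto simp: truncate_def delta_def sum.delta if_distrib[of "\<lambda>z. _ * z"] cong: if_cong)

text \<open>Density of the finitely supported vectors: the squared error is the tail of the norm
  series over \<open>X - F\<close>.\<close>

lemma truncate_approx:
  assumes "f \<in> ell2 X" "\<epsilon> > 0"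
  obtains F where "finite F" "F \<subseteq> X" "ell2_norm X (\<lambda>x. f x - truncate F f x) \<le> \<epsilon>"
proof -
  define h where "h x = (cmod (f x))\<^sup>2" for x
  have s: "h summable_on X" using ell2_summable[OF assms(1)] by (simp add: h_def[abs_def])
  obtain F where F: "finite F" "F \<subseteq> X" "dist (sum h F) (infsum h X) \<le> \<epsilon>\<^sup>2"
    using infsum_finite_approximation[OF s, of "\<epsilon>\<^sup>2"] assms(2) by auto
  have sF: "h summable_on F" using F by simp
  have "(\<Sum>\<^sub>\<infinity>x\<in>X. (cmod (f x - truncate F f x))\<^sup>2) = infsum h (X - F)"
    by (rule infsum_cong_neutral) (auto simp: truncate_def h_def)
  also have "\<dots> = infsum h X - infsum h F"
    using F s by (intro infsum_Diff) auto
  also have "\<dots> \<le> \<epsilon>\<^sup>2" using F by (auto simp: dist_real_def)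
  finally have "ell2_norm X (\<lambda>x. f x - truncate F f x) \<le> \<epsilon>"
    unfolding ell2_norm_def using assms(2) by (simp add: real_le_lsqrt)
  with F that show thesis by blast
qed

section \<open>Bounded operators\<close>

lemma bounded_ops_in: "T \<in> bounded_ops X \<Longrightarrow> f \<in> ell2 X \<Longrightarrow> T f \<in> ell2 X"
  by (auto simp: bounded_ops_def)

lemma bounded_ops_add:
  "T \<in> bounded_ops X \<Longrightarrow> f \<in> ell2 X \<Longrightarrow> g \<in> ell2 X \<Longrightarrow> T (\<lambda>x. f x + g x) = (\<lambda>x. T f x + T g x)"
  by (auto simp: bounded_ops_def)

lemma bounded_ops_scale:
  "T \<in> bounded_ops X \<Longrightarrow> f \<in> ell2 X \<Longrightarrow> T (\<lambda>x. c * f x) = (\<lambda>x. c * T f x)"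
  by (auto simp: bounded_ops_def)

lemma bounded_ops_zero: "T \<in> bounded_ops X \<Longrightarrow> T (\<lambda>x. 0) = (\<lambda>x. 0)"
  using bounded_ops_scale[of T X "\<lambda>x. 0" 0] by simp

lemma bounded_ops_diff:
  assumes "T \<in> bounded_ops X" "f \<in> ell2 X" "g \<in> ell2 X"
  shows "T (\<lambda>x. f x - g x) = (\<lambda>x. T f x - T g x)"
  using bounded_ops_add[OF assms(1,2) ell2_scale(1)[OF assms(3)], of "-1"]
    bounded_ops_scale[OF assms(1,3), of "-1"] by simp

lemma bounded_ops_sum:
  assumes "T \<in> bounded_ops X" "\<And>i. i \<in> I \<Longrightarrow> f i \<in> ell2 X"
  shows "T (\<lambda>x. \<Sum>i\<in>I. f i x) = (\<lambda>x. \<Sum>i\<in>I. T (f i) x)"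
  using assms(2)
proof (induction I rule: infinite_finite_induct)
  case (insert i I)
  then show ?case
    using bounded_ops_add[OF assms(1), of "f i" "\<lambda>x. \<Sum>i\<in>I. f i x"] ell2_sum(1)[of I f X] by auto
qed (use bounded_ops_zero[OF assms(1)] in auto)

lemma bounded_ops_extensional: "T \<in> bounded_ops X \<Longrightarrow> T \<in> extensional (ell2 X)"
  by (auto simp: bounded_ops_def PiE_def)

lemma bounded_ops_eqI:
  assumes "S \<in> bounded_ops X" "T \<in> bounded_ops X" "\<And>f. f \<in> ell2 X \<Longrightarrow> S f = T f"
  shows "S = T"
  using assms(3) bounded_ops_extensional[OF assms(1)] bounded_ops_extensional[OF assms(2)]
  by (rule extensionalityI[rotated 2])

lemma bounded_opsI:
  assumes "\<And>f. f \<in> ell2 X \<Longrightarrow> T f \<in> ell2 X"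
    and "\<And>f g. f \<in> ell2 X \<Longrightarrow> g \<in> ell2 X \<Longrightarrow> T (\<lambda>x. f x + g x) = (\<lambda>x. T f x + T g x)"
    and "\<And>c f. f \<in> ell2 X \<Longrightarrow> T (\<lambda>x. c * f x) = (\<lambda>x. c * T f x)"
    and "\<And>f. f \<in> ell2 X \<Longrightarrow> ell2_norm X (T f) \<le> K * ell2_norm X f"
  shows "(\<lambda>f\<in>ell2 X. T f) \<in> bounded_ops X"
proof -
  have "\<exists>K. \<forall>f\<in>ell2 X. ell2_norm X (T f) \<le> K * ell2_norm X f" using assms(4) by blast
  then show ?thesis
    using assms(1-3) ell2_add(1)[of _ X] ell2_scale(1)[of _ X]
    by (simp add: bounded_ops_def)
qed

lemma op_norm_bound:
  assumes T: "T \<in> bounded_ops X" and f: "f \<in> ell2 X"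
  shows "ell2_norm X (T f) \<le> op_norm X T * ell2_norm X f"
proof (cases "ell2_norm X f = 0")
  case True
  then show ?thesis
    using ell2_norm_eq_0[OF f True] bounded_ops_zero[OF T] by simp
next
  case False
  then have pos: "ell2_norm X f > 0" using ell2_norm_nonneg[of X f] by linarith
  obtain K where K: "\<And>f. f \<in> ell2 X \<Longrightarrow> ell2_norm X (T f) \<le> K * ell2_norm X f"
    using T unfolding bounded_ops_def by blast
  have bdd: "bdd_above ((\<lambda>f. ell2_norm X (T f)) ` {f \<in> ell2 X. ell2_norm X f \<le> 1})"
  proof (rule bdd_aboveI2)
    fix f assume "f \<in> {f \<in> ell2 X. ell2_norm X f \<le> 1}"
    then have f: "f \<in> ell2 X" "ell2_norm X f \<le> 1" by auto
    have "K * ell2_norm X f \<le> \<bar>K\<bar> * 1"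
      using f by (intro mult_mono) auto
    then show "ell2_norm X (T f) \<le> \<bar>K\<bar>" using K[OF f(1)] by simp
  qed
  define g where "g = (\<lambda>x. complex_of_real (1 / ell2_norm X f) * f x)"
  have g: "g \<in> ell2 X" "ell2_norm X g = 1"
    using ell2_scale[OF f, of "complex_of_real (1 / ell2_norm X f)"] pos
    by (simp_all add: g_def norm_divide)
  have "ell2_norm X (T g) \<le> op_norm X T"
    unfolding op_norm_def by (rule cSUP_upper[OF _ bdd]) (use g in auto)
  moreover have "ell2_norm X (T g) = ell2_norm X (T f) / ell2_norm X f"
    unfolding g_def bounded_ops_scale[OF T f]
    using ell2_scale(2)[OF bounded_ops_in[OF T f], of "complex_of_real (1 / ell2_norm X f)"] pos
    by (simp add: norm_divide)
  ultimately show ?thesis using pos by (simp add: field_simps)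
qed

lemma op_norm_le:
  assumes "0 \<le> K" "\<And>f. f \<in> ell2 X \<Longrightarrow> ell2_norm X (T f) \<le> K * ell2_norm X f"
  shows "op_norm X T \<le> K"
  unfolding op_norm_def
proof (rule cSUP_least)
  have "(\<lambda>x. 0) \<in> {f \<in> ell2 X. ell2_norm X f \<le> 1}" by simp
  then show "{f \<in> ell2 X. ell2_norm X f \<le> 1} \<noteq> {}" by blast
  fix f assume f: "f \<in> {f \<in> ell2 X. ell2_norm X f \<le> 1}"
  have "K * ell2_norm X f \<le> K * 1"
    using f assms(1) by (intro mult_left_mono) auto
  then show "ell2_norm X (T f) \<le> K" using assms(2)[of f] f by auto
qed

text \<open>For empty \<open>X\<close> the Hilbert space is zero and no vector of positive norm is
  at hand; the supremum is then that of the constant 0 over a nonempty set.\<close>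

lemma op_norm_nonneg: "T \<in> bounded_ops X \<Longrightarrow> 0 \<le> op_norm X T"
proof -
  assume T: "T \<in> bounded_ops X"
  show ?thesis
  proof (cases "\<exists>f\<in>ell2 X. ell2_norm X f \<noteq> 0")
    case True
    then obtain f where f: "f \<in> ell2 X" "ell2_norm X f > 0"
      using ell2_norm_nonneg by (metis less_eq_real_def)
    then have "0 \<le> op_norm X T * ell2_norm X f"
      using op_norm_bound[OF T f(1)] ell2_norm_nonneg[of X "T f"] by linarith
    then show ?thesis using f(2) by (simp add: zero_le_mult_iff)
  next
    case False
    then have z: "ell2_norm X f = 0" if "f \<in> ell2 X" for f using that by blast
    have "{f \<in> ell2 X. ell2_norm X f \<le> 1} = ell2 X" using z by auto
    then have "op_norm X T = (SUP f\<in>ell2 X. 0)"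
      unfolding op_norm_def using z bounded_ops_in[OF T] by (intro SUP_cong) auto
    moreover have "ell2 X \<noteq> {}" using ell2_zero(1)[of X] by blast
    ultimately show ?thesis by simp
  qed
qed

text \<open>The squared norm of S f equals <f, T S f>, which is at most |f| K |S f|; then one factor
  is cancelled. Only the single vector \<open>S f\<close> enters, so \<open>S\<close> may be a
  constant map onto a truncated vector and \<open>T\<close> may be the identity.\<close>

lemma adjoint_bound:
  assumes S: "S f \<in> ell2 X" and f: "f \<in> ell2 X" and T: "T (S f) \<in> ell2 X"
    and eq: "ell2_inner X (S f) (S f) = ell2_inner X f (T (S f))"
    and K: "ell2_norm X (T (S f)) \<le> K * ell2_norm X (S f)" "0 \<le> K"
  shows "ell2_norm X (S f) \<le> K * ell2_norm X f"
proof -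
  have "(ell2_norm X (S f))\<^sup>2 = cmod (ell2_inner X f (T (S f)))"
    using inner_self[OF S] eq by (metis abs_of_nonneg norm_of_real zero_le_power2)
  also have "\<dots> \<le> ell2_norm X f * ell2_norm X (T (S f))"
    by (rule Cauchy_Schwarz_ell2[OF f T])
  also have "\<dots> \<le> ell2_norm X f * (K * ell2_norm X (S f))"
    by (rule mult_left_mono[OF K(1)]) simp
  finally have le: "ell2_norm X (S f) * ell2_norm X (S f) \<le> (K * ell2_norm X f) * ell2_norm X (S f)"
    by (simp add: power2_eq_square mult_ac)
  show ?thesis
  proof (cases "ell2_norm X (S f) = 0")
    case False
    then show ?thesis using le ell2_norm_nonneg[of X "S f"]
      by (simp add: less_eq_real_def)
  qed (use K in simp)
qed

text \<open>The adjoint is written down through its coordinates <T delta_x, f>. The adjoint identity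
  is a finite sum against finitely supported vectors; taken at the truncations of S f itself it
  yields the norm bound, and density extends it to all vectors.\<close>

lemma adjoint_exists:
  assumes T: "T \<in> bounded_ops X"
  shows "\<exists>S. S \<in> bounded_ops X \<and>
     (\<forall>f\<in>ell2 X. \<forall>g\<in>ell2 X. ell2_inner X (S f) g = ell2_inner X f (T g))"
proof -
  define K where "K = op_norm X T"
  have K: "0 \<le> K" "\<And>f. f \<in> ell2 X \<Longrightarrow> ell2_norm X (T f) \<le> K * ell2_norm X f"
    using op_norm_nonneg[OF T] op_norm_bound[OF T] by (auto simp: K_def)
  define S where "S f = (\<lambda>x. if x \<in> X then ell2_inner X (T (delta x)) f else 0)" for f
  have Td: "T (delta x) \<in> ell2 X" if "x \<in> X" for x
    using bounded_ops_in[OF T delta_in_ell2[OF that]] .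
  have fin: "ell2_inner X (S f) (truncate F g) = ell2_inner X f (T (truncate F g))"
    if F: "finite F" "F \<subseteq> X" and f: "f \<in> ell2 X" for f g F
  proof -
    have d: "delta x \<in> ell2 X" if "x \<in> F" for x
      using delta_in_ell2[OF subsetD[OF F(2) that]] .
    have "ell2_inner X (S f) (truncate F g) = (\<Sum>\<^sub>\<infinity>x\<in>F. cnj (S f x) * g x)"
      unfolding ell2_inner_def
    proof (rule infsum_cong_neutral)
      show "cnj (S f x) * g x = 0" if "x \<in> F - X" for x using that F(2) by blast
      show "cnj (S f x) * truncate F g x = 0" if "x \<in> X - F" for x using that by (simp add: truncate_def)
      show "cnj (S f x) * truncate F g x = cnj (S f x) * g x" if "x \<in> X \<inter> F" for x
        using that by (simp add: truncate_def)
    qed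
    also have "\<dots> = (\<Sum>x\<in>F. g x * ell2_inner X f (T (delta x)))"
    proof -
      have "cnj (S f x) * g x = g x * ell2_inner X f (T (delta x))" if "x \<in> F" for x
        using that F by (subst inner_cnj[of X f]) (auto simp: S_def)
      then show ?thesis using sum.cong[OF refl, of F "\<lambda>x. cnj (S f x) * g x"] F(1)
        by (simp only: infsum_finite)
    qed
    also have "\<dots> = ell2_inner X f (\<lambda>y. \<Sum>x\<in>F. g x * T (delta x) y)"
      using F Td ell2_scale(1)[OF Td] by (subst inner_sum_right[OF f]) (auto simp: inner_scale_right)
    also have "(\<lambda>y. \<Sum>x\<in>F. g x * T (delta x) y) = T (truncate F g)"
      using bounded_ops_sum[OF T, of F "\<lambda>x y. g x * delta x y"] ell2_scale(1)[OF d]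
        bounded_ops_scale[OF T d]
      by (simp add: truncate_eq_sum[OF F(1)])
    finally show ?thesis .
  qed
  have tr: "truncate F g \<in> ell2 X" "ell2_norm X (truncate F g) = L2_set (\<lambda>x. cmod (g x)) F"
    if "finite F" "F \<subseteq> X" for F and g :: "'a \<Rightarrow> complex"
    using ell2_norm_finite_support[OF that, of "truncate F g"]
    by (auto simp: truncate_def L2_set_def)
  have S: "S f \<in> ell2 X" "ell2_norm X (S f) \<le> K * ell2_norm X f" if f: "f \<in> ell2 X" for f
  proof -
    have "L2_set (\<lambda>x. cmod (S f x)) F \<le> K * ell2_norm X f" if F: "finite F" "F \<subseteq> X" for F
    proof -
      let ?w = "truncate F (S f)"
      have w: "?w \<in> ell2 X" "ell2_norm X ?w = L2_set (\<lambda>x. cmod (S f x)) F" using tr[OF F] by auto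
      have "ell2_inner X ?w ?w = ell2_inner X (S f) ?w"
        unfolding ell2_inner_def by (intro infsum_cong) (auto simp: truncate_def)
      then have "ell2_inner X ?w ?w = ell2_inner X f (T ?w)" using fin[OF F f] by simp
      from adjoint_bound[of "\<lambda>_. ?w" f X T K, OF w(1) f bounded_ops_in[OF T w(1)] this K(2)[OF w(1)] K(1)]
      show ?thesis using w(2) by simp
    qed
    moreover have "S f x = 0" if "x \<notin> X" for x using that by (simp add: S_def)
    moreover have "0 \<le> K * ell2_norm X f" using K(1) by simp
    ultimately show "S f \<in> ell2 X" "ell2_norm X (S f) \<le> K * ell2_norm X f"
      using ell2_bound[of X "S f" "K * ell2_norm X f"] by auto
  qed
  have adj: "ell2_inner X (S f) g = ell2_inner X f (T g)" if f: "f \<in> ell2 X" and g: "g \<in> ell2 X" for f g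
  proof (rule ccontr)
    define e where "e = cmod (ell2_inner X (S f) g - ell2_inner X f (T g))"
    assume "\<not> ?thesis"
    then have e: "e > 0" by (simp add: e_def)
    \<comment> \<open>\<open>M\<close> dominates both Cauchy-Schwarz bounds per unit of the norm of
      \<open>h\<close>; the added 1 keeps it positive when \<open>f\<close> and \<open>S f\<close>
      vanish.\<close>
    define M where "M = ell2_norm X (S f) + ell2_norm X f * K + 1"
    have M: "M > 0" using K(1) by (auto simp: M_def intro!: add_nonneg_pos)
    obtain F where F: "finite F" "F \<subseteq> X" "ell2_norm X (\<lambda>x. g x - truncate F g x) \<le> e / (2 * M)"
      using truncate_approx[OF g, of "e / (2 * M)"] e M by auto
    define h where "h = (\<lambda>x. g x - truncate F g x)"
    have h: "h \<in> ell2 X" unfolding h_def by (rule ell2_diff(1)[OF g tr(1)[OF F(1,2)]])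
    have g_eq: "g = (\<lambda>x. truncate F g x + h x)" by (simp add: h_def)
    have 1: "ell2_inner X (S f) g = ell2_inner X (S f) (truncate F g) + ell2_inner X (S f) h"
      by (subst g_eq) (rule inner_add_right[OF S(1)[OF f] tr(1)[OF F(1,2)] h])
    have "T g = (\<lambda>x. T (truncate F g) x + T h x)"
      by (subst g_eq) (rule bounded_ops_add[OF T tr(1)[OF F(1,2)] h])
    then have 2: "ell2_inner X f (T g) = ell2_inner X f (T (truncate F g)) + ell2_inner X f (T h)"
      using inner_add_right[OF f bounded_ops_in[OF T tr(1)[OF F(1,2)]] bounded_ops_in[OF T h]] by simp
    have "e = cmod (ell2_inner X (S f) h - ell2_inner X f (T h))"
      unfolding e_def 1 2 fin[OF F(1,2) f] by simp
    also have "\<dots> \<le> cmod (ell2_inner X (S f) h) + cmod (ell2_inner X f (T h))"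
      by (rule norm_triangle_ineq4)
    also have "\<dots> \<le> ell2_norm X (S f) * ell2_norm X h + ell2_norm X f * ell2_norm X (T h)"
      by (intro add_mono Cauchy_Schwarz_ell2 S f h bounded_ops_in[OF T])
    also have "\<dots> \<le> ell2_norm X (S f) * ell2_norm X h + ell2_norm X f * (K * ell2_norm X h)"
      by (intro add_left_mono mult_left_mono K h) simp
    also have "\<dots> \<le> M * ell2_norm X h"
      by (simp add: M_def algebra_simps)
    also have "\<dots> \<le> M * (e / (2 * M))"
      using F(3) M by (intro mult_left_mono) (auto simp: h_def)
    also have "\<dots> = e / 2" using M by simp
    finally show False using e by simp
  qed
  have "(\<lambda>f\<in>ell2 X. S f) \<in> bounded_ops X"
  proof (rule bounded_opsI[where K = K])
    fix f g assume f: "f \<in> ell2 X" and g: "g \<in> ell2 X"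
    show "S (\<lambda>x. f x + g x) = (\<lambda>x. S f x + S g x)"
      using inner_add_right[OF Td f g] by (auto simp: S_def)
  next
    show "S (\<lambda>x. c * f x) = (\<lambda>x. c * S f x)" if "f \<in> ell2 X" for c f
      by (auto simp: S_def inner_scale_right)
  qed (use S in auto)
  with adj show ?thesis by (intro exI[of _ "\<lambda>f\<in>ell2 X. S f"]) auto
qed

lemma adjoint_unique:
  assumes "S \<in> bounded_ops X" "S' \<in> bounded_ops X"
    and "\<forall>f\<in>ell2 X. \<forall>g\<in>ell2 X. ell2_inner X (S f) g = ell2_inner X f (T g)"
    and "\<forall>f\<in>ell2 X. \<forall>g\<in>ell2 X. ell2_inner X (S' f) g = ell2_inner X f (T g)"
  shows "S = S'"
proof (rule bounded_ops_eqI[OF assms(1,2)])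
  fix f assume f: "f \<in> ell2 X"
  show "S f = S' f"
  proof (rule ell2_eqI[OF bounded_ops_in[OF assms(1) f] bounded_ops_in[OF assms(2) f]])
    fix h assume "h \<in> ell2 X"
    then show "ell2_inner X h (S f) = ell2_inner X h (S' f)"
      using assms(3,4) f by (simp add: inner_cnj[of X h])
  qed
qed

lemma op_adjoint:
  assumes T: "T \<in> bounded_ops X"
  shows "op_adjoint X T \<in> bounded_ops X"
    and "\<And>f g. f \<in> ell2 X \<Longrightarrow> g \<in> ell2 X \<Longrightarrow> ell2_inner X (op_adjoint X T f) g = ell2_inner X f (T g)"
proof -
  have "\<exists>!S. S \<in> bounded_ops X \<and>
     (\<forall>f\<in>ell2 X. \<forall>g\<in>ell2 X. ell2_inner X (S f) g = ell2_inner X f (T g))"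
    by (rule ex_ex1I[OF adjoint_exists[OF T]]) (blast intro: adjoint_unique)
  from theI'[OF this] show "op_adjoint X T \<in> bounded_ops X"
    "\<And>f g. f \<in> ell2 X \<Longrightarrow> g \<in> ell2 X \<Longrightarrow> ell2_inner X (op_adjoint X T f) g = ell2_inner X f (T g)"
    by (auto simp: op_adjoint_def)
qed

lemma op_adjoint_eqI:
  assumes "T \<in> bounded_ops X" "S \<in> bounded_ops X"
    and "\<And>f g. f \<in> ell2 X \<Longrightarrow> g \<in> ell2 X \<Longrightarrow> ell2_inner X (S f) g = ell2_inner X f (T g)"
  shows "op_adjoint X T = S"
  using adjoint_unique[OF op_adjoint(1)[OF assms(1)] assms(2), of T] op_adjoint(2)[OF assms(1)] assms(3)
  by blast

lemma bounded_op_algebra_simps [simp]: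
  "elems (bounded_op_algebra X) = bounded_ops X"
  "azero (bounded_op_algebra X) = (\<lambda>f\<in>ell2 X. \<lambda>x. 0)"
  "aadd (bounded_op_algebra X) S T = (\<lambda>f\<in>ell2 X. \<lambda>x. S f x + T f x)"
  "ascale (bounded_op_algebra X) c T = (\<lambda>f\<in>ell2 X. \<lambda>x. c * T f x)"
  "amult (bounded_op_algebra X) S T = (\<lambda>f\<in>ell2 X. S (T f))"
  "astar (bounded_op_algebra X) = op_adjoint X"
  "anorm (bounded_op_algebra X) = op_norm X"
  by (simp_all add: bounded_op_algebra_def)

lemma bounded_ops_closed:
  assumes "S \<in> bounded_ops X" "T \<in> bounded_ops X"
  shows "(\<lambda>f\<in>ell2 X. \<lambda>x. 0) \<in> bounded_ops X"
    and "(\<lambda>f\<in>ell2 X. \<lambda>x. S f x + T f x) \<in> bounded_ops X"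
    and "(\<lambda>f\<in>ell2 X. \<lambda>x. c * T f x) \<in> bounded_ops X"
    and "(\<lambda>f\<in>ell2 X. S (T f)) \<in> bounded_ops X"
proof -
  note S = bounded_ops_in[OF assms(1)] bounded_ops_add[OF assms(1)] bounded_ops_scale[OF assms(1)]
    op_norm_bound[OF assms(1)] op_norm_nonneg[OF assms(1)]
  note T = bounded_ops_in[OF assms(2)] bounded_ops_add[OF assms(2)] bounded_ops_scale[OF assms(2)]
    op_norm_bound[OF assms(2)] op_norm_nonneg[OF assms(2)]
  show "(\<lambda>f\<in>ell2 X. \<lambda>x. 0) \<in> bounded_ops X"
    by (rule bounded_opsI[where K = 0]) simp_all
  show "(\<lambda>f\<in>ell2 X. \<lambda>x. S f x + T f x) \<in> bounded_ops X"
  proof (rule bounded_opsI[where K = "op_norm X S + op_norm X T"])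
    fix f assume f: "f \<in> ell2 X"
    show "(\<lambda>x. S f x + T f x) \<in> ell2 X" using ell2_add(1)[OF S(1) T(1)] f by simp
    show "ell2_norm X (\<lambda>x. S f x + T f x) \<le> (op_norm X S + op_norm X T) * ell2_norm X f"
      using ell2_add(2)[OF S(1)[OF f] T(1)[OF f]] S(4)[OF f] T(4)[OF f] by (simp add: algebra_simps)
  qed (simp_all add: S(2,3) T(2,3) algebra_simps)
  show "(\<lambda>f\<in>ell2 X. \<lambda>x. c * T f x) \<in> bounded_ops X"
  proof (rule bounded_opsI[where K = "cmod c * op_norm X T"])
    fix f assume f: "f \<in> ell2 X"
    show "(\<lambda>x. c * T f x) \<in> ell2 X" using ell2_scale(1)[OF T(1)[OF f]] .
    show "ell2_norm X (\<lambda>x. c * T f x) \<le> cmod c * op_norm X T * ell2_norm X f"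
      unfolding ell2_scale(2)[OF T(1)[OF f]] using mult_left_mono[OF T(4)[OF f], of "cmod c"]
      by (simp add: mult_ac)
  qed (simp_all add: T(2,3) algebra_simps)
  show "(\<lambda>f\<in>ell2 X. S (T f)) \<in> bounded_ops X"
  proof (rule bounded_opsI[where K = "op_norm X S * op_norm X T"])
    fix f assume f: "f \<in> ell2 X"
    show "S (T f) \<in> ell2 X" using S(1) T(1) f by simp
    show "ell2_norm X (S (T f)) \<le> op_norm X S * op_norm X T * ell2_norm X f"
      using S(4)[OF T(1)[OF f]] mult_left_mono[OF T(4)[OF f] S(5)] by (simp add: mult_ac)
  qed (simp_all add: S T)
qed

section \<open>Complete normed star algebras\<close>

text \<open>Written exactly as in the closedness clause of \<open>closed_star_subalgebra\<close>,
  where differences are formed with \<open>aadd\<close> and \<open>ascale\<close>, so that it can be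
  folded and unfolded there.\<close>

definition adist :: "'a star_algebra \<Rightarrow> 'a \<Rightarrow> 'a \<Rightarrow> real" where
  "adist A a b = anorm A (aadd A a (ascale A (-1) b))"

lemma closed_star_subalgebraD:
  assumes "closed_star_subalgebra A B"
  shows "B \<subseteq> elems A" "azero A \<in> B"
    "\<And>a b. a \<in> B \<Longrightarrow> b \<in> B \<Longrightarrow> aadd A a b \<in> B"
    "\<And>c a. a \<in> B \<Longrightarrow> ascale A c a \<in> B"
    "\<And>a b. a \<in> B \<Longrightarrow> b \<in> B \<Longrightarrow> amult A a b \<in> B"
    "\<And>a. a \<in> B \<Longrightarrow> astar A a \<in> B"
    "\<And>a. a \<in> elems A \<Longrightarrow> (\<And>\<epsilon>. \<epsilon> > 0 \<Longrightarrow> \<exists>b\<in>B. adist A a b < \<epsilon>) \<Longrightarrow> a \<in> B"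
  using assms unfolding closed_star_subalgebra_def adist_def by blast+

text \<open>Collects properties that pass to sup-norm families and that make the closure of a star
  subalgebra a star subalgebra: closedness under the operations, Lipschitz estimates and
  completeness. In \<open>complete\<close> one limit keeps every Cauchy bound with the same
  \<open>N\<close>; this uniform form allows limits in a product to be taken coordinate by
  coordinate.\<close>

locale complete_star_algebra =
  fixes A :: "'a star_algebra"
  assumes zero_closed: "azero A \<in> elems A"
    and add_closed: "\<lbrakk>a \<in> elems A; b \<in> elems A\<rbrakk> \<Longrightarrow> aadd A a b \<in> elems A"
    and scale_closed: "a \<in> elems A \<Longrightarrow> ascale A c a \<in> elems A"
    and mult_closed: "\<lbrakk>a \<in> elems A; b \<in> elems A\<rbrakk> \<Longrightarrow> amult A a b \<in> elems A"
    and star_closed: "a \<in> elems A \<Longrightarrow> astar A a \<in> elems A"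
    and dist_eq: "\<lbrakk>a \<in> elems A; b \<in> elems A\<rbrakk> \<Longrightarrow> adist A a b = 0 \<longleftrightarrow> a = b"
    and dist_sym: "\<lbrakk>a \<in> elems A; b \<in> elems A\<rbrakk> \<Longrightarrow> adist A a b = adist A b a"
    and dist_triangle: "\<lbrakk>a \<in> elems A; b \<in> elems A; a' \<in> elems A\<rbrakk> \<Longrightarrow> adist A a a' \<le> adist A a b + adist A b a'"
    and dist_zero: "a \<in> elems A \<Longrightarrow> adist A a (azero A) = anorm A a"
    and dist_add: "\<lbrakk>a \<in> elems A; b \<in> elems A; a' \<in> elems A; b' \<in> elems A\<rbrakk> \<Longrightarrow>
        adist A (aadd A a b) (aadd A a' b') \<le> adist A a a' + adist A b b'"
    and dist_scale: "\<lbrakk>a \<in> elems A; a' \<in> elems A\<rbrakk> \<Longrightarrow>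
        adist A (ascale A c a) (ascale A c a') \<le> cmod c * adist A a a'"
    and dist_mult: "\<lbrakk>a \<in> elems A; b \<in> elems A; a' \<in> elems A; b' \<in> elems A\<rbrakk> \<Longrightarrow>
        adist A (amult A a b) (amult A a' b') \<le> anorm A a * adist A b b' + adist A a a' * anorm A b'"
    and dist_star: "\<lbrakk>a \<in> elems A; a' \<in> elems A\<rbrakk> \<Longrightarrow> adist A (astar A a) (astar A a') \<le> adist A a a'"
    and norm_add: "\<lbrakk>a \<in> elems A; b \<in> elems A\<rbrakk> \<Longrightarrow> anorm A (aadd A a b) \<le> anorm A a + anorm A b"
    and norm_scale: "a \<in> elems A \<Longrightarrow> anorm A (ascale A c a) \<le> cmod c * anorm A a"
    and norm_mult: "\<lbrakk>a \<in> elems A; b \<in> elems A\<rbrakk> \<Longrightarrow> anorm A (amult A a b) \<le> anorm A a * anorm A b"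
    and norm_star: "a \<in> elems A \<Longrightarrow> anorm A (astar A a) \<le> anorm A a"
    and complete: "\<lbrakk>\<And>n::nat. f n \<in> elems A; \<And>\<epsilon>. \<epsilon> > 0 \<Longrightarrow> \<exists>N. \<forall>m\<ge>N. \<forall>n\<ge>N. adist A (f m) (f n) \<le> \<epsilon>\<rbrakk> \<Longrightarrow>
        \<exists>b\<in>elems A. \<forall>\<epsilon>>0. \<forall>N. (\<forall>m\<ge>N. \<forall>n\<ge>N. adist A (f m) (f n) \<le> \<epsilon>) \<longrightarrow> (\<forall>n\<ge>N. adist A (f n) b \<le> \<epsilon>)"
begin

lemma dist_self: "a \<in> elems A \<Longrightarrow> adist A a a = 0"
  by (simp add: dist_eq)

lemma dist_nonneg: "a \<in> elems A \<Longrightarrow> b \<in> elems A \<Longrightarrow> 0 \<le> adist A a b"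
  using dist_triangle[of a b a] dist_self[of a] dist_sym[of a b] by simp

lemma norm_nonneg: "a \<in> elems A \<Longrightarrow> 0 \<le> anorm A a"
  using dist_nonneg[of a "azero A"] dist_zero zero_closed by simp

lemma norm_le_dist: "a \<in> elems A \<Longrightarrow> b \<in> elems A \<Longrightarrow> anorm A a \<le> adist A a b + anorm A b"
  using dist_triangle[of a b "azero A"] dist_zero zero_closed by simp

lemma dist_le_norms: "a \<in> elems A \<Longrightarrow> b \<in> elems A \<Longrightarrow> adist A a b \<le> anorm A a + anorm A b"
  using dist_triangle[of a "azero A" b] dist_zero zero_closed dist_sym[of "azero A" b] by simp

lemma closed_star_subalgebra_elems: "closed_star_subalgebra A (elems A)"
  using zero_closed add_closed scale_closed mult_closed star_closed
  by (auto simp: closed_star_subalgebra_def)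

lemma closed_star_subalgebra_generated:
  assumes "M \<subseteq> elems A"
  shows "closed_star_subalgebra A (elems (generated_cstar_algebra A M))"
proof -
  let ?F = "{B. closed_star_subalgebra A B \<and> M \<subseteq> B}"
  have ne: "elems A \<in> ?F" using closed_star_subalgebra_elems assms by simp
  then have "\<Inter>?F \<subseteq> elems A" by blast
  moreover have "a \<in> \<Inter>?F" if a: "a \<in> elems A"
    "\<forall>\<epsilon>>0. \<exists>b\<in>\<Inter>?F. anorm A (aadd A a (ascale A (-1) b)) < \<epsilon>" for a
  proof
    fix B assume B: "B \<in> ?F"
    have "\<forall>\<epsilon>>0. \<exists>b\<in>B. anorm A (aadd A a (ascale A (-1) b)) < \<epsilon>"
      using a(2) B by blast
    then show "a \<in> B" using B a(1) by (simp add: closed_star_subalgebra_def)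
  qed
  moreover have "azero A \<in> \<Inter>?F"
    by (blast dest: closed_star_subalgebraD(2))
  moreover have "\<forall>a\<in>\<Inter>?F. \<forall>b\<in>\<Inter>?F. aadd A a b \<in> \<Inter>?F"
    by (blast dest: closed_star_subalgebraD(3))
  moreover have "\<forall>c. \<forall>a\<in>\<Inter>?F. ascale A c a \<in> \<Inter>?F"
    by (blast dest: closed_star_subalgebraD(4))
  moreover have "\<forall>a\<in>\<Inter>?F. \<forall>b\<in>\<Inter>?F. amult A a b \<in> \<Inter>?F"
    by (blast dest: closed_star_subalgebraD(5))
  moreover have "\<forall>a\<in>\<Inter>?F. astar A a \<in> \<Inter>?F"
    by (blast dest: closed_star_subalgebraD(6))
  ultimately have "closed_star_subalgebra A (\<Inter>?F)"
    unfolding closed_star_subalgebra_def by meson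
  then show ?thesis
    by (simp add: generated_cstar_algebra_def)
qed

lemma closure_closed_star_subalgebra:
  assumes sub: "L \<subseteq> elems A" and z: "azero A \<in> L"
    and add: "\<And>a b. a \<in> L \<Longrightarrow> b \<in> L \<Longrightarrow> aadd A a b \<in> L"
    and scale: "\<And>a c. a \<in> L \<Longrightarrow> ascale A c a \<in> L"
    and mult: "\<And>a b. a \<in> L \<Longrightarrow> b \<in> L \<Longrightarrow> amult A a b \<in> L"
    and star: "\<And>a. a \<in> L \<Longrightarrow> astar A a \<in> L"
  shows "closed_star_subalgebra A {a \<in> elems A. \<forall>\<epsilon>>0. \<exists>b\<in>L. adist A a b < \<epsilon>}"
    (is "closed_star_subalgebra A ?C")
  unfolding closed_star_subalgebra_def
proof (intro conjI ballI allI impI)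
  show "?C \<subseteq> elems A" by auto
  show "azero A \<in> ?C" using z zero_closed dist_self[OF zero_closed] by force
next
  fix a b assume ab: "a \<in> ?C" "b \<in> ?C"
  show "aadd A a b \<in> ?C"
  proof (intro CollectI conjI allI impI)
    fix \<epsilon> :: real assume e: "\<epsilon> > 0"
    obtain a' where a': "a' \<in> L" "adist A a a' < \<epsilon> / 2" using ab e half_gt_zero by blast
    obtain b' where b': "b' \<in> L" "adist A b b' < \<epsilon> / 2" using ab e half_gt_zero by blast
    have "adist A (aadd A a b) (aadd A a' b') < \<epsilon>"
      using dist_add[of a b a' b'] a' b' ab subsetD[OF sub a'(1)] subsetD[OF sub b'(1)] by simp
    then show "\<exists>b'\<in>L. adist A (aadd A a b) b' < \<epsilon>" using add a' b' by blast
  qed (use ab add_closed in auto)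
  show "amult A a b \<in> ?C"
  proof (intro CollectI conjI allI impI)
    fix \<epsilon> :: real assume e: "\<epsilon> > 0"
    \<comment> \<open>Since \<open>d\<close> \<le> 1 the norm of \<open>b'\<close> is at most that
      of \<open>b\<close> plus 1, so the product moves by at most d (|a| + |b| + 1); the 2 in
      \<open>K\<close> makes this strictly less than K d \<le> \<epsilon>.\<close>
    define K where "K = anorm A a + anorm A b + 2"
    have na: "0 \<le> anorm A a" "0 \<le> anorm A b" using ab norm_nonneg by auto
    then have K: "K > 0" by (simp add: K_def)
    define d where "d = min 1 (\<epsilon> / K)"
    have d: "d > 0" "d \<le> 1" "K * d \<le> \<epsilon>" using K e by (auto simp: d_def min_def field_simps)
    obtain a' where a': "a' \<in> L" "adist A a a' < d" using ab d by blast
    obtain b' where b': "b' \<in> L" "adist A b b' < d" using ab d by blast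
    have el: "a \<in> elems A" "b \<in> elems A" "a' \<in> elems A" "b' \<in> elems A" using ab a' b' sub by auto
    have "anorm A b' \<le> anorm A b + 1"
      using norm_le_dist[OF el(4,2)] dist_sym[OF el(4,2)] b' d by simp
    then have "adist A (amult A a b) (amult A a' b') \<le> anorm A a * d + d * (anorm A b + 1)"
      using dist_mult[OF el] a' b' na dist_nonneg[OF el(1,3)] norm_nonneg[OF el(4)] d
      by (smt (verit) mult_left_mono mult_mono)
    also have "\<dots> < K * d" using d(1) by (simp add: K_def algebra_simps)
    finally have "adist A (amult A a b) (amult A a' b') < \<epsilon>" using d by simp
    then show "\<exists>b'\<in>L. adist A (amult A a b) b' < \<epsilon>" using mult a' b' by blast
  qed (use ab mult_closed in auto)
next
  fix a c assume a: "a \<in> ?C"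
  show "ascale A c a \<in> ?C"
  proof (intro CollectI conjI allI impI)
    fix \<epsilon> :: real assume e: "\<epsilon> > 0"
    have c: "cmod c + 1 > 0" using norm_ge_zero[of c] by linarith
    obtain a' where a': "a' \<in> L" "adist A a a' < \<epsilon> / (cmod c + 1)" using a divide_pos_pos[OF e c] by blast
    have "adist A (ascale A c a) (ascale A c a') \<le> cmod c * adist A a a'"
      using dist_scale[of a a'] a subsetD[OF sub a'(1)] by simp
    also have "\<dots> \<le> (cmod c + 1) * adist A a a'"
      using dist_nonneg[of a a'] a subsetD[OF sub a'(1)] by (simp add: distrib_right)
    also have "\<dots> < \<epsilon>" using a'(2) c by (simp add: field_simps)
    finally show "\<exists>b'\<in>L. adist A (ascale A c a) b' < \<epsilon>" using scale a' by blast
  qed (use a scale_closed in auto)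
next
  fix a assume a: "a \<in> ?C"
  show "astar A a \<in> ?C"
  proof (intro CollectI conjI allI impI)
    fix \<epsilon> :: real assume e: "\<epsilon> > 0"
    obtain a' where a': "a' \<in> L" "adist A a a' < \<epsilon>" using a e by blast
    then have "adist A (astar A a) (astar A a') < \<epsilon>"
      using dist_star[of a a'] a subsetD[OF sub a'(1)] by simp
    then show "\<exists>b'\<in>L. adist A (astar A a) b' < \<epsilon>" using star a' by blast
  qed (use a star_closed in auto)
next
  fix a assume a: "a \<in> elems A" "\<forall>\<epsilon>>0. \<exists>b\<in>?C. anorm A (aadd A a (ascale A (-1) b)) < \<epsilon>"
  show "a \<in> ?C"
  proof (intro CollectI conjI allI impI a(1))
    fix \<epsilon> :: real assume e: "\<epsilon> > 0"
    obtain b where b: "b \<in> ?C" "adist A a b < \<epsilon> / 2"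
      using a(2) e half_gt_zero unfolding adist_def by blast
    obtain c where c: "c \<in> L" "adist A b c < \<epsilon> / 2" using b e half_gt_zero by blast
    have "adist A a c < \<epsilon>"
      using dist_triangle[of a b c] a(1) b c(2) subsetD[OF sub c(1)] by simp
    then show "\<exists>b'\<in>L. adist A a b' < \<epsilon>" using c by blast
  qed
qed

end

lemma generated_minimal:
  "closed_star_subalgebra A B \<Longrightarrow> M \<subseteq> B \<Longrightarrow> elems (generated_cstar_algebra A M) \<subseteq> B"
  by (auto simp: generated_cstar_algebra_def)

lemma generated_simps [simp]:
  "azero (generated_cstar_algebra A M) = azero A"
  "aadd (generated_cstar_algebra A M) = aadd A"
  "ascale (generated_cstar_algebra A M) = ascale A"
  "amult (generated_cstar_algebra A M) = amult A"
  "astar (generated_cstar_algebra A M) = astar A"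
  "anorm (generated_cstar_algebra A M) = anorm A"
  by (simp_all add: generated_cstar_algebra_def)

lemma generated_contains: "M \<subseteq> elems (generated_cstar_algebra A M)"
  by (auto simp: generated_cstar_algebra_def)

section \<open>Bounded operators and bounded families as complete star algebras\<close>

lemma adist_op: "adist (bounded_op_algebra X) S T = op_norm X (\<lambda>f\<in>ell2 X. \<lambda>x. S f x - T f x)"
  unfolding adist_def by (simp cong: restrict_cong)

lemma bounded_ops_diff_closed:
  assumes "S \<in> bounded_ops X" "T \<in> bounded_ops X"
  shows "(\<lambda>f\<in>ell2 X. \<lambda>x. S f x - T f x) \<in> bounded_ops X"
  using bounded_ops_closed(2)[OF assms(1) bounded_ops_closed(3)[OF assms(2,2), of "-1"]]
  by (simp cong: restrict_cong)

lemma adist_op_bound: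
  assumes "S \<in> bounded_ops X" "T \<in> bounded_ops X" "f \<in> ell2 X"
  shows "ell2_norm X (\<lambda>x. S f x - T f x) \<le> adist (bounded_op_algebra X) S T * ell2_norm X f"
  using op_norm_bound[OF bounded_ops_diff_closed[OF assms(1,2)] assms(3)] assms(3)
  by (simp add: adist_op)

lemma adist_op_le:
  assumes "0 \<le> K" "\<And>f. f \<in> ell2 X \<Longrightarrow> ell2_norm X (\<lambda>x. S f x - T f x) \<le> K * ell2_norm X f"
  shows "adist (bounded_op_algebra X) S T \<le> K"
  unfolding adist_op by (rule op_norm_le[OF assms(1)]) (simp add: assms(2))

lemma adist_op_nonneg:
  assumes "S \<in> bounded_ops X" "T \<in> bounded_ops X"
  shows "0 \<le> adist (bounded_op_algebra X) S T"
  unfolding adist_op by (rule op_norm_nonneg[OF bounded_ops_diff_closed[OF assms]])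

text \<open>Every coordinate of \<open>T n f\<close> is a scalar Cauchy sequence, and the
  coordinatewise limits define the operator. Fatou's lemma for T n f - T m f, with m tending to
  infinity, gives the distance to the limit with the same \<open>N\<close> and
  \<open>\<epsilon>\<close>.\<close>

lemma bounded_ops_complete:
  fixes T :: "nat \<Rightarrow> 'x ell2_op"
  assumes T: "\<And>n. T n \<in> bounded_ops X"
    and cauchy: "\<And>\<epsilon>. \<epsilon> > 0 \<Longrightarrow> \<exists>N. \<forall>m\<ge>N. \<forall>n\<ge>N. adist (bounded_op_algebra X) (T m) (T n) \<le> \<epsilon>"
  shows "\<exists>S\<in>bounded_ops X. \<forall>\<epsilon>>0. \<forall>N. (\<forall>m\<ge>N. \<forall>n\<ge>N. adist (bounded_op_algebra X) (T m) (T n) \<le> \<epsilon>) \<longrightarrow>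
    (\<forall>n\<ge>N. adist (bounded_op_algebra X) (T n) S \<le> \<epsilon>)"
proof -
  have conv: "convergent (\<lambda>n. T n f x)" if f: "f \<in> ell2 X" for f x
  proof (rule Cauchy_convergent, rule metric_CauchyI)
    fix e :: real assume e: "e > 0"
    have pos: "ell2_norm X f + 1 > 0" using ell2_norm_nonneg[of X f] by linarith
    define d where "d = e / (2 * (ell2_norm X f + 1))"
    have d: "d > 0" using e pos by (simp add: d_def)
    obtain N where N: "\<And>m n. m \<ge> N \<Longrightarrow> n \<ge> N \<Longrightarrow> adist (bounded_op_algebra X) (T m) (T n) \<le> d"
      using cauchy[OF d] by blast
    have "dist (T m f x) (T n f x) < e" if "m \<ge> N" "n \<ge> N" for m n
    proof -
      have "dist (T m f x) (T n f x) \<le> ell2_norm X (\<lambda>x. T m f x - T n f x)"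
        unfolding dist_norm
        using cmod_le_ell2_norm[OF ell2_diff(1)[OF bounded_ops_in[OF T f] bounded_ops_in[OF T f]]] .
      also have "\<dots> \<le> d * ell2_norm X f"
        using adist_op_bound[OF T T f, of m n] mult_right_mono[OF N[OF that], of "ell2_norm X f"] by simp
      also have "\<dots> \<le> d * (ell2_norm X f + 1)" using d by simp
      also have "\<dots> = e / 2" using pos by (simp add: d_def field_simps)
      also have "\<dots> < e" using e by simp
      finally show ?thesis .
    qed
    then show "\<exists>N. \<forall>m\<ge>N. \<forall>n\<ge>N. dist (T m f x) (T n f x) < e" by blast
  qed
  define S where "S f = (\<lambda>x. lim (\<lambda>n. T n f x))" for f
  have lim: "(\<lambda>n. T n f x) \<longlonglongrightarrow> S f x" if "f \<in> ell2 X" for f x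
    using conv[OF that] by (simp add: S_def convergent_LIMSEQ_iff)
  have est: "(\<lambda>x. T n f x - S f x) \<in> ell2 X" "ell2_norm X (\<lambda>x. T n f x - S f x) \<le> \<epsilon> * ell2_norm X f"
    if f: "f \<in> ell2 X" and "\<epsilon> > 0" and N: "\<forall>m\<ge>N. \<forall>n\<ge>N. adist (bounded_op_algebra X) (T m) (T n) \<le> \<epsilon>" and n: "n \<ge> N"
    for f \<epsilon> N n
  proof -
    have l: "(\<lambda>m. T n f x - T m f x) \<longlonglongrightarrow> T n f x - S f x" for x
      by (intro tendsto_intros lim f)
    have i: "(\<lambda>x. T n f x - T m f x) \<in> ell2 X" for m
      by (intro ell2_diff(1) bounded_ops_in[OF T] f)
    have b: "ell2_norm X (\<lambda>x. T n f x - T m f x) \<le> \<epsilon> * ell2_norm X f" if "m \<ge> N" for m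
      using adist_op_bound[OF T T f, of n m] N n that mult_right_mono[OF _ ell2_norm_nonneg[of X f]]
      by (meson order_trans)
    show "(\<lambda>x. T n f x - S f x) \<in> ell2 X" "ell2_norm X (\<lambda>x. T n f x - S f x) \<le> \<epsilon> * ell2_norm X f"
      using ell2_pointwise_limit[OF l i b] by auto
  qed
  obtain N1 where N1: "\<forall>m\<ge>N1. \<forall>n\<ge>N1. adist (bounded_op_algebra X) (T m) (T n) \<le> 1"
    using cauchy[of 1] by auto
  have Sin: "S f \<in> ell2 X" "ell2_norm X (S f) \<le> (op_norm X (T N1) + 1) * ell2_norm X f"
    if f: "f \<in> ell2 X" for f
  proof -
    have e: "(\<lambda>x. T N1 f x - S f x) \<in> ell2 X" "ell2_norm X (\<lambda>x. T N1 f x - S f x) \<le> 1 * ell2_norm X f"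
      using est[OF f _ N1 order_refl] by auto
    have eq: "S f = (\<lambda>x. T N1 f x - (T N1 f x - S f x))" by simp
    show "S f \<in> ell2 X" by (subst eq) (rule ell2_diff(1)[OF bounded_ops_in[OF T f] e(1)])
    have "ell2_norm X (S f) \<le> ell2_norm X (T N1 f) + ell2_norm X (\<lambda>x. T N1 f x - S f x)"
      by (subst eq) (rule ell2_diff(2)[OF bounded_ops_in[OF T f] e(1)])
    then show "ell2_norm X (S f) \<le> (op_norm X (T N1) + 1) * ell2_norm X f"
      using e(2) op_norm_bound[OF T f, of N1] by (simp add: algebra_simps)
  qed
  have mem: "(\<lambda>f\<in>ell2 X. S f) \<in> bounded_ops X"
  proof (rule bounded_opsI[where K = "op_norm X (T N1) + 1"])
    fix f g assume f: "f \<in> ell2 X" and g: "g \<in> ell2 X"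
    show "S (\<lambda>x. f x + g x) = (\<lambda>x. S f x + S g x)"
    proof
      fix x
      have "(\<lambda>n. T n (\<lambda>x. f x + g x) x) \<longlonglongrightarrow> S f x + S g x"
        unfolding bounded_ops_add[OF T f g] by (intro tendsto_intros lim f g)
      then show "S (\<lambda>x. f x + g x) x = S f x + S g x"
        using lim[OF ell2_add(1)[OF f g]] LIMSEQ_unique by blast
    qed
  next
    fix c f assume f: "f \<in> ell2 X"
    show "S (\<lambda>x. c * f x) = (\<lambda>x. c * S f x)"
    proof
      fix x
      have "(\<lambda>n. T n (\<lambda>x. c * f x) x) \<longlonglongrightarrow> c * S f x"
        unfolding bounded_ops_scale[OF T f] by (intro tendsto_intros lim f)
      then show "S (\<lambda>x. c * f x) x = c * S f x"
        using lim[OF ell2_scale(1)[OF f]] LIMSEQ_unique by blast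
    qed
  qed (use Sin in auto)
  show ?thesis
  proof (intro bexI[OF _ mem] allI impI)
    fix \<epsilon> :: real and N n :: nat
    assume "\<epsilon> > 0" and "\<forall>m\<ge>N. \<forall>n\<ge>N. adist (bounded_op_algebra X) (T m) (T n) \<le> \<epsilon>" "n \<ge> N"
    then show "adist (bounded_op_algebra X) (T n) (\<lambda>f\<in>ell2 X. S f) \<le> \<epsilon>"
      by (intro adist_op_le) (auto intro: est)
  qed
qed

lemma op_adjoint_norm:
  assumes T: "T \<in> bounded_ops X"
  shows "op_norm X (op_adjoint X T) \<le> op_norm X T"
proof (rule op_norm_le[OF op_norm_nonneg[OF T]])
  fix f assume f: "f \<in> ell2 X"
  note a = bounded_ops_in[OF op_adjoint(1)[OF T] f]
  show "ell2_norm X (op_adjoint X T f) \<le> op_norm X T * ell2_norm X f"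
    by (rule adjoint_bound[where T = T])
      (use a f in \<open>auto intro: bounded_ops_in[OF T] op_adjoint(2)[OF T] op_norm_bound[OF T] op_norm_nonneg[OF T]\<close>)
qed

lemma op_adjoint_diff:
  assumes S: "S \<in> bounded_ops X" and T: "T \<in> bounded_ops X"
  shows "op_adjoint X (\<lambda>f\<in>ell2 X. \<lambda>x. S f x - T f x) =
    (\<lambda>f\<in>ell2 X. \<lambda>x. op_adjoint X S f x - op_adjoint X T f x)"
proof (rule op_adjoint_eqI)
  fix f g assume f: "f \<in> ell2 X" and g: "g \<in> ell2 X"
  have sub: "ell2_inner X h (\<lambda>x. u x - v x) = ell2_inner X h u - ell2_inner X h v"
    if "h \<in> ell2 X" "u \<in> ell2 X" "v \<in> ell2 X" for h u v
    using inner_add_right[OF that(1,2) ell2_scale(1)[OF that(3)], of "-1"]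
      inner_scale_right[of X h "-1" v] by simp
  have sub': "ell2_inner X (\<lambda>x. u x - v x) h = ell2_inner X u h - ell2_inner X v h"
    if "h \<in> ell2 X" "u \<in> ell2 X" "v \<in> ell2 X" for h u v
    using sub[OF that] by (subst (1 2 3) inner_cnj) simp
  show "ell2_inner X ((\<lambda>f\<in>ell2 X. \<lambda>x. op_adjoint X S f x - op_adjoint X T f x) f) g =
    ell2_inner X f ((\<lambda>f\<in>ell2 X. \<lambda>x. S f x - T f x) g)"
    using f g by (simp add: sub sub' op_adjoint(2)[OF S] op_adjoint(2)[OF T]
        bounded_ops_in[OF op_adjoint(1)[OF S]] bounded_ops_in[OF op_adjoint(1)[OF T]]
        bounded_ops_in[OF S] bounded_ops_in[OF T])
qed (intro bounded_ops_diff_closed S T op_adjoint(1))+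

lemma complete_star_algebra_bounded_ops: "complete_star_algebra (bounded_op_algebra X)"
proof
  let ?A = "bounded_op_algebra X"
  fix c :: complex and a b a' b' :: "'a ell2_op" and f :: "nat \<Rightarrow> 'a ell2_op"
  note cl = bounded_ops_closed[where X = X]
  show zero: "azero ?A \<in> elems ?A"
    unfolding bounded_op_algebra_simps by (rule bounded_opsI[where K = 0]) simp_all
  {
    assume a: "a \<in> elems ?A"
    then have a: "a \<in> bounded_ops X" by simp
    show "ascale ?A c a \<in> elems ?A" using cl(3)[OF a a] by simp
    show "astar ?A a \<in> elems ?A" using op_adjoint(1)[OF a] by simp
    show "adist ?A a (azero ?A) = anorm ?A a"
      unfolding adist_op bounded_op_algebra_simps op_norm_def by (intro SUP_cong) auto
    show "anorm ?A (astar ?A a) \<le> anorm ?A a" using op_adjoint_norm[OF a] by simp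
    show "anorm ?A (ascale ?A c a) \<le> cmod c * anorm ?A a"
      unfolding bounded_op_algebra_simps
    proof (rule op_norm_le)
      show "0 \<le> cmod c * op_norm X a" using op_norm_nonneg[OF a] by simp
      fix f assume f: "f \<in> ell2 X"
      then show "ell2_norm X ((\<lambda>f\<in>ell2 X. \<lambda>x. c * a f x) f) \<le> cmod c * op_norm X a * ell2_norm X f"
        using ell2_scale(2)[OF bounded_ops_in[OF a f]] mult_left_mono[OF op_norm_bound[OF a f], of "cmod c"]
        by (simp add: mult.assoc)
    qed
    {
      assume "a' \<in> elems ?A"
      then have a': "a' \<in> bounded_ops X" by simp
      show "adist ?A (ascale ?A c a) (ascale ?A c a') \<le> cmod c * adist ?A a a'"
      proof (rule adist_op_le)
        show "0 \<le> cmod c * adist ?A a a'" using adist_op_nonneg[OF a a'] by simp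
        fix f assume f: "f \<in> ell2 X"
        have d: "(\<lambda>x. a f x - a' f x) \<in> ell2 X"
          by (intro ell2_diff bounded_ops_in[OF a] bounded_ops_in[OF a'] f)
        have "ell2_norm X (\<lambda>x. c * (a f x - a' f x)) \<le> cmod c * (adist ?A a a' * ell2_norm X f)"
          unfolding ell2_scale(2)[OF d] by (intro mult_left_mono adist_op_bound[OF a a' f]) simp
        then show "ell2_norm X (\<lambda>x. ascale ?A c a f x - ascale ?A c a' f x) \<le> cmod c * adist ?A a a' * ell2_norm X f"
          using f by (simp add: right_diff_distrib mult.assoc)
      qed
      show "adist ?A (astar ?A a) (astar ?A a') \<le> adist ?A a a'"
        using op_adjoint_norm[OF bounded_ops_diff_closed[OF a a']]
        by (simp add: adist_op op_adjoint_diff[OF a a'])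
    }
    assume "b \<in> elems ?A"
    then have b: "b \<in> bounded_ops X" by simp
    show "aadd ?A a b \<in> elems ?A" "amult ?A a b \<in> elems ?A" using cl(2,4)[OF a b] by simp_all
    show "adist ?A a b = 0 \<longleftrightarrow> a = b"
    proof
      assume "adist ?A a b = 0"
      show "a = b"
      proof (rule bounded_ops_eqI[OF a b])
        fix f assume f: "f \<in> ell2 X"
        have "ell2_norm X (\<lambda>x. a f x - b f x) = 0"
          using adist_op_bound[OF a b f] \<open>adist ?A a b = 0\<close> ell2_norm_nonneg[of X "\<lambda>x. a f x - b f x"] by simp
        then have "(\<lambda>x. a f x - b f x) = (\<lambda>x. 0)"
          by (intro ell2_norm_eq_0[of _ X] ell2_diff bounded_ops_in[OF a] bounded_ops_in[OF b] f)
        then show "a f = b f" by (auto simp: fun_eq_iff)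
      qed
    next
      assume "a = b"
      then have "adist ?A a b \<le> 0" by (intro adist_op_le) auto
      then show "adist ?A a b = 0" using adist_op_nonneg[OF a b] by simp
    qed
    have "op_norm X (\<lambda>f\<in>ell2 X. \<lambda>x. a f x - b f x) = op_norm X (\<lambda>f\<in>ell2 X. \<lambda>x. b f x - a f x)"
      unfolding op_norm_def
      by (intro SUP_cong refl) (use ell2_norm_minus_commute[of X] in auto)
    then show "adist ?A a b = adist ?A b a" by (simp add: adist_op)
    show "anorm ?A (aadd ?A a b) \<le> anorm ?A a + anorm ?A b"
      unfolding bounded_op_algebra_simps
    proof (rule op_norm_le)
      show "0 \<le> op_norm X a + op_norm X b" using op_norm_nonneg[OF a] op_norm_nonneg[OF b] by simp
      fix f assume f: "f \<in> ell2 X"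
      then show "ell2_norm X ((\<lambda>f\<in>ell2 X. \<lambda>x. a f x + b f x) f) \<le> (op_norm X a + op_norm X b) * ell2_norm X f"
        using ell2_add(2)[OF bounded_ops_in[OF a f] bounded_ops_in[OF b f]] op_norm_bound[OF a f] op_norm_bound[OF b f]
        by (simp add: algebra_simps)
    qed
    show "anorm ?A (amult ?A a b) \<le> anorm ?A a * anorm ?A b"
      unfolding bounded_op_algebra_simps
    proof (rule op_norm_le)
      show "0 \<le> op_norm X a * op_norm X b" using op_norm_nonneg[OF a] op_norm_nonneg[OF b] by simp
      fix f assume f: "f \<in> ell2 X"
      then show "ell2_norm X ((\<lambda>f\<in>ell2 X. a (b f)) f) \<le> op_norm X a * op_norm X b * ell2_norm X f"
        using op_norm_bound[OF a bounded_ops_in[OF b f]]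
          mult_left_mono[OF op_norm_bound[OF b f] op_norm_nonneg[OF a]]
        by (simp add: mult.assoc)
    qed
    assume "a' \<in> elems ?A"
    then have a': "a' \<in> bounded_ops X" by simp
    show "adist ?A a a' \<le> adist ?A a b + adist ?A b a'"
    proof (rule adist_op_le)
      show "0 \<le> adist ?A a b + adist ?A b a'"
        by (intro add_nonneg_nonneg adist_op_nonneg a b a')
      fix f assume f: "f \<in> ell2 X"
      show "ell2_norm X (\<lambda>x. a f x - a' f x) \<le> (adist ?A a b + adist ?A b a') * ell2_norm X f"
        using ell2_norm_diff_triangle[OF bounded_ops_in[OF a f] bounded_ops_in[OF b f] bounded_ops_in[OF a' f]]
          adist_op_bound[OF a b f] adist_op_bound[OF b a' f] by (simp add: algebra_simps)
    qed
    assume "b' \<in> elems ?A"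
    then have b': "b' \<in> bounded_ops X" by simp
    show "adist ?A (aadd ?A a b) (aadd ?A a' b') \<le> adist ?A a a' + adist ?A b b'"
    proof (rule adist_op_le)
      show "0 \<le> adist ?A a a' + adist ?A b b'"
        by (intro add_nonneg_nonneg adist_op_nonneg a b a' b')
      fix f assume f: "f \<in> ell2 X"
      have "ell2_norm X (\<lambda>x. (a f x - a' f x) + (b f x - b' f x)) \<le>
          ell2_norm X (\<lambda>x. a f x - a' f x) + ell2_norm X (\<lambda>x. b f x - b' f x)"
        by (intro ell2_add(2) ell2_diff(1) bounded_ops_in[OF a] bounded_ops_in[OF b] bounded_ops_in[OF a'] bounded_ops_in[OF b'] f)
      then have "ell2_norm X (\<lambda>x. (a f x + b f x) - (a' f x + b' f x)) \<le> (adist ?A a a' + adist ?A b b') * ell2_norm X f"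
        using adist_op_bound[OF a a' f] adist_op_bound[OF b b' f] by (simp add: algebra_simps)
      then show "ell2_norm X (\<lambda>x. aadd ?A a b f x - aadd ?A a' b' f x) \<le> (adist ?A a a' + adist ?A b b') * ell2_norm X f"
        using f by simp
    qed
    show "adist ?A (amult ?A a b) (amult ?A a' b') \<le> anorm ?A a * adist ?A b b' + adist ?A a a' * anorm ?A b'"
    proof (rule adist_op_le)
      show "0 \<le> anorm ?A a * adist ?A b b' + adist ?A a a' * anorm ?A b'"
        unfolding bounded_op_algebra_simps
        by (intro add_nonneg_nonneg mult_nonneg_nonneg adist_op_nonneg op_norm_nonneg a b a' b')
      fix f assume f: "f \<in> ell2 X"
      note bf = bounded_ops_in[OF b f] and bf' = bounded_ops_in[OF b' f]
      have d: "(\<lambda>x. b f x - b' f x) \<in> ell2 X" by (rule ell2_diff(1)[OF bf bf'])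
      have "ell2_norm X (\<lambda>x. a (b f) x - a (b' f) x) \<le> op_norm X a * ell2_norm X (\<lambda>x. b f x - b' f x)"
        using op_norm_bound[OF a d] unfolding bounded_ops_diff[OF a bf bf'] .
      also have "\<dots> \<le> op_norm X a * (adist ?A b b' * ell2_norm X f)"
        by (intro mult_left_mono adist_op_bound[OF b b' f] op_norm_nonneg[OF a])
      finally have 1: "ell2_norm X (\<lambda>x. a (b f) x - a (b' f) x) \<le> op_norm X a * (adist ?A b b' * ell2_norm X f)" .
      have "ell2_norm X (\<lambda>x. a (b' f) x - a' (b' f) x) \<le> adist ?A a a' * ell2_norm X (b' f)"
        by (rule adist_op_bound[OF a a' bf'])
      also have "\<dots> \<le> adist ?A a a' * (op_norm X b' * ell2_norm X f)"
        by (intro mult_left_mono op_norm_bound[OF b' f] adist_op_nonneg[OF a a'])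
      finally have 2: "ell2_norm X (\<lambda>x. a (b' f) x - a' (b' f) x) \<le> adist ?A a a' * (op_norm X b' * ell2_norm X f)" .
      have "ell2_norm X (\<lambda>x. a (b f) x - a' (b' f) x) \<le>
          ell2_norm X (\<lambda>x. a (b f) x - a (b' f) x) + ell2_norm X (\<lambda>x. a (b' f) x - a' (b' f) x)"
        by (intro ell2_norm_diff_triangle bounded_ops_in[OF a] bounded_ops_in[OF a'] bf bf')
      then show "ell2_norm X (\<lambda>x. amult ?A a b f x - amult ?A a' b' f x) \<le>
          (anorm ?A a * adist ?A b b' + adist ?A a a' * anorm ?A b') * ell2_norm X f"
        using 1 2 f by (simp add: algebra_simps)
    qed
  }
  show "\<lbrakk>\<And>n::nat. f n \<in> elems ?A; \<And>\<epsilon>. \<epsilon> > 0 \<Longrightarrow> \<exists>N. \<forall>m\<ge>N. \<forall>n\<ge>N. adist ?A (f m) (f n) \<le> \<epsilon>\<rbrakk> \<Longrightarrow>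
        \<exists>b\<in>elems ?A. \<forall>\<epsilon>>0. \<forall>N. (\<forall>m\<ge>N. \<forall>n\<ge>N. adist ?A (f m) (f n) \<le> \<epsilon>) \<longrightarrow> (\<forall>n\<ge>N. adist ?A (f n) b \<le> \<epsilon>)"
    using bounded_ops_complete[of f X] by simp
qed

lemma bounded_families_simps:
  "elems (bounded_families I A) = {a \<in> I \<rightarrow>\<^sub>E elems A. bdd_above ((\<lambda>i. anorm A (a i)) ` I)}"
  "azero (bounded_families I A) = (\<lambda>i\<in>I. azero A)"
  "aadd (bounded_families I A) = (\<lambda>a b. \<lambda>i\<in>I. aadd A (a i) (b i))"
  "ascale (bounded_families I A) = (\<lambda>c a. \<lambda>i\<in>I. ascale A c (a i))"
  "amult (bounded_families I A) = (\<lambda>a b. \<lambda>i\<in>I. amult A (a i) (b i))"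
  "astar (bounded_families I A) = (\<lambda>a. \<lambda>i\<in>I. astar A (a i))"
  "anorm (bounded_families I A) = (\<lambda>a. SUP i\<in>I. anorm A (a i))"
  by (simp_all add: bounded_families_def)

text \<open>Operations act coordinatewise and the norm is a supremum, which is why \<open>I\<close>
  is nonempty; each estimate is inherited from the coordinates. A Cauchy bound for the family is one
  for every coordinate with the same \<open>N\<close>, and the coordinatewise limits keep
  it.\<close>

lemma (in complete_star_algebra) complete_star_algebra_families:
  assumes ne: "I \<noteq> {}"
  shows "complete_star_algebra (bounded_families I A)"
    and "\<And>a b i. \<lbrakk>a \<in> elems (bounded_families I A); b \<in> elems (bounded_families I A); i \<in> I\<rbrakk> \<Longrightarrow>
      adist A (a i) (b i) \<le> adist (bounded_families I A) a b"
proof -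
  let ?F = "bounded_families I A"
  have dF: "adist ?F a b = (SUP i\<in>I. adist A (a i) (b i))" for a b
    unfolding adist_def bounded_families_simps by (intro SUP_cong) auto
  have FI: "a \<in> elems ?F" if "a \<in> extensional I" "\<And>i. i \<in> I \<Longrightarrow> a i \<in> elems A"
    "\<And>i. i \<in> I \<Longrightarrow> anorm A (a i) \<le> K" for a K
    using that by (auto simp: bounded_families_simps PiE_def intro: bdd_aboveI2[where M = K])
  have Fin: "a i \<in> elems A" if "a \<in> elems ?F" "i \<in> I" for a i
    using that by (auto simp: bounded_families_simps)
  have nb: "anorm A (a i) \<le> anorm ?F a" if "a \<in> elems ?F" "i \<in> I" for a i
    using that by (auto simp: bounded_families_simps intro: cSUP_upper)
  have nl: "anorm ?F a \<le> K" if "\<And>i. i \<in> I \<Longrightarrow> anorm A (a i) \<le> K" for a K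
    using that ne by (auto simp: bounded_families_simps intro: cSUP_least)
  have db: "adist A (a i) (b i) \<le> adist ?F a b" if "a \<in> elems ?F" "b \<in> elems ?F" "i \<in> I" for a b i
    unfolding dF
  proof (rule cSUP_upper[OF that(3)], rule bdd_aboveI2[where M = "anorm ?F a + anorm ?F b"])
    fix i assume "i \<in> I"
    then show "adist A (a i) (b i) \<le> anorm ?F a + anorm ?F b"
      using dist_le_norms[OF Fin Fin] nb that by (meson add_mono order_trans)
  qed
  then show "\<And>a b i. \<lbrakk>a \<in> elems ?F; b \<in> elems ?F; i \<in> I\<rbrakk> \<Longrightarrow> adist A (a i) (b i) \<le> adist ?F a b" .
  have dl: "adist ?F a b \<le> K" if "\<And>i. i \<in> I \<Longrightarrow> adist A (a i) (b i) \<le> K" for a b K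
    unfolding dF using that ne by (auto intro: cSUP_least)
  have ext: "a \<in> extensional I" if "a \<in> elems ?F" for a
    using that by (auto simp: bounded_families_simps PiE_def)
  have Feq: "a = b" if "a \<in> elems ?F" "b \<in> elems ?F" "\<And>i. i \<in> I \<Longrightarrow> a i = b i" for a b
    using that ext by (intro extensionalityI[of a I b]) auto
  obtain i0 where i0: "i0 \<in> I" using ne by blast
  have nn: "0 \<le> anorm ?F a" if "a \<in> elems ?F" for a
    using norm_nonneg[OF Fin[OF that i0]] nb[OF that i0] by linarith
  have dn: "0 \<le> adist ?F a b" if "a \<in> elems ?F" "b \<in> elems ?F" for a b
    using dist_nonneg[OF Fin[OF that(1) i0] Fin[OF that(2) i0]] db[OF that i0] by linarith
  show "complete_star_algebra ?F"
  proof
    fix c :: complex and a b a' b' :: "'b \<Rightarrow> 'a" and f :: "nat \<Rightarrow> 'b \<Rightarrow> 'a"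
    show "azero ?F \<in> elems ?F"
      by (rule FI[where K = "anorm A (azero A)"]) (auto simp: bounded_families_simps zero_closed)
    {
      assume a: "a \<in> elems ?F"
      note ai = Fin[OF a]
      show "ascale ?F c a \<in> elems ?F"
      proof (rule FI[where K = "cmod c * anorm ?F a"])
        fix i assume i: "i \<in> I"
        show "anorm A (ascale ?F c a i) \<le> cmod c * anorm ?F a"
          using norm_scale[OF ai[OF i], of c] mult_left_mono[OF nb[OF a i], of "cmod c"] i
          by (simp add: bounded_families_simps(4))
      qed (auto simp: bounded_families_simps(4) ai scale_closed)
      show "astar ?F a \<in> elems ?F"
      proof (rule FI[where K = "anorm ?F a"])
        fix i assume i: "i \<in> I"
        show "anorm A (astar ?F a i) \<le> anorm ?F a"
          using norm_star[OF ai[OF i]] nb[OF a i] i by (simp add: bounded_families_simps(6))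
      qed (auto simp: bounded_families_simps(6) ai star_closed)
      show "adist ?F a (azero ?F) = anorm ?F a"
        unfolding dF bounded_families_simps using ai by (intro SUP_cong) (auto simp: dist_zero)
      show "anorm ?F (astar ?F a) \<le> anorm ?F a"
        using norm_star[OF ai] nb[OF a] by (intro nl) (force simp: bounded_families_simps(6))
      show "anorm ?F (ascale ?F c a) \<le> cmod c * anorm ?F a"
      proof (rule nl)
        fix i assume i: "i \<in> I"
        show "anorm A (ascale ?F c a i) \<le> cmod c * anorm ?F a"
          using norm_scale[OF ai[OF i], of c] mult_left_mono[OF nb[OF a i], of "cmod c"] i
          by (simp add: bounded_families_simps(4))
      qed
      {
        assume a': "a' \<in> elems ?F"
        note ai' = Fin[OF a']
        show "adist ?F (ascale ?F c a) (ascale ?F c a') \<le> cmod c * adist ?F a a'"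
        proof (rule dl)
          fix i assume i: "i \<in> I"
          show "adist A (ascale ?F c a i) (ascale ?F c a' i) \<le> cmod c * adist ?F a a'"
            using dist_scale[OF ai[OF i] ai'[OF i], of c] mult_left_mono[OF db[OF a a' i], of "cmod c"] i
            by (simp add: bounded_families_simps(4))
        qed
        show "adist ?F (astar ?F a) (astar ?F a') \<le> adist ?F a a'"
        proof (rule dl)
          fix i assume i: "i \<in> I"
          show "adist A (astar ?F a i) (astar ?F a' i) \<le> adist ?F a a'"
            using dist_star[OF ai[OF i] ai'[OF i]] db[OF a a' i] i by (simp add: bounded_families_simps(6))
        qed
      }
      assume b: "b \<in> elems ?F"
      note bi = Fin[OF b]
      show "aadd ?F a b \<in> elems ?F"
      proof (rule FI[where K = "anorm ?F a + anorm ?F b"])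
        fix i assume i: "i \<in> I"
        show "anorm A (aadd ?F a b i) \<le> anorm ?F a + anorm ?F b"
          using norm_add[OF ai[OF i] bi[OF i]] nb[OF a i] nb[OF b i] i by (simp add: bounded_families_simps(3))
      qed (auto simp: bounded_families_simps(3) ai bi add_closed)
      have nm: "anorm A (amult ?F a b i) \<le> anorm ?F a * anorm ?F b" if i: "i \<in> I" for i
          using norm_mult[OF ai[OF i] bi[OF i]]
            mult_mono[OF nb[OF a i] nb[OF b i] nn[OF a] norm_nonneg[OF bi[OF i]]] i
          by (simp add: bounded_families_simps(5))
      show "amult ?F a b \<in> elems ?F"
      proof (rule FI[OF _ _ nm])
        show "amult ?F a b \<in> extensional I" by (simp add: bounded_families_simps(5))
      qed (auto simp: bounded_families_simps(5) ai bi mult_closed)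
      show "adist ?F a b = 0 \<longleftrightarrow> a = b"
      proof
        assume z: "adist ?F a b = 0"
        show "a = b"
        proof (rule Feq[OF a b])
          fix i assume i: "i \<in> I"
          have "adist A (a i) (b i) = 0" using db[OF a b i] dist_nonneg[OF ai[OF i] bi[OF i]] z by simp
          then show "a i = b i" using dist_eq[OF ai[OF i] bi[OF i]] by simp
        qed
      next
        assume "a = b"
        then have "adist ?F a b \<le> 0" by (intro dl) (simp add: dist_self bi)
        then show "adist ?F a b = 0" using dn[OF a b] by simp
      qed
      show "adist ?F a b = adist ?F b a"
        unfolding dF using ai bi by (intro SUP_cong) (auto intro: dist_sym)
      show "anorm ?F (aadd ?F a b) \<le> anorm ?F a + anorm ?F b"
      proof (rule nl)
        fix i assume i: "i \<in> I"
        show "anorm A (aadd ?F a b i) \<le> anorm ?F a + anorm ?F b"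
          using norm_add[OF ai[OF i] bi[OF i]] nb[OF a i] nb[OF b i] i by (simp add: bounded_families_simps(3))
      qed
      show "anorm ?F (amult ?F a b) \<le> anorm ?F a * anorm ?F b"
        by (rule nl[OF nm])
      assume a': "a' \<in> elems ?F"
      note ai' = Fin[OF a']
      show "adist ?F a a' \<le> adist ?F a b + adist ?F b a'"
      proof (rule dl)
        fix i assume i: "i \<in> I"
        show "adist A (a i) (a' i) \<le> adist ?F a b + adist ?F b a'"
          using dist_triangle[OF ai[OF i] bi[OF i] ai'[OF i]] db[OF a b i] db[OF b a' i] by linarith
      qed
      assume b': "b' \<in> elems ?F"
      note bi' = Fin[OF b']
      show "adist ?F (aadd ?F a b) (aadd ?F a' b') \<le> adist ?F a a' + adist ?F b b'"
      proof (rule dl)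
        fix i assume i: "i \<in> I"
        show "adist A (aadd ?F a b i) (aadd ?F a' b' i) \<le> adist ?F a a' + adist ?F b b'"
          using dist_add[OF ai[OF i] bi[OF i] ai'[OF i] bi'[OF i]] db[OF a a' i] db[OF b b' i] i
          by (simp add: bounded_families_simps(3))
      qed
      show "adist ?F (amult ?F a b) (amult ?F a' b') \<le> anorm ?F a * adist ?F b b' + adist ?F a a' * anorm ?F b'"
      proof (rule dl)
        fix i assume i: "i \<in> I"
        have "adist A (amult A (a i) (b i)) (amult A (a' i) (b' i)) \<le>
          anorm A (a i) * adist A (b i) (b' i) + adist A (a i) (a' i) * anorm A (b' i)"
          by (rule dist_mult[OF ai[OF i] bi[OF i] ai'[OF i] bi'[OF i]])
        also have "\<dots> \<le> anorm ?F a * adist ?F b b' + adist ?F a a' * anorm ?F b'"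
          by (intro add_mono mult_mono nb db a b a' b' i nn dn norm_nonneg dist_nonneg ai bi ai' bi')
        finally show "adist A (amult ?F a b i) (amult ?F a' b' i) \<le> anorm ?F a * adist ?F b b' + adist ?F a a' * anorm ?F b'"
          using i by (simp add: bounded_families_simps(5))
      qed
    }
    assume f: "\<And>n::nat. f n \<in> elems ?F"
      and cauchy: "\<And>\<epsilon>. \<epsilon> > 0 \<Longrightarrow> \<exists>N. \<forall>m\<ge>N. \<forall>n\<ge>N. adist ?F (f m) (f n) \<le> \<epsilon>"
    have "\<exists>b\<in>elems A. \<forall>\<epsilon>>0. \<forall>N. (\<forall>m\<ge>N. \<forall>n\<ge>N. adist A (f m i) (f n i) \<le> \<epsilon>) \<longrightarrow> (\<forall>n\<ge>N. adist A (f n i) b \<le> \<epsilon>)"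
      if i: "i \<in> I" for i
    proof (rule complete)
      show "f n i \<in> elems A" for n using Fin[OF f i] .
      show "\<exists>N. \<forall>m\<ge>N. \<forall>n\<ge>N. adist A (f m i) (f n i) \<le> \<epsilon>" if "\<epsilon> > 0" for \<epsilon>
        using cauchy[OF that] db[OF f f i] by (meson order_trans)
    qed
    then obtain b0 where b0: "\<And>i. i \<in> I \<Longrightarrow> b0 i \<in> elems A"
      "\<And>i \<epsilon> N n. i \<in> I \<Longrightarrow> \<epsilon> > 0 \<Longrightarrow> (\<forall>m\<ge>N. \<forall>n\<ge>N. adist A (f m i) (f n i) \<le> \<epsilon>) \<Longrightarrow> n \<ge> N \<Longrightarrow> adist A (f n i) (b0 i) \<le> \<epsilon>"
      by metis
    define b where "b = restrict b0 I"
    have lim: "adist A (f n i) (b i) \<le> \<epsilon>"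
      if "i \<in> I" "\<epsilon> > 0" "\<forall>m\<ge>N. \<forall>n\<ge>N. adist ?F (f m) (f n) \<le> \<epsilon>" "n \<ge> N" for i \<epsilon> N n
    proof -
      have "\<forall>m\<ge>N. \<forall>n\<ge>N. adist A (f m i) (f n i) \<le> \<epsilon>"
        using that(3) db[OF f f that(1)] by (meson order_trans)
      from b0(2)[OF that(1,2) this that(4)] show ?thesis using that(1) by (simp add: b_def)
    qed
    obtain N1 where N1: "\<forall>m\<ge>N1. \<forall>n\<ge>N1. adist ?F (f m) (f n) \<le> 1" using cauchy[of 1] by auto
    have bF: "b \<in> elems ?F"
    proof (rule FI[where K = "1 + anorm ?F (f N1)"])
      fix i assume i: "i \<in> I"
      show bi: "b i \<in> elems A" using b0(1)[OF i] i by (simp add: b_def)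
      show "anorm A (b i) \<le> 1 + anorm ?F (f N1)"
        using norm_le_dist[OF bi Fin[OF f i], of N1] dist_sym[OF bi Fin[OF f i], of N1]
          lim[OF i _ N1 order_refl] nb[OF f i, of N1] by simp
    qed (simp add: b_def)
    show "\<exists>b\<in>elems ?F. \<forall>\<epsilon>>0. \<forall>N. (\<forall>m\<ge>N. \<forall>n\<ge>N. adist ?F (f m) (f n) \<le> \<epsilon>) \<longrightarrow> (\<forall>n\<ge>N. adist ?F (f n) b \<le> \<epsilon>)"
      using bF by (intro bexI[of _ b] allI impI dl) (auto intro: lim)
  qed
qed

section \<open>Partial bijections and their shift operators\<close>

definition partial_bij :: "'x set \<Rightarrow> ('x \<times> 'x) set \<Rightarrow> bool" where
  "partial_bij X s \<longleftrightarrow> s \<subseteq> X \<times> X \<and> single_valued s \<and> single_valued (s\<inverse>)"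

lemma partial_bijD:
  assumes "partial_bij X s"
  shows "(x, y) \<in> s \<Longrightarrow> x \<in> X" "(x, y) \<in> s \<Longrightarrow> y \<in> X"
    "(x, y) \<in> s \<Longrightarrow> (x, y') \<in> s \<Longrightarrow> y = y'" "(x, y) \<in> s \<Longrightarrow> (x', y) \<in> s \<Longrightarrow> x = x'"
proof -
  show "(x, y) \<in> s \<Longrightarrow> x \<in> X" "(x, y) \<in> s \<Longrightarrow> y \<in> X"
    using assms by (auto simp: partial_bij_def)
  show "(x, y) \<in> s \<Longrightarrow> (x, y') \<in> s \<Longrightarrow> y = y'"
    using assms single_valuedD[of s x y y'] by (simp add: partial_bij_def)
  show "(x, y) \<in> s \<Longrightarrow> (x', y) \<in> s \<Longrightarrow> x = x'"
    using assms single_valuedD[of "s\<inverse>" y x x'] by (simp add: partial_bij_def)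
qed

lemma partial_bijI:
  assumes "\<And>x y. (x, y) \<in> s \<Longrightarrow> x \<in> X \<and> y \<in> X"
    and "\<And>x y y'. (x, y) \<in> s \<Longrightarrow> (x, y') \<in> s \<Longrightarrow> y = y'"
    and "\<And>x x' y. (x, y) \<in> s \<Longrightarrow> (x', y) \<in> s \<Longrightarrow> x = x'"
  shows "partial_bij X s"
  unfolding partial_bij_def
proof (intro conjI)
  show "s \<subseteq> X \<times> X" using assms(1) by auto
  show "single_valued s" using assms(2) by (rule single_valuedI)
  show "single_valued (s\<inverse>)" using assms(3) by (intro single_valuedI) simp
qed

lemma partial_bij_converse: "partial_bij X s \<Longrightarrow> partial_bij X (s\<inverse>)"
  unfolding partial_bij_def by auto

text \<open>The operator that carries \<open>delta x\<close> to \<open>delta y\<close> for (x, y) in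
  \<open>s\<close>, written on functions: the value at \<open>y\<close> is read off at its unique
  preimage.\<close>

definition shift :: "('x \<times> 'x) set \<Rightarrow> ('x \<Rightarrow> complex) \<Rightarrow> 'x \<Rightarrow> complex" where
  "shift s f = (\<lambda>y. if y \<in> Range s then f (THE x. (x, y) \<in> s) else 0)"

definition shift_op :: "'x set \<Rightarrow> ('x \<times> 'x) set \<Rightarrow> 'x ell2_op" where
  "shift_op X s = (\<lambda>f\<in>ell2 X. shift s f)"

lemma shift_at:
  assumes "partial_bij X s" "(x, y) \<in> s"
  shows "shift s f y = f x"
proof -
  have "(THE x. (x, y) \<in> s) = x"
    using assms(2) partial_bijD(4)[OF assms(1)] by (intro the_equality)
  then show ?thesis using assms(2) by (auto simp: shift_def)
qed

lemma shift_off: "y \<notin> Range s \<Longrightarrow> shift s f y = 0"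
  by (simp add: shift_def)

lemma shift_eqI:
  assumes "partial_bij X s" "\<And>x y. (x, y) \<in> s \<Longrightarrow> g y = f x" "\<And>y. y \<notin> Range s \<Longrightarrow> g y = 0"
  shows "shift s f = g"
proof
  fix y show "shift s f y = g y"
  proof (cases "y \<in> Range s")
    case True
    then obtain x where "(x, y) \<in> s" by blast
    then show ?thesis using shift_at[OF assms(1)] assms(2) by simp
  qed (simp add: shift_off assms(3))
qed

text \<open>A sum of squares over finitely many targets is the sum over their preimages, which are
  distinct because \<open>s\<close> is single valued.\<close>

lemma shift_ell2:
  assumes s: "partial_bij X s" and f: "f \<in> ell2 X"
  shows "shift s f \<in> ell2 X" "ell2_norm X (shift s f) \<le> ell2_norm X f"
proof -
  define g where "g y = (THE x. (x, y) \<in> s)" for y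
  have g: "(g y, y) \<in> s" if y: "y \<in> Range s" for y
  proof -
    obtain x where x: "(x, y) \<in> s" using y by blast
    then have "g y = x" unfolding g_def using partial_bijD(4)[OF s] by (intro the_equality)
    then show ?thesis using x by simp
  qed
  have "L2_set (\<lambda>y. cmod (shift s f y)) F \<le> ell2_norm X f" if F: "finite F" "F \<subseteq> X" for F
  proof -
    let ?F = "F \<inter> Range s"
    have inj: "inj_on g ?F"
      using g partial_bijD(3)[OF s] by (intro inj_onI) (metis IntD2)
    have sub: "g ` ?F \<subseteq> X" using g partial_bijD(1)[OF s] by blast
    have "(\<Sum>y\<in>F. (cmod (shift s f y))\<^sup>2) = (\<Sum>y\<in>?F. (cmod (shift s f y))\<^sup>2)"
      using F(1) by (intro sum.mono_neutral_right) (auto simp: shift_off)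
    also have "\<dots> = (\<Sum>y\<in>?F. (cmod (f (g y)))\<^sup>2)"
      using shift_at[OF s g] by (intro sum.cong) auto
    also have "\<dots> = (\<Sum>x\<in>g ` ?F. (cmod (f x))\<^sup>2)"
      by (subst sum.reindex[OF inj]) simp
    finally have "L2_set (\<lambda>y. cmod (shift s f y)) F = L2_set (\<lambda>x. cmod (f x)) (g ` ?F)"
      by (simp add: L2_set_def)
    also have "\<dots> \<le> ell2_norm X f"
      using F(1) sub by (intro L2_set_le_ell2_norm[OF f]) auto
    finally show ?thesis .
  qed
  moreover have "shift s f y = 0" if "y \<notin> X" for y
    using that partial_bijD(2)[OF s] by (intro shift_off) auto
  ultimately show "shift s f \<in> ell2 X" "ell2_norm X (shift s f) \<le> ell2_norm X f"
    using ell2_bound[of X "shift s f" "ell2_norm X f"] by auto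
qed

lemma shift_op_bounded: "partial_bij X s \<Longrightarrow> shift_op X s \<in> bounded_ops X"
  unfolding shift_op_def
  by (rule bounded_opsI[where K = 1]) (auto simp: shift_ell2, auto simp: shift_def)

lemma shift_inner:
  assumes s: "partial_bij X s" and f: "f \<in> ell2 X" and h: "h \<in> ell2 X"
  shows "ell2_inner X (shift (s\<inverse>) f) h = ell2_inner X f (shift s h)"
proof -
  define g where "g y = (THE x. (x, y) \<in> s)" for y
  have g: "(g y, y) \<in> s" if y: "y \<in> Range s" for y
  proof -
    obtain x where x: "(x, y) \<in> s" using y by blast
    then have "g y = x" unfolding g_def using partial_bijD(4)[OF s] by (intro the_equality)
    then show ?thesis using x by simp
  qed
  have bij: "bij_betw g (Range s) (Domain s)"
    unfolding bij_betw_def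
  proof
    show "inj_on g (Range s)"
      using g partial_bijD(3)[OF s] by (intro inj_onI) metis
    show "g ` Range s = Domain s"
    proof
      show "Domain s \<subseteq> g ` Range s"
      proof
        fix x assume "x \<in> Domain s"
        then obtain y where y: "(x, y) \<in> s" by blast
        then have "x = g y" "y \<in> Range s" using g partial_bijD(4)[OF s] by blast+
        then show "x \<in> g ` Range s" by blast
      qed
    qed (use g in blast)
  qed
  have RX: "Range s \<subseteq> X" "Domain s \<subseteq> X" using partial_bijD(1,2)[OF s] by blast+
  have 1: "ell2_inner X f (shift s h) = (\<Sum>\<^sub>\<infinity>y\<in>Range s. cnj (f y) * h (g y))"
    unfolding ell2_inner_def
  proof (rule infsum_cong_neutral)
    show "cnj (f y) * h (g y) = 0" if "y \<in> Range s - X" for y using RX that by blast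
    show "cnj (f y) * shift s h y = 0" if "y \<in> X - Range s" for y using that by (simp add: shift_off)
    show "cnj (f y) * shift s h y = cnj (f y) * h (g y)" if "y \<in> X \<inter> Range s" for y
      using that shift_at[OF s g] by simp
  qed
  have sc: "partial_bij X (s\<inverse>)" by (rule partial_bij_converse[OF s])
  have sg: "shift (s\<inverse>) f (g y) = f y" if "y \<in> Range s" for y
    using shift_at[OF sc] g[OF that] by simp
  have "ell2_inner X (shift (s\<inverse>) f) h = (\<Sum>\<^sub>\<infinity>x\<in>Domain s. cnj (shift (s\<inverse>) f x) * h x)"
    unfolding ell2_inner_def
  proof (rule infsum_cong_neutral)
    show "cnj (shift (s\<inverse>) f x) * h x = 0" if "x \<in> Domain s - X" for x using RX that by blast
    show "cnj (shift (s\<inverse>) f x) * h x = 0" if "x \<in> X - Domain s" for x using that by (simp add: shift_off)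
  qed simp
  also have "\<dots> = (\<Sum>\<^sub>\<infinity>y\<in>Range s. cnj (shift (s\<inverse>) f (g y)) * h (g y))"
    by (rule infsum_reindex_bij_betw[OF bij, symmetric])
  also have "\<dots> = (\<Sum>\<^sub>\<infinity>y\<in>Range s. cnj (f y) * h (g y))"
    using sg by (intro infsum_cong) simp
  finally show ?thesis using 1 by simp
qed

lemma op_adjoint_shift:
  assumes s: "partial_bij X s"
  shows "op_adjoint X (shift_op X s) = shift_op X (s\<inverse>)"
proof (rule op_adjoint_eqI)
  show "ell2_inner X (shift_op X (s\<inverse>) f) g = ell2_inner X f (shift_op X s g)"
    if "f \<in> ell2 X" "g \<in> ell2 X" for f g
    using that by (simp add: shift_op_def shift_inner[OF s])
qed (intro shift_op_bounded partial_bij_converse s)+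

lemma partial_bij_relcomp:
  assumes s: "partial_bij X s" and t: "partial_bij X t"
  shows "partial_bij X (t O s)"
proof (rule partial_bijI)
  show "x \<in> X \<and> y \<in> X" if "(x, y) \<in> t O s" for x y
    using that partial_bijD(1)[OF t] partial_bijD(2)[OF s] by blast
  show "y = y'" if "(x, y) \<in> t O s" "(x, y') \<in> t O s" for x y y'
    using that partial_bijD(3)[OF t] partial_bijD(3)[OF s] by (metis relcompE Pair_inject)
  show "x = x'" if "(x, y) \<in> t O s" "(x', y) \<in> t O s" for x x' y
    using that partial_bijD(4)[OF t] partial_bijD(4)[OF s] by (metis relcompE Pair_inject)
qed

lemma shift_relcomp:
  assumes s: "partial_bij X s" and t: "partial_bij X t"
  shows "shift (t O s) f = shift s (shift t f)"
proof (rule shift_eqI[OF partial_bij_relcomp[OF s t]])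
  fix x y assume "(x, y) \<in> t O s"
  then obtain z where z: "(x, z) \<in> t" "(z, y) \<in> s" by blast
  then show "shift s (shift t f) y = f x" using shift_at[OF s z(2)] shift_at[OF t z(1)] by simp
next
  fix y assume y: "y \<notin> Range (t O s)"
  show "shift s (shift t f) y = 0"
  proof (cases "y \<in> Range s")
    case True
    then obtain z where z: "(z, y) \<in> s" by blast
    then have "z \<notin> Range t" using y by blast
    then show ?thesis using shift_at[OF s z] by (simp add: shift_off)
  qed (simp add: shift_off)
qed

lemma amult_shift_op:
  assumes s: "partial_bij X s" and t: "partial_bij X t"
  shows "amult (bounded_op_algebra X) (shift_op X s) (shift_op X t) = shift_op X (t O s)"
  by (auto simp: shift_op_def shift_relcomp[OF s t] shift_ell2[OF t] cong: restrict_cong)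

lemma shift_empty: "shift {} f = (\<lambda>x. 0)"
  by (auto simp: shift_def)

lemma shift_delta:
  assumes s: "partial_bij X s" and "(x, y) \<in> s"
  shows "shift s (delta x) = delta y"
proof (rule shift_eqI[OF s])
  fix x' y' assume "(x', y') \<in> s"
  then show "delta y y' = delta x x'"
    using assms(2) partial_bijD(3,4)[OF s] by (auto simp: delta_def)
next
  fix y' assume "y' \<notin> Range s"
  then show "delta y y' = 0" using assms(2) by (auto simp: delta_def)
qed

lemma shift_delta_off:
  assumes s: "partial_bij X s" and "x \<notin> Domain s"
  shows "shift s (delta x) = (\<lambda>y. 0)"
proof (rule shift_eqI[OF s])
  fix x' y' assume "(x', y') \<in> s"
  then show "0 = delta x x'" using assms(2) by (auto simp: delta_def)
qed simp

lemma partial_bij_inverse_property: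
  assumes "partial_bij X s" shows "s O s\<inverse> O s = s"
proof
  show "s O s\<inverse> O s \<subseteq> s"
  proof
    fix p assume "p \<in> s O s\<inverse> O s"
    then obtain x y z w where p: "p = (x, w)" "(x, y) \<in> s" "(z, y) \<in> s" "(z, w) \<in> s" by auto
    then show "p \<in> s" using partial_bijD(4)[OF assms p(2,3)] by simp
  qed
  show "s \<subseteq> s O s\<inverse> O s" by auto
qed

text \<open>An action \<open>\<tau>\<close> of the inverse semigroup by partial bijections of
  \<open>Z\<close> becomes a representation on l^2(Z). This serves for the zero representation, for
  the regular representation on \<open>P\<close> and for the actions transported to the natural
  numbers.\<close>

lemma shift_rep:
  assumes \<tau>: "\<And>s. s \<in> S \<Longrightarrow> partial_bij Z (\<tau> s)"
    and closed: "\<And>s. s \<in> S \<Longrightarrow> s\<inverse> \<in> S" "\<And>s t. s \<in> S \<Longrightarrow> t \<in> S \<Longrightarrow> t O s \<in> S" "{} \<in> S"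
    and comp: "\<And>s t. s \<in> S \<Longrightarrow> t \<in> S \<Longrightarrow> \<tau> (t O s) = \<tau> t O \<tau> s"
    and conv: "\<And>s. s \<in> S \<Longrightarrow> \<tau> (s\<inverse>) = (\<tau> s)\<inverse>"
    and empty: "\<tau> {} = {}"
  shows "(\<lambda>s\<in>S. shift_op Z (\<tau> s)) \<in> partial_isometry_reps S (bounded_op_algebra Z)"
  unfolding partial_isometry_reps_def
proof (intro CollectI conjI ballI)
  let ?A = "bounded_op_algebra Z" and ?\<rho> = "\<lambda>s\<in>S. shift_op Z (\<tau> s)"
  show "?\<rho> \<in> S \<rightarrow>\<^sub>E elems ?A" using shift_op_bounded[OF \<tau>] by auto
  show "?\<rho> {} = azero ?A"
    using closed(3) empty by (auto simp: shift_op_def shift_empty intro!: restrict_ext)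
  fix s assume s: "s \<in> S"
  note b = \<tau>[OF s] and bc = partial_bij_converse[OF \<tau>[OF s]]
  show "?\<rho> (s\<inverse>) = astar ?A (?\<rho> s)"
    using s closed(1) by (simp add: conv op_adjoint_shift \<tau>)
  show "amult ?A (amult ?A (?\<rho> s) (astar ?A (?\<rho> s))) (?\<rho> s) = ?\<rho> s"
    using s amult_shift_op[OF b bc] amult_shift_op[OF partial_bij_relcomp[OF b bc] b]
      partial_bij_inverse_property[OF b]
    by (simp add: op_adjoint_shift[OF b] del: bounded_op_algebra_simps(5))
  fix t assume t: "t \<in> S"
  show "?\<rho> (t O s) = amult ?A (?\<rho> s) (?\<rho> t)"
    using s t closed(2) amult_shift_op[OF \<tau>[OF s] \<tau>[OF t]] by (simp add: comp del: bounded_op_algebra_simps(5))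
qed

section \<open>Transport of partial bijections to the natural numbers\<close>

lemma map_prod_image_mem: "(a, b) \<in> map_prod e e ` s \<longleftrightarrow> (\<exists>x y. (x, y) \<in> s \<and> a = e x \<and> b = e y)"
  by (auto simp: image_iff) (blast, force)

lemma transport_partial_bij:
  assumes e: "inj_on e Z" and s: "partial_bij Z s"
  shows "partial_bij UNIV (map_prod e e ` s)"
proof (rule partial_bijI)
  fix a b c
  assume "(a, b) \<in> map_prod e e ` s" "(a, c) \<in> map_prod e e ` s"
  then obtain x y x' y' where "(x, y) \<in> s" "(x', y') \<in> s" "e x = e x'" "b = e y" "c = e y'"
    unfolding map_prod_image_mem by metis
  then show "b = c" using partial_bijD[OF s] inj_onD[OF e] by metis
next
  fix a b c
  assume "(a, b) \<in> map_prod e e ` s" "(c, b) \<in> map_prod e e ` s"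
  then obtain x y x' y' where "(x, y) \<in> s" "(x', y') \<in> s" "e y = e y'" "a = e x" "c = e x'"
    unfolding map_prod_image_mem by metis
  then show "a = c" using partial_bijD[OF s] inj_onD[OF e] by metis
qed simp

lemma transport_relcomp:
  assumes e: "inj_on e Z" and s: "partial_bij Z s" and t: "partial_bij Z t"
  shows "map_prod e e ` (t O s) = (map_prod e e ` t) O (map_prod e e ` s)"
proof (rule equalityI; rule subrelI)
  fix a b assume "(a, b) \<in> map_prod e e ` (t O s)"
  then obtain x y where "(x, y) \<in> t O s" and ab: "a = e x" "b = e y"
    unfolding map_prod_image_mem by auto
  then obtain z where z: "(x, z) \<in> t" "(z, y) \<in> s" by blast
  have "(a, e z) \<in> map_prod e e ` t" "(e z, b) \<in> map_prod e e ` s"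
    using imageI[OF z(1), of "map_prod e e"] imageI[OF z(2), of "map_prod e e"] ab by simp_all
  then show "(a, b) \<in> (map_prod e e ` t) O (map_prod e e ` s)" by (rule relcompI)
next
  fix a b assume "(a, b) \<in> (map_prod e e ` t) O (map_prod e e ` s)"
  then obtain c where "(a, c) \<in> map_prod e e ` t" "(c, b) \<in> map_prod e e ` s"
    by (rule relcompEpair)
  then obtain x z z' y where *: "(x, z) \<in> t" "(z', y) \<in> s" "a = e x" "b = e y" "e z = e z'"
    unfolding map_prod_image_mem by auto
  then have "z = z'" using partial_bijD(2)[OF t] partial_bijD(1)[OF s] inj_onD[OF e] by metis
  then have xy: "(x, y) \<in> t O s" using relcompI[OF *(1)] *(2) by simp
  show "(a, b) \<in> map_prod e e ` (t O s)" using imageI[OF xy, of "map_prod e e"] * by simp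
qed

text \<open>The universal algebra sees only representations on l^2 of the natural numbers, so an
  action on a countable set \<open>Z\<close> is moved along an injection. The operators vanish on
  the basis vectors outside the image of \<open>Z\<close>.\<close>

lemma shift_rep_nat:
  fixes e :: "'z \<Rightarrow> nat"
  assumes e: "inj_on e Z"
    and \<tau>: "\<And>s. s \<in> S \<Longrightarrow> partial_bij Z (\<tau> s)"
    and closed: "\<And>s. s \<in> S \<Longrightarrow> s\<inverse> \<in> S" "\<And>s t. s \<in> S \<Longrightarrow> t \<in> S \<Longrightarrow> t O s \<in> S" "{} \<in> S"
    and comp: "\<And>s t. s \<in> S \<Longrightarrow> t \<in> S \<Longrightarrow> \<tau> (t O s) = \<tau> t O \<tau> s"
    and conv: "\<And>s. s \<in> S \<Longrightarrow> \<tau> (s\<inverse>) = (\<tau> s)\<inverse>"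
    and empty: "\<tau> {} = {}"
  shows "(\<lambda>s\<in>S. shift_op UNIV (map_prod e e ` \<tau> s)) \<in> reps_on_ell2_nat S"
proof (rule shift_rep[OF _ closed])
  show "partial_bij UNIV (map_prod e e ` \<tau> s)" if "s \<in> S" for s
    using transport_partial_bij[OF e \<tau>[OF that]] .
  show "map_prod e e ` \<tau> (t O s) = map_prod e e ` \<tau> t O map_prod e e ` \<tau> s" if "s \<in> S" "t \<in> S" for s t
    using transport_relcomp[OF e \<tau>[OF that(1)] \<tau>[OF that(2)]] comp[OF that] by simp
  show "map_prod e e ` \<tau> (s\<inverse>) = (map_prod e e ` \<tau> s)\<inverse>" if "s \<in> S" for s
    using conv[OF that] by (auto simp: map_prod_image_mem image_iff)
qed (simp_all add: empty)

section \<open>The left inverse hull\<close>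

locale subsemigroup_of_group = group G for G (structure) +
  fixes P
  assumes subsemigroup: "subsemigroup G P"
begin

abbreviation "S \<equiv> left_inverse_hull G P"
abbreviation "J \<equiv> constructible_ideals G P"

lemma P_carrier: "p \<in> P \<Longrightarrow> p \<in> carrier G"
  using subsemigroup by (auto simp: subsemigroup_def)

lemma P_mult: "p \<in> P \<Longrightarrow> q \<in> P \<Longrightarrow> p \<otimes> q \<in> P"
  using subsemigroup by (auto simp: subsemigroup_def)

text \<open>A relational form of \<open>group_label\<close> that involves no choice: the empty map
  has every element of the group as a label, so labels may be multiplied without asking whether a
  product is empty.\<close>

definition has_label :: "'a \<Rightarrow> ('a \<times> 'a) set \<Rightarrow> bool" where
  "has_label g s \<longleftrightarrow> g \<in> carrier G \<and> (\<forall>x y. (x, y) \<in> s \<longrightarrow> y = g \<otimes> x)"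

lemma hull_carrier: "s \<in> S \<Longrightarrow> (x, y) \<in> s \<Longrightarrow> x \<in> P \<and> y \<in> P"
proof (induction arbitrary: x y rule: left_inverse_hull.induct)
  case (product s t)
  then show ?case by blast
qed (auto simp: left_mult_def P_mult)

text \<open>Labels follow the constructors of the hull: the converse takes the inverse label, and a
  composite the product of the labels.\<close>

lemma hull_label: "s \<in> S \<Longrightarrow> \<exists>g. has_label g s"
proof (induction rule: left_inverse_hull.induct)
  case (gen p)
  then show ?case by (auto simp: has_label_def left_mult_def P_carrier intro!: exI[of _ p])
next
  case zero
  then show ?case by (auto simp: has_label_def)
next
  case (inverse s)
  then obtain g where g: "has_label g s" by blast
  have "has_label (inv g) (s\<inverse>)"
    unfolding has_label_def
  proof (intro conjI allI impI)
    show "inv g \<in> carrier G" using g by (simp add: has_label_def)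
    fix x y assume "(x, y) \<in> s\<inverse>"
    then have "(y, x) \<in> s" by simp
    then show "y = inv g \<otimes> x"
      using g hull_carrier[OF inverse(1)] P_carrier by (auto simp: has_label_def inv_solve_left)
  qed
  then show ?case by blast
next
  case (product s t)
  then obtain g h where gh: "has_label g s" "has_label h t" by blast
  have "has_label (g \<otimes> h) (t O s)"
    unfolding has_label_def
  proof (intro conjI allI impI)
    show "g \<otimes> h \<in> carrier G" using gh by (simp add: has_label_def)
    fix x y assume "(x, y) \<in> t O s"
    then obtain z where "(x, z) \<in> t" "(z, y) \<in> s" by blast
    then show "y = g \<otimes> h \<otimes> x"
      using gh hull_carrier[OF product(2)] P_carrier by (auto simp: has_label_def m_assoc)
  qed
  then show ?case by blast
qed

lemma label_unique:
  assumes "has_label g s" "(x, y) \<in> s" "has_label h t" "(x, y) \<in> t" "x \<in> carrier G"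
  shows "g = h"
proof -
  have "g \<otimes> x = h \<otimes> x" using assms unfolding has_label_def by metis
  then show ?thesis using assms(1,3,5) right_cancel unfolding has_label_def by metis
qed

lemma group_label_eq:
  assumes "has_label g s" "s \<in> S" "s \<noteq> {}"
  shows "group_label G s = g"
proof -
  obtain x y where xy: "(x, y) \<in> s" using assms(3) by auto
  then have x: "x \<in> carrier G" using hull_carrier[OF assms(2)] P_carrier by blast
  show ?thesis
    unfolding group_label_def
  proof (rule the_equality)
    show "g \<in> carrier G \<and> (\<forall>(x, y)\<in>s. y = g \<otimes> x)" using assms(1) by (auto simp: has_label_def)
    fix h assume "h \<in> carrier G \<and> (\<forall>(x, y)\<in>s. y = h \<otimes> x)"
    then have "has_label h s" by (auto simp: has_label_def)
    then show "h = g" using label_unique xy assms(1) x by blast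
  qed
qed

lemma hull_partial_bij: "s \<in> S \<Longrightarrow> partial_bij P s"
proof -
  assume s: "s \<in> S"
  then obtain g where g: "has_label g s" using hull_label by blast
  show ?thesis
  proof (rule partial_bijI)
    show "x \<in> P \<and> y \<in> P" if "(x, y) \<in> s" for x y using hull_carrier[OF s that] .
    show "y = y'" if "(x, y) \<in> s" "(x, y') \<in> s" for x y y' using that g by (auto simp: has_label_def)
    fix x x' y assume a: "(x, y) \<in> s" "(x', y) \<in> s"
    then have "g \<otimes> x = g \<otimes> x'" using g by (auto simp: has_label_def)
    then show "x = x'" using g hull_carrier[OF s a(1)] hull_carrier[OF s a(2)] P_carrier
      by (simp add: has_label_def)
  qed
qed

section \<open>Constructible ideals as the idempotents of the hull\<close>

lemma J_subset: "X \<in> J \<Longrightarrow> X \<subseteq> P"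
  by (induction rule: constructible_ideals.induct) auto

lemma left_mult_mem: "(x, y) \<in> left_mult G P p \<longleftrightarrow> x \<in> P \<and> y = p \<otimes> x"
  by (auto simp: left_mult_def)

text \<open>As \<open>P\<close> need not contain the identity, p X is written as p^-1 (p p) X to fit
  the only constructor for ideals, which takes an image and then a preimage.\<close>

lemma left_mult_image_J:
  assumes "p \<in> P" "X \<in> J"
  shows "left_mult G P p `` X \<in> J"
proof -
  have "left_mult G P p `` X = {y \<in> P. p \<otimes> y \<in> (\<lambda>x. (p \<otimes> p) \<otimes> x) ` X}"
  proof (intro Set.set_eqI iffI)
    fix y assume "y \<in> left_mult G P p `` X"
    then obtain x where x: "x \<in> X" "x \<in> P" "y = p \<otimes> x" by (auto simp: left_mult_mem)
    then show "y \<in> {y \<in> P. p \<otimes> y \<in> (\<lambda>x. (p \<otimes> p) \<otimes> x) ` X}"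
      using assms(1) P_mult P_carrier m_assoc[of p p x] by (simp add: image_iff) metis
  next
    fix y assume "y \<in> {y \<in> P. p \<otimes> y \<in> (\<lambda>x. (p \<otimes> p) \<otimes> x) ` X}"
    then obtain x where x: "x \<in> X" "y \<in> P" "p \<otimes> y = (p \<otimes> p) \<otimes> x" by auto
    then have xP: "x \<in> P" using J_subset[OF assms(2)] by blast
    then have "p \<otimes> y = p \<otimes> (p \<otimes> x)" using x assms(1) P_carrier by (simp add: m_assoc)
    then have "y = p \<otimes> x" using x xP assms(1) P_carrier by simp
    then show "y \<in> left_mult G P p `` X" using x xP by (auto simp: left_mult_mem)
  qed
  also have "\<dots> \<in> J" using assms P_mult by (intro constructible_ideals.step) auto
  finally show ?thesis .
qed

text \<open>For the same reason the preimage p^-1 X is written as (p p)^-1 p X.\<close>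

lemma left_mult_vimage_J:
  assumes "p \<in> P" "X \<in> J"
  shows "(left_mult G P p)\<inverse> `` X \<in> J"
proof -
  have "(left_mult G P p)\<inverse> `` X = {y \<in> P. (p \<otimes> p) \<otimes> y \<in> (\<lambda>x. p \<otimes> x) ` X}"
  proof (intro Set.set_eqI iffI)
    fix y assume "y \<in> (left_mult G P p)\<inverse> `` X"
    then have y: "p \<otimes> y \<in> X" "y \<in> P" by (auto simp: left_mult_mem)
    then have "(p \<otimes> p) \<otimes> y = p \<otimes> (p \<otimes> y)" using assms(1) P_carrier by (simp add: m_assoc)
    then show "y \<in> {y \<in> P. (p \<otimes> p) \<otimes> y \<in> (\<lambda>x. p \<otimes> x) ` X}" using y by auto
  next
    fix y assume "y \<in> {y \<in> P. (p \<otimes> p) \<otimes> y \<in> (\<lambda>x. p \<otimes> x) ` X}"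
    then obtain x where x: "x \<in> X" "y \<in> P" "(p \<otimes> p) \<otimes> y = p \<otimes> x" by auto
    then have xP: "x \<in> P" using J_subset[OF assms(2)] by blast
    then have "p \<otimes> x = p \<otimes> (p \<otimes> y)" using x assms(1) P_carrier by (simp add: m_assoc)
    then have "x = p \<otimes> y" using x xP assms(1) P_carrier by simp
    then show "y \<in> (left_mult G P p)\<inverse> `` X" using x by (auto simp: left_mult_mem)
  qed
  also have "\<dots> \<in> J" using assms P_mult by (intro constructible_ideals.step) auto
  finally show ?thesis .
qed

text \<open>Converses are a constructor of the hull, so the induction carries the claim for
  \<open>s\<close> and for its converse together.\<close>

lemma hull_image_J: "s \<in> S \<Longrightarrow> X \<in> J \<Longrightarrow> s `` X \<in> J"
proof -
  have "\<forall>X\<in>J. s `` X \<in> J \<and> s\<inverse> `` X \<in> J" if "s \<in> S" for s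
    using that
  proof (induction rule: left_inverse_hull.induct)
    case (gen p)
    then show ?case using left_mult_image_J left_mult_vimage_J by blast
  next
    case (product s t)
    then show ?case by (auto simp: relcomp_Image converse_relcomp)
  qed (auto intro: constructible_ideals.empty)
  then show "s \<in> S \<Longrightarrow> X \<in> J \<Longrightarrow> s `` X \<in> J" by blast
qed

lemma hull_converse: "s \<in> S \<Longrightarrow> s\<inverse> \<in> S"
  by (rule left_inverse_hull.inverse)

lemma hull_Domain_J: "s \<in> S \<Longrightarrow> Domain s \<in> J"
proof -
  assume s: "s \<in> S"
  have "Domain s = s\<inverse> `` P" using hull_carrier[OF s] by auto
  then show ?thesis using hull_image_J[OF hull_converse[OF s] constructible_ideals.top] by simp
qed

lemma hull_Range_J: "s \<in> S \<Longrightarrow> Range s \<in> J"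
  using hull_Domain_J[OF hull_converse, of s] by simp

text \<open>The identity of \<open>P\<close> is p^-1 p for any p, and the idempotent of p^-1 q X is
  p^-1 q e q^-1 p with e the idempotent of \<open>X\<close>. For empty \<open>P\<close> the empty
  map serves.\<close>

lemma Id_on_hull: "X \<in> J \<Longrightarrow> Id_on X \<in> S"
proof (induction rule: constructible_ideals.induct)
  case empty
  then show ?case using left_inverse_hull.zero by simp
next
  case top
  show ?case
  proof (cases "P = {}")
    case True
    then show ?thesis using left_inverse_hull.zero by simp
  next
    case False
    then obtain p where p: "p \<in> P" by blast
    have "left_mult G P p O (left_mult G P p)\<inverse> = Id_on P"
    proof -
      have "x = z" if "x \<in> P" "z \<in> P" "p \<otimes> x = p \<otimes> z" for x z
        using that p P_carrier by simp
      then show ?thesis by (auto simp: left_mult_mem Id_on_def relcomp_unfold)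
    qed
    then show ?thesis
      using left_inverse_hull.product[OF hull_converse left_inverse_hull.gen, OF left_inverse_hull.gen, OF p p]
      by simp
  qed
next
  case (step p q X)
  let ?p = "left_mult G P p" and ?q = "left_mult G P q"
  have XP: "X \<subseteq> P" by (rule J_subset[OF step(3)])
  have c: "x = z" if "x \<in> P" "z \<in> P" "p' \<otimes> x = p' \<otimes> z" "p' \<in> P" for x z p'
    using that P_carrier by simp
  have p: "?p \<in> S" "?q \<in> S" by (rule left_inverse_hull.gen[OF step(1)], rule left_inverse_hull.gen[OF step(2)])
  have qX: "?q\<inverse> O Id_on X O ?q \<in> S"
    using left_inverse_hull.product[OF left_inverse_hull.product[OF p(2) step.IH] hull_converse[OF p(2)]]
    by (simp add: O_assoc)
  have "?p O (?q\<inverse> O Id_on X O ?q) O ?p\<inverse> \<in> S"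
    by (rule left_inverse_hull.product[OF left_inverse_hull.product[OF hull_converse[OF p(1)] qX] p(1)])
  also have "?p O (?q\<inverse> O Id_on X O ?q) O ?p\<inverse> = Id_on {y \<in> P. p \<otimes> y \<in> (\<lambda>x. q \<otimes> x) ` X}"
    (is "?l = ?r")
  proof (intro Set.set_eqI)
    fix z :: "'a \<times> 'a"
    obtain a b where z: "z = (a, b)" by force
    have "(a, b) \<in> ?l \<longleftrightarrow> a \<in> P \<and> b \<in> P \<and> p \<otimes> a = p \<otimes> b \<and> (\<exists>x\<in>X. p \<otimes> a = q \<otimes> x)"
    proof
      assume "(a, b) \<in> ?l"
      then show "a \<in> P \<and> b \<in> P \<and> p \<otimes> a = p \<otimes> b \<and> (\<exists>x\<in>X. p \<otimes> a = q \<otimes> x)"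
        unfolding relcomp_unfold using XP c[of _ _ q] step(2) by (auto simp: left_mult_mem)
    next
      assume *: "a \<in> P \<and> b \<in> P \<and> p \<otimes> a = p \<otimes> b \<and> (\<exists>x\<in>X. p \<otimes> a = q \<otimes> x)"
      then obtain x where x: "x \<in> X" "p \<otimes> a = q \<otimes> x" by blast
      have "x \<in> P" using x(1) XP by (rule subsetD[rotated])
      then have "(a, p \<otimes> a) \<in> ?p" "(p \<otimes> a, x) \<in> ?q\<inverse>" "(x, x) \<in> Id_on X" "(x, p \<otimes> a) \<in> ?q" "(p \<otimes> a, b) \<in> ?p\<inverse>"
        using * x by (simp_all add: left_mult_mem Id_on_iff)
      then show "(a, b) \<in> ?l" by (intro relcompI)
    qed
    also have "\<dots> \<longleftrightarrow> (a, b) \<in> ?r"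
      using c[of a b p] step(1) by (auto simp: Id_on_iff image_iff)
    finally show "z \<in> ?l \<longleftrightarrow> z \<in> ?r" by (simp add: z)
  qed
  finally show ?case .
qed

text \<open>The intersection is the domain of the product of the two idempotents, hence of an
  element of the hull.\<close>

lemma Int_J: "X \<in> J \<Longrightarrow> Y \<in> J \<Longrightarrow> X \<inter> Y \<in> J"
proof -
  assume X: "X \<in> J" and Y: "Y \<in> J"
  have "Id_on X O Id_on Y \<in> S" by (intro left_inverse_hull.product Id_on_hull X Y)
  moreover have "Domain (Id_on X O Id_on Y) = X \<inter> Y" by (auto simp: Id_on_def relcomp_unfold)
  ultimately show ?thesis using hull_Domain_J by metis
qed

lemma Id_on_relcomp: "Id_on X O Id_on Y = Id_on (X \<inter> Y)"
  by (auto simp: Id_on_def relcomp_unfold)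

end

lemma (in subsemigroup_of_group) left_regular_isometry_eq_shift:
  assumes p: "p \<in> P"
  shows "left_regular_isometry G P p = shift_op P (left_mult G P p)"
  unfolding left_regular_isometry_def shift_op_def
proof (rule restrict_ext)
  fix f assume "f \<in> ell2 P"
  have b: "partial_bij P (left_mult G P p)"
    by (rule hull_partial_bij[OF left_inverse_hull.gen[OF p]])
  show "(\<lambda>y. if \<exists>x\<in>P. y = p \<otimes> x then f (inv p \<otimes> y) else 0) = shift (left_mult G P p) f"
  proof (rule shift_eqI[OF b, symmetric])
    fix x y assume "(x, y) \<in> left_mult G P p"
    then have "x \<in> P" "y = p \<otimes> x" by (auto simp: left_mult_mem)
    moreover from this have "inv p \<otimes> y = x" using p P_carrier by (simp add: m_assoc[symmetric])
    ultimately show "(if \<exists>x\<in>P. y = p \<otimes> x then f (inv p \<otimes> y) else 0) = f x" by auto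
  next
    fix y assume "y \<notin> Range (left_mult G P p)"
    then show "(if \<exists>x\<in>P. y = p \<otimes> x then f (inv p \<otimes> y) else 0) = 0" by (auto simp: Range_iff left_mult_mem)
  qed
qed

section \<open>Representations by partial isometries\<close>

lemma
  assumes \<rho>: "\<rho> \<in> partial_isometry_reps S (bounded_op_algebra X)"
  shows rep_bounded: "s \<in> S \<Longrightarrow> \<rho> s \<in> bounded_ops X"
    and rep_relcomp: "\<lbrakk>s \<in> S; t \<in> S; f \<in> ell2 X\<rbrakk> \<Longrightarrow> \<rho> (t O s) f = \<rho> s (\<rho> t f)"
    and rep_empty: "f \<in> ell2 X \<Longrightarrow> \<rho> {} f = (\<lambda>x. 0)"
    and rep_converse: "s \<in> S \<Longrightarrow> \<rho> (s\<inverse>) = op_adjoint X (\<rho> s)"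
    and rep_partial_isometry: "\<lbrakk>s \<in> S; f \<in> ell2 X\<rbrakk> \<Longrightarrow> \<rho> s (op_adjoint X (\<rho> s) (\<rho> s f)) = \<rho> s f"
proof -
  have b: "\<rho> s \<in> bounded_ops X" if "s \<in> S" for s
    using \<rho> that by (auto simp: partial_isometry_reps_def)
  then show "s \<in> S \<Longrightarrow> \<rho> s \<in> bounded_ops X" .
  have "\<rho> (t O s) = amult (bounded_op_algebra X) (\<rho> s) (\<rho> t)" if "s \<in> S" "t \<in> S"
    using \<rho> that unfolding partial_isometry_reps_def by blast
  then show "\<lbrakk>s \<in> S; t \<in> S; f \<in> ell2 X\<rbrakk> \<Longrightarrow> \<rho> (t O s) f = \<rho> s (\<rho> t f)" by simp
  show "f \<in> ell2 X \<Longrightarrow> \<rho> {} f = (\<lambda>x. 0)"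
    using \<rho> by (simp add: partial_isometry_reps_def)
  show "s \<in> S \<Longrightarrow> \<rho> (s\<inverse>) = op_adjoint X (\<rho> s)"
    using \<rho> by (simp add: partial_isometry_reps_def)
  have "amult (bounded_op_algebra X) (amult (bounded_op_algebra X) (\<rho> s) (op_adjoint X (\<rho> s))) (\<rho> s) = \<rho> s"
    if "s \<in> S"
    using \<rho> that unfolding partial_isometry_reps_def by simp
  then show "\<lbrakk>s \<in> S; f \<in> ell2 X\<rbrakk> \<Longrightarrow> \<rho> s (op_adjoint X (\<rho> s) (\<rho> s f)) = \<rho> s f"
    using bounded_ops_in[OF b[of s], of f] by (simp add: fun_eq_iff restrict_def split: if_splits)
qed

lemma inner_op_adjoint_right:
  assumes "T \<in> bounded_ops X" "f \<in> ell2 X" "g \<in> ell2 X"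
  shows "ell2_inner X f (op_adjoint X T g) = ell2_inner X (T f) g"
  using op_adjoint(2)[OF assms(1,3,2)] by (subst (1 2) inner_cnj) simp

text \<open>Since T is a partial isometry, E = T* T is a self-adjoint idempotent; <E f, E f> = <f, E
  f> makes E contractive, and then |T f|^2 = <f, E f> \<le> |f|^2.\<close>

lemma rep_contraction:
  assumes \<rho>: "\<rho> \<in> partial_isometry_reps S (bounded_op_algebra X)" and s: "s \<in> S" and f: "f \<in> ell2 X"
  shows "ell2_norm X (\<rho> s f) \<le> ell2_norm X f"
proof -
  let ?T = "\<rho> s" and ?T' = "op_adjoint X (\<rho> s)"
  note b = rep_bounded[OF \<rho> s] and b' = op_adjoint(1)[OF rep_bounded[OF \<rho> s]]
  note Tf = bounded_ops_in[OF b f] and Ef = bounded_ops_in[OF b' bounded_ops_in[OF b f]]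
  have "ell2_inner X (?T' (?T f)) (?T' (?T f)) = ell2_inner X f (?T' (?T (?T' (?T f))))"
    using inner_op_adjoint_right[OF b f bounded_ops_in[OF b Ef]] op_adjoint(2)[OF b Tf Ef] by simp
  also have "\<dots> = ell2_inner X f (?T' (?T f))"
    using rep_partial_isometry[OF \<rho> s f] by simp
  finally have E: "ell2_norm X (?T' (?T f)) \<le> 1 * ell2_norm X f"
    using adjoint_bound[of "\<lambda>f. ?T' (?T f)" f X "\<lambda>f. f" 1, OF Ef f Ef] by simp
  have "(ell2_norm X (?T f))\<^sup>2 = cmod (ell2_inner X (?T f) (?T f))"
    unfolding inner_self[OF Tf] norm_of_real by simp
  also have "\<dots> = cmod (ell2_inner X f (?T' (?T f)))"
    using inner_op_adjoint_right[OF b f Tf] by simp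
  also have "\<dots> \<le> ell2_norm X f * ell2_norm X (?T' (?T f))"
    by (rule Cauchy_Schwarz_ell2[OF f Ef])
  also have "\<dots> \<le> (ell2_norm X f)\<^sup>2"
    unfolding power2_eq_square using E by (intro mult_left_mono) simp_all
  finally show ?thesis by (rule power2_le_imp_le) simp
qed

section \<open>The canonical homomorphism\<close>

text \<open>The isometry from l^2(X) into l^2 of the natural numbers induced by an injection
  \<open>e\<close>. The map \<open>pull\<close> is its adjoint, as \<open>inner_push\<close>
  shows.\<close>

definition push :: "('x \<Rightarrow> nat) \<Rightarrow> 'x set \<Rightarrow> ('x \<Rightarrow> complex) \<Rightarrow> nat \<Rightarrow> complex" where
  "push e X f = (\<lambda>n. if n \<in> e ` X then f (inv_into X e n) else 0)"

definition pull :: "('x \<Rightarrow> nat) \<Rightarrow> 'x set \<Rightarrow> (nat \<Rightarrow> complex) \<Rightarrow> 'x \<Rightarrow> complex" where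
  "pull e X h = (\<lambda>x. if x \<in> X then h (e x) else 0)"

context
  fixes e :: "'x \<Rightarrow> nat" and X :: "'x set"
  assumes e: "inj_on e X"
begin

lemma push_at: "x \<in> X \<Longrightarrow> push e X f (e x) = f x"
  using e by (simp add: push_def)

lemma infsum_push:
  assumes "\<And>n. n \<notin> e ` X \<Longrightarrow> F n = 0"
  shows "infsum F UNIV = (\<Sum>\<^sub>\<infinity>x\<in>X. F (e x))"
proof -
  have "infsum F UNIV = infsum F (e ` X)"
    using assms by (intro infsum_cong_neutral) auto
  also have "\<dots> = (\<Sum>\<^sub>\<infinity>x\<in>X. F (e x))"
    by (subst infsum_reindex[OF e]) (simp add: comp_def)
  finally show ?thesis .
qed

lemma push_ell2:
  assumes "f \<in> ell2 X"
  shows "push e X f \<in> ell2 UNIV" "ell2_norm UNIV (push e X f) = ell2_norm X f"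
proof -
  have z: "(cmod (push e X f n))\<^sup>2 = 0" if "n \<notin> e ` X" for n using that by (simp add: push_def)
  have "(\<lambda>n. (cmod (push e X f n))\<^sup>2) summable_on e ` X"
    using ell2_summable[OF assms] by (subst summable_on_reindex[OF e])
      (auto simp: comp_def push_at cong: summable_on_cong)
  then have "(\<lambda>n. (cmod (push e X f n))\<^sup>2) summable_on UNIV"
    by (rule summable_on_cong_neutral[THEN iffD1, rotated -1]) (use z in auto)
  then show "push e X f \<in> ell2 UNIV" by (simp add: ell2_def)
  show "ell2_norm UNIV (push e X f) = ell2_norm X f"
    unfolding ell2_norm_def using infsum_push[of "\<lambda>n. (cmod (push e X f n))\<^sup>2", OF z]
    by (simp add: push_at cong: infsum_cong)
qed

lemma pull_ell2:
  assumes "h \<in> ell2 UNIV"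
  shows "pull e X h \<in> ell2 X" "ell2_norm X (pull e X h) \<le> ell2_norm UNIV h"
proof -
  have "L2_set (\<lambda>x. cmod (pull e X h x)) F \<le> ell2_norm UNIV h" if F: "finite F" "F \<subseteq> X" for F
  proof -
    have "(\<Sum>x\<in>F. (cmod (pull e X h x))\<^sup>2) = (\<Sum>x\<in>F. (cmod (h (e x)))\<^sup>2)"
      using F(2) by (intro sum.cong) (auto simp: pull_def)
    also have "\<dots> = (\<Sum>n\<in>e ` F. (cmod (h n))\<^sup>2)"
      by (subst sum.reindex[OF inj_on_subset[OF e F(2)]]) simp
    finally have "L2_set (\<lambda>x. cmod (pull e X h x)) F = L2_set (\<lambda>n. cmod (h n)) (e ` F)"
      by (simp add: L2_set_def)
    then show ?thesis using L2_set_le_ell2_norm[OF assms, of "e ` F"] F(1) by simp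
  qed
  moreover have "pull e X h x = 0" if "x \<notin> X" for x using that by (simp add: pull_def)
  ultimately show "pull e X h \<in> ell2 X" "ell2_norm X (pull e X h) \<le> ell2_norm UNIV h"
    using ell2_bound[of X "pull e X h" "ell2_norm UNIV h"] by auto
qed

lemma pull_push:
  assumes "f \<in> ell2 X" shows "pull e X (push e X f) = f"
  using ell2_outside[OF assms] by (auto simp: pull_def push_at)

lemma inner_push: "ell2_inner UNIV (push e X f) h = ell2_inner X f (pull e X h)"
  unfolding ell2_inner_def
  by (subst infsum_push) (auto simp: push_def[of e X f] pull_def e intro!: infsum_cong)

text \<open>With V = \<open>push\<close> the conditions read a V = V T and V* a = T V*: the range of
  V reduces \<open>a\<close>, and \<open>T\<close> is the part of \<open>a\<close> on it. Taking
  adjoints exchanges the two conditions, so the pair is stable under \<open>astar\<close>, which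
  either condition alone would not be.\<close>

definition intertwines :: "nat ell2_op \<Rightarrow> 'x ell2_op \<Rightarrow> bool" where
  "intertwines a T \<longleftrightarrow> (\<forall>f\<in>ell2 X. a (push e X f) = push e X (T f)) \<and>
    (\<forall>h\<in>ell2 UNIV. pull e X (a h) = T (pull e X h))"

lemma intertwines_eq:
  assumes "T \<in> bounded_ops X" "intertwines a T"
  shows "(\<lambda>f\<in>ell2 X. pull e X (a (push e X f))) = T"
proof (rule extensionalityI[OF restrict_extensional bounded_ops_extensional[OF assms(1)]])
  fix f assume "f \<in> ell2 X"
  then show "(\<lambda>f\<in>ell2 X. pull e X (a (push e X f))) f = T f"
    using assms(2) pull_push[OF bounded_ops_in[OF assms(1)]] by (simp add: intertwines_def)
qed

lemma intertwines_closed: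
  assumes a: "a \<in> bounded_ops UNIV" "T \<in> bounded_ops X" "intertwines a T"
    and b: "b \<in> bounded_ops UNIV" "R \<in> bounded_ops X" "intertwines b R"
  shows "intertwines (azero (bounded_op_algebra UNIV)) (azero (bounded_op_algebra X))"
    and "intertwines (aadd (bounded_op_algebra UNIV) a b) (aadd (bounded_op_algebra X) T R)"
    and "intertwines (ascale (bounded_op_algebra UNIV) c a) (ascale (bounded_op_algebra X) c T)"
    and "intertwines (amult (bounded_op_algebra UNIV) a b) (amult (bounded_op_algebra X) T R)"
    and "intertwines (astar (bounded_op_algebra UNIV) a) (astar (bounded_op_algebra X) T)"
proof -
  note i = a(3)[unfolded intertwines_def] b(3)[unfolded intertwines_def]
  show "intertwines (azero (bounded_op_algebra UNIV)) (azero (bounded_op_algebra X))"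
    by (auto simp: intertwines_def push_ell2 pull_ell2, auto simp: push_def pull_def)
  show "intertwines (aadd (bounded_op_algebra UNIV) a b) (aadd (bounded_op_algebra X) T R)"
    unfolding intertwines_def
  proof (intro conjI ballI)
    fix f assume f: "f \<in> ell2 X"
    show "aadd (bounded_op_algebra UNIV) a b (push e X f) = push e X (aadd (bounded_op_algebra X) T R f)"
      using f i by (auto simp: push_ell2, auto simp: push_def)
  next
    fix h :: "nat \<Rightarrow> complex" assume h: "h \<in> ell2 UNIV"
    have "pull e X (\<lambda>n. a h n + b h n) = (\<lambda>x. pull e X (a h) x + pull e X (b h) x)"
      by (auto simp: pull_def)
    then show "pull e X (aadd (bounded_op_algebra UNIV) a b h) = aadd (bounded_op_algebra X) T R (pull e X h)"
      using h i by (simp add: pull_ell2)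
  qed
  show "intertwines (ascale (bounded_op_algebra UNIV) c a) (ascale (bounded_op_algebra X) c T)"
    unfolding intertwines_def
  proof (intro conjI ballI)
    fix f assume f: "f \<in> ell2 X"
    show "ascale (bounded_op_algebra UNIV) c a (push e X f) = push e X (ascale (bounded_op_algebra X) c T f)"
      using f i by (auto simp: push_ell2, auto simp: push_def)
  next
    fix h :: "nat \<Rightarrow> complex" assume h: "h \<in> ell2 UNIV"
    have "pull e X (\<lambda>n. c * a h n) = (\<lambda>x. c * pull e X (a h) x)"
      by (auto simp: pull_def)
    then show "pull e X (ascale (bounded_op_algebra UNIV) c a h) = ascale (bounded_op_algebra X) c T (pull e X h)"
      using h i by (simp add: pull_ell2)
  qed
  show "intertwines (amult (bounded_op_algebra UNIV) a b) (amult (bounded_op_algebra X) T R)"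
    unfolding intertwines_def
  proof (intro conjI ballI)
    fix f assume f: "f \<in> ell2 X"
    show "amult (bounded_op_algebra UNIV) a b (push e X f) = push e X (amult (bounded_op_algebra X) T R f)"
      using f i bounded_ops_in[OF b(2) f] by (simp add: push_ell2)
  next
    fix h :: "nat \<Rightarrow> complex" assume h: "h \<in> ell2 UNIV"
    show "pull e X (amult (bounded_op_algebra UNIV) a b h) = amult (bounded_op_algebra X) T R (pull e X h)"
      using h i bounded_ops_in[OF b(1) h] by (simp add: pull_ell2)
  qed
  have i1: "a (push e X f) = push e X (T f)" if "f \<in> ell2 X" for f using i that by simp
  have i2: "pull e X (a h) = T (pull e X h)" if "h \<in> ell2 UNIV" for h using i that by simp
  note a' = op_adjoint(1)[OF a(1)] and T' = op_adjoint(1)[OF a(2)]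
  have inner_pull: "ell2_inner UNIV h (push e X f) = ell2_inner X (pull e X h) f" for f h
    using inner_push[of f h] by (subst (1 2) inner_cnj) simp
  show "intertwines (astar (bounded_op_algebra UNIV) a) (astar (bounded_op_algebra X) T)"
    unfolding intertwines_def bounded_op_algebra_simps
  proof (intro conjI ballI)
    fix f assume f: "f \<in> ell2 X"
    note p = push_ell2(1)[OF f] and T'f = bounded_ops_in[OF T' f]
    show "op_adjoint UNIV a (push e X f) = push e X (op_adjoint X T f)"
    proof (rule ell2_eqI[OF bounded_ops_in[OF a' p] push_ell2(1)[OF T'f]])
      fix h :: "nat \<Rightarrow> complex" assume h: "h \<in> ell2 UNIV"
      show "ell2_inner UNIV h (op_adjoint UNIV a (push e X f)) = ell2_inner UNIV h (push e X (op_adjoint X T f))"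
        using inner_op_adjoint_right[OF a(1) h p] i2[OF h]
          inner_op_adjoint_right[OF a(2) pull_ell2(1)[OF h] f] by (simp add: inner_pull)
    qed
  next
    fix h :: "nat \<Rightarrow> complex" assume h: "h \<in> ell2 UNIV"
    note p = pull_ell2(1)[OF h] and a'h = bounded_ops_in[OF a' h]
    show "pull e X (op_adjoint UNIV a h) = op_adjoint X T (pull e X h)"
    proof (rule ell2_eqI[OF pull_ell2(1)[OF a'h] bounded_ops_in[OF T' p]])
      fix k assume k: "k \<in> ell2 X"
      show "ell2_inner X k (pull e X (op_adjoint UNIV a h)) = ell2_inner X k (op_adjoint X T (pull e X h))"
        using inner_op_adjoint_right[OF a(2) k p] inner_push[of "T k" h] i1[OF k]
          inner_push[of k "op_adjoint UNIV a h"] inner_op_adjoint_right[OF a(1) push_ell2(1)[OF k] h] by simp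
    qed
  qed
qed

lemma intertwines_shift:
  assumes s: "partial_bij X s"
  shows "intertwines (shift_op UNIV (map_prod e e ` s)) (shift_op X s)"
  unfolding intertwines_def
proof (intro conjI ballI)
  note t = transport_partial_bij[OF e s]
  fix f assume f: "f \<in> ell2 X"
  have "shift (map_prod e e ` s) (push e X f) = push e X (shift s f)"
  proof (rule shift_eqI[OF t])
    fix a b assume "(a, b) \<in> map_prod e e ` s"
    then obtain x y where xy: "(x, y) \<in> s" "a = e x" "b = e y" unfolding map_prod_image_mem by auto
    then show "push e X (shift s f) b = push e X f a"
      using shift_at[OF s xy(1)] push_at partial_bijD(1,2)[OF s xy(1)] by simp
  next
    fix b assume b: "b \<notin> Range (map_prod e e ` s)"
    show "push e X (shift s f) b = 0"
    proof (cases "b \<in> e ` X")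
      case True
      then obtain y where y: "y \<in> X" "b = e y" by blast
      have "y \<notin> Range s"
      proof
        assume "y \<in> Range s"
        then obtain x where "(x, y) \<in> s" by blast
        from RangeI[OF imageI[OF this, of "map_prod e e", simplified]] show False using b y by simp
      qed
      then show ?thesis using y push_at by (simp add: shift_off)
    qed (simp add: push_def)
  qed
  then show "shift_op UNIV (map_prod e e ` s) (push e X f) = push e X (shift_op X s f)"
    using f by (simp add: shift_op_def push_ell2)
next
  note t = transport_partial_bij[OF e s]
  fix h :: "nat \<Rightarrow> complex" assume h: "h \<in> ell2 UNIV"
  have "shift s (pull e X h) = pull e X (shift (map_prod e e ` s) h)"
  proof (rule shift_eqI[OF s])
    fix x y assume xy: "(x, y) \<in> s"
    have "(e x, e y) \<in> map_prod e e ` s" using imageI[OF xy, of "map_prod e e"] by simp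
    then show "pull e X (shift (map_prod e e ` s) h) y = pull e X h x"
      using shift_at[OF t] partial_bijD(1,2)[OF s xy] by (simp add: pull_def)
  next
    fix y assume y: "y \<notin> Range s"
    have "e y \<notin> Range (map_prod e e ` s)" if "y \<in> X"
    proof
      assume "e y \<in> Range (map_prod e e ` s)"
      then obtain a where "(a, e y) \<in> map_prod e e ` s" by (rule RangeE)
      then obtain x z where xz: "(x, z) \<in> s" "e y = e z" unfolding map_prod_image_mem by auto
      then have "y = z" using inj_onD[OF e xz(2) that] partial_bijD(2)[OF s xz(1)] by simp
      then show False using xz y by blast
    qed
    then show "pull e X (shift (map_prod e e ` s) h) y = 0" by (simp add: pull_def shift_off)
  qed
  then show "pull e X (shift_op UNIV (map_prod e e ` s) h) = shift_op X s (pull e X h)"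
    using h by (simp add: shift_op_def pull_ell2)
qed

text \<open>Compression along the isometry does not increase distances, and the compression of
  \<open>a\<close> is \<open>T\<close>. Nothing is asked of \<open>b\<close> but boundedness,
  because it will be a limit of operators known to intertwine.\<close>

lemma intertwines_dist:
  assumes "a \<in> bounded_ops UNIV" "T \<in> bounded_ops X" "intertwines a T"
    and "b \<in> bounded_ops UNIV"
  shows "adist (bounded_op_algebra X) T (\<lambda>f\<in>ell2 X. pull e X (b (push e X f))) \<le> adist (bounded_op_algebra UNIV) a b"
proof (rule adist_op_le[OF adist_op_nonneg[OF assms(1,4)]])
  fix f assume f: "f \<in> ell2 X"
  note p = push_ell2[OF f]
  have "(\<lambda>x. T f x - pull e X (b (push e X f)) x) = pull e X (\<lambda>n. a (push e X f) n - b (push e X f) n)"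
  proof -
    have "T f = pull e X (a (push e X f))"
      using assms(3) f pull_push[OF bounded_ops_in[OF assms(2) f]] by (simp add: intertwines_def)
    then show ?thesis by (auto simp: pull_def)
  qed
  then have "ell2_norm X (\<lambda>x. T f x - pull e X (b (push e X f)) x) \<le>
      ell2_norm UNIV (\<lambda>n. a (push e X f) n - b (push e X f) n)"
    using pull_ell2(2)[OF ell2_diff(1)[OF bounded_ops_in[OF assms(1) p(1)] bounded_ops_in[OF assms(4) p(1)]]]
    by simp
  also have "\<dots> \<le> adist (bounded_op_algebra UNIV) a b * ell2_norm X f"
    using adist_op_bound[OF assms(1,4) p(1)] p(2) by simp
  finally show "ell2_norm X (\<lambda>x. T f x - (\<lambda>f\<in>ell2 X. pull e X (b (push e X f))) f x) \<le>
      adist (bounded_op_algebra UNIV) a b * ell2_norm X f"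
    using f by simp
qed

end

lemma zero_rep: "{} \<in> S \<Longrightarrow> (\<And>s. s \<in> S \<Longrightarrow> s\<inverse> \<in> S) \<Longrightarrow> (\<And>s t. s \<in> S \<Longrightarrow> t \<in> S \<Longrightarrow> t O s \<in> S) \<Longrightarrow>
  (\<lambda>s\<in>S. shift_op X {}) \<in> partial_isometry_reps S (bounded_op_algebra X)"
  by (rule shift_rep) (auto intro: partial_bijI)

section \<open>The universal and the reduced algebra\<close>

locale countable_subsemigroup = subsemigroup_of_group +
  assumes countable_group: "countable (carrier G)"
begin

abbreviation "Reps \<equiv> reps_on_ell2_nat S"
abbreviation "BN \<equiv> bounded_op_algebra (UNIV :: nat set)"
abbreviation "BP \<equiv> bounded_op_algebra P"
abbreviation "Fam \<equiv> bounded_families Reps BN"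
abbreviation "Full \<equiv> full_semigroup_cstar G P"
abbreviation "Red \<equiv> reduced_semigroup_cstar G P"

lemmas hull_product = left_inverse_hull.product[of _ G P]
  and hull_zero = left_inverse_hull.zero[of G P]

text \<open>The universal norm is a supremum over \<open>Reps\<close>; the zero representation keeps
  the index set nonempty.\<close>

lemma Reps_nonempty: "Reps \<noteq> {}"
  using zero_rep[of S UNIV] hull_zero hull_converse hull_product by blast

sublocale BN: complete_star_algebra BN by (rule complete_star_algebra_bounded_ops)
sublocale BP: complete_star_algebra BP by (rule complete_star_algebra_bounded_ops)
sublocale Fam: complete_star_algebra Fam by (rule BN.complete_star_algebra_families(1)[OF Reps_nonempty])

lemmas Fam_dist = BN.complete_star_algebra_families(2)[OF Reps_nonempty]

text \<open>Representations consist of contractions, so 1 is a bound that is uniform over all of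
  them.\<close>

lemma universal_gen_Fam: "s \<in> S \<Longrightarrow> universal_gen S s \<in> elems Fam"
proof -
  assume s: "s \<in> S"
  have "op_norm UNIV (\<rho> s) \<le> 1" if "\<rho> \<in> Reps" for \<rho>
    using rep_contraction[OF that s] by (intro op_norm_le) auto
  then show ?thesis
    using rep_bounded s
    by (auto simp: bounded_families_simps universal_gen_def intro!: bdd_aboveI2[where M = 1])
qed

lemma universal_gens_Fam: "universal_gen S ` S \<subseteq> elems Fam"
  using universal_gen_Fam by blast

lemma Full_closed: "closed_star_subalgebra Fam (elems Full)"
  unfolding universal_cstar_algebra_def by (rule Fam.closed_star_subalgebra_generated[OF universal_gens_Fam])

lemma Full_gen: "s \<in> S \<Longrightarrow> universal_gen S s \<in> elems Full"
  unfolding universal_cstar_algebra_def using generated_contains[of "universal_gen S ` S"] by (meson imageI subsetD)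

lemma Full_minimal: "closed_star_subalgebra Fam B \<Longrightarrow> (\<And>s. s \<in> S \<Longrightarrow> universal_gen S s \<in> B) \<Longrightarrow> elems Full \<subseteq> B"
  unfolding universal_cstar_algebra_def by (rule generated_minimal) auto

lemma Full_simps:
  "azero Full = azero Fam" "aadd Full = aadd Fam" "ascale Full = ascale Fam" "amult Full = amult Fam"
  "astar Full = astar Fam" "anorm Full = anorm Fam"
  by (simp_all add: universal_cstar_algebra_def)

lemma Full_Fam: "a \<in> elems Full \<Longrightarrow> a \<in> elems Fam"
  using closed_star_subalgebraD(1)[OF Full_closed] by (rule subsetD)

lemma Fam_apply: "a \<in> elems Fam \<Longrightarrow> \<rho> \<in> Reps \<Longrightarrow> a \<rho> \<in> bounded_ops UNIV"
  by (auto simp: bounded_families_simps)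

lemma Fam_ops_apply:
  assumes "\<rho> \<in> Reps"
  shows "azero Fam \<rho> = azero BN" "aadd Fam a b \<rho> = aadd BN (a \<rho>) (b \<rho>)"
    "ascale Fam c a \<rho> = ascale BN c (a \<rho>)" "amult Fam a b \<rho> = amult BN (a \<rho>) (b \<rho>)"
    "astar Fam a \<rho> = astar BN (a \<rho>)"
  using assms by (simp_all add: bounded_families_simps del: bounded_op_algebra_simps)

lemma universal_gen_ops:
  "universal_gen S {} = azero Fam"
  "s \<in> S \<Longrightarrow> universal_gen S (s\<inverse>) = astar Fam (universal_gen S s)"
  "\<lbrakk>s \<in> S; t \<in> S\<rbrakk> \<Longrightarrow> universal_gen S (t O s) = amult Fam (universal_gen S s) (universal_gen S t)"
proof -
  show "universal_gen S {} = azero Fam"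
    by (auto simp: universal_gen_def bounded_families_simps partial_isometry_reps_def intro!: restrict_ext)
  show "universal_gen S (s\<inverse>) = astar Fam (universal_gen S s)" if "s \<in> S"
    using that by (auto simp: universal_gen_def bounded_families_simps rep_converse intro!: restrict_ext)
  have "\<rho> (t O s) = amult BN (\<rho> s) (\<rho> t)" if "s \<in> S" "t \<in> S" "\<rho> \<in> Reps" for \<rho> s t
    using that unfolding partial_isometry_reps_def by blast
  then show "universal_gen S (t O s) = amult Fam (universal_gen S s) (universal_gen S t)" if "s \<in> S" "t \<in> S"
    using that by (auto simp: universal_gen_def bounded_families_simps simp del: bounded_op_algebra_simps intro!: restrict_ext)
qed

lemma regular_gens: "left_regular_isometry G P ` P \<subseteq> elems BP"
  using left_regular_isometry_eq_shift shift_op_bounded[OF hull_partial_bij[OF left_inverse_hull.gen]] by auto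

lemma Red_closed: "closed_star_subalgebra BP (elems Red)"
  unfolding reduced_semigroup_cstar_def by (rule BP.closed_star_subalgebra_generated[OF regular_gens])

lemma Red_gen: "p \<in> P \<Longrightarrow> left_regular_isometry G P p \<in> elems Red"
  unfolding reduced_semigroup_cstar_def
  using generated_contains[of "left_regular_isometry G P ` P"] by (meson imageI subsetD)

lemma Red_minimal: "closed_star_subalgebra BP B \<Longrightarrow> (\<And>p. p \<in> P \<Longrightarrow> left_regular_isometry G P p \<in> B) \<Longrightarrow> elems Red \<subseteq> B"
  unfolding reduced_semigroup_cstar_def by (rule generated_minimal) auto

lemma Red_simps:
  "azero Red = azero BP" "aadd Red = aadd BP" "ascale Red = ascale BP" "amult Red = amult BP"
  "astar Red = astar BP" "anorm Red = anorm BP"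
  by (simp_all add: reduced_semigroup_cstar_def del: bounded_op_algebra_simps)

lemma Red_BP: "T \<in> elems Red \<Longrightarrow> T \<in> bounded_ops P"
  using closed_star_subalgebraD(1)[OF Red_closed] by auto

text \<open>The reduced algebra is generated by the isometries of \<open>P\<close> alone; adjoints
  and products of shift operators are again shift operators, so the induction over the hull stays
  inside it.\<close>

lemma shift_Red: "s \<in> S \<Longrightarrow> shift_op P s \<in> elems Red"
proof (induction rule: left_inverse_hull.induct)
  case (gen p)
  then show ?case using Red_gen left_regular_isometry_eq_shift by simp
next
  case zero
  have "azero BP = shift_op P {}" by (simp add: shift_op_def shift_empty)
  then show ?case using closed_star_subalgebraD(2)[OF Red_closed] by simp
next
  case (inverse s)
  then show ?case
    using closed_star_subalgebraD(6)[OF Red_closed inverse.IH] by (simp add: op_adjoint_shift hull_partial_bij)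
next
  case (product s t)
  then show ?case
    using closed_star_subalgebraD(5)[OF Red_closed product.IH] by (simp only: amult_shift_op hull_partial_bij)
qed

text \<open>What \<^const>\<open>canonical_hom\<close> is required to be, except for being extensional.\<close>

definition canonical :: "(((('a \<times> 'a) set \<Rightarrow> nat ell2_op) \<Rightarrow> nat ell2_op) \<Rightarrow> 'a ell2_op) \<Rightarrow> bool" where
  "canonical \<phi> \<longleftrightarrow> star_hom Full Red \<phi> \<and>
     (\<forall>a\<in>elems Full. anorm Red (\<phi> a) \<le> anorm Full a) \<and>
     (\<forall>p\<in>P. \<phi> (universal_gen S (left_mult G P p)) = left_regular_isometry G P p)"

lemma canonicalD:
  assumes "canonical \<phi>"
  shows "a \<in> elems Full \<Longrightarrow> \<phi> a \<in> elems Red"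
    "\<lbrakk>a \<in> elems Full; b \<in> elems Full\<rbrakk> \<Longrightarrow> \<phi> (aadd Fam a b) = aadd BP (\<phi> a) (\<phi> b)"
    "a \<in> elems Full \<Longrightarrow> \<phi> (ascale Fam c a) = ascale BP c (\<phi> a)"
    "\<lbrakk>a \<in> elems Full; b \<in> elems Full\<rbrakk> \<Longrightarrow> \<phi> (amult Fam a b) = amult BP (\<phi> a) (\<phi> b)"
    "a \<in> elems Full \<Longrightarrow> \<phi> (astar Fam a) = astar BP (\<phi> a)"
    "a \<in> elems Full \<Longrightarrow> op_norm P (\<phi> a) \<le> anorm Fam a"
    "p \<in> P \<Longrightarrow> \<phi> (universal_gen S (left_mult G P p)) = left_regular_isometry G P p"
  using assms unfolding canonical_def star_hom_def Full_simps Red_simps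
  by (auto simp del: bounded_op_algebra_simps(1-6))

text \<open>\<open>star_hom\<close> has no clause for zero; the value is recovered from 0 times
  zero.\<close>

lemma canonical_zero: assumes "canonical \<phi>" shows "\<phi> (azero Fam) = azero BP"
proof -
  have z: "azero Fam \<in> elems Full" by (rule closed_star_subalgebraD(2)[OF Full_closed])
  have "ascale Fam 0 (azero Fam) = azero Fam"
    by (auto simp: bounded_families_simps intro!: restrict_ext)
  then have "\<phi> (azero Fam) = ascale BP 0 (\<phi> (azero Fam))"
    using canonicalD(3)[OF assms z, of 0] by simp
  then show ?thesis by (simp cong: restrict_cong)
qed

lemma canonical_shift:
  assumes "canonical \<phi>" and "s \<in> S"
  shows "\<phi> (universal_gen S s) = shift_op P s"
  using assms(2)
proof (induction rule: left_inverse_hull.induct)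
  case (gen p)
  then show ?case using canonicalD(7)[OF assms(1)] left_regular_isometry_eq_shift by simp
next
  case zero
  have "azero BP = shift_op P {}" by (simp add: shift_op_def shift_empty)
  then show ?case using canonical_zero[OF assms(1)] by (simp only: universal_gen_ops)
next
  case (inverse s)
  then show ?case
    using canonicalD(5)[OF assms(1) Full_gen] by (simp add: universal_gen_ops op_adjoint_shift hull_partial_bij)
next
  case (product s t)
  then show ?case
    using canonicalD(4)[OF assms(1) Full_gen Full_gen, of s t]
    by (simp only: universal_gen_ops amult_shift_op hull_partial_bij)
qed

lemma canonical_dist:
  assumes "canonical \<phi>" "a \<in> elems Full" "b \<in> elems Full"
  shows "adist BP (\<phi> a) (\<phi> b) \<le> adist Fam a b"
proof -
  have b: "ascale Fam (-1) b \<in> elems Full" by (rule closed_star_subalgebraD(4)[OF Full_closed assms(3)])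
  have ab: "aadd Fam a (ascale Fam (-1) b) \<in> elems Full" by (rule closed_star_subalgebraD(3)[OF Full_closed assms(2) b])
  show ?thesis
    using canonicalD(6)[OF assms(1) ab]
    unfolding adist_def canonicalD(2)[OF assms(1,2) b] canonicalD(3)[OF assms(1,3)] by (simp only: bounded_op_algebra_simps(7))
qed

text \<open>The elements on which the two maps agree form a star subalgebra that is closed, by
  contractivity. It contains the generators, where the values are forced by those at the elements of
  \<open>P\<close>.\<close>

lemma canonical_unique:
  assumes \<phi>: "canonical \<phi>" and \<psi>: "canonical \<psi>" and a: "a \<in> elems Full"
  shows "\<phi> a = \<psi> a"
proof -
  note F = closed_star_subalgebraD[OF Full_closed]
  let ?E = "{a \<in> elems Full. \<phi> a = \<psi> a}"
  have "closed_star_subalgebra Fam ?E"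
    unfolding closed_star_subalgebra_def
  proof (intro conjI ballI allI impI)
    show "?E \<subseteq> elems Fam" using Full_Fam by blast
    show "azero Fam \<in> ?E" using F(2) canonical_zero[OF \<phi>] canonical_zero[OF \<psi>] by simp
  next
    fix a b assume ab: "a \<in> ?E" "b \<in> ?E"
    then show "aadd Fam a b \<in> ?E" "amult Fam a b \<in> ?E"
      using F(3,5)[of a b] canonicalD(2,4)[OF \<phi>, of a b] canonicalD(2,4)[OF \<psi>, of a b] by simp_all
  next
    fix a c assume "a \<in> ?E"
    then show "ascale Fam c a \<in> ?E"
      using F(4)[of a c] canonicalD(3)[OF \<phi>, of a c] canonicalD(3)[OF \<psi>, of a c] by simp
  next
    fix a assume "a \<in> ?E"
    then show "astar Fam a \<in> ?E"
      using F(6)[of a] canonicalD(5)[OF \<phi>, of a] canonicalD(5)[OF \<psi>, of a] by simp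
  next
    fix a assume a: "a \<in> elems Fam" and app: "\<forall>\<epsilon>>0. \<exists>b\<in>?E. anorm Fam (aadd Fam a (ascale Fam (-1) b)) < \<epsilon>"
    have app': "\<exists>b\<in>elems Full. adist Fam a b < \<epsilon> \<and> \<phi> b = \<psi> b" if "\<epsilon> > 0" for \<epsilon>
      using app that unfolding adist_def by blast
    then have aF: "a \<in> elems Full" using F(7)[OF a] by blast
    note pa = Red_BP[OF canonicalD(1)[OF \<phi> aF]] and qa = Red_BP[OF canonicalD(1)[OF \<psi> aF]]
    have "adist BP (\<phi> a) (\<psi> a) \<le> 0"
    proof (rule field_le_epsilon)
      fix \<epsilon> :: real assume "\<epsilon> > 0"
      then obtain b where b: "b \<in> elems Full" "adist Fam a b < \<epsilon> / 2" "\<phi> b = \<psi> b"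
        using app'[of "\<epsilon> / 2"] by auto
      have "adist BP (\<phi> a) (\<psi> a) \<le> adist BP (\<phi> a) (\<phi> b) + adist BP (\<phi> b) (\<psi> a)"
        using BP.dist_triangle pa qa Red_BP[OF canonicalD(1)[OF \<phi> b(1)]] by simp
      also have "adist BP (\<phi> b) (\<psi> a) = adist BP (\<psi> a) (\<psi> b)"
        using BP.dist_sym qa Red_BP[OF canonicalD(1)[OF \<psi> b(1)]] b(3) by simp
      finally show "adist BP (\<phi> a) (\<psi> a) \<le> 0 + \<epsilon>"
        using canonical_dist[OF \<phi> aF b(1)] canonical_dist[OF \<psi> aF b(1)] b(2) by simp
    qed
    then have "\<phi> a = \<psi> a"
      using BP.dist_eq[of "\<phi> a" "\<psi> a"] BP.dist_nonneg[of "\<phi> a" "\<psi> a"] pa qa by simp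
    then show "a \<in> ?E" using aF by simp
  qed
  then have "elems Full \<subseteq> ?E"
    by (rule Full_minimal) (use Full_gen canonical_shift[OF \<phi>] canonical_shift[OF \<psi>] in simp)
  then show ?thesis using a by blast
qed

text \<open>The regular representation, moved to the natural numbers, is one of the coordinates
  \<open>\<rho>\<close> of the universal algebra. The map evaluates at \<open>\<rho>\<close> and
  compresses to l^2(P). It is multiplicative because l^2(P) sits there as a reducing subspace; its
  values are in the reduced algebra because the elements with both properties form a closed star
  subalgebra containing the generators.\<close>

lemma canonical_exists: "\<exists>\<phi>\<in>extensional (elems Full). canonical \<phi>"
proof -
  define e where "e = to_nat_on P"
  have "P \<subseteq> carrier G" using P_carrier by blast
  then have e: "inj_on e P" unfolding e_def by (intro inj_on_to_nat_on countable_subset[OF _ countable_group])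
  define \<rho> where "\<rho> = (\<lambda>s\<in>S. shift_op (UNIV :: nat set) (map_prod e e ` s))"
  have \<rho>: "\<rho> \<in> Reps"
    unfolding \<rho>_def
    by (rule shift_rep_nat[where \<tau> = "\<lambda>s. s", OF e]) (auto intro: hull_partial_bij hull_converse hull_product hull_zero)
  note Fapp = Fam_apply[OF _ \<rho>]
  note R = closed_star_subalgebraD[OF Red_closed]
  note ic = intertwines_closed[OF e]
  let ?B = "{a \<in> elems Fam. \<exists>T\<in>elems Red. intertwines e P (a \<rho>) T}"
  have "closed_star_subalgebra Fam ?B"
    unfolding closed_star_subalgebra_def
  proof (intro conjI ballI allI impI)
    show "?B \<subseteq> elems Fam" by blast
    have "intertwines e P (azero BN) (azero BP)"
      using ic(1) shift_op_bounded[OF transport_partial_bij[OF e hull_partial_bij[OF hull_zero]]]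
        shift_op_bounded[OF hull_partial_bij[OF hull_zero]] intertwines_shift[OF e hull_partial_bij[OF hull_zero]]
      by blast
    then show "azero Fam \<in> ?B" using R(2) Fam.zero_closed Fam_ops_apply(1)[OF \<rho>] by (metis (mono_tags, lifting) mem_Collect_eq)
  next
    fix a b assume ab: "a \<in> ?B" "b \<in> ?B"
    then obtain T U where T: "T \<in> elems Red" "intertwines e P (a \<rho>) T" and U: "U \<in> elems Red" "intertwines e P (b \<rho>) U"
      by blast
    have el: "a \<in> elems Fam" "b \<in> elems Fam" using ab by blast+
    note i = ic[OF Fapp[OF el(1)] Red_BP[OF T(1)] T(2) Fapp[OF el(2)] Red_BP[OF U(1)] U(2)]
    show "aadd Fam a b \<in> ?B"
      using Fam.add_closed[OF el] R(3)[OF T(1) U(1)] i(2) unfolding Fam_ops_apply(2)[OF \<rho>, symmetric] by blast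
    show "amult Fam a b \<in> ?B"
      using Fam.mult_closed[OF el] R(5)[OF T(1) U(1)] i(4) unfolding Fam_ops_apply(4)[OF \<rho>, symmetric] by blast
  next
    fix a c assume a: "a \<in> ?B"
    then obtain T where T: "T \<in> elems Red" "intertwines e P (a \<rho>) T" by blast
    have el: "a \<in> elems Fam" using a by blast
    note i = ic[OF Fapp[OF el] Red_BP[OF T(1)] T(2) Fapp[OF el] Red_BP[OF T(1)] T(2)]
    show "ascale Fam c a \<in> ?B"
      using Fam.scale_closed[OF el] R(4)[OF T(1)] i(3) unfolding Fam_ops_apply(3)[OF \<rho>, symmetric] by blast
  next
    fix a assume a: "a \<in> ?B"
    then obtain T where T: "T \<in> elems Red" "intertwines e P (a \<rho>) T" by blast
    have el: "a \<in> elems Fam" using a by blast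
    note i = ic[OF Fapp[OF el] Red_BP[OF T(1)] T(2) Fapp[OF el] Red_BP[OF T(1)] T(2)]
    show "astar Fam a \<in> ?B"
      using Fam.star_closed[OF el] R(6)[OF T(1)] i(5) unfolding Fam_ops_apply(5)[OF \<rho>, symmetric] by blast
  next
    fix a assume a: "a \<in> elems Fam" and app: "\<forall>\<epsilon>>0. \<exists>b\<in>?B. anorm Fam (aadd Fam a (ascale Fam (-1) b)) < \<epsilon>"
    have app': "\<exists>b T. b \<in> elems Fam \<and> T \<in> elems Red \<and> intertwines e P (b \<rho>) T \<and> adist Fam a b < \<epsilon>" if "\<epsilon> > 0" for \<epsilon>
      using app that unfolding adist_def by blast
    \<comment> \<open>The compression is the only operator that can be intertwined with the
      limit.\<close>
    define T where "T = (\<lambda>f\<in>ell2 P. pull e P (a \<rho> (push e P f)))"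
    note ab = Fapp[OF a]
    have T: "T \<in> bounded_ops P"
      unfolding T_def
    proof (rule bounded_opsI[where K = "op_norm UNIV (a \<rho>)"])
      fix f assume f: "f \<in> ell2 P"
      note p = push_ell2[OF e f]
      show "pull e P (a \<rho> (push e P f)) \<in> ell2 P" by (intro pull_ell2(1)[OF e] bounded_ops_in[OF ab] p)
      show "ell2_norm P (pull e P (a \<rho> (push e P f))) \<le> op_norm UNIV (a \<rho>) * ell2_norm P f"
        using pull_ell2(2)[OF e bounded_ops_in[OF ab p(1)]] op_norm_bound[OF ab p(1)] p(2) by simp
      show "pull e P (a \<rho> (push e P (\<lambda>x. c * f x))) = (\<lambda>x. c * pull e P (a \<rho> (push e P f)) x)" for c
      proof -
        have "push e P (\<lambda>x. c * f x) = (\<lambda>n. c * push e P f n)" by (auto simp: push_def)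
        then show ?thesis using bounded_ops_scale[OF ab p(1)] by (auto simp: pull_def)
      qed
      fix g assume g: "g \<in> ell2 P"
      note q = push_ell2[OF e g]
      have "push e P (\<lambda>x. f x + g x) = (\<lambda>n. push e P f n + push e P g n)" by (auto simp: push_def)
      then show "pull e P (a \<rho> (push e P (\<lambda>x. f x + g x))) = (\<lambda>x. pull e P (a \<rho> (push e P f)) x + pull e P (a \<rho> (push e P g)) x)"
        using bounded_ops_add[OF ab p(1) q(1)] by (auto simp: pull_def)
    qed
    have close: "adist BP T U \<le> adist Fam a b"
      if "b \<in> elems Fam" "U \<in> elems Red" "intertwines e P (b \<rho>) U" for b U
    proof -
      have "adist BP U T \<le> adist BN (b \<rho>) (a \<rho>)"
        unfolding T_def by (rule intertwines_dist[OF e Fapp[OF that(1)] Red_BP[OF that(2)] that(3) ab])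
      also have "\<dots> \<le> adist Fam a b"
        using Fam_dist[OF a that(1) \<rho>] BN.dist_sym[of "b \<rho>" "a \<rho>"] ab Fapp[OF that(1)] by simp
      finally show ?thesis using BP.dist_sym[of U T] T Red_BP[OF that(2)] by simp
    qed
    have TR: "T \<in> elems Red"
    proof (rule R(7))
      show "T \<in> elems BP" using T by simp
      fix \<epsilon> :: real assume "\<epsilon> > 0"
      then obtain b U where bU: "b \<in> elems Fam" "U \<in> elems Red" "intertwines e P (b \<rho>) U" "adist Fam a b < \<epsilon>"
        using app' by blast
      then show "\<exists>b\<in>elems Red. adist BP T b < \<epsilon>" using close[OF bU(1-3)] by (intro bexI[OF _ bU(2)]) simp
    qed
    \<comment> \<open>Vectors are equal if they are arbitrarily close. Below \<open>K\<close> is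
      twice a norm: one part pays for passing from \<open>a\<close> to \<open>b\<close>, the other
      for passing between \<open>U\<close> and \<open>T\<close>.\<close>
    have zero: "u = v" if u: "u \<in> ell2 Y" and v: "v \<in> ell2 Y" and "0 \<le> K"
      and le: "\<And>\<epsilon>. \<epsilon> > 0 \<Longrightarrow> ell2_norm Y (\<lambda>x. u x - v x) \<le> \<epsilon> * K" for u v :: "'y \<Rightarrow> complex" and Y K
    proof -
      have "ell2_norm Y (\<lambda>x. u x - v x) \<le> 0"
      proof (rule field_le_epsilon)
        fix \<epsilon> :: real assume e: "\<epsilon> > 0"
        have K: "K + 1 > 0" using \<open>0 \<le> K\<close> by simp
        have "ell2_norm Y (\<lambda>x. u x - v x) \<le> \<epsilon> / (K + 1) * K" by (rule le) (use K e in simp)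
        also have "\<dots> \<le> \<epsilon> / (K + 1) * (K + 1)" using K e by (intro mult_left_mono) auto
        also have "\<dots> = \<epsilon>" using K by simp
        finally show "ell2_norm Y (\<lambda>x. u x - v x) \<le> 0 + \<epsilon>" by simp
      qed
      then have "ell2_norm Y (\<lambda>x. u x - v x) = 0" using ell2_norm_nonneg[of Y "\<lambda>x. u x - v x"] by simp
      from ell2_norm_eq_0[OF ell2_diff(1)[OF u v] this] show "u = v" by (auto simp: fun_eq_iff)
    qed
    have "intertwines e P (a \<rho>) T"
      unfolding intertwines_def[OF e]
    proof (intro conjI ballI)
      fix f assume f: "f \<in> ell2 P"
      note p = push_ell2[OF e f]
      note i1 = bounded_ops_in[OF ab p(1)] and i2 = push_ell2(1)[OF e bounded_ops_in[OF T f]]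
      show "a \<rho> (push e P f) = push e P (T f)"
      proof (rule zero[OF i1 i2, of "2 * ell2_norm P f"])
        fix \<epsilon> :: real assume "\<epsilon> > 0"
        then obtain b U where bU: "b \<in> elems Fam" "U \<in> elems Red" "intertwines e P (b \<rho>) U" "adist Fam a b < \<epsilon>"
          using app' by blast
        note Ub = Red_BP[OF bU(2)]
        note i3 = bounded_ops_in[OF Fapp[OF bU(1)] p(1)]
        have "ell2_norm UNIV (\<lambda>n. a \<rho> (push e P f) n - b \<rho> (push e P f) n) \<le> adist BN (a \<rho>) (b \<rho>) * ell2_norm P f"
          using adist_op_bound[OF ab Fapp[OF bU(1)] p(1)] p(2) by simp
        also have "\<dots> \<le> \<epsilon> * ell2_norm P f"
          using Fam_dist[OF a bU(1) \<rho>] bU(4) by (intro mult_right_mono) auto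
        finally have 1: "ell2_norm UNIV (\<lambda>n. a \<rho> (push e P f) n - b \<rho> (push e P f) n) \<le> \<epsilon> * ell2_norm P f" .
        have "b \<rho> (push e P f) = push e P (U f)" using bU(3) f by (simp add: intertwines_def[OF e])
        then have "(\<lambda>n. b \<rho> (push e P f) n - push e P (T f) n) = push e P (\<lambda>x. U f x - T f x)" by (auto simp: push_def)
        then have "ell2_norm UNIV (\<lambda>n. b \<rho> (push e P f) n - push e P (T f) n) = ell2_norm P (\<lambda>x. U f x - T f x)"
          using push_ell2(2)[OF e ell2_diff(1)[OF bounded_ops_in[OF Ub f] bounded_ops_in[OF T f]]] by simp
        also have "\<dots> = ell2_norm P (\<lambda>x. T f x - U f x)" by (rule ell2_norm_minus_commute)
        also have "\<dots> \<le> adist BP T U * ell2_norm P f" by (rule adist_op_bound[OF T Ub f])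
        also have "\<dots> \<le> \<epsilon> * ell2_norm P f"
          using close[OF bU(1-3)] bU(4) by (intro mult_right_mono) auto
        finally show "ell2_norm UNIV (\<lambda>n. a \<rho> (push e P f) n - push e P (T f) n) \<le> \<epsilon> * (2 * ell2_norm P f)"
          using 1 ell2_norm_diff_triangle[OF i1 i3 i2] by simp
      qed simp
    next
      fix h :: "nat \<Rightarrow> complex" assume h: "h \<in> ell2 UNIV"
      note p = pull_ell2[OF e h]
      note i1 = pull_ell2(1)[OF e bounded_ops_in[OF ab h]] and i2 = bounded_ops_in[OF T p(1)]
      show "pull e P (a \<rho> h) = T (pull e P h)"
      proof (rule zero[OF i1 i2, of "2 * ell2_norm UNIV h"])
        fix \<epsilon> :: real assume ep: "\<epsilon> > 0"
        then obtain b U where bU: "b \<in> elems Fam" "U \<in> elems Red" "intertwines e P (b \<rho>) U" "adist Fam a b < \<epsilon>"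
          using app' by blast
        note Ub = Red_BP[OF bU(2)]
        note bh = bounded_ops_in[OF Fapp[OF bU(1)] h] and ah = bounded_ops_in[OF ab h]
        note i3 = pull_ell2(1)[OF e bh]
        have "(\<lambda>x. pull e P (a \<rho> h) x - pull e P (b \<rho> h) x) = pull e P (\<lambda>n. a \<rho> h n - b \<rho> h n)" by (auto simp: pull_def)
        then have "ell2_norm P (\<lambda>x. pull e P (a \<rho> h) x - pull e P (b \<rho> h) x) \<le> ell2_norm UNIV (\<lambda>n. a \<rho> h n - b \<rho> h n)"
          using pull_ell2(2)[OF e ell2_diff(1)[OF ah bh]] by simp
        also have "\<dots> \<le> adist BN (a \<rho>) (b \<rho>) * ell2_norm UNIV h"
          by (rule adist_op_bound[OF ab Fapp[OF bU(1)] h])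
        also have "\<dots> \<le> \<epsilon> * ell2_norm UNIV h"
          using Fam_dist[OF a bU(1) \<rho>] bU(4) by (intro mult_right_mono) auto
        finally have 1: "ell2_norm P (\<lambda>x. pull e P (a \<rho> h) x - pull e P (b \<rho> h) x) \<le> \<epsilon> * ell2_norm UNIV h" .
        have "pull e P (b \<rho> h) = U (pull e P h)" using bU(3) h by (simp add: intertwines_def[OF e])
        then have "ell2_norm P (\<lambda>x. pull e P (b \<rho> h) x - T (pull e P h) x) = ell2_norm P (\<lambda>x. T (pull e P h) x - U (pull e P h) x)"
          using ell2_norm_minus_commute[of P "U (pull e P h)"] by simp
        also have "\<dots> \<le> adist BP T U * ell2_norm P (pull e P h)" by (rule adist_op_bound[OF T Ub p(1)])
        also have "\<dots> \<le> \<epsilon> * ell2_norm UNIV h"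
          using close[OF bU(1-3)] bU(4) p(2) ep by (intro mult_mono) auto
        finally show "ell2_norm P (\<lambda>x. pull e P (a \<rho> h) x - T (pull e P h) x) \<le> \<epsilon> * (2 * ell2_norm UNIV h)"
          using 1 ell2_norm_diff_triangle[OF i1 i3 i2] by simp
      qed simp
    qed
    then show "a \<in> ?B" using a TR by blast
  qed
  then have "elems Full \<subseteq> ?B"
  proof (rule Full_minimal)
    fix s assume s: "s \<in> S"
    have "universal_gen S s \<rho> = shift_op UNIV (map_prod e e ` s)"
      using \<rho> s by (simp add: universal_gen_def) (simp add: \<rho>_def)
    then show "universal_gen S s \<in> ?B"
      using intertwines_shift[OF e hull_partial_bij[OF s]] shift_Red[OF s] universal_gen_Fam[OF s] by auto
  qed
  then have good: "\<exists>T\<in>elems Red. intertwines e P (a \<rho>) T" if "a \<in> elems Full" for a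
    using that by blast
  define \<phi> where "\<phi> = (\<lambda>a\<in>elems Full. \<lambda>f\<in>ell2 P. pull e P (a \<rho> (push e P f)))"
  have \<phi>_eq: "\<phi> a = T" if "a \<in> elems Full" "T \<in> elems Red" "intertwines e P (a \<rho>) T" for a T
    using that intertwines_eq[OF e Red_BP[OF that(2)] that(3)] by (simp add: \<phi>_def)
  have \<phi>: "\<phi> a \<in> elems Red" "intertwines e P (a \<rho>) (\<phi> a)" if "a \<in> elems Full" for a
    using good[OF that] \<phi>_eq[OF that] by blast+
  note F = closed_star_subalgebraD[OF Full_closed]
  have "canonical \<phi>"
    unfolding canonical_def star_hom_def Full_simps Red_simps
  proof (intro conjI ballI allI)
    show "\<phi> \<in> elems Full \<rightarrow> elems Red" using \<phi>(1) by blast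
  next
    fix a b assume a: "a \<in> elems Full" and b: "b \<in> elems Full"
    note i = ic[OF Fapp[OF Full_Fam[OF a]] Red_BP[OF \<phi>(1)[OF a]] \<phi>(2)[OF a] Fapp[OF Full_Fam[OF b]] Red_BP[OF \<phi>(1)[OF b]] \<phi>(2)[OF b]]
    show "\<phi> (aadd Fam a b) = aadd BP (\<phi> a) (\<phi> b)"
      by (rule \<phi>_eq[OF F(3)[OF a b] R(3)[OF \<phi>(1)[OF a] \<phi>(1)[OF b]]]) (unfold Fam_ops_apply[OF \<rho>], rule i)
    show "\<phi> (amult Fam a b) = amult BP (\<phi> a) (\<phi> b)"
      by (rule \<phi>_eq[OF F(5)[OF a b] R(5)[OF \<phi>(1)[OF a] \<phi>(1)[OF b]]]) (unfold Fam_ops_apply[OF \<rho>], rule i)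
  next
    fix a c assume a: "a \<in> elems Full"
    note i = ic[OF Fapp[OF Full_Fam[OF a]] Red_BP[OF \<phi>(1)[OF a]] \<phi>(2)[OF a] Fapp[OF Full_Fam[OF a]] Red_BP[OF \<phi>(1)[OF a]] \<phi>(2)[OF a]]
    show "\<phi> (ascale Fam c a) = ascale BP c (\<phi> a)"
      by (rule \<phi>_eq[OF F(4)[OF a] R(4)[OF \<phi>(1)[OF a]]]) (unfold Fam_ops_apply[OF \<rho>], rule i)
  next
    fix a assume a: "a \<in> elems Full"
    note i = ic[OF Fapp[OF Full_Fam[OF a]] Red_BP[OF \<phi>(1)[OF a]] \<phi>(2)[OF a] Fapp[OF Full_Fam[OF a]] Red_BP[OF \<phi>(1)[OF a]] \<phi>(2)[OF a]]
    show "\<phi> (astar Fam a) = astar BP (\<phi> a)"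
      by (rule \<phi>_eq[OF F(6)[OF a] R(6)[OF \<phi>(1)[OF a]]]) (unfold Fam_ops_apply[OF \<rho>], rule i)
    have "azero Fam \<in> elems Full" by (rule F(2))
    note z = Fam_apply[OF Full_Fam[OF this] \<rho>] and aa = Fapp[OF Full_Fam[OF a]]
    have "op_norm P (\<phi> a) \<le> op_norm UNIV (a \<rho>)"
    proof (rule op_norm_le[OF op_norm_nonneg[OF aa]])
      fix f assume f: "f \<in> ell2 P"
      note p = push_ell2[OF e f]
      have "ell2_norm P (\<phi> a f) \<le> ell2_norm UNIV (a \<rho> (push e P f))"
        using pull_ell2(2)[OF e bounded_ops_in[OF aa p(1)]] a f by (simp add: \<phi>_def)
      then show "ell2_norm P (\<phi> a f) \<le> op_norm UNIV (a \<rho>) * ell2_norm P f"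
        using op_norm_bound[OF aa p(1)] p(2) by simp
    qed
    also have "\<dots> \<le> anorm Fam a"
      using Full_Fam[OF a] \<rho> by (auto simp: bounded_families_simps intro: cSUP_upper)
    finally show "anorm BP (\<phi> a) \<le> anorm Fam a" by simp
  next
    fix p assume p: "p \<in> P"
    have s: "left_mult G P p \<in> S" by (rule left_inverse_hull.gen[OF p])
    have "universal_gen S (left_mult G P p) \<rho> = shift_op UNIV (map_prod e e ` left_mult G P p)"
      using \<rho> s by (simp add: universal_gen_def) (simp add: \<rho>_def)
    then show "\<phi> (universal_gen S (left_mult G P p)) = left_regular_isometry G P p"
      unfolding left_regular_isometry_eq_shift[OF p]
      using intertwines_shift[OF e hull_partial_bij[OF s]] by (intro \<phi>_eq[OF Full_gen[OF s] shift_Red[OF s]]) simp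
  qed
  then show ?thesis by (intro bexI[of _ \<phi>]) (simp_all add: \<phi>_def)
qed

theorem canonical_canonical_hom: "canonical (canonical_hom G P)"
proof -
  have "\<exists>!\<phi>. \<phi> \<in> extensional (elems Full) \<and> canonical \<phi>"
  proof (rule ex_ex1I)
    show "\<exists>\<phi>. \<phi> \<in> extensional (elems Full) \<and> canonical \<phi>" using canonical_exists by blast
    show "\<phi> = \<psi>" if "\<phi> \<in> extensional (elems Full) \<and> canonical \<phi>" "\<psi> \<in> extensional (elems Full) \<and> canonical \<psi>" for \<phi> \<psi>
      using that canonical_unique by (intro extensionalityI[of \<phi> "elems Full" \<psi>]) auto
  qed
  from theI'[OF this] show ?thesis
    unfolding canonical_hom_def canonical_def by simp
qed

end

section \<open>Injectivity of the canonical map forces independence\<close>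

context countable_subsemigroup begin

text \<open>Every constructible ideal is reached by a finite word over P \<times> P from the empty
  set or from \<open>P\<close>. Countability is what lets the action on ideals be moved to the
  natural numbers.\<close>

lemma countable_J: "countable J"
proof -
  define step where "step = (\<lambda>(p, q) X. {y \<in> P. p \<otimes> y \<in> (\<lambda>x. q \<otimes> x) ` X})"
  have "J \<subseteq> (\<lambda>(w, X). foldr step w X) ` (lists (P \<times> P) \<times> {{}, P})"
  proof
    fix X assume "X \<in> J"
    then show "X \<in> (\<lambda>(w, X). foldr step w X) ` (lists (P \<times> P) \<times> {{}, P})"
    proof (induction rule: constructible_ideals.induct)
      case empty
      show ?case by (rule image_eqI[of _ _ "([], {})"]) auto
    next
      case top
      show ?case by (rule image_eqI[of _ _ "([], P)"]) auto
    next
      case (step p q X)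
      then obtain w X0 where "w \<in> lists (P \<times> P)" "X0 \<in> {{}, P}" "X = foldr step w X0" by auto
      then show ?case
        using step(1,2) by (intro image_eqI[of _ _ "((p, q) # w, X0)"]) (auto simp: step_def)
    qed
  qed
  moreover have "P \<subseteq> carrier G" using P_carrier by blast
  then have "countable P" using countable_group by (rule countable_subset)
  then have "countable (lists (P \<times> P) \<times> {{}, P})" by (intro countable_SIGMA countable_lists) auto
  ultimately show ?thesis by (meson countable_image countable_subset)
qed

text \<open>The action of the left inverse hull on the nonempty constructible ideals separates the
  idempotents strongly enough to detect that \<open>X\<close> is not one of finitely many smaller ideals.\<close>

definition ideal_action :: "('a \<times> 'a) set \<Rightarrow> ('a set \<times> 'a set) set" where
  "ideal_action s = {(Y, s `` Y) | Y. Y \<in> J \<and> Y \<noteq> {} \<and> Y \<subseteq> Domain s}"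

lemma ideal_action_mem: "(Y, Z) \<in> ideal_action s \<longleftrightarrow> Y \<in> J \<and> Y \<noteq> {} \<and> Y \<subseteq> Domain s \<and> Z = s `` Y"
  by (auto simp: ideal_action_def)

lemma hull_Image_inverse:
  assumes "s \<in> S" "Y \<subseteq> Domain s"
  shows "s\<inverse> `` (s `` Y) = Y" "s `` Y \<subseteq> Range s"
proof -
  note b = partial_bijD[OF hull_partial_bij[OF assms(1)]]
  show "s `` Y \<subseteq> Range s" by auto
  show "s\<inverse> `` (s `` Y) = Y"
  proof (intro equalityI subsetI)
    fix x assume "x \<in> s\<inverse> `` (s `` Y)"
    then obtain y z where "(z, y) \<in> s" "z \<in> Y" "(x, y) \<in> s" by auto
    then show "x \<in> Y" using b(4) by blast
  next
    fix x assume "x \<in> Y"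
    moreover from this obtain y where "(x, y) \<in> s" using assms(2) by blast
    ultimately show "x \<in> s\<inverse> `` (s `` Y)" by auto
  qed
qed

lemma ideal_action_partial_bij: "s \<in> S \<Longrightarrow> partial_bij (J - {{}}) (ideal_action s)"
proof -
  assume s: "s \<in> S"
  show ?thesis
  proof (rule partial_bijI)
    fix Y Z assume *: "(Y, Z) \<in> ideal_action s"
    then have "s\<inverse> `` Z = Y" "Y \<noteq> {}" using hull_Image_inverse(1)[OF s] by (auto simp: ideal_action_mem)
    then have "Z \<noteq> {}" by blast
    then show "Y \<in> J - {{}} \<and> Z \<in> J - {{}}"
      using * hull_image_J[OF s] by (auto simp: ideal_action_mem)
  next
    fix Y Y' Z assume "(Y, Z) \<in> ideal_action s" "(Y', Z) \<in> ideal_action s"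
    then show "Y = Y'" using hull_Image_inverse(1)[OF s] unfolding ideal_action_mem by metis
  qed (simp add: ideal_action_mem)
qed

text \<open>If \<open>Y\<close> lies in the domain of the composite, its image under
  \<open>t\<close> lies in the domain of \<open>s\<close> because \<open>t\<close> is single valued,
  and it is nonempty because it can be moved back.\<close>

lemma ideal_action_relcomp:
  assumes s: "s \<in> S" and t: "t \<in> S"
  shows "ideal_action (t O s) = ideal_action t O ideal_action s"
proof (rule equalityI; rule subrelI)
  note b = partial_bijD[OF hull_partial_bij[OF t]]
  fix Y Z
  {
    assume "(Y, Z) \<in> ideal_action (t O s)"
    then have Y: "Y \<in> J" "Y \<noteq> {}" "Y \<subseteq> Domain (t O s)" "Z = s `` (t `` Y)"
      by (auto simp: ideal_action_mem relcomp_Image)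
    have "t `` Y \<subseteq> Domain s"
    proof
      fix y assume "y \<in> t `` Y"
      then obtain x where x: "x \<in> Y" "(x, y) \<in> t" by auto
      then obtain y' z where "(x, y') \<in> t" "(y', z) \<in> s" using Y(3) by blast
      then show "y \<in> Domain s" using b(3)[OF x(2)] by blast
    qed
    moreover have "Y \<subseteq> Domain t" using Y(3) by blast
    moreover from this have "t `` Y \<noteq> {}" using Y(2) hull_Image_inverse(1)[OF t, of Y] by auto
    ultimately have "(Y, t `` Y) \<in> ideal_action t" "(t `` Y, Z) \<in> ideal_action s"
      using Y hull_image_J[OF t] by (simp_all add: ideal_action_mem)
    then show "(Y, Z) \<in> ideal_action t O ideal_action s" by (rule relcompI)
  next
    assume "(Y, Z) \<in> ideal_action t O ideal_action s"
    then obtain W where W: "(Y, W) \<in> ideal_action t" "(W, Z) \<in> ideal_action s" by (rule relcompEpair)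
    then have "Y \<subseteq> Domain (t O s)" unfolding ideal_action_mem by blast
    then show "(Y, Z) \<in> ideal_action (t O s)" using W by (simp add: ideal_action_mem relcomp_Image)
  }
qed

lemma ideal_action_converse:
  assumes s: "s \<in> S"
  shows "ideal_action (s\<inverse>) = (ideal_action s)\<inverse>"
proof -
  have "(Z, Y) \<in> ideal_action s" if s: "s \<in> S" and "(Y, Z) \<in> ideal_action (s\<inverse>)" for s Y Z
  proof -
    have Y: "Y \<in> J" "Y \<noteq> {}" "Y \<subseteq> Domain (s\<inverse>)" "Z = s\<inverse> `` Y" using that(2) by (simp_all add: ideal_action_mem)
    note i = hull_Image_inverse[OF hull_converse[OF s] Y(3)]
    then have "s `` Z = Y" "Z \<subseteq> Domain s" using Y(4) by simp_all
    moreover have "Z \<noteq> {}" using \<open>s `` Z = Y\<close> Y(2) by blast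
    ultimately show ?thesis using hull_image_J[OF hull_converse[OF s] Y(1)] Y(4) by (simp add: ideal_action_mem)
  qed
  from this[OF s] this[OF hull_converse[OF s]] show ?thesis by auto
qed

text \<open>Basis vectors indexed by ideals instead of points are decisive: the projection of
  \<open>X\<close> fixes the vector of \<open>X\<close>, while the projection of an ideal not
  containing \<open>X\<close> kills it. So proper subsets of \<open>X\<close> never see that vector,
  even when together they cover \<open>X\<close>.\<close>

lemma independent_if_injective:
  assumes inj: "inj_on (canonical_hom G P) (elems Full)"
  shows "independent_semigroup G P"
  unfolding independent_semigroup_def
proof (intro ballI allI impI, elim conjE)
  fix X F assume X: "X \<in> J" and F: "F \<subseteq> J" "finite F" "F \<noteq> {}" "X = \<Union>F"
  show "X \<in> F"
  proof (rule ccontr)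
    assume nX: "X \<notin> F"
    \<comment> \<open>An empty \<open>X\<close> would force the nonempty family to consist of the
      empty set alone.\<close>
    have ne: "X \<noteq> {}"
    proof
      assume "X = {}"
      then have "F \<subseteq> {{}}" using F(4) by blast
      then show False using F(3) nX \<open>X = {}\<close> by blast
    qed
    define e where "e = to_nat_on (J - {{}})"
    have e: "inj_on e (J - {{}})"
      unfolding e_def by (intro inj_on_to_nat_on countable_Diff countable_J)
    let ?\<tau> = "\<lambda>s. map_prod e e ` ideal_action s"
    define \<rho> where "\<rho> = (\<lambda>s\<in>S. shift_op (UNIV :: nat set) (?\<tau> s))"
    have \<rho>: "\<rho> \<in> Reps"
      unfolding \<rho>_def
    proof (rule shift_rep_nat[OF e])
      show "ideal_action {} = {}" by (auto simp: ideal_action_def)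
      show "ideal_action (t O s) = ideal_action t O ideal_action s" if "s \<in> S" "t \<in> S" for s t
        by (rule ideal_action_relcomp[OF that])
      show "ideal_action (s\<inverse>) = (ideal_action s)\<inverse>" if "s \<in> S" for s
        by (rule ideal_action_converse[OF that])
    qed (auto intro: ideal_action_partial_bij hull_converse hull_product hull_zero)
    let ?d = "delta (e X)"
    have d: "?d \<in> ell2 UNIV" by (rule delta_in_ell2) simp
    note tb = transport_partial_bij[OF e ideal_action_partial_bij[OF Id_on_hull]]
    have gen: "universal_gen S (Id_on Y) \<rho> f = shift (?\<tau> (Id_on Y)) f" if "Y \<in> J" "f \<in> ell2 UNIV" for Y f
      using that \<rho> Id_on_hull[OF that(1)] by (simp add: universal_gen_def) (simp add: \<rho>_def shift_op_def)
    have gen_X: "universal_gen S (Id_on X) \<rho> ?d = ?d"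
    proof -
      have "(X, X) \<in> ideal_action (Id_on X)" using X ne by (auto simp: ideal_action_mem)
      from imageI[OF this, of "map_prod e e"] have "(e X, e X) \<in> ?\<tau> (Id_on X)" by simp
      then show ?thesis unfolding gen[OF X d] by (rule shift_delta[OF tb[OF X]])
    qed
    have gen_Y: "universal_gen S (Id_on Y) \<rho> ?d = (\<lambda>n. 0)" if Y: "Y \<in> J" and nsub: "\<not> X \<subseteq> Y" for Y
    proof -
      have "e X \<notin> Domain (?\<tau> (Id_on Y))"
      proof
        assume "e X \<in> Domain (?\<tau> (Id_on Y))"
        then obtain b where "(e X, b) \<in> ?\<tau> (Id_on Y)" by (rule DomainE)
        then obtain Z where "Z \<in> J" "Z \<noteq> {}" "Z \<subseteq> Y" "e X = e Z"
          unfolding map_prod_image_mem ideal_action_mem by auto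
        then have "X = Z" using inj_onD[OF e] X ne by simp
        then show False using nsub \<open>Z \<subseteq> Y\<close> by simp
      qed
      then show ?thesis unfolding gen[OF Y d] by (rule shift_delta_off[OF tb[OF Y]])
    qed
    let ?\<phi> = "canonical_hom G P"
    note \<phi> = canonicalD[OF canonical_canonical_hom]
    note FC = closed_star_subalgebraD[OF Full_closed]
    have idm: "shift (Id_on Y) f = (\<lambda>x. if x \<in> Y then f x else 0)" if "Y \<in> J" for Y f
      by (rule shift_eqI[OF hull_partial_bij[OF Id_on_hull[OF that]]]) auto
    have \<phi>_gen: "?\<phi> (universal_gen S (Id_on Y)) = (\<lambda>f\<in>ell2 P. \<lambda>x. if x \<in> Y then f x else 0)" if "Y \<in> J" for Y
      using canonical_shift[OF canonical_canonical_hom Id_on_hull[OF that]] by (simp add: shift_op_def idm[OF that])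
    \<comment> \<open>Each step subtracts from \<open>a\<close> its product with the projection of
      \<open>Y\<close>. Under the canonical map this removes \<open>Y\<close> from the support,
      while the coordinate at \<open>\<rho>\<close> keeps fixing the basis vector of
      \<open>X\<close>.\<close>
    have "\<exists>a\<in>elems Full. ?\<phi> a = (\<lambda>f\<in>ell2 P. \<lambda>x. if x \<in> X - \<Union>F' then f x else 0) \<and> a \<rho> ?d = ?d"
      if "finite F'" "F' \<subseteq> F" for F'
      using that
    proof (induction F' rule: finite_induct)
      case empty
      show ?case
        using \<phi>_gen[OF X] gen_X Full_gen[OF Id_on_hull[OF X]] by (intro bexI[of _ "universal_gen S (Id_on X)"]) auto
    next
      case (insert Y F')
      have "F' \<subseteq> F" using insert.prems by simp
      from insert.IH[OF this]
      obtain a where a: "a \<in> elems Full" "?\<phi> a = (\<lambda>f\<in>ell2 P. \<lambda>x. if x \<in> X - \<Union>F' then f x else 0)" "a \<rho> ?d = ?d"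
        by blast
      have Y: "Y \<in> J" "Y \<subseteq> X" "Y \<noteq> X" using insert.prems F nX by auto
      define u where "u = universal_gen S (Id_on Y)"
      have u: "u \<in> elems Full" unfolding u_def by (rule Full_gen[OF Id_on_hull[OF Y(1)]])
      define m where "m = amult Fam u a"
      have m: "m \<in> elems Full" unfolding m_def by (rule FC(5)[OF u a(1)])
      define b where "b = aadd Fam a (ascale Fam (-1) m)"
      have b: "b \<in> elems Full" unfolding b_def by (intro FC(3) FC(4) a(1) m)
      have "?\<phi> m = (\<lambda>f\<in>ell2 P. ?\<phi> u (?\<phi> a f))" unfolding m_def using \<phi>(4)[OF u a(1)] by simp
      then have \<phi>m: "?\<phi> m f = (\<lambda>x. if x \<in> Y then (if x \<in> X - \<Union>F' then f x else 0) else 0)" if "f \<in> ell2 P" for f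
      proof -
        have "?\<phi> a f \<in> ell2 P" by (rule bounded_ops_in[OF Red_BP[OF \<phi>(1)[OF a(1)]] that])
        then show ?thesis using \<open>?\<phi> m = (\<lambda>f\<in>ell2 P. ?\<phi> u (?\<phi> a f))\<close> that a(2)
          unfolding u_def \<phi>_gen[OF Y(1)] by (simp cong: if_cong)
      qed
      have "?\<phi> b = (\<lambda>f\<in>ell2 P. \<lambda>x. ?\<phi> a f x - ?\<phi> m f x)"
        unfolding b_def \<phi>(2)[OF a(1) FC(4)[OF m]] \<phi>(3)[OF m] by (simp cong: restrict_cong)
      also have "\<dots> = (\<lambda>f\<in>ell2 P. \<lambda>x. if x \<in> X - \<Union>(insert Y F') then f x else 0)"
        using a(2) \<phi>m by (intro restrict_ext) auto
      finally have 1: "?\<phi> b = (\<lambda>f\<in>ell2 P. \<lambda>x. if x \<in> X - \<Union>(insert Y F') then f x else 0)" .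
      have "m \<rho> ?d = (\<lambda>n. 0)"
        using gen_Y[OF Y(1)] Y(2,3) d a(3) Fam_ops_apply(4)[OF \<rho>, of u a] by (auto simp: m_def u_def)
      then have "b \<rho> ?d = ?d"
        using d a(3) Fam_ops_apply(2,3)[OF \<rho>] by (simp add: b_def)
      with 1 b show ?case by blast
    qed
    then obtain a where a: "a \<in> elems Full" "?\<phi> a = (\<lambda>f\<in>ell2 P. \<lambda>x. if x \<in> X - \<Union>F then f x else 0)" "a \<rho> ?d = ?d"
      using F(2) by blast
    \<comment> \<open>For the whole family the remaining support \<open>X - \<Union>F\<close> is
      empty.\<close>
    have "?\<phi> a = ?\<phi> (azero Fam)"
      unfolding a(2) canonical_zero[OF canonical_canonical_hom] using F(4) by (auto intro!: restrict_ext)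
    then have "a = azero Fam" using inj_onD[OF inj _ a(1) FC(2)] by simp
    then have "?d = (\<lambda>n. 0)" using a(3) d Fam_ops_apply(1)[OF \<rho>] by simp
    then have "?d (e X) = 0" by (rule fun_cong)
    then show False by (simp add: delta_def)
  qed
qed

end

section \<open>Finite linear combinations\<close>

text \<open>Terms are kept in a list, possibly with repetitions, so that sums, products and adjoints
  are formed on lists alone, without collecting equal terms and in the same way for every
  representation.\<close>

definition comb :: "'x set \<Rightarrow> ('s \<Rightarrow> 'x ell2_op) \<Rightarrow> (complex \<times> 's) list \<Rightarrow> 'x ell2_op" where
  "comb X \<rho> xs = (\<lambda>f\<in>ell2 X. \<lambda>x. \<Sum>(c, s)\<leftarrow>xs. c * \<rho> s f x)"

lemma comb_Nil: "comb X \<rho> [] = azero (bounded_op_algebra X)"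
  by (simp add: comb_def)

lemma comb_Cons: "comb X \<rho> ((c, s) # xs) =
    aadd (bounded_op_algebra X) (ascale (bounded_op_algebra X) c (\<rho> s)) (comb X \<rho> xs)"
  by (auto simp: comb_def cong: restrict_cong)

lemma comb_append: "aadd (bounded_op_algebra X) (comb X \<rho> xs) (comb X \<rho> ys) = comb X \<rho> (xs @ ys)"
  by (auto simp: comb_def cong: restrict_cong)

lemma comb_scale: "ascale (bounded_op_algebra X) c (comb X \<rho> xs) = comb X \<rho> (map (\<lambda>(d, s). (c * d, s)) xs)"
proof -
  have "c * (\<Sum>(d, s)\<leftarrow>xs. d * \<rho> s f x) = (\<Sum>(d, s)\<leftarrow>map (\<lambda>(d, s). (c * d, s)) xs. d * \<rho> s f x)" for f x
    by (induction xs) (auto simp: algebra_simps)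
  then show ?thesis by (simp add: comb_def cong: restrict_cong)
qed

lemma comb_bounded:
  assumes "\<And>s. s \<in> snd ` set xs \<Longrightarrow> \<rho> s \<in> bounded_ops X"
  shows "comb X \<rho> xs \<in> bounded_ops X"
  using assms
proof (induction xs)
  case Nil
  show ?case
    using complete_star_algebra.zero_closed[OF complete_star_algebra_bounded_ops[of X]]
    unfolding comb_Nil bounded_op_algebra_simps(1) .
next
  case (Cons x xs)
  obtain c s where x: "x = (c, s)" by force
  have "\<rho> s \<in> bounded_ops X" "comb X \<rho> xs \<in> bounded_ops X" using Cons by (auto simp: x)
  then show ?case
    unfolding x comb_Cons
    by (intro complete_star_algebra.add_closed[OF complete_star_algebra_bounded_ops[of X], unfolded bounded_op_algebra_simps(1)]
      complete_star_algebra.scale_closed[OF complete_star_algebra_bounded_ops[of X], unfolded bounded_op_algebra_simps(1)])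
qed

context
  fixes S :: "('g \<times> 'g) set set" and X :: "'x set" and \<rho>
  assumes \<rho>: "\<rho> \<in> partial_isometry_reps S (bounded_op_algebra X)"
    and S: "\<And>s t. s \<in> S \<Longrightarrow> t \<in> S \<Longrightarrow> t O s \<in> S" "\<And>s. s \<in> S \<Longrightarrow> s\<inverse> \<in> S"
begin

lemma comb_rep_bounded: "snd ` set xs \<subseteq> S \<Longrightarrow> comb X \<rho> xs \<in> bounded_ops X"
  using rep_bounded[OF \<rho>] by (intro comb_bounded) blast

lemma rep_comb:
  assumes s: "s \<in> S" and xs: "snd ` set xs \<subseteq> S" and f: "f \<in> ell2 X"
  shows "\<rho> s (comb X \<rho> xs f) = comb X \<rho> (map (\<lambda>(d, t). (d, t O s)) xs) f"
  using xs
proof (induction xs)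
  case Nil
  then show ?case using bounded_ops_zero[OF rep_bounded[OF \<rho> s]] f by (simp add: comb_def)
next
  case (Cons x xs)
  obtain d t where x: "x = (d, t)" by force
  have t: "t \<in> S" and xs: "snd ` set xs \<subseteq> S" using Cons.prems by (auto simp: x)
  note b = rep_bounded[OF \<rho> s]
  note tf = bounded_ops_in[OF rep_bounded[OF \<rho> t] f] and cf = bounded_ops_in[OF comb_rep_bounded[OF xs] f]
  have "comb X \<rho> (x # xs) f = (\<lambda>n. d * \<rho> t f n + comb X \<rho> xs f n)"
    using f by (simp add: comb_def x)
  then have "\<rho> s (comb X \<rho> (x # xs) f) = (\<lambda>n. d * \<rho> s (\<rho> t f) n + \<rho> s (comb X \<rho> xs f) n)"
    using bounded_ops_add[OF b ell2_scale(1)[OF tf] cf, of d] bounded_ops_scale[OF b tf, of d] by simp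
  also have "\<dots> = comb X \<rho> (map (\<lambda>(d, t). (d, t O s)) (x # xs)) f"
    unfolding Cons.IH[OF xs] rep_relcomp[OF \<rho> s t f, symmetric] using f by (simp add: comb_def x)
  finally show ?case .
qed

text \<open>The product is represented by all pairwise products of terms; the product s t of the
  hull is \<open>t O s\<close> because relations compose from left to right.\<close>

lemma comb_mult:
  assumes xs: "snd ` set xs \<subseteq> S" and ys: "snd ` set ys \<subseteq> S"
  shows "amult (bounded_op_algebra X) (comb X \<rho> xs) (comb X \<rho> ys) =
    comb X \<rho> (concat (map (\<lambda>(c, s). map (\<lambda>(d, t). (c * d, t O s)) ys) xs))"
proof -
  have "comb X \<rho> xs (comb X \<rho> ys f) = comb X \<rho> (concat (map (\<lambda>(c, s). map (\<lambda>(d, t). (c * d, t O s)) ys) xs)) f"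
    if f: "f \<in> ell2 X" for f
    using xs
  proof (induction xs)
    case Nil
    then show ?case using bounded_ops_in[OF comb_rep_bounded[OF ys] f] f by (simp add: comb_def)
  next
    case (Cons x xs)
    obtain c s where x: "x = (c, s)" by force
    have s: "s \<in> S" and xs: "snd ` set xs \<subseteq> S" using Cons.prems by (auto simp: x)
    note yf = bounded_ops_in[OF comb_rep_bounded[OF ys] f]
    let ?m = "map (\<lambda>(d, t). (d, t O s)) ys"
    have "comb X \<rho> (x # xs) (comb X \<rho> ys f) = (\<lambda>n. c * \<rho> s (comb X \<rho> ys f) n + comb X \<rho> xs (comb X \<rho> ys f) n)"
      unfolding x using yf by (simp add: comb_def[of X \<rho> "(c, s) # xs"] comb_def[of X \<rho> xs])
    also have "\<dots> = (\<lambda>n. c * comb X \<rho> ?m f n + comb X \<rho> (concat (map (\<lambda>(c, s). map (\<lambda>(d, t). (c * d, t O s)) ys) xs)) f n)"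
      unfolding rep_comb[OF s ys f] Cons.IH[OF xs] ..
    also have "(\<lambda>n. c * comb X \<rho> ?m f n) = comb X \<rho> (map (\<lambda>(d, t). (c * d, t O s)) ys) f"
      using fun_cong[OF comb_scale[of X c \<rho> ?m], of f] f by (simp add: comp_def case_prod_unfold)
    finally show ?case using f by (simp add: comb_def x fun_eq_iff) 
  qed
  then have "amult (bounded_op_algebra X) (comb X \<rho> xs) (comb X \<rho> ys) =
    (\<lambda>f\<in>ell2 X. comb X \<rho> (concat (map (\<lambda>(c, s). map (\<lambda>(d, t). (c * d, t O s)) ys) xs)) f)"
    by (simp cong: restrict_cong)
  also have "\<dots> = comb X \<rho> (concat (map (\<lambda>(c, s). map (\<lambda>(d, t). (c * d, t O s)) ys) xs))"
    unfolding comb_def by (rule restrict_restrict[THEN trans]) simp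
  finally show ?thesis .
qed

lemma comb_star:
  assumes xs: "snd ` set xs \<subseteq> S"
  shows "op_adjoint X (comb X \<rho> xs) = comb X \<rho> (map (\<lambda>(c, s). (cnj c, s\<inverse>)) xs)"
proof (rule op_adjoint_eqI[OF comb_rep_bounded[OF xs]])
  show "comb X \<rho> (map (\<lambda>(c, s). (cnj c, s\<inverse>)) xs) \<in> bounded_ops X"
    using xs S(2) by (intro comb_rep_bounded) force
  fix f g assume f: "f \<in> ell2 X" and g: "g \<in> ell2 X"
  show "ell2_inner X (comb X \<rho> (map (\<lambda>(c, s). (cnj c, s\<inverse>)) xs) f) g = ell2_inner X f (comb X \<rho> xs g)"
    using xs
  proof (induction xs)
    case Nil
    then show ?case using f g by (simp add: comb_def)
  next
    case (Cons x xs)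
    obtain c s where x: "x = (c, s)" by force
    have s: "s \<in> S" and xs: "snd ` set xs \<subseteq> S" using Cons.prems by (auto simp: x)
    have xs': "snd ` set (map (\<lambda>(c, s). (cnj c, s\<inverse>)) xs) \<subseteq> S" using xs S(2) by force
    note b = rep_bounded[OF \<rho> s] rep_bounded[OF \<rho> S(2)[OF s]]
    note i1 = bounded_ops_in[OF b(1) g] bounded_ops_in[OF comb_rep_bounded[OF xs] g]
    note i2 = bounded_ops_in[OF b(2) f] bounded_ops_in[OF comb_rep_bounded[OF xs'] f]
    have "comb X \<rho> (x # xs) g = (\<lambda>n. c * \<rho> s g n + comb X \<rho> xs g n)"
      using g by (simp add: comb_def x)
    then have 1: "ell2_inner X f (comb X \<rho> (x # xs) g) = c * ell2_inner X f (\<rho> s g) + ell2_inner X f (comb X \<rho> xs g)"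
      using inner_add_right[OF f ell2_scale(1)[OF i1(1)] i1(2), of c] by (simp add: inner_scale_right)
    have "comb X \<rho> (map (\<lambda>(c, s). (cnj c, s\<inverse>)) (x # xs)) f =
        (\<lambda>n. cnj c * \<rho> (s\<inverse>) f n + comb X \<rho> (map (\<lambda>(c, s). (cnj c, s\<inverse>)) xs) f n)"
      using f by (simp add: comb_def x)
    then have 2: "ell2_inner X (comb X \<rho> (map (\<lambda>(c, s). (cnj c, s\<inverse>)) (x # xs)) f) g =
        c * ell2_inner X (\<rho> (s\<inverse>) f) g + ell2_inner X (comb X \<rho> (map (\<lambda>(c, s). (cnj c, s\<inverse>)) xs) f) g"
      using inner_add_left[OF g ell2_scale(1)[OF i2(1)] i2(2), of "cnj c"] by (simp add: inner_scale_left)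
    show ?case
      unfolding 1 2 Cons.IH[OF xs] using op_adjoint(2)[OF b(1) f g] rep_converse[OF \<rho> s] by simp
  qed
qed

end

section \<open>Norm estimates on combinations yield an isomorphism\<close>

lemma comb_single: "\<rho> s \<in> bounded_ops X \<Longrightarrow> comb X \<rho> [(1, s)] = \<rho> s"
  using bounded_ops_extensional[of "\<rho> s" X]
  by (intro extensionalityI[of _ "ell2 X"]) (simp_all add: comb_def)

context countable_subsemigroup begin

definition regular_rep :: "('a \<times> 'a) set \<Rightarrow> 'a ell2_op" where
  "regular_rep = (\<lambda>s\<in>S. shift_op P s)"

lemma regular_rep: "regular_rep \<in> partial_isometry_reps S BP"
  unfolding regular_rep_def
  by (rule shift_rep[where \<tau> = "\<lambda>s. s"]) (auto intro: hull_partial_bij hull_converse hull_product hull_zero)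

text \<open>The star algebra generated without limits: dense in the universal algebra, and
  consisting of finite combinations.\<close>

inductive_set Alg where
  "s \<in> S \<Longrightarrow> universal_gen S s \<in> Alg"
| "a \<in> Alg \<Longrightarrow> b \<in> Alg \<Longrightarrow> aadd Fam a b \<in> Alg"
| "a \<in> Alg \<Longrightarrow> ascale Fam c a \<in> Alg"
| "a \<in> Alg \<Longrightarrow> b \<in> Alg \<Longrightarrow> amult Fam a b \<in> Alg"
| "a \<in> Alg \<Longrightarrow> astar Fam a \<in> Alg"

lemma Alg_Full: "a \<in> Alg \<Longrightarrow> a \<in> elems Full"
proof (induction rule: Alg.induct)
qed (blast intro: Full_gen closed_star_subalgebraD[OF Full_closed])+

text \<open>One and the same list represents the element in every representation and its image in
  the regular one. This uniformity turns a bound for combinations into a bound for the universal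
  norm.\<close>

lemma Alg_comb:
  assumes "a \<in> Alg" and \<phi>: "canonical \<phi>"
  shows "\<exists>xs. snd ` set xs \<subseteq> S \<and> (\<forall>\<rho>\<in>Reps. a \<rho> = comb UNIV \<rho> xs) \<and> \<phi> a = comb P regular_rep xs"
  using assms(1)
proof (induction rule: Alg.induct)
  case (1 s)
  show ?case
  proof (intro exI[of _ "[(1, s)]"] conjI ballI)
    show "universal_gen S s \<rho> = comb UNIV \<rho> [(1, s)]" if "\<rho> \<in> Reps" for \<rho>
      using that comb_single[of \<rho> s UNIV, OF rep_bounded[OF that 1]] by (simp add: universal_gen_def)
    show "\<phi> (universal_gen S s) = comb P regular_rep [(1, s)]"
      using comb_single[of regular_rep s P, OF rep_bounded[OF regular_rep 1]] canonical_shift[OF \<phi> 1] 1 by (simp add: regular_rep_def)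
  qed (use 1 in simp)
next
  case (2 a b)
  then obtain xs ys where xs: "snd ` set xs \<subseteq> S" "\<forall>\<rho>\<in>Reps. a \<rho> = comb UNIV \<rho> xs" "\<phi> a = comb P regular_rep xs"
    and ys: "snd ` set ys \<subseteq> S" "\<forall>\<rho>\<in>Reps. b \<rho> = comb UNIV \<rho> ys" "\<phi> b = comb P regular_rep ys" by blast
  show ?case
    using xs ys canonicalD(2)[OF \<phi> Alg_Full[OF 2(1)] Alg_Full[OF 2(2)]]
    by (intro exI[of _ "xs @ ys"]) (auto simp: Fam_ops_apply(2) comb_append simp del: bounded_op_algebra_simps)
next
  case (3 a c)
  then obtain xs where xs: "snd ` set xs \<subseteq> S" "\<forall>\<rho>\<in>Reps. a \<rho> = comb UNIV \<rho> xs" "\<phi> a = comb P regular_rep xs"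
    by blast
  let ?z = "map (\<lambda>(d, s). (c * d, s)) xs"
  have z: "snd ` set ?z \<subseteq> S" using xs(1) by force
  have "ascale Fam c a \<rho> = comb UNIV \<rho> ?z" if \<rho>: "\<rho> \<in> Reps" for \<rho>
    unfolding Fam_ops_apply(3)[OF \<rho>] xs(2)[rule_format, OF \<rho>] by (rule comb_scale)
  moreover have "\<phi> (ascale Fam c a) = comb P regular_rep ?z"
    unfolding canonicalD(3)[OF \<phi> Alg_Full[OF 3(1)]] xs(3) by (rule comb_scale)
  ultimately show ?case using z by blast
next
  case (4 a b)
  then obtain xs ys where xs: "snd ` set xs \<subseteq> S" "\<forall>\<rho>\<in>Reps. a \<rho> = comb UNIV \<rho> xs" "\<phi> a = comb P regular_rep xs"
    and ys: "snd ` set ys \<subseteq> S" "\<forall>\<rho>\<in>Reps. b \<rho> = comb UNIV \<rho> ys" "\<phi> b = comb P regular_rep ys" by blast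
  let ?z = "concat (map (\<lambda>(c, s). map (\<lambda>(d, t). (c * d, t O s)) ys) xs)"
  have z: "snd ` set ?z \<subseteq> S"
  proof
    fix u assume "u \<in> snd ` set ?z"
    then obtain c s d t where "(c, s) \<in> set xs" "(d, t) \<in> set ys" "u = t O s" by auto
    then show "u \<in> S" using xs(1) ys(1) hull_product[of s t] by force
  qed
  have "amult Fam a b \<rho> = comb UNIV \<rho> ?z" if \<rho>: "\<rho> \<in> Reps" for \<rho>
    unfolding Fam_ops_apply(4)[OF \<rho>] xs(2)[rule_format, OF \<rho>] ys(2)[rule_format, OF \<rho>]
    by (rule comb_mult[OF \<rho> hull_product hull_converse xs(1) ys(1)])
  moreover have "\<phi> (amult Fam a b) = comb P regular_rep ?z"
    unfolding canonicalD(4)[OF \<phi> Alg_Full[OF 4(1)] Alg_Full[OF 4(2)]] xs(3) ys(3)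
    by (rule comb_mult[OF regular_rep hull_product hull_converse xs(1) ys(1)])
  ultimately show ?case using z by blast
next
  case (5 a)
  then obtain xs where xs: "snd ` set xs \<subseteq> S" "\<forall>\<rho>\<in>Reps. a \<rho> = comb UNIV \<rho> xs" "\<phi> a = comb P regular_rep xs"
    by blast
  let ?z = "map (\<lambda>(c, s). (cnj c, s\<inverse>)) xs"
  have z: "snd ` set ?z \<subseteq> S" using xs(1) hull_converse by force
  have "astar Fam a \<rho> = comb UNIV \<rho> ?z" if \<rho>: "\<rho> \<in> Reps" for \<rho>
    unfolding Fam_ops_apply(5)[OF \<rho>] xs(2)[rule_format, OF \<rho>] bounded_op_algebra_simps(6)
    by (rule comb_star[OF \<rho> hull_product hull_converse xs(1)])
  moreover have "\<phi> (astar Fam a) = comb P regular_rep ?z"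
    unfolding canonicalD(5)[OF \<phi> Alg_Full[OF 5(1)]] xs(3) bounded_op_algebra_simps(6)
    by (rule comb_star[OF regular_rep hull_product hull_converse xs(1)])
  ultimately show ?case using z by blast
qed

text \<open>On the dense algebra the hypothesis bounds every coordinate by the reduced norm, so the
  canonical map, being contractive, is isometric there and hence on the closure. The isometric image
  of a complete algebra is closed and therefore contains the reduced algebra by minimality.\<close>

theorem star_iso_if_norm_bound:
  assumes bound: "\<And>xs \<rho> f. \<lbrakk>snd ` set xs \<subseteq> S; \<rho> \<in> Reps; f \<in> ell2 UNIV\<rbrakk> \<Longrightarrow>
    ell2_norm UNIV (comb UNIV \<rho> xs f) \<le> op_norm P (comb P regular_rep xs) * ell2_norm UNIV f"
  shows "star_iso Full Red (canonical_hom G P)"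
proof -
  let ?\<phi> = "canonical_hom G P"
  note can = canonical_canonical_hom
  note \<phi> = canonicalD[OF can]
  note F = closed_star_subalgebraD[OF Full_closed]
  have ne: "op_norm P (?\<phi> b) \<ge> 0" if "b \<in> elems Full" for b by (rule op_norm_nonneg[OF Red_BP[OF \<phi>(1)[OF that]]])
  have Alg_norm: "anorm Fam a \<le> op_norm P (?\<phi> a)" if a: "a \<in> Alg" for a
  proof -
    obtain xs where xs: "snd ` set xs \<subseteq> S" "\<forall>\<rho>\<in>Reps. a \<rho> = comb UNIV \<rho> xs" "?\<phi> a = comb P regular_rep xs"
      using Alg_comb[OF a can] by blast
    have "op_norm UNIV (a \<rho>) \<le> op_norm P (?\<phi> a)" if "\<rho> \<in> Reps" for \<rho>
      using xs that bound[OF xs(1) that] ne[OF Alg_Full[OF a]] by (intro op_norm_le) auto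
    then show ?thesis
      using Reps_nonempty by (auto simp: bounded_families_simps intro: cSUP_least)
  qed
  have dense: "elems Full \<subseteq> {a \<in> elems Fam. \<forall>\<epsilon>>0. \<exists>b\<in>Alg. adist Fam a b < \<epsilon>}" (is "_ \<subseteq> ?C")
  proof (rule Full_minimal)
    have "azero Fam \<in> Alg" using Alg.intros(1)[OF hull_zero] universal_gen_ops(1) by simp
    then show "closed_star_subalgebra Fam ?C"
      using Full_Fam[OF Alg_Full] by (intro Fam.closure_closed_star_subalgebra) (auto intro: Alg.intros)
    show "universal_gen S s \<in> ?C" if "s \<in> S" for s
    proof -
      have "\<exists>b\<in>Alg. adist Fam (universal_gen S s) b < \<epsilon>" if "\<epsilon> > 0" for \<epsilon>
        using Alg.intros(1)[OF \<open>s \<in> S\<close>] Fam.dist_self[OF universal_gen_Fam[OF \<open>s \<in> S\<close>]] that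
        by (intro bexI[of _ "universal_gen S s"]) auto
      then show ?thesis using universal_gen_Fam[OF that] by simp
    qed
  qed
  have norm: "anorm Fam a \<le> op_norm P (?\<phi> a)" if a: "a \<in> elems Full" for a
  proof (rule field_le_epsilon)
    fix \<epsilon> :: real assume "\<epsilon> > 0"
    then have "\<epsilon> / 2 > 0" by simp
    then obtain b where b: "b \<in> Alg" "adist Fam a b < \<epsilon> / 2" using dense a by blast
    note bF = Alg_Full[OF b(1)]
    have "anorm Fam a \<le> adist Fam a b + anorm Fam b" by (rule Fam.norm_le_dist[OF Full_Fam[OF a] Full_Fam[OF bF]])
    moreover have "anorm Fam b \<le> op_norm P (?\<phi> b)" by (rule Alg_norm[OF b(1)])
    moreover have "op_norm P (?\<phi> b) \<le> adist BP (?\<phi> b) (?\<phi> a) + op_norm P (?\<phi> a)"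
      using BP.norm_le_dist[of "?\<phi> b" "?\<phi> a"] Red_BP[OF \<phi>(1)[OF a]] Red_BP[OF \<phi>(1)[OF bF]] by simp
    moreover have "adist BP (?\<phi> b) (?\<phi> a) \<le> adist Fam a b"
      using canonical_dist[OF can bF a] Fam.dist_sym[OF Full_Fam[OF a] Full_Fam[OF bF]] by simp
    ultimately show "anorm Fam a \<le> op_norm P (?\<phi> a) + \<epsilon>" using b(2) by simp
  qed
  have isom: "adist Fam a b \<le> adist BP (?\<phi> a) (?\<phi> b)" if a: "a \<in> elems Full" and b: "b \<in> elems Full" for a b
    using norm[OF F(3)[OF a F(4)[OF b, of "-1"]]]
    unfolding adist_def \<phi>(2)[OF a F(4)[OF b]] \<phi>(3)[OF b] bounded_op_algebra_simps(7) .
  have inj: "inj_on ?\<phi> (elems Full)"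
  proof (rule inj_onI)
    fix a b assume a: "a \<in> elems Full" and b: "b \<in> elems Full" and eq: "?\<phi> a = ?\<phi> b"
    have "adist Fam a b \<le> 0"
      using isom[OF a b] BP.dist_self[of "?\<phi> b"] Red_BP[OF \<phi>(1)[OF b]] by (simp add: eq)
    then show "a = b"
      using Fam.dist_eq[OF Full_Fam[OF a] Full_Fam[OF b]] Fam.dist_nonneg[OF Full_Fam[OF a] Full_Fam[OF b]] by simp
  qed
  have "closed_star_subalgebra BP (?\<phi> ` elems Full)"
    unfolding closed_star_subalgebra_def
  proof (intro conjI ballI allI impI)
    show "?\<phi> ` elems Full \<subseteq> elems BP" using Red_BP[OF \<phi>(1)] by auto
    show "azero BP \<in> ?\<phi> ` elems Full" using F(2) canonical_zero[OF can] by (intro image_eqI[of _ _ "azero Fam"]) auto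
  next
    fix u v assume "u \<in> ?\<phi> ` elems Full" "v \<in> ?\<phi> ` elems Full"
    then obtain a b where ab: "a \<in> elems Full" "b \<in> elems Full" "u = ?\<phi> a" "v = ?\<phi> b" by blast
    show "aadd BP u v \<in> ?\<phi> ` elems Full"
      unfolding ab(3,4) \<phi>(2)[OF ab(1,2), symmetric] by (intro imageI F(3) ab)
    show "amult BP u v \<in> ?\<phi> ` elems Full"
      unfolding ab(3,4) \<phi>(4)[OF ab(1,2), symmetric] by (intro imageI F(5) ab)
  next
    fix c u assume "u \<in> ?\<phi> ` elems Full"
    then obtain a where a: "a \<in> elems Full" "u = ?\<phi> a" by blast
    show "ascale BP c u \<in> ?\<phi> ` elems Full"
      unfolding a(2) \<phi>(3)[OF a(1), symmetric] by (intro imageI F(4) a)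
  next
    fix u assume "u \<in> ?\<phi> ` elems Full"
    then obtain a where a: "a \<in> elems Full" "u = ?\<phi> a" by blast
    show "astar BP u \<in> ?\<phi> ` elems Full"
      unfolding a(2) \<phi>(5)[OF a(1), symmetric] by (intro imageI F(6) a)
  next
    fix T assume T: "T \<in> elems BP" and app: "\<forall>\<epsilon>>0. \<exists>b\<in>?\<phi> ` elems Full. anorm BP (aadd BP T (ascale BP (-1) b)) < \<epsilon>"
    \<comment> \<open>Preimages of approximations to \<open>T\<close>; since the map is isometric
      they form a Cauchy sequence in the universal algebra.\<close>
    have "\<exists>b. b \<in> elems Full \<and> adist BP T (?\<phi> b) < 1 / real (Suc n)" for n
    proof -
      have "(0::real) < 1 / real (Suc n)" by simp
      then show ?thesis using app unfolding adist_def by blast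
    qed
    then obtain b where b: "\<And>n. b n \<in> elems Full" "\<And>n. adist BP T (?\<phi> (b n)) < 1 / real (Suc n)" by metis
    note bR = Red_BP[OF \<phi>(1)[OF b(1)]]
    have dmn: "adist Fam (b m) (b n) \<le> 1 / real (Suc m) + 1 / real (Suc n)" for m n
    proof -
      have "adist Fam (b m) (b n) \<le> adist BP (?\<phi> (b m)) (?\<phi> (b n))" by (rule isom[OF b(1) b(1)])
      also have "\<dots> \<le> adist BP (?\<phi> (b m)) T + adist BP T (?\<phi> (b n))"
        using BP.dist_triangle[of "?\<phi> (b m)" T "?\<phi> (b n)"] T bR by simp
      also have "adist BP (?\<phi> (b m)) T = adist BP T (?\<phi> (b m))"
        using BP.dist_sym[of "?\<phi> (b m)" T] T bR by simp
      finally show ?thesis using b(2)[of m] b(2)[of n] by simp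
    qed
    have cauchy: "\<exists>N. \<forall>m\<ge>N. \<forall>n\<ge>N. adist Fam (b m) (b n) \<le> \<epsilon>" if e: "\<epsilon> > 0" for \<epsilon>
    proof -
      obtain N where N: "inverse (real (Suc N)) < \<epsilon> / 2" using reals_Archimedean[OF half_gt_zero[OF e]] by blast
      have *: "1 / real (Suc m) < \<epsilon> / 2" if "m \<ge> N" for m
      proof -
        have "1 / real (Suc m) \<le> inverse (real (Suc N))" using that by (simp add: inverse_eq_divide frac_le)
        then show ?thesis using N by simp
      qed
      have "adist Fam (b m) (b n) \<le> \<epsilon>" if "m \<ge> N" "n \<ge> N" for m n
        using dmn[of m n] *[OF that(1)] *[OF that(2)] by linarith
      then show ?thesis by blast
    qed
    obtain a where a: "a \<in> elems Fam"
      "\<And>\<epsilon> N n. \<epsilon> > 0 \<Longrightarrow> \<forall>m\<ge>N. \<forall>n\<ge>N. adist Fam (b m) (b n) \<le> \<epsilon> \<Longrightarrow> n \<ge> N \<Longrightarrow> adist Fam (b n) a \<le> \<epsilon>"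
      using Fam.complete[of b, OF Full_Fam[OF b(1)] cauchy] by blast
    have conv: "\<exists>N. \<forall>n\<ge>N. adist Fam (b n) a \<le> \<epsilon>" if "\<epsilon> > 0" for \<epsilon>
      using a(2)[OF that] cauchy[OF that] by blast
    have aF: "a \<in> elems Full"
    proof (rule F(7)[OF a(1)])
      fix \<epsilon> :: real assume "\<epsilon> > 0"
      then obtain n where "adist Fam (b n) a \<le> \<epsilon> / 2" using conv[of "\<epsilon> / 2"] by auto
      then show "\<exists>b\<in>elems Full. adist Fam a b < \<epsilon>"
        using b(1) Fam.dist_sym[OF a(1) Full_Fam[OF b(1)], of n] \<open>\<epsilon> > 0\<close> by (intro bexI[of _ "b n"]) auto
    qed
    note aR = Red_BP[OF \<phi>(1)[OF aF]]
    have "adist BP T (?\<phi> a) \<le> 0"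
    proof (rule field_le_epsilon)
      fix \<epsilon> :: real assume e: "\<epsilon> > 0"
      then obtain N1 where N1: "\<forall>n\<ge>N1. adist Fam (b n) a \<le> \<epsilon> / 2" using conv[of "\<epsilon> / 2"] by auto
      obtain N2 where N2: "inverse (real (Suc N2)) < \<epsilon> / 2" using reals_Archimedean[OF half_gt_zero[OF e]] by blast
      define n where "n = max N1 N2"
      have "1 / real (Suc n) \<le> inverse (real (Suc N2))" by (simp add: n_def inverse_eq_divide frac_le)
      then have "adist BP T (?\<phi> (b n)) < \<epsilon> / 2" using b(2)[of n] N2 by linarith
      moreover have "adist BP (?\<phi> (b n)) (?\<phi> a) \<le> \<epsilon> / 2"
      proof -
        have "adist Fam (b n) a \<le> \<epsilon> / 2" using N1 by (simp only: n_def max.cobounded1)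
        then show ?thesis using canonical_dist[OF can b(1) aF, of n] by linarith
      qed
      ultimately show "adist BP T (?\<phi> a) \<le> 0 + \<epsilon>"
        using BP.dist_triangle[of T "?\<phi> (b n)" "?\<phi> a"] T bR[of n] aR by simp
    qed
    then have "T = ?\<phi> a" using BP.dist_eq[of T "?\<phi> a"] BP.dist_nonneg[of T "?\<phi> a"] T aR by simp
    then show "T \<in> ?\<phi> ` elems Full" using aF by blast
  qed
  then have "elems Red \<subseteq> ?\<phi> ` elems Full"
    by (rule Red_minimal) (use \<phi>(7) Full_gen[OF left_inverse_hull.gen] in \<open>metis imageI\<close>)
  then have "bij_betw ?\<phi> (elems Full) (elems Red)"
    using inj \<phi>(1) by (auto simp: bij_betw_def)
  then show ?thesis using can by (simp add: star_iso_def canonical_def)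
qed

end

section \<open>Functional calculus for the constructible ideals\<close>

context countable_subsemigroup begin

text \<open>Among the nonempty ideals with nonzero coefficient a maximal one, \<open>M\<close>, is
  taken. By maximality all others meet it in proper subsets, and by independence these do not cover
  it. At a point of \<open>M\<close> outside them only the coefficient of \<open>M\<close>
  survives.\<close>

lemma independent_linearly_independent:
  fixes c :: "'a set \<Rightarrow> complex"
  assumes indep: "independent_semigroup G P" and F: "finite F" "F \<subseteq> J"
    and zero: "\<And>x. x \<in> P \<Longrightarrow> (\<Sum>X\<in>F. c X * (if x \<in> X then 1 else 0)) = 0"
    and X: "X \<in> F" "X \<noteq> {}"
  shows "c X = 0"
proof (rule ccontr)
  assume cX: "c X \<noteq> 0"
  define B where "B = {X \<in> F. X \<noteq> {} \<and> c X \<noteq> 0}"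
  have "finite B" "B \<noteq> {}" using F(1) X cX by (auto simp: B_def)
  then obtain M where M: "M \<in> B" "\<And>Y. Y \<in> B \<Longrightarrow> M \<subseteq> Y \<Longrightarrow> M = Y"
    using finite_has_maximal[of B] by blast
  define F' where "F' = (\<lambda>Y. M \<inter> Y) ` (B - {M})"
  have MJ: "M \<in> J" "M \<in> F" "M \<noteq> {}" "c M \<noteq> 0" using M(1) F(2) by (auto simp: B_def)
  have "\<exists>x\<in>M. x \<notin> \<Union>F'"
  proof (rule ccontr)
    assume "\<not> ?thesis"
    then have eq: "M = \<Union>F'" by (auto simp: F'_def)
    then have "F' \<noteq> {}" using MJ(3) by auto
    moreover have "F' \<subseteq> J" using Int_J[OF MJ(1)] F(2) by (auto simp: F'_def B_def)
    moreover have "finite F'" using \<open>finite B\<close> by (simp add: F'_def)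
    ultimately have "M \<in> F'" using indep MJ(1) eq unfolding independent_semigroup_def by blast
    then obtain Y where "Y \<in> B" "Y \<noteq> M" "M = M \<inter> Y" by (auto simp: F'_def)
    then show False using M(2)[of Y] by blast
  qed
  then obtain x where x: "x \<in> M" "x \<notin> \<Union>F'" by blast
  have "c Y * (if x \<in> Y then 1 else 0) = 0" if "Y \<in> F - {M}" for Y
  proof (cases "x \<in> Y \<and> c Y \<noteq> 0")
    case True
    then have "Y \<in> B - {M}" using that by (auto simp: B_def)
    then have "x \<in> \<Union>F'" using x(1) True by (auto simp: F'_def)
    then show ?thesis using x(2) by simp
  qed auto
  then have "(\<Sum>X\<in>F. c X * (if x \<in> X then 1 else 0)) = c M * (if x \<in> M then 1 else 0)"
    using sum.neutral[of "F - {M}" "\<lambda>X. c X * (if x \<in> X then 1 else 0)"]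
    by (subst sum.remove[OF F(1) MJ(2)]) simp
  then show False using zero[of x] x(1) MJ(1,4) J_subset[of M] by auto
qed

section \<open>Simple functions on the semigroup\<close>

definition simple_val :: "(complex \<times> 'a set) list \<Rightarrow> 'a \<Rightarrow> complex" where
  "simple_val xs x = (\<Sum>(c, X)\<leftarrow>xs. c * (if x \<in> X then 1 else 0))"

text \<open>The span of the indicators of constructible ideals, where only values on
  \<open>P\<close> count. Lists are used as in \<open>comb\<close>, so that the same list also
  yields an operator.\<close>

definition simple :: "('a \<Rightarrow> complex) \<Rightarrow> bool" where
  "simple h \<longleftrightarrow> (\<exists>xs. snd ` set xs \<subseteq> J \<and> (\<forall>x\<in>P. h x = simple_val xs x))"

lemma simple_val_simps [simp]:
  "simple_val [] x = 0"
  "simple_val ((c, X) # xs) x = c * (if x \<in> X then 1 else 0) + simple_val xs x"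
  "simple_val (xs @ ys) x = simple_val xs x + simple_val ys x"
  by (simp_all add: simple_val_def)

lemma simpleI: "snd ` set xs \<subseteq> J \<Longrightarrow> (\<And>x. x \<in> P \<Longrightarrow> h x = simple_val xs x) \<Longrightarrow> simple h"
  unfolding simple_def by blast

lemma simple_val_scale: "simple_val (map (\<lambda>(d, X). (c * d, X)) xs) x = c * simple_val xs x"
  by (induction xs) (auto simp: algebra_simps)

lemma simple_val_Int: "simple_val (map (\<lambda>(d, Y). (c * d, X \<inter> Y)) xs) x = c * (if x \<in> X then 1 else 0) * simple_val xs x"
  by (induction xs) (auto simp: algebra_simps)

lemma simple_val_mult:
  "simple_val (concat (map (\<lambda>(c, X). map (\<lambda>(d, Y). (c * d, X \<inter> Y)) ys) xs)) x = simple_val xs x * simple_val ys x"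
  by (induction xs) (auto simp: algebra_simps simple_val_Int)

lemma simple_indicator: "X \<in> J \<Longrightarrow> simple (\<lambda>x. if x \<in> X then 1 else 0)"
  by (rule simpleI[of "[(1, X)]"]) auto

lemma simple_add: "simple h \<Longrightarrow> simple k \<Longrightarrow> simple (\<lambda>x. h x + k x)"
  unfolding simple_def
proof (elim exE conjE)
  fix xs ys
  assume "snd ` set xs \<subseteq> J" "\<forall>x\<in>P. h x = simple_val xs x" "snd ` set ys \<subseteq> J" "\<forall>x\<in>P. k x = simple_val ys x"
  then show "\<exists>xs. snd ` set xs \<subseteq> J \<and> (\<forall>x\<in>P. h x + k x = simple_val xs x)"
    by (intro exI[of _ "xs @ ys"]) auto
qed

lemma simple_scale: "simple h \<Longrightarrow> simple (\<lambda>x. c * h x)"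
  unfolding simple_def
proof (elim exE conjE)
  fix xs
  assume "snd ` set xs \<subseteq> J" "\<forall>x\<in>P. h x = simple_val xs x"
  then show "\<exists>xs. snd ` set xs \<subseteq> J \<and> (\<forall>x\<in>P. c * h x = simple_val xs x)"
    by (intro exI[of _ "map (\<lambda>(d, X). (c * d, X)) xs"]) (force simp: simple_val_scale)
qed

lemma mult_list_J:
  assumes "snd ` set xs \<subseteq> J" "snd ` set ys \<subseteq> J"
  shows "snd ` set (concat (map (\<lambda>(c, X). map (\<lambda>(d, Y). (c * d, X \<inter> Y)) ys) xs)) \<subseteq> J"
proof
  fix u assume "u \<in> snd ` set (concat (map (\<lambda>(c, X). map (\<lambda>(d, Y). (c * d, X \<inter> Y)) ys) xs))"
  then obtain c X d Y where "(c, X) \<in> set xs" "(d, Y) \<in> set ys" "u = X \<inter> Y" by auto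
  then show "u \<in> J" using assms Int_J[of X Y] by force
qed

lemma simple_mult: "simple h \<Longrightarrow> simple k \<Longrightarrow> simple (\<lambda>x. h x * k x)"
  unfolding simple_def
proof (elim exE conjE)
  fix xs ys
  assume *: "snd ` set xs \<subseteq> J" "\<forall>x\<in>P. h x = simple_val xs x" "snd ` set ys \<subseteq> J" "\<forall>x\<in>P. k x = simple_val ys x"
  then show "\<exists>xs. snd ` set xs \<subseteq> J \<and> (\<forall>x\<in>P. h x * k x = simple_val xs x)"
    using mult_list_J[OF *(1,3)]
    by (intro exI[of _ "concat (map (\<lambda>(c, X). map (\<lambda>(d, Y). (c * d, X \<inter> Y)) ys) xs)"]) (simp add: simple_val_mult)
qed

lemma simple_zero: "simple (\<lambda>x. 0)"
  by (rule simpleI[of "[]"]) auto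

lemma simple_sum: "(\<And>i. i \<in> I \<Longrightarrow> simple (h i)) \<Longrightarrow> simple (\<lambda>x. \<Sum>i\<in>I. h i x)"
  by (induction I rule: infinite_finite_induct) (auto intro: simple_zero simple_add)

lemma simple_cong: "simple h \<Longrightarrow> (\<And>x. x \<in> P \<Longrightarrow> h x = k x) \<Longrightarrow> simple k"
  unfolding simple_def by metis

text \<open>Constancy on the atoms which \<open>F\<close> cuts out of \<open>P\<close>, an atom
  being a class of points that lie in the same members of \<open>F\<close>.\<close>

definition measurable_wrt :: "'a set set \<Rightarrow> ('a \<Rightarrow> 'c) \<Rightarrow> bool" where
  "measurable_wrt F h \<longleftrightarrow> (\<forall>x\<in>P. \<forall>y\<in>P. (\<forall>X\<in>F. x \<in> X \<longleftrightarrow> y \<in> X) \<longrightarrow> h x = h y)"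

lemma measurable_wrtD: "measurable_wrt F h \<Longrightarrow> x \<in> P \<Longrightarrow> y \<in> P \<Longrightarrow> (\<And>X. X \<in> F \<Longrightarrow> x \<in> X \<longleftrightarrow> y \<in> X) \<Longrightarrow> h x = h y"
  unfolding measurable_wrt_def by blast

text \<open>The complement of an ideal need not be an ideal, but its indicator is 1 minus an
  indicator. When \<open>X\<close> joins the family, the function is matched on \<open>X\<close> and
  off \<open>X\<close> by two functions measurable for the smaller family, and these are glued with
  the indicator of \<open>X\<close>.\<close>

lemma measurable_simple:
  assumes "finite F" "F \<subseteq> J" "measurable_wrt F h"
  shows "simple h"
  using assms
proof (induction F arbitrary: h rule: finite_induct)
  case empty
  show ?case
  proof (cases "P = {}")
    case True
    then show ?thesis by (intro simpleI[of "[]"]) auto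
  next
    case False
    then obtain y where y: "y \<in> P" by blast
    then have "h x = h y" if "x \<in> P" for x using measurable_wrtD[OF empty(2)] that by blast
    then show ?thesis using constructible_ideals.top by (intro simpleI[of "[(h y, P)]"]) auto
  qed
next
  case (insert X F)
  have split: "\<exists>k. simple k \<and> (\<forall>x\<in>P \<inter> A. k x = h x)"
    if A: "A = X \<or> A = - X" for A
  proof -
    \<comment> \<open>\<open>C x\<close> is the part inside \<open>A\<close> of the atom of
      \<open>x\<close>. The function \<open>k\<close> copies \<open>h\<close> from a chosen point of
      it, with default 0 for atoms that miss \<open>A\<close>.\<close>
    define C where "C x = {y \<in> P \<inter> A. \<forall>Z\<in>F. x \<in> Z \<longleftrightarrow> y \<in> Z}" for x
    define k where "k x = (if C x = {} then 0 else h (SOME y. y \<in> C x))" for x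
    have "measurable_wrt F k"
      unfolding measurable_wrt_def
    proof (intro ballI impI)
      fix x y assume "\<forall>Z\<in>F. x \<in> Z \<longleftrightarrow> y \<in> Z"
      then have "C x = C y" by (auto simp: C_def)
      then show "k x = k y" by (simp add: k_def)
    qed
    then have "simple k" using insert.IH insert.prems(1) by simp
    moreover have "k x = h x" if x: "x \<in> P \<inter> A" for x
    proof -
      have "x \<in> C x" using x by (simp add: C_def)
      then have "C x \<noteq> {}" "(SOME y. y \<in> C x) \<in> C x" by (auto intro: someI)
      moreover have "h x = h (SOME y. y \<in> C x)"
      proof (rule measurable_wrtD[OF insert.prems(2)])
        define y where "y = (SOME y. y \<in> C x)"
        have yC: "y \<in> C x" unfolding y_def by fact
        have y: "y \<in> P" "y \<in> A" "\<forall>Z\<in>F. x \<in> Z \<longleftrightarrow> y \<in> Z"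
          using CollectD[OF yC[unfolded C_def]] by simp_all
        show "x \<in> P" using x by simp
        show "(SOME y. y \<in> C x) \<in> P" using y(1) by (simp only: y_def)
        show "x \<in> Z \<longleftrightarrow> (SOME y. y \<in> C x) \<in> Z" if "Z \<in> insert X F" for Z
        proof (cases "Z = X")
          case True
          have "x \<in> Z \<longleftrightarrow> y \<in> Z" unfolding True using A x y(2) by (elim disjE) simp_all
          then show ?thesis by (simp only: y_def)
        next
          case False
          then have "x \<in> Z \<longleftrightarrow> y \<in> Z" using that y(3) by simp
          then show ?thesis by (simp only: y_def)
        qed
      qed
      ultimately show ?thesis by (simp add: k_def)
    qed
    ultimately show ?thesis by blast
  qed
  obtain k1 where k1: "simple k1" "\<And>x. x \<in> P \<inter> X \<Longrightarrow> k1 x = h x" using split[of X] by auto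
  obtain k2 where k2: "simple k2" "\<And>x. x \<in> P \<inter> - X \<Longrightarrow> k2 x = h x" using split[of "- X"] by auto
  have X: "X \<in> J" using insert.prems(1) by simp
  have "simple (\<lambda>x. (if x \<in> X then 1 else 0) * k1 x + (k2 x + (- 1) * ((if x \<in> X then 1 else 0) * k2 x)))"
    by (intro simple_add simple_mult simple_scale simple_indicator X k1 k2)
  then show ?case by (rule simple_cong) (use k1(2) k2(2) in auto)
qed

lemma simple_measurable:
  assumes "simple h" obtains F where "finite F" "F \<subseteq> J" "measurable_wrt F h"
proof -
  obtain xs where xs: "snd ` set xs \<subseteq> J" "\<forall>x\<in>P. h x = simple_val xs x" using assms by (auto simp: simple_def)
  have "simple_val ys x = simple_val ys y" if "\<forall>X\<in>snd ` set ys. x \<in> X \<longleftrightarrow> y \<in> X" for x y ys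
    using that by (induction ys) auto
  then have "measurable_wrt (snd ` set xs) h" using xs(2) by (simp add: measurable_wrt_def)
  then show thesis using that[of "snd ` set xs"] xs(1) by simp
qed

text \<open>Measurability for a finite family is kept by any function of the value. Square roots of
  simple functions are obtained this way.\<close>

lemma simple_comp: assumes "simple h" shows "simple (\<lambda>x. f (h x))"
proof -
  obtain F where F: "finite F" "F \<subseteq> J" "measurable_wrt F h" using simple_measurable[OF assms] .
  then have "measurable_wrt F (\<lambda>x. f (h x))" unfolding measurable_wrt_def by metis
  then show ?thesis by (rule measurable_simple[OF F(1,2)])
qed

end

lemma sum_list_by_set:
  fixes \<phi> :: "'s \<Rightarrow> complex"
  assumes "finite F" "snd ` set xs \<subseteq> F"
  shows "(\<Sum>(c, X)\<leftarrow>xs. c * \<phi> X) = (\<Sum>X\<in>F. (\<Sum>(c, Y)\<leftarrow>xs. if Y = X then c else 0) * \<phi> X)"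
  using assms(2)
proof (induction xs)
  case (Cons a xs)
  obtain c Y where a: "a = (c, Y)" by force
  have Y: "Y \<in> F" and xs: "snd ` set xs \<subseteq> F" using Cons.prems by (auto simp: a)
  have "(\<Sum>X\<in>F. (\<Sum>(c, Z)\<leftarrow>a # xs. if Z = X then c else 0) * \<phi> X) =
      (\<Sum>X\<in>F. (if Y = X then c * \<phi> X else 0) + (\<Sum>(c, Z)\<leftarrow>xs. if Z = X then c else 0) * \<phi> X)"
    by (intro sum.cong) (auto simp: a algebra_simps)
  also have "\<dots> = c * \<phi> Y + (\<Sum>X\<in>F. (\<Sum>(c, Z)\<leftarrow>xs. if Z = X then c else 0) * \<phi> X)"
    using assms(1) Y by (simp add: sum.distrib sum.delta')
  finally show ?case using Cons.IH[OF xs] by (simp add: a)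
qed auto

lemma snd_map_fst: "snd ` set (map (\<lambda>(d, X). (f d, X)) xs) = snd ` set xs"
  by (induction xs) auto

section \<open>The functional calculus of one representation\<close>

locale independent_rep = countable_subsemigroup +
  fixes \<rho> :: "('a \<times> 'a) set \<Rightarrow> nat ell2_op"
  assumes rho: "\<rho> \<in> reps_on_ell2_nat (left_inverse_hull G P)"
    and indep: "independent_semigroup G P"
begin

abbreviation "H \<equiv> ell2 (UNIV :: nat set)"
abbreviation "nrm \<equiv> ell2_norm (UNIV :: nat set)"
abbreviation "ip \<equiv> ell2_inner (UNIV :: nat set)"

definition proj :: "'a set \<Rightarrow> nat ell2_op" where "proj X = \<rho> (Id_on X)"

lemmas rho_bounded = rep_bounded[OF rho]
lemmas rho_relcomp = rep_relcomp[OF rho]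
lemmas rho_H = bounded_ops_in[OF rho_bounded]

lemma rho_adjoint:
  assumes "s \<in> S" "f \<in> H" "g \<in> H"
  shows "ip (\<rho> (s\<inverse>) f) g = ip f (\<rho> s g)"
  using op_adjoint(2)[OF rho_bounded[OF assms(1)] assms(2,3)] rep_converse[OF rho assms(1)] by simp

lemma proj_bounded: "X \<in> J \<Longrightarrow> proj X \<in> bounded_ops UNIV"
  by (simp add: proj_def rho_bounded Id_on_hull)

lemma proj_mult: "X \<in> J \<Longrightarrow> Y \<in> J \<Longrightarrow> f \<in> H \<Longrightarrow> proj X (proj Y f) = proj (X \<inter> Y) f"
  using rho_relcomp[OF Id_on_hull Id_on_hull, of X Y f] by (simp add: proj_def Id_on_relcomp Int_commute)

lemma proj_adjoint: "X \<in> J \<Longrightarrow> f \<in> H \<Longrightarrow> g \<in> H \<Longrightarrow> ip (proj X f) g = ip f (proj X g)"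
  using rho_adjoint[OF Id_on_hull, of X f g] by (simp add: proj_def)

lemma proj_empty: "f \<in> H \<Longrightarrow> proj {} f = (\<lambda>n. 0)"
  using rep_empty[OF rho] by (simp add: proj_def)

text \<open>Both composites of partial bijections are the restriction of \<open>s\<close> to the
  points that it sends into \<open>X\<close>.\<close>

lemma proj_rho:
  assumes X: "X \<in> J" and s: "s \<in> S" and f: "f \<in> H"
  shows "proj X (\<rho> s f) = \<rho> s (proj (s\<inverse> `` X) f)"
proof -
  have Y: "s\<inverse> `` X \<in> J" by (rule hull_image_J[OF hull_converse[OF s] X])
  have "s O Id_on X = Id_on (s\<inverse> `` X) O s"
    using partial_bijD(3)[OF hull_partial_bij[OF s]] by (auto simp: relcomp_unfold Id_on_iff)
  then show ?thesis
    using rho_relcomp[OF Id_on_hull[OF X] s f] rho_relcomp[OF s Id_on_hull[OF Y] f] by (simp add: proj_def)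
qed

text \<open>After equal ideals are collected, the coefficients of the nonempty ones vanish by linear
  independence, and the empty ideal contributes nothing because the zero of the hull acts as 0. This
  makes the functional calculus well defined.\<close>

lemma comb_proj_zero:
  assumes xs: "snd ` set xs \<subseteq> J" and z: "\<And>x. x \<in> P \<Longrightarrow> simple_val xs x = 0" and f: "f \<in> H"
  shows "comb UNIV proj xs f = (\<lambda>n. 0)"
proof
  fix n
  define F where "F = snd ` set xs"
  define C where "C X = (\<Sum>(c, Y)\<leftarrow>xs. if Y = X then c else 0)" for X
  have F: "finite F" "F \<subseteq> J" "snd ` set xs \<subseteq> F" using xs by (auto simp: F_def)
  have "(\<Sum>X\<in>F. C X * (if x \<in> X then 1 else 0)) = 0" if "x \<in> P" for x
    using z[OF that] unfolding simple_val_def sum_list_by_set[OF F(1,3)] C_def .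
  then have C0: "C X = 0" if "X \<in> F" "X \<noteq> {}" for X
    using independent_linearly_independent[OF indep F(1,2)] that by blast
  have "comb UNIV proj xs f n = (\<Sum>X\<in>F. C X * proj X f n)"
    using f by (simp add: comb_def sum_list_by_set[OF F(1,3)] C_def)
  also have "\<dots> = 0"
    using C0 proj_empty[OF f] by (intro sum.neutral) (metis mult_eq_0_iff)
  finally show "comb UNIV proj xs f n = 0" .
qed

text \<open>Independence makes the indicator functions of the nonempty constructible ideals linearly
  independent, so the choice of the combination does not matter.\<close>

definition Phi :: "('a \<Rightarrow> complex) \<Rightarrow> nat ell2_op" where
  "Phi h = comb UNIV proj (SOME xs. snd ` set xs \<subseteq> J \<and> (\<forall>x\<in>P. h x = simple_val xs x))"

lemma Phi_eq:
  assumes xs: "snd ` set xs \<subseteq> J" "\<And>x. x \<in> P \<Longrightarrow> h x = simple_val xs x" and f: "f \<in> H"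
  shows "Phi h f = comb UNIV proj xs f"
proof -
  define ys where "ys = (SOME xs. snd ` set xs \<subseteq> J \<and> (\<forall>x\<in>P. h x = simple_val xs x))"
  have ys: "snd ` set ys \<subseteq> J \<and> (\<forall>x\<in>P. h x = simple_val ys x)"
    unfolding ys_def by (rule someI[of _ xs]) (use xs in blast)
  let ?zs = "ys @ map (\<lambda>(d, X). ((- 1) * d, X)) xs"
  have "comb UNIV proj ?zs f = (\<lambda>n. 0)"
  proof (rule comb_proj_zero[OF _ _ f])
    show "snd ` set ?zs \<subseteq> J" using xs(1) ys unfolding set_append image_Un snd_map_fst by simp
    show "simple_val ?zs x = 0" if "x \<in> P" for x
      using xs(2)[OF that] ys that unfolding simple_val_simps simple_val_scale by simp
  qed
  moreover have "comb UNIV proj ?zs f n = comb UNIV proj ys f n + (- 1) * comb UNIV proj xs f n" for n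
    using f unfolding comb_append[symmetric] comb_scale[symmetric] by simp
  ultimately have "comb UNIV proj ys f n = comb UNIV proj xs f n" for n by (simp add: fun_eq_iff)
  then show ?thesis by (auto simp: Phi_def ys_def)
qed

lemma Phi_eq':
  assumes "snd ` set xs \<subseteq> J" "\<forall>x\<in>P. h x = simple_val xs x" "f \<in> H"
  shows "Phi h f = comb UNIV proj xs f"
  using assms by (intro Phi_eq) auto

lemma comb_proj_bounded: "snd ` set xs \<subseteq> J \<Longrightarrow> comb UNIV proj xs \<in> bounded_ops UNIV"
  by (rule comb_bounded) (blast intro: proj_bounded)

lemma Phi_bounded: "simple h \<Longrightarrow> Phi h \<in> bounded_ops UNIV"
proof -
  assume "simple h"
  then have "\<exists>xs. snd ` set xs \<subseteq> J \<and> (\<forall>x\<in>P. h x = simple_val xs x)" by (simp add: simple_def)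
  from someI_ex[OF this] show ?thesis unfolding Phi_def by (intro comb_proj_bounded) blast
qed

lemmas Phi_H = bounded_ops_in[OF Phi_bounded]

lemma Phi_cong: "simple h \<Longrightarrow> (\<And>x. x \<in> P \<Longrightarrow> h x = k x) \<Longrightarrow> f \<in> H \<Longrightarrow> Phi h f = Phi k f"
proof -
  assume eq: "\<And>x. x \<in> P \<Longrightarrow> h x = k x" and f: "f \<in> H" and "simple h"
  then obtain xs where xs0: "snd ` set xs \<subseteq> J" "\<forall>x\<in>P. h x = simple_val xs x" by (auto simp: simple_def)
  note xs = xs0(1) bspec[OF xs0(2)]
  have "k x = simple_val xs x" if "x \<in> P" for x using xs(2)[OF that] eq[OF that] by simp
  from Phi_eq[of xs k f, OF xs(1) this f] Phi_eq'[OF xs0 f] show "Phi h f = Phi k f" by simp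
qed

lemma Phi_indicator: "X \<in> J \<Longrightarrow> f \<in> H \<Longrightarrow> Phi (\<lambda>x. if x \<in> X then 1 else 0) f = proj X f"
  using Phi_eq[of "[(1, X)]"] by (simp add: comb_def)

lemma Phi_zero: "f \<in> H \<Longrightarrow> Phi (\<lambda>x. 0) f = (\<lambda>n. 0)"
  using Phi_eq[of "[]"] by (simp add: comb_def)

lemma Phi_add:
  assumes h: "simple h" and k: "simple k" and f: "f \<in> H"
  shows "Phi (\<lambda>x. h x + k x) f = (\<lambda>n. Phi h f n + Phi k f n)"
proof -
  obtain xs where xs0: "snd ` set xs \<subseteq> J" "\<forall>x\<in>P. h x = simple_val xs x" using h by (auto simp: simple_def)
  note xs = xs0(1) bspec[OF xs0(2)]
  obtain ys where ys0: "snd ` set ys \<subseteq> J" "\<forall>x\<in>P. k x = simple_val ys x" using k by (auto simp: simple_def)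
  note ys = ys0(1) bspec[OF ys0(2)]
  have "Phi (\<lambda>x. h x + k x) f = comb UNIV proj (xs @ ys) f"
    using xs ys by (intro Phi_eq[OF _ _ f]) auto
  then show ?thesis
    unfolding Phi_eq'[OF xs0 f] Phi_eq'[OF ys0 f] comb_append[symmetric] using f by simp
qed

lemma Phi_scale:
  assumes h: "simple h" and f: "f \<in> H"
  shows "Phi (\<lambda>x. c * h x) f = (\<lambda>n. c * Phi h f n)"
proof -
  obtain xs where xs0: "snd ` set xs \<subseteq> J" "\<forall>x\<in>P. h x = simple_val xs x" using h by (auto simp: simple_def)
  note xs = xs0(1) bspec[OF xs0(2)]
  have "snd ` set (map (\<lambda>(d, X). (c * d, X)) xs) \<subseteq> J" using xs(1) unfolding snd_map_fst .
  then have "Phi (\<lambda>x. c * h x) f = comb UNIV proj (map (\<lambda>(d, X). (c * d, X)) xs) f"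
    by (rule Phi_eq[OF _ _ f]) (simp add: simple_val_scale xs(2))
  then show ?thesis
    unfolding Phi_eq'[OF xs0 f] comb_scale[symmetric] using f by simp
qed

lemma Phi_sum:
  assumes "\<And>i. i \<in> I \<Longrightarrow> simple (h i)" and f: "f \<in> H"
  shows "Phi (\<lambda>x. \<Sum>i\<in>I. h i x) f = (\<lambda>n. \<Sum>i\<in>I. Phi (h i) f n)"
  using assms(1)
proof (induction I rule: infinite_finite_induct)
  case (insert i I)
  then show ?case using Phi_add[OF _ simple_sum f, of "h i" I h] by simp
qed (use Phi_zero[OF f] in auto)

lemma proj_comb:
  assumes X: "X \<in> J" and ys: "snd ` set ys \<subseteq> J" and f: "f \<in> H"
  shows "(\<lambda>n. c * proj X (comb UNIV proj ys f) n) = comb UNIV proj (map (\<lambda>(d, Y). (c * d, X \<inter> Y)) ys) f"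
  using ys
proof (induction ys)
  case Nil
  then show ?case using bounded_ops_zero[OF proj_bounded[OF X]] f by (simp add: comb_def)
next
  case (Cons a ys)
  obtain d Y where a: "a = (d, Y)" by force
  have Y: "Y \<in> J" and ys: "snd ` set ys \<subseteq> J" using Cons.prems by (auto simp: a)
  note Yf = bounded_ops_in[OF proj_bounded[OF Y] f] and yf = bounded_ops_in[OF comb_proj_bounded[OF ys] f]
  have "comb UNIV proj (a # ys) f = (\<lambda>n. d * proj Y f n + comb UNIV proj ys f n)"
    using f by (simp add: comb_def a)
  then have "proj X (comb UNIV proj (a # ys) f) = (\<lambda>n. d * proj (X \<inter> Y) f n + proj X (comb UNIV proj ys f) n)"
    using bounded_ops_add[OF proj_bounded[OF X] ell2_scale(1)[OF Yf] yf] bounded_ops_scale[OF proj_bounded[OF X] Yf]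
      proj_mult[OF X Y f] by simp
  then have "(\<lambda>n. c * proj X (comb UNIV proj (a # ys) f) n) =
      (\<lambda>n. c * d * proj (X \<inter> Y) f n + c * proj X (comb UNIV proj ys f) n)" by (simp add: algebra_simps)
  also have "\<dots> = (\<lambda>n. c * d * proj (X \<inter> Y) f n + comb UNIV proj (map (\<lambda>(d, Y). (c * d, X \<inter> Y)) ys) f n)"
    using fun_cong[OF Cons.IH[OF ys]] by simp
  finally show ?case using f by (simp add: comb_def a)
qed

lemma Phi_mult:
  assumes h: "simple h" and k: "simple k" and f: "f \<in> H"
  shows "Phi (\<lambda>x. h x * k x) f = Phi h (Phi k f)"
proof -
  obtain xs where xs0: "snd ` set xs \<subseteq> J" "\<forall>x\<in>P. h x = simple_val xs x" using h by (auto simp: simple_def)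
  note xs = xs0(1) bspec[OF xs0(2)]
  obtain ys where ys0: "snd ` set ys \<subseteq> J" "\<forall>x\<in>P. k x = simple_val ys x" using k by (auto simp: simple_def)
  note ys = ys0(1) bspec[OF ys0(2)]
  note yf = bounded_ops_in[OF comb_proj_bounded[OF ys(1)] f]
  have "Phi (\<lambda>x. h x * k x) f = comb UNIV proj (concat (map (\<lambda>(c, X). map (\<lambda>(d, Y). (c * d, X \<inter> Y)) ys) xs)) f"
    using mult_list_J[OF xs(1) ys(1)] by (rule Phi_eq[OF _ _ f]) (simp add: simple_val_mult xs ys)
  also have "\<dots> = comb UNIV proj xs (comb UNIV proj ys f)"
    using xs(1)
  proof (induction xs)
    case Nil
    then show ?case using f yf by (simp add: comb_def[of UNIV proj "[]"])
  next
    case (Cons a xs)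
    obtain c X where a: "a = (c, X)" by force
    have X: "X \<in> J" and xs: "snd ` set xs \<subseteq> J" using Cons.prems by (auto simp: a)
    have "comb UNIV proj (a # xs) (comb UNIV proj ys f) =
        (\<lambda>n. c * proj X (comb UNIV proj ys f) n + comb UNIV proj xs (comb UNIV proj ys f) n)"
      unfolding a comb_Cons using yf by simp
    also have "\<dots> = comb UNIV proj (concat (map (\<lambda>(c, X). map (\<lambda>(d, Y). (c * d, X \<inter> Y)) ys) (a # xs))) f"
      unfolding Cons.IH[OF xs, symmetric] using fun_cong[OF proj_comb[OF X ys(1) f, of c]] f
      by (simp add: a comb_append[symmetric])
    finally show ?case by simp
  qed
  finally show ?thesis unfolding Phi_eq'[OF xs0 yf] Phi_eq'[OF ys0 f] by simp
qed

text \<open>The projections are self-adjoint, and for a real function the list with conjugated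
  coefficients represents the same function; it remains to use that the operator does not depend on
  the list.\<close>

lemma Phi_adjoint:
  assumes h: "simple h" and real: "\<And>x. x \<in> P \<Longrightarrow> cnj (h x) = h x" and f: "f \<in> H" and g: "g \<in> H"
  shows "ip (Phi h f) g = ip f (Phi h g)"
proof -
  obtain xs where xs0: "snd ` set xs \<subseteq> J" "\<forall>x\<in>P. h x = simple_val xs x" using h by (auto simp: simple_def)
  note xs = xs0(1) bspec[OF xs0(2)]
  let ?xs' = "map (\<lambda>(c, X). (cnj c, X)) xs"
  have xs'J: "snd ` set ?xs' \<subseteq> J" using xs(1) unfolding snd_map_fst .
  have "simple_val ?xs' x = cnj (simple_val xs x)" for x by (induction xs) auto
  then have xs': "h x = simple_val ?xs' x" if "x \<in> P" for x using xs(2)[OF that] real[OF that] by simp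
  then have xs'': "\<forall>x\<in>P. h x = simple_val ?xs' x" by blast
  have "ip (comb UNIV proj ?xs' f) g = ip f (comb UNIV proj xs g)"
    using xs(1)
  proof (induction xs)
    case Nil
    then show ?case using f g by (simp add: comb_def)
  next
    case (Cons a xs)
    obtain c X where a: "a = (c, X)" by force
    have X: "X \<in> J" and xs: "snd ` set xs \<subseteq> J" using Cons.prems by (auto simp: a)
    have xs': "snd ` set (map (\<lambda>(c, X). (cnj c, X)) xs) \<subseteq> J" using xs unfolding snd_map_fst .
    note b = proj_bounded[OF X]
    note i1 = bounded_ops_in[OF b g] bounded_ops_in[OF comb_proj_bounded[OF xs] g]
    note i2 = bounded_ops_in[OF b f] bounded_ops_in[OF comb_proj_bounded[OF xs'] f]
    have "comb UNIV proj (a # xs) g = (\<lambda>n. c * proj X g n + comb UNIV proj xs g n)"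
      using g by (simp add: comb_def a)
    then have 1: "ip f (comb UNIV proj (a # xs) g) = c * ip f (proj X g) + ip f (comb UNIV proj xs g)"
      using inner_add_right[OF f ell2_scale(1)[OF i1(1)] i1(2), of c] by (simp add: inner_scale_right)
    have "comb UNIV proj (map (\<lambda>(c, X). (cnj c, X)) (a # xs)) f =
        (\<lambda>n. cnj c * proj X f n + comb UNIV proj (map (\<lambda>(c, X). (cnj c, X)) xs) f n)"
      using f by (simp add: comb_def a)
    then have 2: "ip (comb UNIV proj (map (\<lambda>(c, X). (cnj c, X)) (a # xs)) f) g =
        c * ip (proj X f) g + ip (comb UNIV proj (map (\<lambda>(c, X). (cnj c, X)) xs) f) g"
      using inner_add_left[OF g ell2_scale(1)[OF i2(1)] i2(2), of "cnj c"] by (simp add: inner_scale_left)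
    show ?case unfolding 1 2 Cons.IH[OF xs] using proj_adjoint[OF X f g] by simp
  qed
  then show ?thesis unfolding Phi_eq'[OF xs0 g] Phi_eq'[OF xs'J xs'' f] .
qed

lemma simple_val_pullback:
  assumes s: "s \<in> S"
  shows "simple_val (map (\<lambda>(c, X). (c, s\<inverse> `` X)) xs) x = shift (s\<inverse>) (simple_val xs) x"
proof (cases "x \<in> Domain s")
  case True
  then obtain y where y: "(x, y) \<in> s" by blast
  have "x \<in> s\<inverse> `` X \<longleftrightarrow> y \<in> X" for X
    using y partial_bijD(3)[OF hull_partial_bij[OF s]] by blast
  then have "simple_val (map (\<lambda>(c, X). (c, s\<inverse> `` X)) xs) x = simple_val xs y"
    by (induction xs) auto
  then show ?thesis
    using shift_at[OF partial_bij_converse[OF hull_partial_bij[OF s]], of y x "simple_val xs"] y by simp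
next
  case False
  then have "x \<notin> s\<inverse> `` X" for X by auto
  then have "simple_val (map (\<lambda>(c, X). (c, s\<inverse> `` X)) xs) x = 0"
    by (induction xs) auto
  then show ?thesis using False by (simp add: shift_off)
qed

text \<open>The function \<open>shift (s\<inverse>) h\<close> is h after \<open>s\<close> on the
  domain of \<open>s\<close> and 0 elsewhere. The covariance of the ideal projections extends to it
  by linearity.\<close>

lemma Phi_rho:
  assumes h: "simple h" and s: "s \<in> S" and f: "f \<in> H"
  shows "simple (shift (s\<inverse>) h)" "Phi h (\<rho> s f) = \<rho> s (Phi (shift (s\<inverse>) h) f)"
proof -
  obtain xs where xs0: "snd ` set xs \<subseteq> J" "\<forall>x\<in>P. h x = simple_val xs x" using h by (auto simp: simple_def)
  note xs = xs0(1) bspec[OF xs0(2)]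
  let ?xs = "map (\<lambda>(c, X). (c, s\<inverse> `` X)) xs"
  have J: "snd ` set ?xs \<subseteq> J"
  proof
    fix u assume "u \<in> snd ` set ?xs"
    then obtain c X where "(c, X) \<in> set xs" "u = s\<inverse> `` X" by auto
    then show "u \<in> J" using xs(1) hull_image_J[OF hull_converse[OF s]] by force
  qed
  have val: "shift (s\<inverse>) h x = simple_val ?xs x" for x
  proof (cases "x \<in> Domain s")
    case True
    then obtain y where y: "(x, y) \<in> s" by blast
    note p = partial_bij_converse[OF hull_partial_bij[OF s]]
    have "h y = simple_val xs y" using hull_carrier[OF s y] xs(2) by blast
    then show ?thesis unfolding simple_val_pullback[OF s] using shift_at[OF p, of y x] y by simp
  next
    case False
    then show ?thesis unfolding simple_val_pullback[OF s] by (simp add: shift_off)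
  qed
  show "simple (shift (s\<inverse>) h)" by (rule simpleI[OF J val])
  have "comb UNIV proj xs (\<rho> s f) = \<rho> s (comb UNIV proj ?xs f)"
    using xs(1)
  proof (induction xs)
    case Nil
    then show ?case using rho_H[OF s f] f bounded_ops_zero[OF rho_bounded[OF s]] by (simp add: comb_def)
  next
    case (Cons a xs)
    obtain c X where a: "a = (c, X)" by force
    have X: "X \<in> J" and xs: "snd ` set xs \<subseteq> J" using Cons.prems by (auto simp: a)
    have Y: "s\<inverse> `` X \<in> J" by (rule hull_image_J[OF hull_converse[OF s] X])
    let ?m = "map (\<lambda>(c, X). (c, s\<inverse> `` X)) xs"
    have m: "snd ` set ?m \<subseteq> J"
    proof
      fix u assume "u \<in> snd ` set ?m"
      then obtain c X where "(c, X) \<in> set xs" "u = s\<inverse> `` X" by auto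
      then show "u \<in> J" using xs hull_image_J[OF hull_converse[OF s]] by force
    qed
    note i = bounded_ops_in[OF proj_bounded[OF Y] f] bounded_ops_in[OF comb_proj_bounded[OF m] f]
    have "comb UNIV proj (a # xs) (\<rho> s f) = (\<lambda>n. c * proj X (\<rho> s f) n + comb UNIV proj xs (\<rho> s f) n)"
      using rho_H[OF s f] by (simp add: comb_def a)
    also have "\<dots> = (\<lambda>n. c * \<rho> s (proj (s\<inverse> `` X) f) n + \<rho> s (comb UNIV proj ?m f) n)"
      unfolding proj_rho[OF X s f] Cons.IH[OF xs] ..
    also have "\<dots> = \<rho> s (\<lambda>n. c * proj (s\<inverse> `` X) f n + comb UNIV proj ?m f n)"
      using bounded_ops_add[OF rho_bounded[OF s] ell2_scale(1)[OF i(1)] i(2), of c]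
        bounded_ops_scale[OF rho_bounded[OF s] i(1), of c] by simp
    also have "(\<lambda>n. c * proj (s\<inverse> `` X) f n + comb UNIV proj ?m f n) = comb UNIV proj (map (\<lambda>(c, X). (c, s\<inverse> `` X)) (a # xs)) f"
      using f by (simp add: comb_def a)
    finally show ?case .
  qed
  then show "Phi h (\<rho> s f) = \<rho> s (Phi (shift (s\<inverse>) h) f)"
    unfolding Phi_eq'[OF xs0 rho_H[OF s f]] Phi_eq'[OF J ballI[OF val] f] .
qed

lemma Phi_norm_sq:
  assumes h: "simple h" and real: "\<And>x. x \<in> P \<Longrightarrow> cnj (h x) = h x" and f: "f \<in> H"
  shows "complex_of_real ((nrm (Phi h f))\<^sup>2) = ip (Phi (\<lambda>x. h x * h x) f) f"
  using inner_self[OF Phi_H[OF h f]] Phi_adjoint[OF h real Phi_H[OF h f] f] Phi_mult[OF h h f] by simp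

lemma top_J: "P \<in> J" by (rule constructible_ideals.top)

text \<open>The difference k - h is the square of a real simple function on \<open>P\<close>, so its
  operator has the form A* A and is positive.\<close>

lemma Phi_mono:
  assumes h: "simple (\<lambda>x. complex_of_real (h x))" and k: "simple (\<lambda>x. complex_of_real (k x))"
    and le: "\<And>x. x \<in> P \<Longrightarrow> h x \<le> k x" and f: "f \<in> H"
  shows "Re (ip (Phi (\<lambda>x. complex_of_real (h x)) f) f) \<le> Re (ip (Phi (\<lambda>x. complex_of_real (k x)) f) f)"
proof -
  have d: "simple (\<lambda>x. complex_of_real (k x) + (- 1) * complex_of_real (h x))"
    by (intro simple_add simple_scale h k)
  let ?r = "\<lambda>x. complex_of_real (sqrt (k x - h x))"
  have r: "simple ?r"
    using simple_comp[OF d, of "\<lambda>z. complex_of_real (sqrt (Re z))"] by simp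
  have sq: "?r x * ?r x = complex_of_real (k x) + (- 1) * complex_of_real (h x)" if "x \<in> P" for x
    using le[OF that] by (simp flip: of_real_mult of_real_diff)
  have "complex_of_real ((nrm (Phi ?r f))\<^sup>2) = ip (Phi (\<lambda>x. complex_of_real (k x) + (- 1) * complex_of_real (h x)) f) f"
    using Phi_norm_sq[OF r _ f] Phi_cong[OF simple_mult[OF r r] sq f] by simp
  also have "\<dots> = ip (Phi (\<lambda>x. complex_of_real (k x)) f) f + (- 1) * ip (Phi (\<lambda>x. complex_of_real (h x)) f) f"
    unfolding Phi_add[OF k simple_scale[OF h] f] Phi_scale[OF h f]
    using inner_add_left[OF f Phi_H[OF k f] ell2_scale(1)[OF Phi_H[OF h f]], of "- 1"]
      inner_scale_left[of UNIV "- 1" "Phi (\<lambda>x. complex_of_real (h x)) f" f] by simp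
  finally have "Re (complex_of_real ((nrm (Phi ?r f))\<^sup>2)) =
      Re (ip (Phi (\<lambda>x. complex_of_real (k x)) f) f) - Re (ip (Phi (\<lambda>x. complex_of_real (h x)) f) f)" by simp
  then have "(nrm (Phi ?r f))\<^sup>2 = Re (ip (Phi (\<lambda>x. complex_of_real (k x)) f) f) - Re (ip (Phi (\<lambda>x. complex_of_real (h x)) f) f)"
    by (simp only: Re_complex_of_real)
  then show ?thesis by (smt (verit) zero_le_power2)
qed

end

lemma ell2_norm_sum_sq:
  assumes "\<And>i. i \<in> M \<Longrightarrow> f i \<in> ell2 X"
  shows "complex_of_real ((ell2_norm X (\<lambda>n. \<Sum>i\<in>M. f i n))\<^sup>2) = (\<Sum>i\<in>M. \<Sum>j\<in>M. ell2_inner X (f i) (f j))"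
proof -
  have s: "(\<lambda>n. \<Sum>i\<in>M. f i n) \<in> ell2 X" by (rule ell2_sum(1)[OF assms])
  have "complex_of_real ((ell2_norm X (\<lambda>n. \<Sum>i\<in>M. f i n))\<^sup>2) = (\<Sum>i\<in>M. ell2_inner X (f i) (\<lambda>n. \<Sum>i\<in>M. f i n))"
    unfolding inner_self[OF s, symmetric] by (rule inner_sum_left[OF s assms])
  also have "\<dots> = (\<Sum>i\<in>M. \<Sum>j\<in>M. ell2_inner X (f i) (f j))"
    by (rule sum.cong[OF refl]) (rule inner_sum_right[OF assms assms])
  finally show ?thesis .
qed

section \<open>Atoms of finite families of ideals\<close>

context countable_subsemigroup begin

text \<open>A point of the atom of \<open>x\<close>. The choice depends only on the set of
  candidates, so it is the same for all points of an atom, and atoms can be indexed by points of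
  \<open>P\<close>.\<close>

definition atom_rep :: "'a set set \<Rightarrow> 'a \<Rightarrow> 'a" where
  "atom_rep F x = (SOME y. y \<in> P \<and> (\<forall>X\<in>F. y \<in> X \<longleftrightarrow> x \<in> X))"

lemma atom_rep:
  assumes "x \<in> P"
  shows "atom_rep F x \<in> P" "X \<in> F \<Longrightarrow> atom_rep F x \<in> X \<longleftrightarrow> x \<in> X"
proof -
  have "\<exists>y. y \<in> P \<and> (\<forall>X\<in>F. y \<in> X \<longleftrightarrow> x \<in> X)" using assms by (intro exI[of _ x]) simp
  from someI_ex[OF this] show "atom_rep F x \<in> P" "X \<in> F \<Longrightarrow> atom_rep F x \<in> X \<longleftrightarrow> x \<in> X"
    unfolding atom_rep_def[symmetric] by blast+
qed

lemma atom_rep_eq: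
  assumes "\<And>X. X \<in> F \<Longrightarrow> x \<in> X \<longleftrightarrow> y \<in> X" shows "atom_rep F x = atom_rep F y"
proof -
  have "(\<lambda>z. z \<in> P \<and> (\<forall>X\<in>F. z \<in> X \<longleftrightarrow> x \<in> X)) = (\<lambda>z. z \<in> P \<and> (\<forall>X\<in>F. z \<in> X \<longleftrightarrow> y \<in> X))"
    using assms by auto
  then show ?thesis by (simp add: atom_rep_def)
qed

lemma measurable_atom_rep: "measurable_wrt F (\<lambda>x. f (atom_rep F x))"
  unfolding measurable_wrt_def using atom_rep_eq by metis

definition atoms :: "'a set set \<Rightarrow> 'a set" where "atoms F = atom_rep F ` P"

text \<open>The chosen point is a function of the set of members of \<open>F\<close> containing
  \<open>x\<close>, and \<open>F\<close> has only finitely many subsets.\<close>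

lemma finite_atoms:
  assumes "finite F" shows "finite (atoms F)"
proof -
  define pat where "pat x = {X \<in> F. x \<in> X}" for x
  define g where "g U = (SOME y. y \<in> P \<and> (\<forall>X\<in>F. y \<in> X \<longleftrightarrow> X \<in> U))" for U
  have g: "atom_rep F x = g (pat x)" for x
  proof -
    have "(\<forall>X\<in>F. y \<in> X \<longleftrightarrow> x \<in> X) \<longleftrightarrow> (\<forall>X\<in>F. y \<in> X \<longleftrightarrow> X \<in> pat x)" for y
      by (rule ball_cong) (simp_all add: pat_def)
    then show ?thesis by (simp only: atom_rep_def g_def)
  qed
  have "atoms F \<subseteq> g ` Pow F" by (auto simp: atoms_def g pat_def)
  then show ?thesis using finite_subset assms by blast
qed

lemma atoms_P: "w \<in> atoms F \<Longrightarrow> w \<in> P"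
  by (auto simp: atoms_def atom_rep(1))

end

context independent_rep begin

text \<open>The projection that the functional calculus assigns to the atom represented by
  \<open>w\<close>; an atom is usually not an ideal.\<close>

definition Q :: "'a set set \<Rightarrow> 'a \<Rightarrow> nat ell2_op" where
  "Q F w = Phi (\<lambda>x. if atom_rep F x = w then 1 else 0)"

lemma atom_simple: "finite F \<Longrightarrow> F \<subseteq> J \<Longrightarrow> simple (\<lambda>x. if atom_rep F x = w then 1 else 0)"
  by (rule measurable_simple) (auto intro: measurable_atom_rep[of F "\<lambda>y. if y = w then 1 else 0"])

lemma Q_H: "finite F \<Longrightarrow> F \<subseteq> J \<Longrightarrow> f \<in> H \<Longrightarrow> Q F w f \<in> H"
  unfolding Q_def by (rule Phi_H[OF atom_simple])

lemma Q_scale: "finite F \<Longrightarrow> F \<subseteq> J \<Longrightarrow> f \<in> H \<Longrightarrow> Q F w (\<lambda>n. c * f n) = (\<lambda>n. c * Q F w f n)"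
  unfolding Q_def by (rule bounded_ops_scale[OF Phi_bounded[OF atom_simple]])

lemma inner_Q:
  assumes F: "finite F" "F \<subseteq> J" and f: "f \<in> H" and g: "g \<in> H"
  shows "ip (Q F w f) (Q F w g) = ip (Q F w f) g"
proof -
  let ?h = "\<lambda>x. if atom_rep F x = w then 1 else (0::complex)"
  have s: "simple ?h" by (rule atom_simple[OF F])
  have "ip (Q F w f) (Q F w g) = ip (Phi ?h (Phi ?h f)) g"
    unfolding Q_def using Phi_adjoint[OF s _ Phi_H[OF s f] g] by simp
  also have "Phi ?h (Phi ?h f) = Phi (\<lambda>x. ?h x * ?h x) f" by (rule Phi_mult[OF s s f, symmetric])
  also have "(\<lambda>x. ?h x * ?h x) = ?h" by auto
  finally show ?thesis by (simp add: Q_def)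
qed

text \<open>On \<open>P\<close> the indicator of \<open>X\<close> is the sum of the indicators of
  the atoms whose representative lies in \<open>X\<close>, and the atom projections are self-adjoint
  idempotents.\<close>

lemma inner_proj_atoms:
  assumes F: "finite F" "F \<subseteq> J" and f: "f \<in> H" and g: "g \<in> H" and X: "X \<in> J" "measurable_wrt F (\<lambda>x. x \<in> X)"
  shows "ip (proj X f) g = (\<Sum>w\<in>atoms F. if w \<in> X then ip (Q F w f) (Q F w g) else 0)"
proof -
  define a where "a w = (\<lambda>x. if atom_rep F x = w then 1 else (0::complex))" for w
  define b where "b w = (\<lambda>x. (if w \<in> X then 1 else 0) * a w x)" for w
  have a: "simple (a w)" for w unfolding a_def by (rule atom_simple[OF F])
  have b: "simple (b w)" for w unfolding b_def by (rule simple_scale[OF a])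
  have eq: "(\<Sum>w\<in>atoms F. b w x) = (if x \<in> X then 1 else 0)" if x: "x \<in> P" for x
  proof -
    have "atom_rep F x \<in> X \<longleftrightarrow> x \<in> X"
      using measurable_wrtD[OF X(2) atom_rep(1)[OF x] x] atom_rep(2)[OF x] by blast
    moreover have "atom_rep F x \<in> atoms F" using x by (simp add: atoms_def)
    moreover have "(\<Sum>w\<in>atoms F. b w x) = (\<Sum>w\<in>atoms F. if atom_rep F x = w then (if w \<in> X then 1 else 0) else 0)"
      by (intro sum.cong) (auto simp: a_def b_def)
    ultimately show ?thesis using finite_atoms[OF F(1)] by (simp add: sum.delta')
  qed
  have "proj X f = Phi (\<lambda>x. \<Sum>w\<in>atoms F. b w x) f"
    using Phi_cong[OF simple_sum[OF b] eq f] Phi_indicator[OF X(1) f] by simp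
  also have "\<dots> = (\<lambda>n. \<Sum>w\<in>atoms F. Phi (b w) f n)" by (rule Phi_sum[OF b f])
  finally have "ip (proj X f) g = (\<Sum>w\<in>atoms F. ip (Phi (b w) f) g)"
    using inner_sum_left[OF g Phi_H[OF b f]] by simp
  also have "\<dots> = (\<Sum>w\<in>atoms F. if w \<in> X then ip (Q F w f) (Q F w g) else 0)"
  proof (rule sum.cong[OF refl])
    fix w
    have "Phi (b w) f = (\<lambda>n. (if w \<in> X then 1 else 0) * Q F w f n)"
      using Phi_scale[OF a f, of "if w \<in> X then 1 else 0" w] by (simp add: b_def Q_def a_def)
    then show "ip (Phi (b w) f) g = (if w \<in> X then ip (Q F w f) (Q F w g) else 0)"
      using inner_Q[OF F f g] by simp
  qed
  finally show ?thesis .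
qed

text \<open>Because the labels agree, each \<open>(t m')\<inverse> (t m)\<close> is idempotent, so all cross terms are seen by the atoms.\<close>

lemma norm_sum_common_label:
  assumes F: "finite F" "F \<subseteq> J" and M: "finite M"
    and t: "\<And>m. m \<in> M \<Longrightarrow> t m \<in> S" "\<And>m. m \<in> M \<Longrightarrow> has_label g (t m)" "\<And>m. m \<in> M \<Longrightarrow> Domain (t m) \<in> F"
    and z: "\<And>m. m \<in> M \<Longrightarrow> z m \<in> H"
  shows "(nrm (\<lambda>n. \<Sum>m\<in>M. \<rho> (t m) (z m) n))\<^sup>2 =
    (\<Sum>w\<in>atoms F. (nrm (\<lambda>n. \<Sum>m\<in>{m \<in> M. w \<in> Domain (t m)}. Q F w (z m) n))\<^sup>2)"
proof -
  have rz: "\<rho> (t m) (z m) \<in> H" if "m \<in> M" for m using rho_H[OF t(1)[OF that] z[OF that]] .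
  have qz: "Q F w (z m) \<in> H" if "m \<in> M" for m w using Q_H[OF F z[OF that]] .
  have pair: "ip (\<rho> (t m) (z m)) (\<rho> (t m') (z m')) =
      (\<Sum>w\<in>atoms F. if w \<in> Domain (t m) \<and> w \<in> Domain (t m') then ip (Q F w (z m)) (Q F w (z m')) else 0)"
    if m: "m \<in> M" and m': "m' \<in> M" for m m'
  proof -
    let ?D = "Domain (t m) \<inter> Domain (t m')"
    have D: "?D \<in> J" using Int_J hull_Domain_J t(1) m m' by blast
    have "t m O (t m')\<inverse> = Id_on ?D"
    proof (rule equalityI; rule subrelI)
      fix x y assume "(x, y) \<in> t m O (t m')\<inverse>"
      then obtain u where u: "(x, u) \<in> t m" "(y, u) \<in> t m'" by auto
      then have "u = g \<otimes> x" "u = g \<otimes> y" "g \<in> carrier G" using t(2)[OF m] t(2)[OF m'] by (auto simp: has_label_def)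
      moreover have "x \<in> carrier G" "y \<in> carrier G"
        using hull_carrier[OF t(1)[OF m] u(1)] hull_carrier[OF t(1)[OF m'] u(2)] P_carrier by auto
      ultimately have "x = y" by simp
      then show "(x, y) \<in> Id_on ?D" using u by (auto simp: Id_on_iff)
    next
      fix x y assume "(x, y) \<in> Id_on ?D"
      then have "x = y" "x \<in> Domain (t m)" "x \<in> Domain (t m')" by (auto simp: Id_on_iff)
      then obtain u u' where u: "(x, u) \<in> t m" "(x, u') \<in> t m'" by blast
      then have "u = g \<otimes> x" "u' = g \<otimes> x" using t(2)[OF m] t(2)[OF m'] by (auto simp: has_label_def)
      then show "(x, y) \<in> t m O (t m')\<inverse>" using u \<open>x = y\<close> by (intro relcompI[of x u]) auto
    qed
    then have "\<rho> ((t m')\<inverse>) (\<rho> (t m) (z m)) = proj ?D (z m)"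
      using rho_relcomp[OF hull_converse[OF t(1)[OF m']] t(1)[OF m] z[OF m]] by (simp add: proj_def)
    then have "ip (\<rho> (t m) (z m)) (\<rho> (t m') (z m')) = ip (proj ?D (z m)) (z m')"
      using rho_adjoint[OF t(1)[OF m'] rz[OF m] z[OF m']] by simp
    also have "\<dots> = (\<Sum>w\<in>atoms F. if w \<in> ?D then ip (Q F w (z m)) (Q F w (z m')) else 0)"
    proof (rule inner_proj_atoms[OF F z[OF m] z[OF m'] D])
      show "measurable_wrt F (\<lambda>x. x \<in> ?D)"
        using t(3)[OF m] t(3)[OF m'] by (auto simp: measurable_wrt_def)
    qed
    finally show ?thesis by simp
  qed
  let ?Mw = "\<lambda>w. {m \<in> M. w \<in> Domain (t m)}"
  have "complex_of_real ((nrm (\<lambda>n. \<Sum>m\<in>M. \<rho> (t m) (z m) n))\<^sup>2) =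
      (\<Sum>m\<in>M. \<Sum>m'\<in>M. ip (\<rho> (t m) (z m)) (\<rho> (t m') (z m')))"
    by (rule ell2_norm_sum_sq[OF rz])
  also have "\<dots> = (\<Sum>m\<in>M. \<Sum>m'\<in>M. \<Sum>w\<in>atoms F. if w \<in> Domain (t m) \<and> w \<in> Domain (t m') then ip (Q F w (z m)) (Q F w (z m')) else 0)"
    using pair by simp
  also have "\<dots> = (\<Sum>w\<in>atoms F. \<Sum>m\<in>M. \<Sum>m'\<in>M. if w \<in> Domain (t m) \<and> w \<in> Domain (t m') then ip (Q F w (z m)) (Q F w (z m')) else 0)"
    by (subst sum.swap[of _ "atoms F"]) (simp add: sum.swap[of _ "atoms F"])
  also have "\<dots> = (\<Sum>w\<in>atoms F. complex_of_real ((nrm (\<lambda>n. \<Sum>m\<in>?Mw w. Q F w (z m) n))\<^sup>2))"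
  proof (rule sum.cong[OF refl])
    fix w
    have qz': "Q F w (z m) \<in> H" if "m \<in> ?Mw w" for m using qz that by simp
    have "complex_of_real ((nrm (\<lambda>n. \<Sum>m\<in>?Mw w. Q F w (z m) n))\<^sup>2) =
        (\<Sum>m\<in>?Mw w. \<Sum>m'\<in>?Mw w. ip (Q F w (z m)) (Q F w (z m')))"
      by (rule ell2_norm_sum_sq[OF qz'])
    also have "\<dots> = (\<Sum>m\<in>M. if w \<in> Domain (t m) then (\<Sum>m'\<in>M. if w \<in> Domain (t m') then ip (Q F w (z m)) (Q F w (z m')) else 0) else 0)"
      by (simp only: sum.inter_filter[OF M])
    also have "\<dots> = (\<Sum>m\<in>M. \<Sum>m'\<in>M. if w \<in> Domain (t m) \<and> w \<in> Domain (t m') then ip (Q F w (z m)) (Q F w (z m')) else 0)"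
      by (intro sum.cong) auto
    finally show "(\<Sum>m\<in>M. \<Sum>m'\<in>M. if w \<in> Domain (t m) \<and> w \<in> Domain (t m') then ip (Q F w (z m)) (Q F w (z m')) else 0) =
      complex_of_real ((nrm (\<lambda>n. \<Sum>m\<in>?Mw w. Q F w (z m) n))\<^sup>2)" by simp
  qed
  finally show ?thesis by (simp only: of_real_sum[symmetric] of_real_eq_iff)
qed

section \<open>The regular representation with multiplicity, and Fell absorption\<close>

lemma sum_nrm_sq:
  assumes "finite A" "\<And>i. i \<in> A \<Longrightarrow> f i \<in> H"
  shows "((\<lambda>n. \<Sum>i\<in>A. (cmod (f i n))\<^sup>2) has_sum (\<Sum>i\<in>A. (nrm (f i))\<^sup>2)) UNIV"
  using assms
proof (induction A rule: finite_induct)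
  case (insert i A)
  have "((\<lambda>n. (cmod (f i n))\<^sup>2) has_sum (nrm (f i))\<^sup>2) UNIV"
    using ell2_summable[of "f i" UNIV] insert.prems by (simp add: ell2_norm_sq)
  then show ?case using insert by (simp add: has_sum_add)
qed simp

text \<open>The scalar bound is applied to each coordinate \<open>n\<close> of the vectors
  \<open>v y\<close>, and the squares are summed over \<open>n\<close>: with multiplicity the
  regular representation has the same bound. Finite sets of points suffice, so no tensor product of
  Hilbert spaces has to be formed.\<close>

lemma regular_bound_vector:
  fixes v :: "'a \<Rightarrow> nat \<Rightarrow> complex"
  assumes I: "finite I" and r: "\<And>i. i \<in> I \<Longrightarrow> r i \<in> S"
    and bound: "\<And>f. f \<in> ell2 P \<Longrightarrow> ell2_norm P (\<lambda>y. \<Sum>i\<in>I. c i * shift (r i) f y) \<le> C * ell2_norm P f"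
    and Y: "finite Y" "Y \<subseteq> P" and Y': "finite Y'" "Y' \<subseteq> P" and v: "\<And>y. y \<in> Y \<Longrightarrow> v y \<in> H"
  shows "(\<Sum>y'\<in>Y'. (nrm (\<lambda>n. \<Sum>i\<in>I. c i * (\<Sum>y\<in>{y \<in> Y. (y, y') \<in> r i}. v y n)))\<^sup>2) \<le> C\<^sup>2 * (\<Sum>y\<in>Y. (nrm (v y))\<^sup>2)"
proof -
  define u where "u y' = (\<lambda>n. \<Sum>i\<in>I. c i * (\<Sum>y\<in>{y \<in> Y. (y, y') \<in> r i}. v y n))" for y'
  have u: "u y' \<in> H" for y'
    unfolding u_def by (intro ell2_sum(1) ell2_scale(1)) (use v in simp)
  have hs1: "((\<lambda>n. \<Sum>y'\<in>Y'. (cmod (u y' n))\<^sup>2) has_sum (\<Sum>y'\<in>Y'. (nrm (u y'))\<^sup>2)) UNIV"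
    by (rule sum_nrm_sq[OF Y'(1) u])
  have hs2: "((\<lambda>n. C\<^sup>2 * (\<Sum>y\<in>Y. (cmod (v y n))\<^sup>2)) has_sum C\<^sup>2 * (\<Sum>y\<in>Y. (nrm (v y))\<^sup>2)) UNIV"
    by (rule has_sum_cmult_right[OF sum_nrm_sq[OF Y(1) v]])
  have "(\<Sum>y'\<in>Y'. (cmod (u y' n))\<^sup>2) \<le> C\<^sup>2 * (\<Sum>y\<in>Y. (cmod (v y n))\<^sup>2)" for n
  proof -
    define f where "f y = (if y \<in> Y then v y n else 0)" for y
    have f0: "f y = 0" if "y \<notin> Y" for y using that by (simp add: f_def)
    have f: "f \<in> ell2 P" "ell2_norm P f = L2_set (\<lambda>y. cmod (f y)) Y"
      using ell2_norm_finite_support[where f = f, OF Y f0] by auto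
    \<comment> \<open>By injectivity of \<open>r i\<close> the sum over the preimages of
      \<open>y'\<close> has at most one term.\<close>
    have sh: "shift (r i) f y' = (\<Sum>y\<in>{y \<in> Y. (y, y') \<in> r i}. v y n)" if i: "i \<in> I" for i y'
    proof (cases "y' \<in> Range (r i)")
      case True
      then obtain y where y: "(y, y') \<in> r i" by blast
      note pb = hull_partial_bij[OF r[OF i]]
      have "{z \<in> Y. (z, y') \<in> r i} = (if y \<in> Y then {y} else {})"
        using y partial_bijD(4)[OF pb] by auto
      then show ?thesis using shift_at[OF pb y, of f] by (simp add: f_def)
    next
      case False
      then have e: "{z \<in> Y. (z, y') \<in> r i} = {}" by auto
      show ?thesis unfolding e using shift_off[OF False] by simp
    qed
    define k where "k = (\<lambda>y. \<Sum>i\<in>I. c i * shift (r i) f y)"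
    have k: "k \<in> ell2 P"
      unfolding k_def by (intro ell2_sum(1) ell2_scale(1) shift_ell2(1)[OF hull_partial_bij[OF r] f(1)])
    have ku: "u y' n = k y'" for y' unfolding u_def k_def using sh by simp
    have "(\<Sum>y'\<in>Y'. (cmod (u y' n))\<^sup>2) = (L2_set (\<lambda>y. cmod (k y)) Y')\<^sup>2" by (simp add: L2_set_sq ku)
    also have "\<dots> \<le> (ell2_norm P k)\<^sup>2"
      by (intro power_mono L2_set_le_ell2_norm[OF k Y'] L2_set_nonneg)
    also have "\<dots> \<le> (C * ell2_norm P f)\<^sup>2"
      using bound[OF f(1)] by (intro power_mono) (simp_all add: k_def)
    also have "\<dots> = C\<^sup>2 * (\<Sum>y\<in>Y. (cmod (v y n))\<^sup>2)"
      unfolding power_mult_distrib f(2) L2_set_sq by (simp add: f_def)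
    finally show ?thesis .
  qed
  then have "(\<Sum>y'\<in>Y'. (nrm (u y'))\<^sup>2) \<le> C\<^sup>2 * (\<Sum>y\<in>Y. (nrm (v y))\<^sup>2)"
    by (intro has_sum_mono[OF hs1 hs2])
  then show ?thesis by (simp only: u_def)
qed

text \<open>Up to multiplicity, \<open>\<rho>\<close> tensored with the regular representation of the group is a part of
  the regular representation of the semigroup (Fell absorption); here this is an inequality
  between norms of finitely supported functions from the group to the Hilbert space of \<open>\<rho>\<close>.\<close>

lemma Fell_absorption:
  fixes s :: "'j \<Rightarrow> ('a \<times> 'a) set" and r :: "'i \<Rightarrow> ('a \<times> 'a) set"
  assumes I: "finite I" and r: "\<And>i. i \<in> I \<Longrightarrow> r i \<in> S" "\<And>i. i \<in> I \<Longrightarrow> has_label (l i) (r i)"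
    and JJ: "finite JJ" and s: "\<And>j. j \<in> JJ \<Longrightarrow> s j \<in> S" "\<And>j. j \<in> JJ \<Longrightarrow> has_label (k j) (s j)"
    and bound: "\<And>f. f \<in> ell2 P \<Longrightarrow> ell2_norm P (\<lambda>y. \<Sum>i\<in>I. c i * shift (r i) f y) \<le> C * ell2_norm P f"
    and z: "\<And>j. j \<in> JJ \<Longrightarrow> z j \<in> H" and K: "finite K" "K \<subseteq> carrier G"
  shows "(\<Sum>g\<in>K. (nrm (\<lambda>n. \<Sum>(i, j)\<in>{(i, j) \<in> I \<times> JJ. l i \<otimes> k j = g}. c i * \<rho> (r i) (\<rho> (s j) (z j)) n))\<^sup>2)
    \<le> C\<^sup>2 * (\<Sum>g\<in>k ` JJ. (nrm (\<lambda>n. \<Sum>j\<in>{j \<in> JJ. k j = g}. \<rho> (s j) (z j) n))\<^sup>2)"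
proof -
  define t where "t = (\<lambda>(i, j). s j O r i)"
  \<comment> \<open>Domains of the \<open>s j\<close> and of the composites are both included, so
    that one set of atoms resolves the two sides of the inequality.\<close>
  define F where "F = (\<lambda>j. Domain (s j)) ` JJ \<union> (\<lambda>m. Domain (t m)) ` (I \<times> JJ)"
  have tS: "t (i, j) \<in> S" if "i \<in> I" "j \<in> JJ" for i j
    unfolding t_def using hull_product[OF r(1)[OF that(1)] s(1)[OF that(2)]] by simp
  have F: "finite F" "F \<subseteq> J"
    using I JJ hull_Domain_J s(1) tS by (auto simp: F_def)
  have lab: "l i \<in> carrier G" if "i \<in> I" for i using r(2)[OF that] by (simp add: has_label_def)
  have lab': "k j \<in> carrier G" if "j \<in> JJ" for j using s(2)[OF that] by (simp add: has_label_def)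
  have tlab: "has_label (l i \<otimes> k j) (t (i, j))" if ij: "i \<in> I" "j \<in> JJ" for i j
    unfolding has_label_def
  proof (intro conjI allI impI)
    show "l i \<otimes> k j \<in> carrier G" using lab lab' ij by simp
    fix x y assume "(x, y) \<in> t (i, j)"
    then obtain u where u: "(x, u) \<in> s j" "(u, y) \<in> r i" by (auto simp: t_def)
    then show "y = l i \<otimes> k j \<otimes> x"
      using r(2)[OF ij(1)] s(2)[OF ij(2)] hull_carrier[OF s(1)[OF ij(2)] u(1)] P_carrier
      by (auto simp: has_label_def m_assoc)
  qed
  define M where "M g = {(i, j) \<in> I \<times> JJ. l i \<otimes> k j = g}" for g
  have M: "finite (M g)" for g by (rule finite_subset[of _ "I \<times> JJ"]) (use I JJ in \<open>auto simp: M_def\<close>)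
  define q where "q w j = Q F w (z j)" for w j
  have q: "q w j \<in> H" if "j \<in> JJ" for w j unfolding q_def by (rule Q_H[OF F z[OF that]])
  have L: "(nrm (\<lambda>n. \<Sum>(i, j)\<in>M g. c i * \<rho> (r i) (\<rho> (s j) (z j)) n))\<^sup>2 =
      (\<Sum>w\<in>atoms F. (nrm (\<lambda>n. \<Sum>(i, j)\<in>{m \<in> M g. w \<in> Domain (t m)}. c i * q w j n))\<^sup>2)" for g
  proof -
    have "c i * \<rho> (r i) (\<rho> (s j) (z j)) n = \<rho> (t (i, j)) (\<lambda>n. c i * z j n) n" if "(i, j) \<in> M g" for i j n
    proof -
      have ij: "i \<in> I" "j \<in> JJ" using that by (auto simp: M_def)
      show ?thesis
        using rho_relcomp[OF r(1)[OF ij(1)] s(1)[OF ij(2)] z[OF ij(2)]]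
          bounded_ops_scale[OF rho_bounded[OF tS[OF ij]] z[OF ij(2)], of "c i"] by (simp add: t_def)
    qed
    then have "(nrm (\<lambda>n. \<Sum>(i, j)\<in>M g. c i * \<rho> (r i) (\<rho> (s j) (z j)) n))\<^sup>2 =
        (nrm (\<lambda>n. \<Sum>m\<in>M g. \<rho> (t m) (case m of (i, j) \<Rightarrow> \<lambda>n. c i * z j n) n))\<^sup>2"
      by (intro arg_cong[where f = "\<lambda>f. (nrm f)\<^sup>2"] ext sum.cong) auto
    also have "\<dots> = (\<Sum>w\<in>atoms F. (nrm (\<lambda>n. \<Sum>m\<in>{m \<in> M g. w \<in> Domain (t m)}. Q F w (case m of (i, j) \<Rightarrow> \<lambda>n. c i * z j n) n))\<^sup>2)"
    proof (rule norm_sum_common_label[OF F M])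
      fix m assume "m \<in> M g"
      then obtain i j where ij: "m = (i, j)" "i \<in> I" "j \<in> JJ" "l i \<otimes> k j = g" by (auto simp: M_def)
      show "t m \<in> S" "has_label g (t m)" using tS[OF ij(2,3)] tlab[OF ij(2,3)] ij(1,4) by simp_all
      show "Domain (t m) \<in> F" unfolding F_def using ij by (intro UnI2 imageI) simp
      show "(case m of (i, j) \<Rightarrow> \<lambda>n. c i * z j n) \<in> H" using ij ell2_scale(1)[OF z] by simp
    qed
    also have "\<dots> = (\<Sum>w\<in>atoms F. (nrm (\<lambda>n. \<Sum>(i, j)\<in>{m \<in> M g. w \<in> Domain (t m)}. c i * q w j n))\<^sup>2)"
      using Q_scale[OF F z]
      by (intro sum.cong refl arg_cong[where f = "\<lambda>f. (nrm f)\<^sup>2"] ext) (auto simp: M_def q_def)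
    finally show ?thesis .
  qed
  have R: "(nrm (\<lambda>n. \<Sum>j\<in>{j \<in> JJ. k j = g}. \<rho> (s j) (z j) n))\<^sup>2 =
      (\<Sum>w\<in>atoms F. (nrm (\<lambda>n. \<Sum>j\<in>{j \<in> {j \<in> JJ. k j = g}. w \<in> Domain (s j)}. q w j n))\<^sup>2)" for g
    unfolding q_def
  proof (rule norm_sum_common_label[where g = g, OF F])
    show "finite {j \<in> JJ. k j = g}" using JJ by simp
  qed (use s z in \<open>auto simp: F_def\<close>)
  \<comment> \<open>The representative \<open>w\<close> turns group coordinates into points: g
    becomes g w, and \<open>r i\<close> moves the point with coordinate \<open>k j\<close> to the
    one with coordinate l_i k_j. For a fixed atom the inequality is thus the bound for the regular
    representation.\<close>
  have per_atom: "(\<Sum>g\<in>K. (nrm (\<lambda>n. \<Sum>(i, j)\<in>{m \<in> M g. w \<in> Domain (t m)}. c i * q w j n))\<^sup>2) \<le>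
      C\<^sup>2 * (\<Sum>g\<in>k ` JJ. (nrm (\<lambda>n. \<Sum>j\<in>{j \<in> {j \<in> JJ. k j = g}. w \<in> Domain (s j)}. q w j n))\<^sup>2)"
    if w: "w \<in> P" for w
  proof -
    have wc: "w \<in> carrier G" by (rule P_carrier[OF w])
    define v where "v y = (\<lambda>n. \<Sum>j\<in>{j \<in> JJ. (w, y) \<in> s j}. q w j n)" for y
    have vH: "v y \<in> H" for y unfolding v_def by (rule ell2_sum(1)) (use q in simp)
    \<comment> \<open>Coordinates that move \<open>w\<close> out of \<open>P\<close> carry no
      vector; they are removed so that \<open>Y\<close> and \<open>Y'\<close> consist of points of
      \<open>P\<close>.\<close>
    define A where "A = {g \<in> k ` JJ. g \<otimes> w \<in> P}"
    define B where "B = {g \<in> K. g \<otimes> w \<in> P}"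
    have Ac: "A \<subseteq> carrier G" "finite A" using lab' JJ by (auto simp: A_def)
    have Bc: "B \<subseteq> carrier G" "finite B" using K by (auto simp: B_def)
    have injc: "inj_on (\<lambda>g. g \<otimes> w) X" if "X \<subseteq> carrier G" for X
    proof (rule inj_onI)
      fix g h assume gh: "g \<in> X" "h \<in> X" "g \<otimes> w = h \<otimes> w"
      have "g \<in> carrier G" "h \<in> carrier G" using subsetD[OF that gh(1)] subsetD[OF that gh(2)] by auto
      then show "g = h" using gh(3) wc by simp
    qed
    define Y where "Y = (\<lambda>g. g \<otimes> w) ` A"
    define Y' where "Y' = (\<lambda>g. g \<otimes> w) ` B"
    have Y: "finite Y" "Y \<subseteq> P" "finite Y'" "Y' \<subseteq> P"
      using Ac(2) Bc(2) by (auto simp: Y_def Y'_def A_def B_def)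
    have in_Y: "y \<in> Y" if "j \<in> JJ" "(w, y) \<in> s j" for j y
    proof -
      have "y = k j \<otimes> w" using s(2)[OF that(1)] that(2) by (simp add: has_label_def)
      moreover have "y \<in> P" using hull_carrier[OF s(1)[OF that(1)] that(2)] by simp
      ultimately show ?thesis using that(1) by (auto simp: Y_def A_def)
    qed
    have sj: "(w, g \<otimes> w) \<in> s j \<longleftrightarrow> k j = g \<and> w \<in> Domain (s j)" if j: "j \<in> JJ" and g: "g \<in> carrier G" for j g
    proof
      assume a: "(w, g \<otimes> w) \<in> s j"
      then have "g \<otimes> w = k j \<otimes> w" using s(2)[OF j] by (simp add: has_label_def)
      then show "k j = g \<and> w \<in> Domain (s j)" using a g lab'[OF j] wc by auto
    next
      assume "k j = g \<and> w \<in> Domain (s j)"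
      then show "(w, g \<otimes> w) \<in> s j" using s(2)[OF j] by (auto simp: has_label_def)
    qed
    have tij: "(w, g \<otimes> w) \<in> t (i, j) \<longleftrightarrow> l i \<otimes> k j = g \<and> w \<in> Domain (t (i, j))"
      if i: "i \<in> I" and j: "j \<in> JJ" and g: "g \<in> carrier G" for i j g
    proof
      assume a: "(w, g \<otimes> w) \<in> t (i, j)"
      then have "g \<otimes> w = l i \<otimes> k j \<otimes> w" using tlab[OF i j] by (simp add: has_label_def)
      moreover have "l i \<otimes> k j \<in> carrier G" using lab[OF i] lab'[OF j] by simp
      ultimately have "g = l i \<otimes> k j" using g wc right_cancel by blast
      then show "l i \<otimes> k j = g \<and> w \<in> Domain (t (i, j))" using a by blast
    next
      assume "l i \<otimes> k j = g \<and> w \<in> Domain (t (i, j))"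
      then show "(w, g \<otimes> w) \<in> t (i, j)" using tlab[OF i j] by (auto simp: has_label_def)
    qed
    define D where "D y' = (nrm (\<lambda>n. \<Sum>i\<in>I. c i * (\<Sum>y\<in>{y \<in> Y. (y, y') \<in> r i}. v y n)))\<^sup>2" for y'
    have left: "(nrm (\<lambda>n. \<Sum>(i, j)\<in>{m \<in> M g. w \<in> Domain (t m)}. c i * q w j n))\<^sup>2 = (if g \<in> B then D (g \<otimes> w) else 0)"
      if g: "g \<in> K" for g
    proof -
      have gc: "g \<in> carrier G" using subsetD[OF K(2) g] .
      have set_eq: "{m \<in> M g. w \<in> Domain (t m)} = {(i, j) \<in> I \<times> JJ. (w, g \<otimes> w) \<in> t (i, j)}"
        using tij gc by (auto simp: M_def)
      show ?thesis
      proof (cases "g \<in> B")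
        case False
        have "(w, g \<otimes> w) \<notin> t (i, j)" if "i \<in> I" "j \<in> JJ" for i j
          using hull_carrier[OF tS[OF that]] False g by (auto simp: B_def)
        then have "{m \<in> M g. w \<in> Domain (t m)} = {}" unfolding set_eq by auto
        then show ?thesis using False by (simp only: sum.empty) simp
      next
        case True
        have "(\<Sum>(i, j)\<in>{m \<in> M g. w \<in> Domain (t m)}. c i * q w j n) =
            (\<Sum>i\<in>I. c i * (\<Sum>y\<in>{y \<in> Y. (y, g \<otimes> w) \<in> r i}. v y n))" for n
        proof -
          have "(\<Sum>(i, j)\<in>{m \<in> M g. w \<in> Domain (t m)}. c i * q w j n) =
              (\<Sum>m\<in>I \<times> JJ. if (w, g \<otimes> w) \<in> t m then (case m of (i, j) \<Rightarrow> c i * q w j n) else 0)"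
          proof -
            have "{m \<in> M g. w \<in> Domain (t m)} = {m \<in> I \<times> JJ. (w, g \<otimes> w) \<in> t m}" unfolding set_eq by auto
            then show ?thesis using I JJ by (simp add: sum.inter_filter)
          qed
          also have "\<dots> = (\<Sum>i\<in>I. \<Sum>j\<in>JJ. if (w, g \<otimes> w) \<in> t (i, j) then c i * q w j n else 0)"
            unfolding sum.cartesian_product by (intro sum.cong) auto
          also have "\<dots> = (\<Sum>i\<in>I. c i * (\<Sum>y\<in>{y \<in> Y. (y, g \<otimes> w) \<in> r i}. v y n))"
          proof (rule sum.cong[OF refl])
            fix i assume i: "i \<in> I"
            have "(\<Sum>y\<in>{y \<in> Y. (y, g \<otimes> w) \<in> r i}. v y n) =
                (\<Sum>y\<in>{y \<in> Y. (y, g \<otimes> w) \<in> r i}. \<Sum>j\<in>JJ. if (w, y) \<in> s j then q w j n else 0)"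
              unfolding v_def using JJ by (simp add: sum.inter_filter)
            also have "\<dots> = (\<Sum>j\<in>JJ. \<Sum>y\<in>{y \<in> Y. (y, g \<otimes> w) \<in> r i}. if (w, y) \<in> s j then q w j n else 0)"
              by (rule sum.swap)
            also have "\<dots> = (\<Sum>j\<in>JJ. if (w, g \<otimes> w) \<in> t (i, j) then q w j n else 0)"
            proof (rule sum.cong[OF refl])
              fix j assume j: "j \<in> JJ"
              have "(\<Sum>y\<in>{y \<in> Y. (y, g \<otimes> w) \<in> r i}. if (w, y) \<in> s j then q w j n else 0) =
                  (\<Sum>y\<in>{y \<in> {y \<in> Y. (y, g \<otimes> w) \<in> r i}. (w, y) \<in> s j}. q w j n)"
                by (rule sum.inter_filter[symmetric]) (use Y(1) in simp)
              also have "{y \<in> {y \<in> Y. (y, g \<otimes> w) \<in> r i}. (w, y) \<in> s j} =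
                  (if (w, g \<otimes> w) \<in> t (i, j) then {k j \<otimes> w} else {})" (is "?U = _")
              proof (cases "(w, g \<otimes> w) \<in> t (i, j)")
                case True
                then obtain y where y: "(w, y) \<in> s j" "(y, g \<otimes> w) \<in> r i" by (auto simp: t_def)
                have "y' = k j \<otimes> w" if "(w, y') \<in> s j" for y' using s(2)[OF j] that by (simp add: has_label_def)
                then have "?U = {k j \<otimes> w}" using y in_Y[OF j y(1)] by auto
                then show ?thesis using True by simp
              next
                case False
                then have "?U = {}" by (auto simp: t_def)
                then show ?thesis using False by simp
              qed
              finally show "(\<Sum>y\<in>{y \<in> Y. (y, g \<otimes> w) \<in> r i}. if (w, y) \<in> s j then q w j n else 0) =
                (if (w, g \<otimes> w) \<in> t (i, j) then q w j n else 0)" by simp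
            qed
            finally have "c i * (\<Sum>y\<in>{y \<in> Y. (y, g \<otimes> w) \<in> r i}. v y n) =
              (\<Sum>j\<in>JJ. c i * (if (w, g \<otimes> w) \<in> t (i, j) then q w j n else 0))" by (simp only: sum_distrib_left)
            also have "\<dots> = (\<Sum>j\<in>JJ. if (w, g \<otimes> w) \<in> t (i, j) then c i * q w j n else 0)"
              by (intro sum.cong) auto
            finally show "(\<Sum>j\<in>JJ. if (w, g \<otimes> w) \<in> t (i, j) then c i * q w j n else 0) =
              c i * (\<Sum>y\<in>{y \<in> Y. (y, g \<otimes> w) \<in> r i}. v y n)" by simp
          qed
          finally show ?thesis .
        qed
        then show ?thesis using True by (simp only: D_def if_True)
      qed
    qed
    have "(\<Sum>g\<in>K. (nrm (\<lambda>n. \<Sum>(i, j)\<in>{m \<in> M g. w \<in> Domain (t m)}. c i * q w j n))\<^sup>2) = (\<Sum>g\<in>K. if g \<in> B then D (g \<otimes> w) else 0)"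
      using left by (rule sum.cong[OF refl])
    also have "\<dots> = (\<Sum>g\<in>B. D (g \<otimes> w))"
      using K(1) by (intro sum.mono_neutral_cong_right) (auto simp: B_def)
    also have "\<dots> = (\<Sum>y'\<in>Y'. D y')" unfolding Y'_def by (simp add: sum.reindex[OF injc[OF Bc(1)]])
    also have "\<dots> \<le> C\<^sup>2 * (\<Sum>y\<in>Y. (nrm (v y))\<^sup>2)"
      unfolding D_def by (rule regular_bound_vector[OF I r(1) bound Y(1,2,3,4) vH])
    also have "(\<Sum>y\<in>Y. (nrm (v y))\<^sup>2) = (\<Sum>g\<in>A. (nrm (v (g \<otimes> w)))\<^sup>2)"
      unfolding Y_def by (simp add: sum.reindex[OF injc[OF Ac(1)]])
    \<comment> \<open>The coordinates left out of \<open>A\<close> only add nonnegative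
      terms.\<close>
    also have "\<dots> \<le> (\<Sum>g\<in>k ` JJ. (nrm (v (g \<otimes> w)))\<^sup>2)"
      using JJ by (intro sum_mono2) (auto simp: A_def)
    also have "\<dots> = (\<Sum>g\<in>k ` JJ. (nrm (\<lambda>n. \<Sum>j\<in>{j \<in> {j \<in> JJ. k j = g}. w \<in> Domain (s j)}. q w j n))\<^sup>2)"
    proof (rule sum.cong[OF refl])
      fix g assume "g \<in> k ` JJ"
      then have gc: "g \<in> carrier G" using lab' by blast
      have "{j \<in> JJ. (w, g \<otimes> w) \<in> s j} = {j \<in> {j \<in> JJ. k j = g}. w \<in> Domain (s j)}"
        using sj[OF _ gc] by auto
      then show "(nrm (v (g \<otimes> w)))\<^sup>2 = (nrm (\<lambda>n. \<Sum>j\<in>{j \<in> {j \<in> JJ. k j = g}. w \<in> Domain (s j)}. q w j n))\<^sup>2"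
        by (simp only: v_def)
    qed
    finally show ?thesis by (simp add: mult_left_mono)
  qed
  have "(\<Sum>g\<in>K. (nrm (\<lambda>n. \<Sum>(i, j)\<in>M g. c i * \<rho> (r i) (\<rho> (s j) (z j)) n))\<^sup>2) =
      (\<Sum>w\<in>atoms F. \<Sum>g\<in>K. (nrm (\<lambda>n. \<Sum>(i, j)\<in>{m \<in> M g. w \<in> Domain (t m)}. c i * q w j n))\<^sup>2)"
    unfolding L by (rule sum.swap)
  also have "\<dots> \<le> (\<Sum>w\<in>atoms F. C\<^sup>2 * (\<Sum>g\<in>k ` JJ. (nrm (\<lambda>n. \<Sum>j\<in>{j \<in> {j \<in> JJ. k j = g}. w \<in> Domain (s j)}. q w j n))\<^sup>2))"
    by (intro sum_mono per_atom atoms_P)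
  also have "\<dots> = C\<^sup>2 * (\<Sum>g\<in>k ` JJ. (nrm (\<lambda>n. \<Sum>j\<in>{j \<in> JJ. k j = g}. \<rho> (s j) (z j) n))\<^sup>2)"
    unfolding R by (subst sum.swap) (simp only: sum_distrib_left)
  finally show ?thesis by (simp only: M_def)
qed

end

section \<open>The norm estimate from approximately invariant means\<close>

lemma L2_set_sum_le: "L2_set (\<lambda>g. \<Sum>i\<in>I. f i g) K \<le> (\<Sum>i\<in>I. L2_set (f i) K)"
proof (induction I rule: infinite_finite_induct)
  case (insert i I)
  have "L2_set (\<lambda>g. f i g + (\<Sum>i\<in>I. f i g)) K \<le> L2_set (f i) K + L2_set (\<lambda>g. \<Sum>i\<in>I. f i g) K"
    by (rule L2_set_triangle_ineq)
  then show ?case using insert by simp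
qed (simp_all add: L2_set_def)

text \<open>One factor |sqrt a - sqrt b| is enlarged to sqrt a + sqrt b. This passes from almost
  invariance of \<open>F\<close> in the sum norm to almost invariance of its square roots in the
  square norm.\<close>

lemma sqrt_diff_sq_le:
  assumes "0 \<le> a" "0 \<le> b" shows "(sqrt a - sqrt b)\<^sup>2 \<le> \<bar>a - b\<bar>"
proof -
  have "(sqrt a - sqrt b)\<^sup>2 = \<bar>sqrt a - sqrt b\<bar> * \<bar>sqrt a - sqrt b\<bar>" by (simp add: power2_eq_square)
  also have "\<dots> \<le> \<bar>sqrt a - sqrt b\<bar> * \<bar>sqrt a + sqrt b\<bar>"
    using real_sqrt_ge_zero[OF assms(1)] real_sqrt_ge_zero[OF assms(2)] by (intro mult_left_mono) linarith+
  also have "\<dots> = \<bar>(sqrt a - sqrt b) * (sqrt a + sqrt b)\<bar>" by (simp add: abs_mult)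
  also have "(sqrt a - sqrt b) * (sqrt a + sqrt b) = a - b" using assms by (simp add: algebra_simps)
  finally show ?thesis .
qed

context countable_subsemigroup begin

text \<open>The data which amenability provides on the points of \<open>P\<close>: \<open>F g x\<close> stands for the value at the arrow
  with group element \<open>g\<close> and range \<open>x\<close>, and \<open>T\<close> lists the elements of the inverse hull, with their
  labels, under which \<open>F\<close> is almost invariant.\<close>

definition approx_mean ::
    "(('a \<times> 'a) set \<times> 'a) set \<Rightarrow> real \<Rightarrow> 'a set \<Rightarrow> ('a \<times> 'a) set set \<Rightarrow> 'a set set \<Rightarrow> ('a \<Rightarrow> 'a \<Rightarrow> real) \<Rightarrow> bool" where
  "approx_mean T \<epsilon> K \<Sigma> \<F> F \<longleftrightarrow>
     finite K \<and> K \<subseteq> carrier G \<and> finite \<Sigma> \<and> \<Sigma> \<subseteq> S \<and> finite \<F> \<and> \<F> \<subseteq> J \<and>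
     (\<forall>g x. 0 \<le> F g x) \<and> (\<forall>g x. g \<notin> K \<longrightarrow> F g x = 0) \<and> (\<forall>g. measurable_wrt \<F> (F g)) \<and>
     (\<forall>g. \<forall>x\<in>P. F g x \<noteq> 0 \<longrightarrow> (\<exists>s\<in>\<Sigma>. has_label g s \<and> x \<in> Range s)) \<and>
     (\<forall>x\<in>P. \<bar>(\<Sum>g\<in>K. F g x) - 1\<bar> \<le> \<epsilon>) \<and>
     (\<forall>(s, h)\<in>T. \<forall>(x, y)\<in>s. \<forall>K'. finite K' \<longrightarrow> K' \<subseteq> carrier G \<longrightarrow> (\<Sum>g\<in>K'. \<bar>F (h \<otimes> g) y - F g x\<bar>) \<le> \<epsilon>)"

definition has_approx_means :: bool where
  "has_approx_means \<longleftrightarrow> (\<forall>T \<epsilon>. finite T \<longrightarrow> (\<forall>(s, h)\<in>T. s \<in> S \<and> has_label h s) \<longrightarrow> 0 < \<epsilon> \<longrightarrow>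
     (\<exists>K \<Sigma> \<F> F. approx_mean T \<epsilon> K \<Sigma> \<F> F))"

end

section \<open>Almost isometric maps from approximate means\<close>

context independent_rep begin

lemma const_simple: "simple (\<lambda>x. c)"
  by (rule simpleI[of "[(c, P)]"]) (auto simp: top_J)

lemma Phi_const: "f \<in> H \<Longrightarrow> Phi (\<lambda>x. c) f = (\<lambda>n. c * proj P f n)"
  using Phi_eq[of "[(c, P)]" "\<lambda>x. c" f] top_J by (simp add: comb_def)

text \<open>The operator of the constant 1 is \<open>proj P\<close>, a self-adjoint idempotent
  contraction that differs from the identity when \<open>\<rho>\<close> is degenerate.\<close>

lemma proj_P_bound:
  assumes f: "f \<in> H"
  shows "0 \<le> Re (ip (proj P f) f)" "Re (ip (proj P f) f) \<le> (nrm f)\<^sup>2"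
proof -
  have p: "proj P f \<in> H" by (rule bounded_ops_in[OF proj_bounded[OF top_J] f])
  have "ip (proj P f) f = ip (proj P (proj P f)) f" using proj_mult[OF top_J top_J f] by simp
  also have "\<dots> = of_real ((nrm (proj P f))\<^sup>2)" using proj_adjoint[OF top_J p f] inner_self[OF p] by simp
  finally have eq: "Re (ip (proj P f) f) = (nrm (proj P f))\<^sup>2" by simp
  then show "0 \<le> Re (ip (proj P f) f)" by simp
  have "nrm (proj P f) \<le> nrm f"
    unfolding proj_def by (rule rep_contraction[OF rho Id_on_hull[OF top_J] f])
  then show "Re (ip (proj P f) f) \<le> (nrm f)\<^sup>2" unfolding eq by (intro power_mono) auto
qed

text \<open>The squared norm of f \<mapsto> (\<Phi>(w_g) f)_g is governed by the single function
  \<Sum> w_g^2, since \<Phi>(w) is self-adjoint with square \<Phi>(w^2) for real w. Bounds for that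
  function on \<open>P\<close> become bounds for the map.\<close>

lemma sum_Phi_norm_sq:
  assumes w: "\<And>g. g \<in> K \<Longrightarrow> simple (\<lambda>x. complex_of_real (w g x))" and f: "f \<in> H"
  shows "(\<Sum>g\<in>K. (nrm (Phi (\<lambda>x. complex_of_real (w g x)) f))\<^sup>2) =
    Re (ip (Phi (\<lambda>x. complex_of_real (\<Sum>g\<in>K. (w g x)\<^sup>2)) f) f)"
    and "simple (\<lambda>x. complex_of_real (\<Sum>g\<in>K. (w g x)\<^sup>2))"
proof -
  define q where "q g = (\<lambda>x. complex_of_real (w g x) * complex_of_real (w g x))" for g
  have q: "simple (q g)" if "g \<in> K" for g unfolding q_def by (intro simple_mult w that)
  have eq: "(\<lambda>x. complex_of_real (\<Sum>g\<in>K. (w g x)\<^sup>2)) = (\<lambda>x. \<Sum>g\<in>K. q g x)"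
    by (simp add: q_def power2_eq_square)
  show "simple (\<lambda>x. complex_of_real (\<Sum>g\<in>K. (w g x)\<^sup>2))" unfolding eq by (rule simple_sum[OF q])
  have "complex_of_real (\<Sum>g\<in>K. (nrm (Phi (\<lambda>x. complex_of_real (w g x)) f))\<^sup>2) = (\<Sum>g\<in>K. ip (Phi (q g) f) f)"
    unfolding of_real_sum
  proof (rule sum.cong[OF refl])
    fix g assume "g \<in> K"
    from Phi_norm_sq[OF w[OF this] _ f] show "complex_of_real ((nrm (Phi (\<lambda>x. complex_of_real (w g x)) f))\<^sup>2) = ip (Phi (q g) f) f"
      unfolding q_def by simp
  qed
  also have "\<dots> = ip (\<lambda>n. \<Sum>g\<in>K. Phi (q g) f n) f"
    by (rule inner_sum_left[OF f Phi_H[OF q f], symmetric])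
  also have "\<dots> = ip (Phi (\<lambda>x. complex_of_real (\<Sum>g\<in>K. (w g x)\<^sup>2)) f) f"
    unfolding eq by (subst Phi_sum[OF q f]) simp_all
  finally have "Re (complex_of_real (\<Sum>g\<in>K. (nrm (Phi (\<lambda>x. complex_of_real (w g x)) f))\<^sup>2)) =
    Re (ip (Phi (\<lambda>x. complex_of_real (\<Sum>g\<in>K. (w g x)\<^sup>2)) f) f)" by (rule arg_cong)
  then show "(\<Sum>g\<in>K. (nrm (Phi (\<lambda>x. complex_of_real (w g x)) f))\<^sup>2) =
    Re (ip (Phi (\<lambda>x. complex_of_real (\<Sum>g\<in>K. (w g x)\<^sup>2)) f) f)" by (simp only: Re_complex_of_real)
qed

lemma sum_Phi_norm_sq_upper:
  assumes w: "\<And>g. g \<in> K \<Longrightarrow> simple (\<lambda>x. complex_of_real (w g x))" and f: "f \<in> H"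
    and le: "\<And>x. x \<in> P \<Longrightarrow> (\<Sum>g\<in>K. (w g x)\<^sup>2) \<le> c" and c: "0 \<le> c"
  shows "(\<Sum>g\<in>K. (nrm (Phi (\<lambda>x. complex_of_real (w g x)) f))\<^sup>2) \<le> c * (nrm f)\<^sup>2"
proof -
  have "(\<Sum>g\<in>K. (nrm (Phi (\<lambda>x. complex_of_real (w g x)) f))\<^sup>2) \<le> Re (ip (Phi (\<lambda>x. complex_of_real c) f) f)"
  proof -
    have "Re (ip (Phi (\<lambda>x. complex_of_real (\<Sum>g\<in>K. (w g x)\<^sup>2)) f) f) \<le> Re (ip (Phi (\<lambda>x. complex_of_real c) f) f)"
      by (rule Phi_mono[OF _ const_simple le f]) (rule sum_Phi_norm_sq(2)[OF w f])
    then show ?thesis by (subst sum_Phi_norm_sq(1)[OF w f])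
  qed
  also have "\<dots> = c * Re (ip (proj P f) f)" by (simp add: Phi_const[OF f] inner_scale_left)
  also have "\<dots> \<le> c * (nrm f)\<^sup>2" by (intro mult_left_mono proj_P_bound f c)
  finally show ?thesis .
qed

text \<open>The vector is taken in the range of \<open>proj P\<close>, because the functional
  calculus has this projection as its value at the constant 1.\<close>

lemma sum_Phi_norm_sq_lower:
  assumes w: "\<And>g. g \<in> K \<Longrightarrow> simple (\<lambda>x. complex_of_real (w g x))" and f: "f \<in> H" "proj P f = f"
    and le: "\<And>x. x \<in> P \<Longrightarrow> c \<le> (\<Sum>g\<in>K. (w g x)\<^sup>2)"
  shows "c * (nrm f)\<^sup>2 \<le> (\<Sum>g\<in>K. (nrm (Phi (\<lambda>x. complex_of_real (w g x)) f))\<^sup>2)"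
proof -
  have "c * (nrm f)\<^sup>2 = Re (ip (Phi (\<lambda>x. complex_of_real c) f) f)"
    using f by (simp add: Phi_const[OF f(1)] inner_scale_left inner_self)
  also have "\<dots> \<le> (\<Sum>g\<in>K. (nrm (Phi (\<lambda>x. complex_of_real (w g x)) f))\<^sup>2)"
  proof -
    have "Re (ip (Phi (\<lambda>x. complex_of_real c) f) f) \<le> Re (ip (Phi (\<lambda>x. complex_of_real (\<Sum>g\<in>K. (w g x)\<^sup>2)) f) f)"
      by (rule Phi_mono[OF const_simple _ le f(1)]) (rule sum_Phi_norm_sq(2)[OF w f(1)])
    then show ?thesis by (subst sum_Phi_norm_sq(1)[OF w f(1)])
  qed
  finally show ?thesis .
qed

lemma rho_proj_Domain:
  assumes "s \<in> S" "f \<in> H" shows "\<rho> s (proj (Domain s) f) = \<rho> s f"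
proof -
  have "Id_on (Domain s) O s = s" by (auto simp: relcomp_unfold Id_on_iff)
  then show ?thesis using rho_relcomp[OF assms(1) Id_on_hull[OF hull_Domain_J[OF assms(1)]] assms(2)] by (simp add: proj_def)
qed

lemma proj_P_rho:
  assumes "s \<in> S" "f \<in> H" shows "proj P (\<rho> s f) = \<rho> s f"
proof -
  have "s O Id_on P = s" using hull_carrier[OF assms(1)] by (auto simp: relcomp_unfold Id_on_iff)
  then show ?thesis using rho_relcomp[OF Id_on_hull[OF top_J] assms] by (simp add: proj_def)
qed

lemma rho_converse_Range:
  assumes "s \<in> S" "f \<in> H" shows "\<rho> s (\<rho> (s\<inverse>) f) = proj (Range s) f"
proof -
  have "s\<inverse> O s = Id_on (Range s)"
    using partial_bijD(3)[OF hull_partial_bij[OF assms(1)]] by (auto simp: relcomp_unfold Id_on_iff)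
  then show ?thesis using rho_relcomp[OF assms(1) hull_converse[OF assms(1)] assms(2)] by (simp add: proj_def)
qed

text \<open>Put \<xi>_g = sqrt F_g, W f = (\<Phi>(\<xi>_g) f)_g and b = \<Sum> c_i \<rho>(r_i)
  \<eta>. Then sqrt(1 - \<epsilon>) |b| \<le> |W b|. Up to the translation of coordinates by l_i,
  the families W \<rho>(r_i) \<eta> and \<rho>(r_i) W \<eta> differ by at most sqrt \<epsilon>
  |\<eta>|, whence the last term. Fell absorption bounds the combination of the translated families
  by C |W \<eta>|, and |W \<eta>| \<le> sqrt(1 + \<epsilon>) |\<eta>|.\<close>

lemma norm_estimate_eps:
  assumes I: "finite I" and r: "\<And>i. i \<in> I \<Longrightarrow> r i \<in> S" "\<And>i. i \<in> I \<Longrightarrow> has_label (l i) (r i)"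
    and bound: "\<And>f. f \<in> ell2 P \<Longrightarrow> ell2_norm P (\<lambda>y. \<Sum>i\<in>I. c i * shift (r i) f y) \<le> C * ell2_norm P f" and C: "0 \<le> C"
    and \<eta>: "\<eta> \<in> H" and \<epsilon>: "0 < \<epsilon>" "\<epsilon> < 1"
    and mean: "approx_mean ((\<lambda>i. (r i, l i)) ` I) \<epsilon> K \<Sigma> \<F> F"
  shows "sqrt (1 - \<epsilon>) * nrm (\<lambda>n. \<Sum>i\<in>I. c i * \<rho> (r i) \<eta> n) \<le>
    C * (sqrt (1 + \<epsilon>) * nrm \<eta>) + (\<Sum>i\<in>I. cmod (c i)) * (sqrt \<epsilon> * nrm \<eta>)"
proof -
  have K: "finite K" "K \<subseteq> carrier G" and \<Sigma>: "finite \<Sigma>" "\<Sigma> \<subseteq> S" and \<F>: "finite \<F>" "\<F> \<subseteq> J"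
    and F0: "\<And>g x. 0 \<le> F g x" and FK: "\<And>g x. g \<notin> K \<Longrightarrow> F g x = 0" and Fm: "\<And>g. measurable_wrt \<F> (F g)"
    and supp: "\<And>g x. x \<in> P \<Longrightarrow> F g x \<noteq> 0 \<Longrightarrow> \<exists>s\<in>\<Sigma>. has_label g s \<and> x \<in> Range s"
    and one: "\<And>x. x \<in> P \<Longrightarrow> \<bar>(\<Sum>g\<in>K. F g x) - 1\<bar> \<le> \<epsilon>"
    using mean unfolding approx_mean_def by (elim conjE, simp)+
  have inv: "(\<Sum>g\<in>K'. \<bar>F (l i \<otimes> g) y - F g x\<bar>) \<le> \<epsilon>"
    if "i \<in> I" "(x, y) \<in> r i" "finite K'" "K' \<subseteq> carrier G" for i x y K'
  proof -
    have "\<forall>(s, h)\<in>(\<lambda>i. (r i, l i)) ` I. \<forall>(x, y)\<in>s. \<forall>K'. finite K' \<longrightarrow> K' \<subseteq> carrier G \<longrightarrow> (\<Sum>g\<in>K'. \<bar>F (h \<otimes> g) y - F g x\<bar>) \<le> \<epsilon>"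
      using mean unfolding approx_mean_def by blast
    from bspec[OF this imageI[OF that(1)]] that(2-) show ?thesis by auto
  qed
  have lc: "l i \<in> carrier G" if "i \<in> I" for i using r(2)[OF that] by (simp add: has_label_def)
  define x0 where "x0 g x = sqrt (F g x)" for g x
  define \<xi> where "\<xi> g = (\<lambda>x. complex_of_real (x0 g x))" for g
  have \<xi>m: "measurable_wrt \<F> (\<xi> g)" for g
    unfolding measurable_wrt_def \<xi>_def x0_def using measurable_wrtD[OF Fm] by metis
  have \<xi>: "simple (\<xi> g)" for g by (rule measurable_simple[OF \<F> \<xi>m])
  have x0: "simple (\<lambda>x. complex_of_real (x0 g x))" for g using \<xi>[of g] by (simp add: \<xi>_def)
  \<comment> \<open>The choice depends only on which ranges of elements of \<open>\<Sigma>\<close>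
    contain \<open>x\<close>, so it splits \<xi>_g into finitely many simple pieces, each supported
    in the range of one element with label \<open>g\<close>.\<close>
  define pick where "pick g x = (SOME s. s \<in> \<Sigma> \<and> has_label g s \<and> x \<in> Range s)" for g x
  have pick: "pick g x \<in> \<Sigma>" "has_label g (pick g x)" "x \<in> Range (pick g x)" if "x \<in> P" "F g x \<noteq> 0" for g x
  proof -
    have "\<exists>s. s \<in> \<Sigma> \<and> has_label g s \<and> x \<in> Range s" using supp[OF that] by blast
    from someI_ex[OF this] show "pick g x \<in> \<Sigma>" "has_label g (pick g x)" "x \<in> Range (pick g x)"
      unfolding pick_def by blast+
  qed
  define \<zeta> where "\<zeta> g s = (\<lambda>x. if F g x \<noteq> 0 \<and> pick g x = s then \<xi> g x else 0)" for g s
  have \<zeta>: "simple (\<zeta> g s)" for g s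
  proof (rule measurable_simple)
    show "finite (\<F> \<union> Range ` \<Sigma>)" using \<F> \<Sigma> by simp
    show "\<F> \<union> Range ` \<Sigma> \<subseteq> J"
    proof
      fix X assume "X \<in> \<F> \<union> Range ` \<Sigma>"
      then show "X \<in> J" using subsetD[OF \<F>(2)] hull_Range_J subsetD[OF \<Sigma>(2)] by auto
    qed
    show "measurable_wrt (\<F> \<union> Range ` \<Sigma>) (\<zeta> g s)"
      unfolding measurable_wrt_def
    proof (intro ballI impI)
      fix x y assume xy: "x \<in> P" "y \<in> P" "\<forall>X\<in>\<F> \<union> Range ` \<Sigma>. x \<in> X \<longleftrightarrow> y \<in> X"
      have e: "x \<in> X \<longleftrightarrow> y \<in> X" if "X \<in> \<F>" for X by (rule bspec[OF xy(3) UnI1[OF that]])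
      have "F g x = F g y" by (rule measurable_wrtD[OF Fm xy(1,2) e])
      moreover have "\<xi> g x = \<xi> g y" by (rule measurable_wrtD[OF \<xi>m xy(1,2) e])
      moreover have "pick g x = pick g y"
      proof -
        have "(\<lambda>s. s \<in> \<Sigma> \<and> has_label g s \<and> x \<in> Range s) = (\<lambda>s. s \<in> \<Sigma> \<and> has_label g s \<and> y \<in> Range s)"
        proof
          fix s
          have "x \<in> Range s \<longleftrightarrow> y \<in> Range s" if "s \<in> \<Sigma>" by (rule bspec[OF xy(3) UnI2[OF imageI[OF that]]])
          then show "(s \<in> \<Sigma> \<and> has_label g s \<and> x \<in> Range s) = (s \<in> \<Sigma> \<and> has_label g s \<and> y \<in> Range s)"
            by (cases "s \<in> \<Sigma>") simp_all
        qed
        then show ?thesis by (simp only: pick_def)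
      qed
      ultimately show "\<zeta> g s x = \<zeta> g s y" by (simp add: \<zeta>_def)
    qed
  qed
  define E where "E g = Phi (\<xi> g) \<eta>" for g
  have E: "E g \<in> H" for g unfolding E_def by (rule Phi_H[OF \<xi> \<eta>])
  define JJ where "JJ = {j \<in> K \<times> \<Sigma>. has_label (fst j) (snd j)}"
  \<comment> \<open>Fell absorption asks for vectors \<rho>(s) z. The piece belonging to s is
    supported in the range of s, so applying s^-1 and then s reproduces it.\<close>
  define z where "z j = \<rho> ((snd j)\<inverse>) (Phi (\<zeta> (fst j) (snd j)) \<eta>)" for j
  have JJ: "finite JJ" using K(1) \<Sigma>(1) by (simp add: JJ_def)
  have sS: "snd j \<in> S" if "j \<in> JJ" for j using that subsetD[OF \<Sigma>(2)] by (auto simp: JJ_def)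
  have sl: "has_label (fst j) (snd j)" if "j \<in> JJ" for j using that by (simp add: JJ_def)
  have z: "z j \<in> H" if "j \<in> JJ" for j
    unfolding z_def by (rule rho_H[OF hull_converse[OF sS[OF that]] Phi_H[OF \<zeta> \<eta>]])
  have rz: "\<rho> (snd j) (z j) = Phi (\<zeta> (fst j) (snd j)) \<eta>" if j: "j \<in> JJ" for j
  proof -
    let ?s = "snd j" and ?h = "\<zeta> (fst j) (snd j)"
    have RJ: "Range ?s \<in> J" by (rule hull_Range_J[OF sS[OF j]])
    have "\<rho> ?s (z j) = proj (Range ?s) (Phi ?h \<eta>)"
      unfolding z_def by (rule rho_converse_Range[OF sS[OF j] Phi_H[OF \<zeta> \<eta>]])
    also have "\<dots> = Phi (\<lambda>x. (if x \<in> Range ?s then 1 else 0) * ?h x) \<eta>"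
      using Phi_mult[OF simple_indicator[OF RJ] \<zeta> \<eta>] Phi_indicator[OF RJ Phi_H[OF \<zeta> \<eta>]] by simp
    also have "\<dots> = Phi ?h \<eta>"
    proof (rule Phi_cong[OF simple_mult[OF simple_indicator[OF RJ] \<zeta>] _ \<eta>])
      fix x assume x: "x \<in> P"
      have "x \<in> Range ?s" if "?h x \<noteq> 0"
        using that pick(3)[OF x, of "fst j"] by (auto simp: \<zeta>_def split: if_splits)
      then show "(if x \<in> Range ?s then 1 else 0) * ?h x = ?h x" by auto
    qed
    finally show ?thesis .
  qed
  have E_sum: "(\<lambda>n. \<Sum>j\<in>{j \<in> JJ. fst j = g}. \<rho> (snd j) (z j) n) = E g" for g
  proof -
    let ?A = "{j \<in> JJ. fst j = g}"
    have "(\<lambda>n. \<Sum>j\<in>?A. \<rho> (snd j) (z j) n) = (\<lambda>n. \<Sum>j\<in>?A. Phi (\<zeta> (fst j) (snd j)) \<eta> n)"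
      using rz by (intro ext sum.cong) auto
    also have "\<dots> = Phi (\<lambda>x. \<Sum>j\<in>?A. \<zeta> (fst j) (snd j) x) \<eta>" by (rule Phi_sum[OF \<zeta> \<eta>, symmetric])
    also have "\<dots> = E g"
      unfolding E_def
    proof (rule Phi_cong[OF simple_sum[OF \<zeta>] _ \<eta>])
      fix x assume x: "x \<in> P"
      show "(\<Sum>j\<in>?A. \<zeta> (fst j) (snd j) x) = \<xi> g x"
      proof (cases "F g x = 0")
        case True
        then show ?thesis by (simp add: \<zeta>_def \<xi>_def x0_def)
      next
        case False
        then have gK: "g \<in> K" using FK by blast
        have mem: "(g, pick g x) \<in> ?A" using pick[OF x False] gK by (simp add: JJ_def)
        have trm: "\<zeta> (fst j) (snd j) x = (if j = (g, pick g x) then \<xi> g x else 0)" if "j \<in> ?A" for j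
        proof -
          have "fst j = g" using that by simp
          then have "\<zeta> (fst j) (snd j) x = (if pick g x = snd j then \<xi> g x else 0)" using False by (simp add: \<zeta>_def)
          moreover have "j = (g, pick g x) \<longleftrightarrow> pick g x = snd j" using \<open>fst j = g\<close> by (cases j) auto
          ultimately show ?thesis by simp
        qed
        have "(\<Sum>j\<in>?A. \<zeta> (fst j) (snd j) x) = (\<Sum>j\<in>?A. if j = (g, pick g x) then \<xi> g x else 0)"
          by (rule sum.cong[OF refl trm])
        also have "\<dots> = \<xi> g x" using sum.delta[of ?A "(g, pick g x)" "\<lambda>_. \<xi> g x"] mem JJ by simp
        finally show ?thesis .
      qed
    qed
    finally show ?thesis .
  qed
  \<comment> \<open>Coordinate \<open>g\<close> of the combination of the \<rho>(r_i) tensored with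
    translation by l_i, applied to the family \<open>E\<close>.\<close>
  define A where "A g = (\<lambda>n. \<Sum>i\<in>I. c i * \<rho> (r i) (E (inv (l i) \<otimes> g)) n)" for g
  have A: "A g \<in> H" for g
    unfolding A_def by (intro ell2_sum(1) ell2_scale(1) rho_H[OF r(1) E])
  have A_eq: "(\<lambda>n. \<Sum>(i, j)\<in>{(i, j) \<in> I \<times> JJ. l i \<otimes> fst j = g}. c i * \<rho> (r i) (\<rho> (snd j) (z j)) n) = A g"
    if g: "g \<in> K" for g
  proof
    fix n
    have gc: "g \<in> carrier G" using subsetD[OF K(2) g] .
    have "(\<Sum>(i, j)\<in>{(i, j) \<in> I \<times> JJ. l i \<otimes> fst j = g}. c i * \<rho> (r i) (\<rho> (snd j) (z j)) n) =
        (\<Sum>(i, j)\<in>Sigma I (\<lambda>i. {j \<in> JJ. l i \<otimes> fst j = g}). c i * \<rho> (r i) (\<rho> (snd j) (z j)) n)"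
      by (intro sum.cong) auto
    also have "\<dots> = (\<Sum>i\<in>I. \<Sum>j\<in>{j \<in> JJ. l i \<otimes> fst j = g}. c i * \<rho> (r i) (\<rho> (snd j) (z j)) n)"
      using I JJ by (intro sum.Sigma[symmetric]) auto
    also have "\<dots> = A g n"
      unfolding A_def
    proof (rule sum.cong[OF refl])
      fix i assume i: "i \<in> I"
      have "{j \<in> JJ. l i \<otimes> fst j = g} = {j \<in> JJ. fst j = inv (l i) \<otimes> g}"
      proof -
        have "l i \<otimes> fst j = g \<longleftrightarrow> fst j = inv (l i) \<otimes> g" if "j \<in> JJ" for j
        proof -
          have "fst j \<in> carrier G" using that subsetD[OF K(2)] by (auto simp: JJ_def)
          then show ?thesis using lc[OF i] gc by (metis inv_solve_left)
        qed
        then show ?thesis by auto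
      qed
      then have "(\<Sum>j\<in>{j \<in> JJ. l i \<otimes> fst j = g}. c i * \<rho> (r i) (\<rho> (snd j) (z j)) n) =
          c i * (\<Sum>j\<in>{j \<in> JJ. fst j = inv (l i) \<otimes> g}. \<rho> (r i) (\<rho> (snd j) (z j)) n)"
        by (simp only: sum_distrib_left)
      also have "(\<Sum>j\<in>{j \<in> JJ. fst j = inv (l i) \<otimes> g}. \<rho> (r i) (\<rho> (snd j) (z j)) n) = \<rho> (r i) (E (inv (l i) \<otimes> g)) n"
      proof -
        have "\<rho> (snd j) (z j) \<in> H" if "j \<in> {j \<in> JJ. fst j = inv (l i) \<otimes> g}" for j
          using that rho_H[OF sS z] by simp
        then have "\<rho> (r i) (\<lambda>n. \<Sum>j\<in>{j \<in> JJ. fst j = inv (l i) \<otimes> g}. \<rho> (snd j) (z j) n) =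
            (\<lambda>n. \<Sum>j\<in>{j \<in> JJ. fst j = inv (l i) \<otimes> g}. \<rho> (r i) (\<rho> (snd j) (z j)) n)"
          by (rule bounded_ops_sum[OF rho_bounded[OF r(1)[OF i]]])
        from fun_cong[OF this, of n] show ?thesis unfolding E_sum by simp
      qed
      finally show "(\<Sum>j\<in>{j \<in> JJ. l i \<otimes> fst j = g}. c i * \<rho> (r i) (\<rho> (snd j) (z j)) n) =
        c i * \<rho> (r i) (E (inv (l i) \<otimes> g)) n" .
    qed
    finally show "(\<Sum>(i, j)\<in>{(i, j) \<in> I \<times> JJ. l i \<otimes> fst j = g}. c i * \<rho> (r i) (\<rho> (snd j) (z j)) n) = A g n" .
  qed
  have "(\<Sum>g\<in>K. (nrm (A g))\<^sup>2) =
      (\<Sum>g\<in>K. (nrm (\<lambda>n. \<Sum>(i, j)\<in>{(i, j) \<in> I \<times> JJ. l i \<otimes> fst j = g}. c i * \<rho> (r i) (\<rho> (snd j) (z j)) n))\<^sup>2)"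
    by (intro sum.cong refl) (simp only: A_eq)
  also have "\<dots> \<le> C\<^sup>2 * (\<Sum>g\<in>fst ` JJ. (nrm (\<lambda>n. \<Sum>j\<in>{j \<in> JJ. fst j = g}. \<rho> (snd j) (z j) n))\<^sup>2)"
    by (rule Fell_absorption[OF I r JJ sS sl bound z K])
  also have "\<dots> \<le> C\<^sup>2 * (\<Sum>g\<in>K. (nrm (E g))\<^sup>2)"
    unfolding E_sum by (intro mult_left_mono sum_mono2 K) (auto simp: JJ_def)
  also have "\<dots> \<le> C\<^sup>2 * ((1 + \<epsilon>) * (nrm \<eta>)\<^sup>2)"
  proof (rule mult_left_mono)
    show "(\<Sum>g\<in>K. (nrm (E g))\<^sup>2) \<le> (1 + \<epsilon>) * (nrm \<eta>)\<^sup>2"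
      unfolding E_def \<xi>_def
    proof (rule sum_Phi_norm_sq_upper[OF x0 \<eta>])
      show "(\<Sum>g\<in>K. (x0 g x)\<^sup>2) \<le> 1 + \<epsilon>" if "x \<in> P" for x
        using one[OF that] F0 by (simp add: x0_def)
    qed (use \<epsilon> in simp)
  qed simp
  finally have "(\<Sum>g\<in>K. (nrm (A g))\<^sup>2) \<le> C\<^sup>2 * ((1 + \<epsilon>) * (nrm \<eta>)\<^sup>2)" .
  then have "L2_set (\<lambda>g. nrm (A g)) K \<le> sqrt (C\<^sup>2 * ((1 + \<epsilon>) * (nrm \<eta>)\<^sup>2))"
    unfolding L2_set_def by (rule real_sqrt_le_mono)
  also have "\<dots> = C * (sqrt (1 + \<epsilon>) * nrm \<eta>)"
    using C by (simp add: real_sqrt_mult)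
  finally have LA: "L2_set (\<lambda>g. nrm (A g)) K \<le> C * (sqrt (1 + \<epsilon>) * nrm \<eta>)" .
  \<comment> \<open>Cutting down to the domain of \<open>r i\<close> is invisible after \<rho>(r_i)
    is applied. Without it the difference would not be small: off the domain the function pulled
    back along \<open>r i\<close> is 0.\<close>
  define u where "u i g x = (if x \<in> Domain (r i) then x0 (inv (l i) \<otimes> g) x - x0 g (l i \<otimes> x) else 0)" for i g x
  define D where "D i g = Phi (\<lambda>x. complex_of_real (u i g x)) \<eta>" for i g
  have ind: "simple (\<lambda>x. if x \<in> Domain (r i) then 1 else 0)" if "i \<in> I" for i
    by (rule simple_indicator[OF hull_Domain_J[OF r(1)[OF that]]])
  have pull: "shift ((r i)\<inverse>) (\<xi> g) x = \<xi> g (l i \<otimes> x)" if i: "i \<in> I" and x: "x \<in> Domain (r i)" for i g x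
  proof -
    obtain y where y: "(x, y) \<in> r i" using x by blast
    have "y = l i \<otimes> x" using r(2)[OF i] y by (simp add: has_label_def)
    then show ?thesis
      using shift_at[OF partial_bij_converse[OF hull_partial_bij[OF r(1)[OF i]]], of y x] y by simp
  qed
  define v where "v i g = (\<lambda>x. \<xi> (inv (l i) \<otimes> g) x + (- 1) * shift ((r i)\<inverse>) (\<xi> g) x)" for i g
  have v: "simple (v i g)" if "i \<in> I" for i g
    unfolding v_def by (intro simple_add simple_scale \<xi> Phi_rho(1)[OF \<xi> r(1)[OF that] \<eta>])
  have uv: "complex_of_real (u i g x) = (if x \<in> Domain (r i) then 1 else 0) * v i g x" if "i \<in> I" for i g x
    using pull[OF that] by (simp add: u_def v_def \<xi>_def)
  have u: "simple (\<lambda>x. complex_of_real (u i g x))" if "i \<in> I" for i g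
    unfolding uv[OF that] by (intro simple_mult ind v that)
  have D: "D i g \<in> H" if "i \<in> I" for i g unfolding D_def by (rule Phi_H[OF u[OF that] \<eta>])
  have D_eq: "\<rho> (r i) (E (inv (l i) \<otimes> g)) n - Phi (\<xi> g) (\<rho> (r i) \<eta>) n = \<rho> (r i) (D i g) n" if i: "i \<in> I" for i g n
  proof -
    note ri = r(1)[OF i]
    have vi: "Phi (v i g) \<eta> \<in> H" by (rule Phi_H[OF v[OF i] \<eta>])
    have "D i g = Phi (\<lambda>x. (if x \<in> Domain (r i) then 1 else 0) * v i g x) \<eta>" unfolding D_def uv[OF i] ..
    also have "\<dots> = proj (Domain (r i)) (Phi (v i g) \<eta>)"
      using Phi_mult[OF ind[OF i] v[OF i] \<eta>] Phi_indicator[OF hull_Domain_J[OF ri] vi] by simp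
    finally have 1: "\<rho> (r i) (D i g) = \<rho> (r i) (Phi (v i g) \<eta>)" using rho_proj_Domain[OF ri vi] by simp
    note sh = Phi_rho(1)[OF \<xi> ri \<eta>, of g]
    have "Phi (v i g) \<eta> = (\<lambda>n. E (inv (l i) \<otimes> g) n + (- 1) * Phi (shift ((r i)\<inverse>) (\<xi> g)) \<eta> n)"
      unfolding v_def E_def Phi_add[OF \<xi> simple_scale[OF sh] \<eta>] Phi_scale[OF sh \<eta>] ..
    then have "\<rho> (r i) (Phi (v i g) \<eta>) = (\<lambda>n. \<rho> (r i) (E (inv (l i) \<otimes> g)) n - \<rho> (r i) (Phi (shift ((r i)\<inverse>) (\<xi> g)) \<eta>) n)"
      using bounded_ops_diff[OF rho_bounded[OF ri] E Phi_H[OF sh \<eta>]] by simp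
    then show ?thesis unfolding 1 Phi_rho(2)[OF \<xi> ri \<eta>] by simp
  qed
  have LD: "L2_set (\<lambda>g. nrm (D i g)) K \<le> sqrt \<epsilon> * nrm \<eta>" if i: "i \<in> I" for i
  proof -
    have "(\<Sum>g\<in>K. (nrm (D i g))\<^sup>2) \<le> \<epsilon> * (nrm \<eta>)\<^sup>2"
      unfolding D_def
    proof (rule sum_Phi_norm_sq_upper[OF u[OF i] \<eta>])
      fix x assume x: "x \<in> P"
      show "(\<Sum>g\<in>K. (u i g x)\<^sup>2) \<le> \<epsilon>"
      proof (cases "x \<in> Domain (r i)")
        case False
        then show ?thesis using \<epsilon> by (simp add: u_def)
      next
        case True
        then obtain y where y: "(x, y) \<in> r i" by blast
        have yx: "y = l i \<otimes> x" using r(2)[OF i] y by (simp add: has_label_def)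
        \<comment> \<open>Invariance compares l g with g; here it is read at l^-1 g. As
          \<open>K'\<close> in \<open>approx_mean\<close> is arbitrary, it can be the translate of
          \<open>K\<close>.\<close>
        let ?m = "\<lambda>g. inv (l i) \<otimes> g"
        have inj: "inj_on ?m K"
        proof (rule inj_onI)
          fix g h assume gh: "g \<in> K" "h \<in> K" "?m g = ?m h"
          have "g \<in> carrier G" "h \<in> carrier G" using subsetD[OF K(2) gh(1)] subsetD[OF K(2) gh(2)] by auto
          then show "g = h" using gh(3) lc[OF i] by simp
        qed
        have cancel: "l i \<otimes> ?m g = g" if "g \<in> K" for g
          using subsetD[OF K(2) that] lc[OF i] by (simp add: m_assoc[symmetric])
        have "(\<Sum>g\<in>K. (u i g x)\<^sup>2) \<le> (\<Sum>g\<in>K. \<bar>F (?m g) x - F g y\<bar>)"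
          using True F0 by (intro sum_mono) (simp add: u_def x0_def yx sqrt_diff_sq_le)
        also have "\<dots> = (\<Sum>g\<in>K. \<bar>F (l i \<otimes> ?m g) y - F (?m g) x\<bar>)"
          by (intro sum.cong refl) (simp only: cancel abs_minus_commute)
        also have "\<dots> = (\<Sum>g\<in>?m ` K. \<bar>F (l i \<otimes> g) y - F g x\<bar>)"
          by (simp add: sum.reindex[OF inj])
        also have "\<dots> \<le> \<epsilon>"
        proof (rule inv[OF i y])
          show "finite (?m ` K)" using K(1) by simp
          show "?m ` K \<subseteq> carrier G" using lc[OF i] subsetD[OF K(2)] by auto
        qed
        finally show ?thesis .
      qed
    qed (use \<epsilon> in simp)
    then have "L2_set (\<lambda>g. nrm (D i g)) K \<le> sqrt (\<epsilon> * (nrm \<eta>)\<^sup>2)"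
      unfolding L2_set_def by (rule real_sqrt_le_mono)
    then show ?thesis by (simp add: real_sqrt_mult)
  qed
  define b where "b = (\<lambda>n. \<Sum>i\<in>I. c i * \<rho> (r i) \<eta> n)"
  have bi: "(\<lambda>n. c i * \<rho> (r i) \<eta> n) \<in> H" if "i \<in> I" for i by (rule ell2_scale(1)[OF rho_H[OF r(1)[OF that] \<eta>]])
  have b: "b \<in> H" unfolding b_def by (rule ell2_sum(1)[OF bi])
  have Tb: "T b = (\<lambda>n. \<Sum>i\<in>I. c i * T (\<rho> (r i) \<eta>) n)" if T: "T \<in> bounded_ops UNIV" for T
  proof -
    have "T b = (\<lambda>n. \<Sum>i\<in>I. T (\<lambda>n. c i * \<rho> (r i) \<eta> n) n)"
      unfolding b_def by (rule bounded_ops_sum[OF T bi])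
    also have "\<dots> = (\<lambda>n. \<Sum>i\<in>I. c i * T (\<rho> (r i) \<eta>) n)"
      using bounded_ops_scale[OF T rho_H[OF r(1) \<eta>]] by (intro ext sum.cong refl) simp
    finally show ?thesis .
  qed
  \<comment> \<open>Every \<rho>(s) maps into the range of \<open>proj P\<close>, so the lower bound
    applies to \<open>b\<close>.\<close>
  have pb: "proj P b = b"
    unfolding Tb[OF proj_bounded[OF top_J]] unfolding b_def
    by (intro ext sum.cong refl) (simp add: proj_P_rho[OF r(1) \<eta>])
  have step: "nrm (Phi (\<xi> g) b) \<le> nrm (A g) + (\<Sum>i\<in>I. cmod (c i) * nrm (D i g))" for g
  proof -
    have di: "(\<lambda>n. c i * \<rho> (r i) (D i g) n) \<in> H" if "i \<in> I" for i
      by (rule ell2_scale(1)[OF rho_H[OF r(1)[OF that] D[OF that]]])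
    have "Phi (\<xi> g) b = (\<lambda>n. A g n - (\<Sum>i\<in>I. c i * \<rho> (r i) (D i g) n))"
    proof
      fix n
      have "A g n - (\<Sum>i\<in>I. c i * \<rho> (r i) (D i g) n) =
          (\<Sum>i\<in>I. c i * \<rho> (r i) (E (inv (l i) \<otimes> g)) n - c i * \<rho> (r i) (D i g) n)"
        unfolding A_def by (simp only: sum_subtractf)
      also have "\<dots> = (\<Sum>i\<in>I. c i * Phi (\<xi> g) (\<rho> (r i) \<eta>) n)"
        by (intro sum.cong refl) (simp add: D_eq[symmetric] right_diff_distrib[symmetric])
      finally show "Phi (\<xi> g) b n = A g n - (\<Sum>i\<in>I. c i * \<rho> (r i) (D i g) n)"
        unfolding Tb[OF Phi_bounded[OF \<xi>]] by simp
    qed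
    then have "nrm (Phi (\<xi> g) b) \<le> nrm (A g) + nrm (\<lambda>n. \<Sum>i\<in>I. c i * \<rho> (r i) (D i g) n)"
      using ell2_diff(2)[OF A ell2_sum(1)[OF di]] by simp
    also have "nrm (\<lambda>n. \<Sum>i\<in>I. c i * \<rho> (r i) (D i g) n) \<le> (\<Sum>i\<in>I. nrm (\<lambda>n. c i * \<rho> (r i) (D i g) n))"
      by (rule ell2_sum(2)[OF di])
    also have "\<dots> \<le> (\<Sum>i\<in>I. cmod (c i) * nrm (D i g))"
    proof (rule sum_mono)
      fix i assume i: "i \<in> I"
      show "nrm (\<lambda>n. c i * \<rho> (r i) (D i g) n) \<le> cmod (c i) * nrm (D i g)"
        unfolding ell2_scale(2)[OF rho_H[OF r(1)[OF i] D[OF i]]]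
        by (intro mult_left_mono rep_contraction[OF rho r(1)[OF i] D[OF i]]) simp
    qed
    finally show ?thesis by simp
  qed
  have "(1 - \<epsilon>) * (nrm b)\<^sup>2 \<le> (\<Sum>g\<in>K. (nrm (Phi (\<xi> g) b))\<^sup>2)"
    unfolding \<xi>_def
  proof (rule sum_Phi_norm_sq_lower[OF x0 b pb])
    show "1 - \<epsilon> \<le> (\<Sum>g\<in>K. (x0 g x)\<^sup>2)" if "x \<in> P" for x
      using one[OF that] F0 by (simp add: x0_def)
  qed
  then have "sqrt ((1 - \<epsilon>) * (nrm b)\<^sup>2) \<le> L2_set (\<lambda>g. nrm (Phi (\<xi> g) b)) K"
    unfolding L2_set_def by (rule real_sqrt_le_mono)
  then have "sqrt (1 - \<epsilon>) * nrm b \<le> L2_set (\<lambda>g. nrm (Phi (\<xi> g) b)) K"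
    by (simp add: real_sqrt_mult)
  also have "\<dots> \<le> L2_set (\<lambda>g. nrm (A g) + (\<Sum>i\<in>I. cmod (c i) * nrm (D i g))) K"
    by (intro L2_set_mono step) simp
  also have "\<dots> \<le> L2_set (\<lambda>g. nrm (A g)) K + L2_set (\<lambda>g. \<Sum>i\<in>I. cmod (c i) * nrm (D i g)) K"
    by (rule L2_set_triangle_ineq)
  also have "L2_set (\<lambda>g. \<Sum>i\<in>I. cmod (c i) * nrm (D i g)) K \<le> (\<Sum>i\<in>I. L2_set (\<lambda>g. cmod (c i) * nrm (D i g)) K)"
    by (rule L2_set_sum_le)
  also have "\<dots> = (\<Sum>i\<in>I. cmod (c i) * L2_set (\<lambda>g. nrm (D i g)) K)"
    by (simp add: L2_set_right_distrib)
  also have "\<dots> \<le> (\<Sum>i\<in>I. cmod (c i) * (sqrt \<epsilon> * nrm \<eta>))"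
    by (intro sum_mono mult_left_mono LD) auto
  also have "\<dots> = (\<Sum>i\<in>I. cmod (c i)) * (sqrt \<epsilon> * nrm \<eta>)" by (simp only: sum_distrib_right)
  finally show ?thesis using LA by (simp add: b_def)
qed

text \<open>The constant \<open>C\<close> and the coefficients do not depend on \<epsilon>, so both
  error terms disappear as \<epsilon> tends to 0 from the right.\<close>

lemma norm_estimate:
  assumes I: "finite I" and r: "\<And>i. i \<in> I \<Longrightarrow> r i \<in> S"
    and bound: "\<And>f. f \<in> ell2 P \<Longrightarrow> ell2_norm P (\<lambda>y. \<Sum>i\<in>I. c i * shift (r i) f y) \<le> C * ell2_norm P f" and C: "0 \<le> C"
    and \<eta>: "\<eta> \<in> H" and mean: has_approx_means
  shows "nrm (\<lambda>n. \<Sum>i\<in>I. c i * \<rho> (r i) \<eta> n) \<le> C * nrm \<eta>"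
proof -
  obtain l where l: "\<And>i. i \<in> I \<Longrightarrow> has_label (l i) (r i)" using hull_label[OF r] by metis
  let ?b = "nrm (\<lambda>n. \<Sum>i\<in>I. c i * \<rho> (r i) \<eta> n)"
  let ?L = "\<lambda>\<epsilon>. sqrt (1 - \<epsilon>) * ?b"
  let ?R = "\<lambda>\<epsilon>. C * (sqrt (1 + \<epsilon>) * nrm \<eta>) + (\<Sum>i\<in>I. cmod (c i)) * (sqrt \<epsilon> * nrm \<eta>)"
  have le: "?L \<epsilon> \<le> ?R \<epsilon>" if \<epsilon>: "0 < \<epsilon>" "\<epsilon> < 1" for \<epsilon>
  proof -
    have fin: "finite ((\<lambda>i. (r i, l i)) ` I)" using I by simp
    have lab: "\<forall>(s, h)\<in>(\<lambda>i. (r i, l i)) ` I. s \<in> S \<and> has_label h s" using r l by simp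
    obtain K \<Sigma> \<F> F where "approx_mean ((\<lambda>i. (r i, l i)) ` I) \<epsilon> K \<Sigma> \<F> F"
      using mean[unfolded has_approx_means_def, THEN spec, THEN spec, THEN mp, THEN mp, THEN mp, OF fin lab \<epsilon>(1)]
      by (elim exE)
    from norm_estimate_eps[OF I r l bound C \<eta> \<epsilon> this] show ?thesis .
  qed
  have tL: "(?L \<longlongrightarrow> sqrt (1 - 0) * ?b) (at_right 0)" by (intro tendsto_intros)
  have tR: "(?R \<longlongrightarrow> C * (sqrt (1 + 0) * nrm \<eta>) + (\<Sum>i\<in>I. cmod (c i)) * (sqrt 0 * nrm \<eta>)) (at_right 0)"
    by (intro tendsto_intros)
  have ev: "eventually (\<lambda>\<epsilon>. ?L \<epsilon> \<le> ?R \<epsilon>) (at_right 0)"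
    unfolding eventually_at_right_field using le by (intro exI[of _ 1]) auto
  from tendsto_le[OF _ tR tL ev] show ?thesis by simp
qed

end

context countable_subsemigroup begin

theorem star_iso_if_independent:
  assumes indep: "independent_semigroup G P" and mean: has_approx_means
  shows "star_iso Full Red (canonical_hom G P)"
proof (rule star_iso_if_norm_bound)
  fix xs :: "(complex \<times> ('a \<times> 'a) set) list" and \<rho> f assume xs: "snd ` set xs \<subseteq> S" and \<rho>: "\<rho> \<in> Reps" and f: "f \<in> ell2 (UNIV :: nat set)"
  interpret independent_rep G P \<rho> by unfold_locales (fact \<rho> indep)+
  let ?I = "{..<length xs}" and ?r = "\<lambda>i. snd (xs ! i)" and ?c = "\<lambda>i. fst (xs ! i)"
  have list: "(\<Sum>(c, s)\<leftarrow>xs. c * \<phi> s) = (\<Sum>i\<in>?I. ?c i * \<phi> (?r i))" for \<phi> :: "('a \<times> 'a) set \<Rightarrow> complex"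
    by (simp add: sum_list_sum_nth case_prod_beta atLeast0LessThan)
  have r: "?r i \<in> S" if "i \<in> ?I" for i
  proof -
    have "xs ! i \<in> set xs" using that by simp
    then show ?thesis by (rule subsetD[OF xs imageI])
  qed
  note cb = comb_rep_bounded[OF regular_rep hull_product hull_converse xs]
  have "nrm (\<lambda>n. \<Sum>i\<in>?I. ?c i * \<rho> (?r i) f n) \<le> op_norm P (comb P regular_rep xs) * nrm f"
  proof (rule norm_estimate[OF _ r _ op_norm_nonneg[OF cb] f mean])
    fix g assume g: "g \<in> ell2 P"
    have "(\<lambda>y. \<Sum>i\<in>?I. ?c i * shift (?r i) g y) = comb P regular_rep xs g"
    proof
      fix y
      have "comb P regular_rep xs g y = (\<Sum>i\<in>?I. ?c i * regular_rep (?r i) g y)"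
        using g list[of "\<lambda>s. regular_rep s g y"] by (simp add: comb_def)
      also have "\<dots> = (\<Sum>i\<in>?I. ?c i * shift (?r i) g y)"
        using r g by (intro sum.cong refl) (simp add: regular_rep_def shift_op_def)
      finally show "(\<Sum>i\<in>?I. ?c i * shift (?r i) g y) = comb P regular_rep xs g y" by simp
    qed
    then show "ell2_norm P (\<lambda>y. \<Sum>i\<in>?I. ?c i * shift (?r i) g y) \<le> op_norm P (comb P regular_rep xs) * ell2_norm P g"
      using op_norm_bound[OF cb g] by simp
  qed simp
  moreover have "comb UNIV \<rho> xs f = (\<lambda>n. \<Sum>i\<in>?I. ?c i * \<rho> (?r i) f n)"
    using f list by (simp add: comb_def)
  ultimately show "ell2_norm UNIV (comb UNIV \<rho> xs f) \<le> op_norm P (comb P regular_rep xs) * ell2_norm UNIV f" by simp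
qed

end

section \<open>Characters and cylinder sets\<close>

context countable_subsemigroup begin

abbreviation cube :: "('a set \<Rightarrow> nat) topology" where
  "cube \<equiv> product_topology (\<lambda>_. discrete_topology {0, 1}) J"

text \<open>For finite \<open>F\<close> these are basic neighbourhoods in the product topology, in a
  form that mentions only finitely many ideals.\<close>

definition cyl :: "'a set set \<Rightarrow> ('a set \<Rightarrow> nat) \<Rightarrow> ('a set \<Rightarrow> nat) set" where
  "cyl F \<omega> = {\<omega>' \<in> topspace cube. \<forall>X\<in>F. \<omega>' X = \<omega> X}"

lemma open_contains_cyl:
  assumes "openin cube U" "\<omega> \<in> U"
  obtains F where "finite F" "F \<subseteq> J" "cyl F \<omega> \<subseteq> U"
proof -
  obtain V where V: "finite {X \<in> J. V X \<noteq> topspace (discrete_topology {0, 1::nat})}"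
    "\<omega> \<in> Pi\<^sub>E J V" "Pi\<^sub>E J V \<subseteq> U"
    using assms unfolding openin_product_topology_alt by meson
  define F where "F = {X \<in> J. V X \<noteq> topspace (discrete_topology {0, 1::nat})}"
  have "cyl F \<omega> \<subseteq> Pi\<^sub>E J V"
  proof
    fix \<omega>' assume "\<omega>' \<in> cyl F \<omega>"
    then have c: "\<omega>' \<in> Pi\<^sub>E J (\<lambda>_. {0, 1})" "\<And>X. X \<in> F \<Longrightarrow> \<omega>' X = \<omega> X" by (auto simp: cyl_def)
    show "\<omega>' \<in> Pi\<^sub>E J V"
    proof (rule PiE_I)
      fix X assume X: "X \<in> J"
      show "\<omega>' X \<in> V X"
      proof (cases "X \<in> F")
        case True
        then show ?thesis using c(2)[OF True] PiE_mem[OF V(2) X] by simp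
      next
        case False
        then have "V X = {0, 1}" using X by (simp add: F_def)
        then show ?thesis using PiE_mem[OF c(1) X] by simp
      qed
    qed (use c(1) in \<open>auto simp: PiE_def extensional_def\<close>)
  qed
  then show thesis using that[of F] V(1,3) by (auto simp: F_def)
qed

lemma cyl_open: "finite F \<Longrightarrow> F \<subseteq> J \<Longrightarrow> \<omega> \<in> topspace cube \<Longrightarrow> openin cube (cyl F \<omega>)"
proof -
  assume F: "finite F" "F \<subseteq> J" and \<omega>: "\<omega> \<in> topspace cube"
  define V where "V X = (if X \<in> F then {\<omega> X} else {0, 1})" for X
  have \<omega>V: "\<omega> X \<in> {0, 1}" if "X \<in> J" for X using \<omega> that by (auto simp: PiE_iff)
  have "cyl F \<omega> = Pi\<^sub>E J V"
  proof (intro equalityI subsetI)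
    fix \<omega>' assume "\<omega>' \<in> cyl F \<omega>"
    then show "\<omega>' \<in> Pi\<^sub>E J V" by (auto simp: cyl_def V_def PiE_iff)
  next
    fix \<omega>' assume p: "\<omega>' \<in> Pi\<^sub>E J V"
    have "\<omega>' X \<in> {0, 1}" if "X \<in> J" for X
      using PiE_mem[OF p that] \<omega>V[OF that] by (auto simp: V_def split: if_splits)
    moreover have "\<omega>' X = \<omega> X" if "X \<in> F" for X
      using PiE_mem[OF p subsetD[OF F(2) that]] that by (simp add: V_def)
    moreover have "\<omega>' \<in> extensional J" using p by (simp add: PiE_def)
    ultimately show "\<omega>' \<in> cyl F \<omega>" by (simp add: cyl_def PiE_iff)
  qed
  moreover have "openin cube (Pi\<^sub>E J V)"
  proof (rule openin_PiE_gen[THEN iffD2])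
    show "Pi\<^sub>E J V = {} \<or> finite {i \<in> J. V i \<noteq> topspace (discrete_topology {0, 1})} \<and>
      (\<forall>i\<in>J. openin (discrete_topology {0, 1}) (V i))"
    proof (rule disjI2, intro conjI ballI)
      show "finite {i \<in> J. V i \<noteq> topspace (discrete_topology {0, 1})}"
        by (rule finite_subset[OF _ F(1)]) (auto simp: V_def)
      show "openin (discrete_topology {0, 1}) (V i)" if "i \<in> J" for i
        using \<omega>V[OF that] by (auto simp: V_def)
    qed
  qed
  ultimately show ?thesis by simp
qed

lemma openin_cubeI:
  assumes "U \<subseteq> topspace cube" "\<And>\<omega>. \<omega> \<in> U \<Longrightarrow> \<exists>F. finite F \<and> F \<subseteq> J \<and> cyl F \<omega> \<subseteq> U"
  shows "openin cube U"
proof (subst openin_subopen, intro ballI)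
  fix \<omega> assume w: "\<omega> \<in> U"
  then obtain F where F: "finite F" "F \<subseteq> J" "cyl F \<omega> \<subseteq> U" using assms(2) by blast
  have wt: "\<omega> \<in> topspace cube" using subsetD[OF assms(1) w] .
  have "\<omega> \<in> cyl F \<omega>" using wt by (simp add: cyl_def)
  then show "\<exists>V. openin cube V \<and> \<omega> \<in> V \<and> V \<subseteq> U"
    using cyl_open[OF F(1,2) wt] F(3) by blast
qed

lemma closedin_cubeI:
  assumes "A \<subseteq> topspace cube"
    and "\<And>\<omega>. \<omega> \<in> topspace cube \<Longrightarrow> \<omega> \<notin> A \<Longrightarrow> \<exists>F. finite F \<and> F \<subseteq> J \<and> cyl F \<omega> \<inter> A = {}"
  shows "closedin cube A"
  unfolding closedin_def
proof (intro conjI assms(1) openin_cubeI)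
  fix \<omega> assume "\<omega> \<in> topspace cube - A"
  then obtain F where F: "finite F" "F \<subseteq> J" "cyl F \<omega> \<inter> A = {}" using assms(2)[of \<omega>] by blast
  moreover have "cyl F \<omega> \<subseteq> topspace cube" unfolding cyl_def by blast
  ultimately show "\<exists>F. finite F \<and> F \<subseteq> J \<and> cyl F \<omega> \<subseteq> topspace cube - A" by (intro exI[of _ F]) blast
qed blast

lemma compact_cube: "compact_space cube"
  by (simp add: compact_space_product_topology compact_space_discrete_topology)

lemma compact_if_closed: "closedin cube A \<Longrightarrow> compactin cube A"
  by (rule closedin_compact_space[OF compact_cube])

text \<open>Around each point of \<open>A\<close> the function varies by less than \<delta>/2 on a
  cylinder, and finitely many of these cover the compact set \<open>A\<close>. Points that agree on
  all coordinates involved share one of them. In this way the functions given by amenability become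
  approximable by simple ones.\<close>

lemma uniform_on_cylinders:
  fixes \<phi> :: "('a set \<Rightarrow> nat) \<Rightarrow> real"
  assumes A: "closedin cube A" and \<phi>: "continuous_map (subtopology cube A) euclideanreal \<phi>" and \<delta>: "0 < \<delta>"
  obtains F where "finite F" "F \<subseteq> J"
    "\<And>\<omega> \<omega>'. \<omega> \<in> A \<Longrightarrow> \<omega>' \<in> A \<Longrightarrow> (\<And>X. X \<in> F \<Longrightarrow> \<omega> X = \<omega>' X) \<Longrightarrow> \<bar>\<phi> \<omega> - \<phi> \<omega>'\<bar> < \<delta>"
proof -
  have At: "A \<subseteq> topspace cube" by (rule closedin_subset[OF A])
  have "\<exists>F. finite F \<and> F \<subseteq> J \<and> (\<forall>\<omega>'\<in>cyl F \<omega> \<inter> A. \<bar>\<phi> \<omega>' - \<phi> \<omega>\<bar> < \<delta> / 2)" if w: "\<omega> \<in> A" for \<omega>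
  proof -
    have "openin (subtopology cube A) {x \<in> topspace (subtopology cube A). \<phi> x \<in> ball (\<phi> \<omega>) (\<delta> / 2)}"
      by (rule openin_continuous_map_preimage[OF \<phi>]) simp
    then obtain U where U: "openin cube U" "{x \<in> topspace (subtopology cube A). \<phi> x \<in> ball (\<phi> \<omega>) (\<delta> / 2)} = U \<inter> A"
      unfolding openin_subtopology by blast
    have "\<omega> \<in> {x \<in> topspace (subtopology cube A). \<phi> x \<in> ball (\<phi> \<omega>) (\<delta> / 2)}"
      using w subsetD[OF At w] \<delta> by simp
    then have "\<omega> \<in> U" unfolding U(2) by simp
    then obtain F where F: "finite F" "F \<subseteq> J" "cyl F \<omega> \<subseteq> U" by (rule open_contains_cyl[OF U(1)])
    have "\<bar>\<phi> \<omega>' - \<phi> \<omega>\<bar> < \<delta> / 2" if "\<omega>' \<in> cyl F \<omega> \<inter> A" for \<omega>'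
    proof -
      have "\<omega>' \<in> U \<inter> A" using that F(3) by blast
      then have "\<phi> \<omega>' \<in> ball (\<phi> \<omega>) (\<delta> / 2)" unfolding U(2)[symmetric] by simp
      then show ?thesis by (simp add: dist_real_def abs_minus_commute)
    qed
    then show ?thesis using F(1,2) by blast
  qed
  then obtain F where F: "\<And>\<omega>. \<omega> \<in> A \<Longrightarrow> finite (F \<omega>)" "\<And>\<omega>. \<omega> \<in> A \<Longrightarrow> F \<omega> \<subseteq> J"
    "\<And>\<omega> \<omega>'. \<omega> \<in> A \<Longrightarrow> \<omega>' \<in> cyl (F \<omega>) \<omega> \<inter> A \<Longrightarrow> \<bar>\<phi> \<omega>' - \<phi> \<omega>\<bar> < \<delta> / 2"
    by metis
  have wt: "\<omega> \<in> topspace cube" if "\<omega> \<in> A" for \<omega> using subsetD[OF At that] .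
  let ?U = "(\<lambda>\<omega>. cyl (F \<omega>) \<omega>) ` A"
  have "\<exists>\<F>. finite \<F> \<and> \<F> \<subseteq> ?U \<and> A \<subseteq> \<Union>\<F>"
  proof (rule compactinD[OF compact_if_closed[OF A]])
    show "openin cube U" if "U \<in> ?U" for U using that cyl_open[OF F(1,2) wt] by blast
    show "A \<subseteq> \<Union>?U"
    proof
      fix \<omega> assume w: "\<omega> \<in> A"
      then have "\<omega> \<in> cyl (F \<omega>) \<omega>" using wt by (simp add: cyl_def)
      then show "\<omega> \<in> \<Union>?U" using w by blast
    qed
  qed
  then obtain \<F> where fs: "finite \<F>" "\<F> \<subseteq> ?U" "A \<subseteq> \<Union>\<F>" by blast
  obtain A0 where A0: "A0 \<subseteq> A" "finite A0" "\<F> = (\<lambda>\<omega>. cyl (F \<omega>) \<omega>) ` A0"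
    using finite_subset_image[OF fs(1,2)] by blast
  show thesis
  proof (rule that[of "\<Union>(F ` A0)"])
    show "finite (\<Union>(F ` A0))" using A0(1,2) F(1) by (intro finite_Union) auto
    show "\<Union>(F ` A0) \<subseteq> J" using A0(1) F(2) by (intro UN_least) auto
    fix \<omega> \<omega>' assume w: "\<omega> \<in> A" "\<omega>' \<in> A" and eq: "\<And>X. X \<in> \<Union>(F ` A0) \<Longrightarrow> \<omega> X = \<omega>' X"
    obtain \<omega>0 where w0: "\<omega>0 \<in> A0" "\<omega> \<in> cyl (F \<omega>0) \<omega>0" using w(1) fs(3) unfolding A0(3) by blast
    have w0A: "\<omega>0 \<in> A" using subsetD[OF A0(1) w0(1)] .
    have "\<omega>' X = \<omega>0 X" if "X \<in> F \<omega>0" for X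
    proof -
      have "\<omega> X = \<omega>' X" using w0(1) that by (intro eq) blast
      moreover have "\<omega> X = \<omega>0 X" using w0(2) that by (simp add: cyl_def)
      ultimately show ?thesis by simp
    qed
    then have "\<omega>' \<in> cyl (F \<omega>0) \<omega>0" using wt[OF w(2)] by (simp add: cyl_def)
    then have "\<bar>\<phi> \<omega>' - \<phi> \<omega>0\<bar> < \<delta> / 2" "\<bar>\<phi> \<omega> - \<phi> \<omega>0\<bar> < \<delta> / 2"
      using F(3)[OF w0A, of \<omega>'] F(3)[OF w0A, of \<omega>] w w0(2) by blast+
    then show "\<bar>\<phi> \<omega> - \<phi> \<omega>'\<bar> < \<delta>" by linarith
  qed
qed

section \<open>Closed sets of characters\<close>

lemma characters_cube: "\<omega> \<in> characters G P \<Longrightarrow> \<omega> \<in> topspace cube"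
  by (simp add: characters_def)

lemma character_top: "\<omega> \<in> characters G P \<Longrightarrow> \<omega> P = 1"
proof -
  assume w: "\<omega> \<in> characters G P"
  then obtain X where X: "X \<in> J" "\<omega> X \<noteq> 0" by (auto simp: characters_def)
  have P: "P \<in> J" by (rule constructible_ideals.top)
  have "\<omega> (X \<inter> P) = \<omega> X * \<omega> P" using w X(1) P unfolding characters_def by blast
  moreover have "X \<inter> P = X" using J_subset[OF X(1)] by blast
  ultimately show ?thesis using X(2) by simp
qed

text \<open>That a character is nonzero is, by multiplicativity, the condition on the single
  coordinate \<open>P\<close> that its value is 1; in this form the set is visibly closed.\<close>

lemma characters_eq:
  "characters G P = {\<omega> \<in> topspace cube. \<omega> P = 1 \<and> \<omega> {} = 0 \<and> (\<forall>X\<in>J. \<forall>Y\<in>J. \<omega> (X \<inter> Y) = \<omega> X * \<omega> Y)}"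
proof (intro equalityI subsetI)
  fix \<omega> assume w: "\<omega> \<in> characters G P"
  then show "\<omega> \<in> {\<omega> \<in> topspace cube. \<omega> P = 1 \<and> \<omega> {} = 0 \<and> (\<forall>X\<in>J. \<forall>Y\<in>J. \<omega> (X \<inter> Y) = \<omega> X * \<omega> Y)}"
    using character_top[OF w] characters_cube[OF w] unfolding characters_def by blast
next
  fix \<omega> assume "\<omega> \<in> {\<omega> \<in> topspace cube. \<omega> P = 1 \<and> \<omega> {} = 0 \<and> (\<forall>X\<in>J. \<forall>Y\<in>J. \<omega> (X \<inter> Y) = \<omega> X * \<omega> Y)}"
  then show "\<omega> \<in> characters G P"
    using constructible_ideals.top[of P G] unfolding characters_def by (auto intro: bexI[of _ P])
qed

lemma closedin_characters: "closedin cube (characters G P)"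
proof (rule closedin_cubeI)
  show "characters G P \<subseteq> topspace cube" using characters_cube by blast
  fix \<omega> assume "\<omega> \<in> topspace cube" "\<omega> \<notin> characters G P"
  then have "\<omega> P \<noteq> 1 \<or> \<omega> {} \<noteq> 0 \<or> (\<exists>X\<in>J. \<exists>Y\<in>J. \<omega> (X \<inter> Y) \<noteq> \<omega> X * \<omega> Y)"
    by (simp add: characters_eq)
  then consider "\<omega> P \<noteq> 1" | "\<omega> {} \<noteq> 0" | X Y where "X \<in> J" "Y \<in> J" "\<omega> (X \<inter> Y) \<noteq> \<omega> X * \<omega> Y"
    by blast
  then show "\<exists>F. finite F \<and> F \<subseteq> J \<and> cyl F \<omega> \<inter> characters G P = {}"
  proof cases
    case 1
    then show ?thesis
      using constructible_ideals.top[of P G] by (intro exI[of _ "{P}"]) (auto simp: cyl_def characters_eq)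
  next
    case 2
    then show ?thesis
      using constructible_ideals.empty[of G P] by (intro exI[of _ "{{}}"]) (auto simp: cyl_def characters_eq)
  next
    case 3
    have "\<omega>' \<notin> characters G P" if "\<omega>' \<in> cyl {X, Y, X \<inter> Y} \<omega>" for \<omega>'
    proof
      assume "\<omega>' \<in> characters G P"
      then have "\<omega>' (X \<inter> Y) = \<omega>' X * \<omega>' Y" using 3(1,2) unfolding characters_def by blast
      moreover have "\<omega>' X = \<omega> X" "\<omega>' Y = \<omega> Y" "\<omega>' (X \<inter> Y) = \<omega> (X \<inter> Y)"
        using that by (simp_all add: cyl_def)
      ultimately show False using 3(3) by (simp only: simp_thms)
    qed
    then show ?thesis using 3 Int_J by (intro exI[of _ "{X, Y, X \<inter> Y}"]) auto
  qed
qed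

definition Omega_set :: "('a set \<Rightarrow> nat) set" where
  "Omega_set = {\<omega>. \<forall>X\<in>J. \<forall>F. F \<subseteq> J \<and> finite F \<and> F \<noteq> {} \<and> X = \<Union>F \<and> \<omega> X = 1 \<longrightarrow> (\<exists>Y\<in>F. \<omega> Y = 1)}"

text \<open>A failure of the covering condition is witnessed by finitely many coordinates, those of
  \<open>X\<close> and of the members of the cover, so it persists on a cylinder.\<close>

lemma closedin_Omega: "closedin cube (characters G P \<inter> Omega_set)"
proof (rule closedin_cubeI)
  show "characters G P \<inter> Omega_set \<subseteq> topspace cube" using characters_cube by blast
  fix \<omega> assume w: "\<omega> \<in> topspace cube" "\<omega> \<notin> characters G P \<inter> Omega_set"
  show "\<exists>F. finite F \<and> F \<subseteq> J \<and> cyl F \<omega> \<inter> (characters G P \<inter> Omega_set) = {}"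
  proof (cases "\<omega> \<in> characters G P")
    case False
    have "openin cube (topspace cube - characters G P)" using closedin_characters unfolding closedin_def by blast
    then obtain F where "finite F" "F \<subseteq> J" "cyl F \<omega> \<subseteq> topspace cube - characters G P"
      by (rule open_contains_cyl) (use w False in simp)
    then show ?thesis by (intro exI[of _ F]) blast
  next
    case True
    then have "\<omega> \<notin> Omega_set" using w(2) by simp
    then obtain X F where XF: "X \<in> J" "F \<subseteq> J" "finite F" "F \<noteq> {}" "X = \<Union>F" "\<omega> X = 1" "\<not> (\<exists>Y\<in>F. \<omega> Y = 1)"
      unfolding Omega_set_def by blast
    have "\<omega>' \<notin> Omega_set" if c: "\<omega>' \<in> cyl (insert X F) \<omega>" for \<omega>'
    proof
      assume o: "\<omega>' \<in> Omega_set"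
      have "\<omega>' X = 1" using c XF(6) by (simp add: cyl_def)
      with o XF(1-5) obtain Y where Y: "Y \<in> F" "\<omega>' Y = 1" unfolding Omega_set_def by blast
      then have "\<omega> Y = 1" using c by (simp add: cyl_def)
      then show False using XF(7) Y(1) by blast
    qed
    then show ?thesis using XF(1-3) by (intro exI[of _ "insert X F"]) blast
  qed
qed

text \<open>Evaluation of ideals at \<open>x\<close>. It satisfies the covering condition too,
  because a point of a union lies in one of its members.\<close>

definition point_char :: "'a \<Rightarrow> 'a set \<Rightarrow> nat" where
  "point_char x = (\<lambda>X\<in>J. if x \<in> X then 1 else 0)"

lemma point_char_at: "X \<in> J \<Longrightarrow> point_char x X = (if x \<in> X then 1 else 0)"
  by (simp add: point_char_def)

lemma point_char_eq_1: "X \<in> J \<Longrightarrow> point_char x X = 1 \<longleftrightarrow> x \<in> X"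
  by (simp add: point_char_def)

lemma point_char_characters: "x \<in> P \<Longrightarrow> point_char x \<in> characters G P"
  unfolding characters_eq using constructible_ideals.top[of P G] constructible_ideals.empty[of G P] Int_J
  by (auto simp: point_char_def PiE_iff)

lemma point_char_Omega: "point_char x \<in> Omega_set"
  unfolding Omega_set_def
proof (intro CollectI ballI allI impI, elim conjE)
  fix X F assume X: "X \<in> J" and F: "F \<subseteq> J" "X = \<Union>F" "point_char x X = 1"
  then have "x \<in> \<Union>F" using point_char_eq_1[OF X] by simp
  then obtain Y where Y: "Y \<in> F" "x \<in> Y" by blast
  then have "point_char x Y = 1" using point_char_eq_1[OF subsetD[OF F(1) Y(1)]] by simp
  then show "\<exists>Y\<in>F. point_char x Y = 1" using Y(1) by blast
qed

section \<open>The partial action on the characters of points\<close>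

lemma implements_label: "implements_at G P g \<omega> s \<Longrightarrow> has_label g s"
  using hull_label[of s] group_label_eq[of _ s] unfolding implements_at_def by blast

lemma implementsI:
  "s \<in> S \<Longrightarrow> has_label g s \<Longrightarrow> s \<noteq> {} \<Longrightarrow> \<omega> (Domain s) = 1 \<Longrightarrow> implements_at G P g \<omega> s"
  unfolding implements_at_def using group_label_eq by blast

text \<open>The group elements of the arrows ending at the character of \<open>x\<close>, described
  inside the hull; the arrow with element g starts at the character of g^-1 x.\<close>

definition arrow_range :: "'a \<Rightarrow> 'a set" where
  "arrow_range x = {g. \<exists>s\<in>S. has_label g s \<and> x \<in> Range s}"

lemma act_domain_point_char:
  assumes "s \<in> S" "has_label g s" "x \<in> Domain s"
  shows "point_char x \<in> act_domain G P g"
proof -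
  have "x \<in> P" using assms(3) hull_carrier[OF assms(1)] by blast
  moreover have "implements_at G P g (point_char x) s"
    using assms by (intro implementsI) (auto simp: point_char_at hull_Domain_J)
  ultimately show ?thesis using point_char_characters by (auto simp: act_domain_def)
qed

text \<open>Whichever element of the hull the choice in \<open>act\<close> selects, it has label
  \<open>g\<close> and \<open>x\<close> in its domain, so it sends \<open>x\<close> to g x as
  well.\<close>

lemma act_point_char:
  assumes s: "s \<in> S" "has_label g s" "(x, y) \<in> s"
  shows "act G P g (point_char x) = point_char y"
proof -
  have x: "x \<in> Domain s" using s(3) by blast
  have y: "y = g \<otimes> x" using s(2,3) by (simp add: has_label_def)
  define s0 where "s0 = (SOME s. implements_at G P g (point_char x) s)"
  have "implements_at G P g (point_char x) s"
    using s x by (intro implementsI) (auto simp: point_char_at hull_Domain_J)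
  then have i: "implements_at G P g (point_char x) s0" unfolding s0_def by (rule someI)
  have s0: "s0 \<in> S" "has_label g s0" "x \<in> Domain s0"
    using i implements_label[OF i] hull_Domain_J[of s0] point_char_eq_1[of "Domain s0" x] unfolding implements_at_def by auto
  have xy: "(x, y) \<in> s0" using s0(2,3) y by (auto simp: has_label_def)
  have "act G P g (point_char x) = (\<lambda>X\<in>J. point_char x (s0\<inverse> `` (X \<inter> Range s0)))"
    by (simp add: act_def Let_def s0_def)
  also have "\<dots> = point_char y"
    unfolding point_char_def[of y]
  proof (rule restrict_ext)
    fix X assume X: "X \<in> J"
    have "s0\<inverse> `` (X \<inter> Range s0) \<in> J"
      by (intro hull_image_J hull_converse s0(1) Int_J X hull_Range_J)
    moreover have "x \<in> s0\<inverse> `` (X \<inter> Range s0) \<longleftrightarrow> y \<in> X"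
      using xy partial_bijD(3)[OF hull_partial_bij[OF s0(1)]] by auto
    ultimately show "point_char x (s0\<inverse> `` (X \<inter> Range s0)) = (if y \<in> X then 1 else 0)"
      by (simp add: point_char_at)
  qed
  finally show ?thesis .
qed

text \<open>For \<omega> moved to the character of x, the value \<omega> X = \<omega>(X \<inter> dom
  s) is the value of the latter at s X, so it tells whether x0 lies in \<open>X\<close>. Hence range
  fibres over characters of points contain only arrows that start at such characters.\<close>

lemma act_eq_point_char:
  assumes \<omega>: "\<omega> \<in> act_domain G P g" and eq: "act G P g \<omega> = point_char x"
  obtains x0 s where "s \<in> S" "has_label g s" "(x0, x) \<in> s" "\<omega> = point_char x0"
proof -
  define s where "s = (SOME s. implements_at G P g \<omega> s)"
  have w: "\<omega> \<in> characters G P" and "\<exists>s. implements_at G P g \<omega> s" using \<omega> by (auto simp: act_domain_def)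
  then have i: "implements_at G P g \<omega> s" unfolding s_def by (auto intro: someI)
  have s: "s \<in> S" "has_label g s" "\<omega> (Domain s) = 1"
    using i implements_label[OF i] by (auto simp: implements_at_def)
  note RJ = hull_Range_J[OF s(1)] and DJ = hull_Domain_J[OF s(1)]
  have act: "point_char x X = \<omega> (s\<inverse> `` (X \<inter> Range s))" if "X \<in> J" for X
    using fun_cong[OF eq, of X] that by (simp add: act_def Let_def s_def)
  have "s\<inverse> `` (Range s \<inter> Range s) = Domain s" by auto
  then have "point_char x (Range s) = 1" using act[OF RJ] s(3) by simp
  then have "x \<in> Range s" using point_char_eq_1[OF RJ] by simp
  then obtain x0 where x0: "(x0, x) \<in> s" by blast
  note pb = partial_bijD[OF hull_partial_bij[OF s(1)]]
  have "\<omega> X = point_char x0 X" if X: "X \<in> J" for X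
  proof -
    have XD: "X \<inter> Domain s \<in> J" by (rule Int_J[OF X DJ])
    have sX: "s `` X \<in> J" by (rule hull_image_J[OF s(1) X])
    have "\<omega> X = \<omega> X * \<omega> (Domain s)" using s(3) by simp
    also have "\<dots> = \<omega> (X \<inter> Domain s)" using w X DJ unfolding characters_def by auto
    also have "X \<inter> Domain s = s\<inverse> `` (s `` X \<inter> Range s)" using pb(4) by blast
    also have "\<omega> \<dots> = point_char x (s `` X)" by (rule act[OF sX, symmetric])
    also have "\<dots> = point_char x0 X"
    proof -
      have "x \<in> s `` X \<longleftrightarrow> x0 \<in> X" using x0 pb(4) by blast
      then show ?thesis by (simp add: point_char_at[OF sX] point_char_at[OF X])
    qed
    finally show ?thesis .
  qed
  moreover have "\<omega> \<in> extensional J" using characters_cube[OF w] by (simp add: PiE_def)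
  moreover have "point_char x0 \<in> extensional J" by (simp add: point_char_def)
  ultimately have "\<omega> = point_char x0" by (intro extensionalityI[of _ J]) auto
  then show thesis using that s(1,2) x0 by blast
qed

end

section \<open>Amenability yields approximately invariant means\<close>

context countable_subsemigroup begin

text \<open>Amenability is only evaluated on the arrows over the characters of points of the semigroup,
  which belong to both of the spaces in question.\<close>

lemma has_approx_means_if_amenable:
  assumes Z: "closedin cube Z" "Z \<subseteq> characters G P" and points: "\<And>x. x \<in> P \<Longrightarrow> point_char x \<in> Z"
    and amen: "etale_amenable (transformation_groupoid G (act_domain G P) (act G P) (subtopology cube Z))"
  shows has_approx_means
  unfolding has_approx_means_def
proof (intro allI impI)
  fix T :: "(('a \<times> 'a) set \<times> 'a) set" and \<epsilon> :: real
  assume T: "finite T" "\<forall>(s, h)\<in>T. s \<in> S \<and> has_label h s" and \<epsilon>: "0 < \<epsilon>"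
  let ?Y = "subtopology cube Z"
  let ?GG = "transformation_groupoid G (act_domain G P) (act G P) ?Y"
  let ?A = "arrows ?GG"
  have Tl: "s \<in> S" "has_label h s" if "(s, h) \<in> T" for s h using bspec[OF T(2) that] by auto
  have topZ: "topspace ?Y = Z" using closedin_subset[OF Z(1)] by (simp add: inf_absorb2)
  have A_def: "?A = subtopology (prod_topology (discrete_topology (carrier G)) ?Y) {(g, y). y \<in> act_domain G P g}"
    and units: "units ?GG = ?Y" and src: "src ?GG (g, y) = y" and rng: "rng ?GG (g, y) = act G P g y"
    and comp: "gcomp ?GG (g, y) (h, y') = (g \<otimes> h, y')" for g y h y'
    by (simp_all add: transformation_groupoid_def)
  have topA: "topspace ?A = {(g, y). g \<in> carrier G \<and> y \<in> Z \<and> y \<in> act_domain G P g}"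
    unfolding A_def using topZ by auto
  have embed: "continuous_map (subtopology cube B) ?A (\<lambda>\<omega>. (g, \<omega>))"
    if B: "B \<subseteq> Z" "B \<subseteq> act_domain G P g" and g: "g \<in> carrier G" for B g
    unfolding A_def
  proof (rule continuous_map_into_subtopology)
    show "continuous_map (subtopology cube B) (prod_topology (discrete_topology (carrier G)) ?Y) (\<lambda>\<omega>. (g, \<omega>))"
    proof (rule continuous_map_pairedI)
      show "continuous_map (subtopology cube B) (discrete_topology (carrier G)) (\<lambda>x. g)" using g by simp
      show "continuous_map (subtopology cube B) ?Y (\<lambda>x. x)"
        using B(1) by (intro continuous_map_into_subtopology continuous_map_from_subtopology) auto
    qed
    show "(\<lambda>\<omega>. (g, \<omega>)) \<in> topspace (subtopology cube B) \<rightarrow> {(g, y). y \<in> act_domain G P g}"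
      using B(2) by auto
  qed
  \<comment> \<open>A closed, hence compact, set of units on which \<open>s\<close> implements the
    action; its copy at a label of \<open>s\<close> is a compact set of arrows.\<close>
  define ZD where "ZD s = {\<omega> \<in> Z. \<omega> (Domain s) = 1}" for s :: "('a \<times> 'a) set"
  have val: "closedin cube {\<omega> \<in> topspace cube. \<omega> X = 1}" if X: "X \<in> J" for X
  proof (rule closedin_cubeI)
    fix \<omega> assume "\<omega> \<in> topspace cube" "\<omega> \<notin> {\<omega> \<in> topspace cube. \<omega> X = 1}"
    then show "\<exists>F. finite F \<and> F \<subseteq> J \<and> cyl F \<omega> \<inter> {\<omega> \<in> topspace cube. \<omega> X = 1} = {}"
      using X by (intro exI[of _ "{X}"]) (auto simp: cyl_def)
  qed blast
  have ZD: "closedin cube (ZD s)" "ZD s \<subseteq> Z" if s: "s \<in> S" for s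
  proof -
    have "ZD s = Z \<inter> {\<omega> \<in> topspace cube. \<omega> (Domain s) = 1}"
      unfolding ZD_def using closedin_subset[OF Z(1)] by blast
    then show "closedin cube (ZD s)" using closedin_Int[OF Z(1) val[OF hull_Domain_J[OF s]]] by simp
    show "ZD s \<subseteq> Z" by (auto simp: ZD_def)
  qed
  have ne_if: "s \<noteq> {}" if "\<omega> \<in> Z" "\<omega> (Domain s) = 1" for s \<omega>
  proof
    assume "s = {}"
    moreover have "\<omega> {} = 0" using subsetD[OF Z(2) that(1)] by (simp add: characters_def)
    ultimately show False using that(2) by simp
  qed
  have ZD_dom: "ZD s \<subseteq> act_domain G P g" if s: "s \<in> S" "has_label g s" for s g
  proof
    fix \<omega> assume w: "\<omega> \<in> ZD s"
    then have "implements_at G P g \<omega> s" using s ne_if[of \<omega> s] by (intro implementsI) (auto simp: ZD_def)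
    moreover have "\<omega> \<in> characters G P" using w subsetD[OF Z(2)] by (auto simp: ZD_def)
    ultimately show "\<omega> \<in> act_domain G P g" by (auto simp: act_domain_def)
  qed
  have embedZD: "continuous_map (subtopology cube (ZD s)) ?A (\<lambda>\<omega>. (g, \<omega>))" if s: "s \<in> S" "has_label g s" for s g
    using s(2) by (intro embed ZD(2)[OF s(1)] ZD_dom[OF s]) (simp add: has_label_def)
  have compactZD: "compactin (subtopology cube (ZD s)) (ZD s)" if s: "s \<in> S" for s
    using compact_if_closed[OF ZD(1)[OF s]] by (simp add: compactin_subtopology)
  \<comment> \<open>Invariance is requested on all arrows implemented by the pairs in
    \<open>T\<close>, in particular at the characters of all points in their domains.\<close>
  define KK where "KK = (\<Union>(s, h)\<in>T. (\<lambda>\<omega>. (h, \<omega>)) ` ZD s)"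
  have KK: "compactin ?A KK"
    unfolding KK_def
  proof (rule compactin_Union)
    show "finite ((\<lambda>(s, h). (\<lambda>\<omega>. (h, \<omega>)) ` ZD s) ` T)" using T(1) by simp
    fix U assume "U \<in> (\<lambda>(s, h). (\<lambda>\<omega>. (h, \<omega>)) ` ZD s) ` T"
    then obtain s h where sh: "(s, h) \<in> T" "U = (\<lambda>\<omega>. (h, \<omega>)) ` ZD s" by auto
    show "compactin ?A U"
      unfolding sh(2) by (rule image_compactin[OF compactZD[OF Tl(1)[OF sh(1)]] embedZD[OF Tl[OF sh(1)]]])
  qed
  have LL: "compactin (units ?GG) Z"
    unfolding units using compact_if_closed[OF Z(1)] by (simp add: compactin_subtopology)
  \<comment> \<open>The other half is reserved for making the functions simple afterwards.\<close>
  have "0 < \<epsilon> / 2" using \<epsilon> by simp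
  with amen LL KK have ex: "\<exists>f :: 'a \<times> ('a set \<Rightarrow> nat) \<Rightarrow> real.
          continuous_map ?A euclideanreal f \<and>
          (\<forall>\<gamma>\<in>topspace ?A. f \<gamma> \<ge> 0) \<and>
          (\<exists>C. compactin ?A C \<and> (\<forall>\<gamma>\<in>topspace ?A - C. f \<gamma> = 0)) \<and>
          (\<forall>x\<in>Z. \<bar>(\<Sum>\<^sub>\<infinity>\<beta>\<in>{\<beta>\<in>topspace ?A. rng ?GG \<beta> = x}. f \<beta>) - 1\<bar> < \<epsilon> / 2) \<and>
          (\<forall>\<gamma>\<in>KK. (\<Sum>\<^sub>\<infinity>\<beta>\<in>{\<beta>\<in>topspace ?A. rng ?GG \<beta> = src ?GG \<gamma>}.
                     \<bar>f (gcomp ?GG \<gamma> \<beta>) - f \<beta>\<bar>) < \<epsilon> / 2)"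
    unfolding etale_amenable_def by blast
  obtain f :: "'a \<times> ('a set \<Rightarrow> nat) \<Rightarrow> real" where f1: "continuous_map ?A euclideanreal f"
    and f2: "\<forall>\<gamma>\<in>topspace ?A. f \<gamma> \<ge> 0"
    and f3: "\<exists>C. compactin ?A C \<and> (\<forall>\<gamma>\<in>topspace ?A - C. f \<gamma> = 0)"
    and f4: "\<forall>x\<in>Z. \<bar>(\<Sum>\<^sub>\<infinity>\<beta>\<in>{\<beta>\<in>topspace ?A. rng ?GG \<beta> = x}. f \<beta>) - 1\<bar> < \<epsilon> / 2"
    and f5: "\<forall>\<gamma>\<in>KK. (\<Sum>\<^sub>\<infinity>\<beta>\<in>{\<beta>\<in>topspace ?A. rng ?GG \<beta> = src ?GG \<gamma>}.
                     \<bar>f (gcomp ?GG \<gamma> \<beta>) - f \<beta>\<bar>) < \<epsilon> / 2"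
    by (rule exE[OF ex]) (elim conjE, rule that; assumption)
  obtain C where C1: "compactin ?A C" and C2: "\<forall>\<gamma>\<in>topspace ?A - C. f \<gamma> = 0" using f3 by (elim exE conjE)
  note f = f1 bspec[OF f2] and sum1 = bspec[OF f4] and sum2 = bspec[OF f5]
  note C = C1 bspec[OF C2, OF DiffI]
  have gc: "g \<in> carrier G" if "g \<in> arrow_range x" for g x using that by (auto simp: arrow_range_def has_label_def)
  have source: "inv g \<otimes> x = x0" "x0 \<in> P" "x \<in> P" if "s \<in> S" "has_label g s" "(x0, x) \<in> s" for s g x0 x
  proof -
    show x: "x0 \<in> P" "x \<in> P" using hull_carrier[OF that(1,3)] by auto
    have "x = g \<otimes> x0" "g \<in> carrier G" using that(2,3) by (auto simp: has_label_def)
    then show "inv g \<otimes> x = x0" using P_carrier[OF x(1)] by (simp add: m_assoc[symmetric])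
  qed
  have range_source: "\<exists>s. s \<in> S \<and> has_label g s \<and> (inv g \<otimes> x, x) \<in> s" if g: "g \<in> arrow_range x" for g x
  proof -
    obtain s where s: "s \<in> S" "has_label g s" "x \<in> Range s" using g by (auto simp: arrow_range_def)
    then obtain x0 where "(x0, x) \<in> s" by blast
    then show ?thesis using s source(1)[OF s(1,2)] by metis
  qed
  have arrow_top: "(g, point_char (inv g \<otimes> x)) \<in> topspace ?A" "act G P g (point_char (inv g \<otimes> x)) = point_char x"
    if g: "g \<in> arrow_range x" for g x
  proof -
    obtain s where s: "s \<in> S" "has_label g s" "(inv g \<otimes> x, x) \<in> s" using range_source[OF g] by blast
    have "point_char (inv g \<otimes> x) \<in> act_domain G P g"
      using s(3) by (intro act_domain_point_char[OF s(1,2)]) blast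
    then show "(g, point_char (inv g \<otimes> x)) \<in> topspace ?A"
      unfolding topA using gc[OF g] points[OF source(2)[OF s]] by simp
    show "act G P g (point_char (inv g \<otimes> x)) = point_char x" by (rule act_point_char[OF s])
  qed
  have fibre: "{\<beta> \<in> topspace ?A. rng ?GG \<beta> = point_char x} = (\<lambda>g. (g, point_char (inv g \<otimes> x))) ` arrow_range x" for x
  proof (intro equalityI subsetI)
    fix \<beta> assume "\<beta> \<in> {\<beta> \<in> topspace ?A. rng ?GG \<beta> = point_char x}"
    then obtain g y where b: "\<beta> = (g, y)" "y \<in> act_domain G P g" "act G P g y = point_char x"
      unfolding topA using rng by (cases \<beta>) auto
    obtain x0 s where s: "s \<in> S" "has_label g s" "(x0, x) \<in> s" "y = point_char x0"
      by (rule act_eq_point_char[OF b(2,3)])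
    have "g \<in> arrow_range x" using s(1-3) by (auto simp: arrow_range_def)
    then show "\<beta> \<in> (\<lambda>g. (g, point_char (inv g \<otimes> x))) ` arrow_range x"
      using b(1) s(4) source(1)[OF s(1-3)] by (intro image_eqI[of _ _ g]) simp_all
  next
    fix \<beta> assume "\<beta> \<in> (\<lambda>g. (g, point_char (inv g \<otimes> x))) ` arrow_range x"
    then obtain g where "g \<in> arrow_range x" "\<beta> = (g, point_char (inv g \<otimes> x))" by blast
    then show "\<beta> \<in> {\<beta> \<in> topspace ?A. rng ?GG \<beta> = point_char x}" using arrow_top[of g x] rng by simp
  qed
  have infsum_fibre: "(\<Sum>\<^sub>\<infinity>\<beta>\<in>{\<beta> \<in> topspace ?A. rng ?GG \<beta> = point_char x}. \<phi> \<beta>) =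
      (\<Sum>\<^sub>\<infinity>g\<in>arrow_range x. \<phi> (g, point_char (inv g \<otimes> x)))" for \<phi> :: "_ \<Rightarrow> real" and x
  proof -
    have "inj_on (\<lambda>g. (g, point_char (inv g \<otimes> x))) (arrow_range x)" by (rule inj_onI) simp
    from infsum_reindex[OF this, of \<phi>] show ?thesis unfolding fibre by (simp add: comp_def)
  qed
  \<comment> \<open>The arrow with element \<open>g\<close> and range \<open>x\<close> has source
    g^-1 x. Where there is no such arrow the value is 0, which keeps sums over finite sets of group
    elements equal to sums over the fibre.\<close>
  define F where "F g x = (if x \<in> P \<and> g \<in> arrow_range x then f (g, point_char (inv g \<otimes> x)) else 0)" for g x
  have F0: "0 \<le> F g x" for g x using f(2)[OF arrow_top(1)] by (simp add: F_def)
  \<comment> \<open>The sets \<open>U s\<close> form an open cover of the arrows, so finitely many of them cover the support of \<open>f\<close>.\<close>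
  define U where "U s = topspace ?A \<inter> {(g, y). has_label g s \<and> y (Domain s) = 1}" for s
  have U_open: "openin ?A (U s)" if s: "s \<in> S" "s \<noteq> {}" for s
  proof -
    obtain g where g: "has_label g s" using hull_label[OF s(1)] by blast
    then have gcar: "g \<in> carrier G" by (simp add: has_label_def)
    have uniq: "h = g" if "has_label h s" for h using group_label_eq[OF g s] group_label_eq[OF that s] by simp
    have "openin cube {\<omega> \<in> topspace cube. \<omega> (Domain s) = 1}"
    proof (rule openin_cubeI)
      fix \<omega> assume "\<omega> \<in> {\<omega> \<in> topspace cube. \<omega> (Domain s) = 1}"
      then show "\<exists>F. finite F \<and> F \<subseteq> J \<and> cyl F \<omega> \<subseteq> {\<omega> \<in> topspace cube. \<omega> (Domain s) = 1}"
        using hull_Domain_J[OF s(1)] by (intro exI[of _ "{Domain s}"]) (auto simp: cyl_def)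
    qed blast
    then have "openin ?Y ({\<omega> \<in> topspace cube. \<omega> (Domain s) = 1} \<inter> Z)"
      unfolding openin_subtopology by blast
    moreover have "openin (discrete_topology (carrier G)) {g}" using gcar by simp
    ultimately have op: "openin (prod_topology (discrete_topology (carrier G)) ?Y) ({g} \<times> ({\<omega> \<in> topspace cube. \<omega> (Domain s) = 1} \<inter> Z))"
      by (simp add: openin_prod_Times_iff)
    have "U s = ({g} \<times> ({\<omega> \<in> topspace cube. \<omega> (Domain s) = 1} \<inter> Z)) \<inter> {(g, y). y \<in> act_domain G P g}"
    proof (rule Set.set_eqI)
      fix p :: "'a \<times> ('a set \<Rightarrow> nat)"
      obtain h y where p: "p = (h, y)" by (cases p)
      have yt: "y \<in> Z \<Longrightarrow> y \<in> topspace cube" by (rule subsetD[OF closedin_subset[OF Z(1)]])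
      have "p \<in> U s \<longleftrightarrow> (h \<in> carrier G \<and> y \<in> Z \<and> y \<in> act_domain G P h) \<and> has_label h s \<and> y (Domain s) = 1"
        unfolding U_def topA p by simp
      also have "\<dots> \<longleftrightarrow> h = g \<and> (y \<in> topspace cube \<and> y (Domain s) = 1) \<and> y \<in> Z \<and> y \<in> act_domain G P h"
      proof (cases "h = g")
        case True
        then show ?thesis using g gcar yt by (simp only: simp_thms) blast
      next
        case False
        then have "\<not> has_label h s" using uniq by blast
        then show ?thesis using False by (simp only: simp_thms)
      qed
      also have "\<dots> \<longleftrightarrow> p \<in> ({g} \<times> ({\<omega> \<in> topspace cube. \<omega> (Domain s) = 1} \<inter> Z)) \<inter> {(g, y). y \<in> act_domain G P g}"
        unfolding p by (simp only: Int_iff mem_Times_iff mem_Collect_eq fst_conv snd_conv singleton_iff prod.case) blast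
      finally show "p \<in> U s \<longleftrightarrow> p \<in> ({g} \<times> ({\<omega> \<in> topspace cube. \<omega> (Domain s) = 1} \<inter> Z)) \<inter> {(g, y). y \<in> act_domain G P g}" .
    qed
    then show ?thesis unfolding A_def openin_subtopology using op by blast
  qed
  have "\<exists>\<U>. finite \<U> \<and> \<U> \<subseteq> U ` {s \<in> S. s \<noteq> {}} \<and> C \<subseteq> \<Union>\<U>"
  proof (rule compactinD[OF C(1)])
    show "openin ?A V" if "V \<in> U ` {s \<in> S. s \<noteq> {}}" for V using that U_open by blast
    show "C \<subseteq> \<Union>(U ` {s \<in> S. s \<noteq> {}})"
    proof
      fix \<gamma> assume "\<gamma> \<in> C"
      then have gt: "\<gamma> \<in> topspace ?A" using subsetD[OF compactin_subset_topspace[OF C(1)]] by blast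
      obtain g y where gy: "\<gamma> = (g, y)" by (cases \<gamma>)
      then have "y \<in> act_domain G P g" using gt topA by auto
      then obtain s where s: "implements_at G P g y s" by (auto simp: act_domain_def)
      then have "\<gamma> \<in> U s" using gt gy implements_label[OF s] unfolding U_def by (auto simp: implements_at_def)
      then show "\<gamma> \<in> \<Union>(U ` {s \<in> S. s \<noteq> {}})" using s unfolding implements_at_def by blast
    qed
  qed
  then obtain \<U> where \<U>: "finite \<U>" "\<U> \<subseteq> U ` {s \<in> S. s \<noteq> {}}" "C \<subseteq> \<Union>\<U>" by (elim exE conjE)
  obtain \<Sigma> where \<Sigma>: "\<Sigma> \<subseteq> {s \<in> S. s \<noteq> {}}" "finite \<Sigma>" "\<U> = U ` \<Sigma>"
    using finite_subset_image[OF \<U>(1,2)] by (elim exE conjE)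
  have \<Sigma>S: "s \<in> S" "s \<noteq> {}" if "s \<in> \<Sigma>" for s using subsetD[OF \<Sigma>(1) that] by auto
  \<comment> \<open>An arrow where \<open>f\<close> does not vanish lies in some \<open>U s\<close>
    of the finite cover; its source is then in the domain of \<open>s\<close>, and its range in the
    range of \<open>s\<close>.\<close>
  have supp: "\<exists>s\<in>\<Sigma>. has_label g s \<and> x \<in> Range s" if nz: "F g x \<noteq> 0" for g x
  proof -
    have g: "x \<in> P" "g \<in> arrow_range x" and fnz: "f (g, point_char (inv g \<otimes> x)) \<noteq> 0"
      using nz by (auto simp: F_def split: if_splits)
    have "(g, point_char (inv g \<otimes> x)) \<in> C"
      by (rule ccontr) (use C(2)[OF arrow_top(1)[OF g(2)]] fnz in simp)
    then have "(g, point_char (inv g \<otimes> x)) \<in> \<Union>(U ` \<Sigma>)"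
      using subsetD[OF \<U>(3)] unfolding \<Sigma>(3) by simp
    then obtain s where s: "s \<in> \<Sigma>" "(g, point_char (inv g \<otimes> x)) \<in> U s" by blast
    have lab: "has_label g s" and "point_char (inv g \<otimes> x) (Domain s) = 1" using s(2) by (auto simp: U_def)
    then have "inv g \<otimes> x \<in> Domain s" using point_char_eq_1[OF hull_Domain_J[OF \<Sigma>S(1)[OF s(1)]]] by simp
    then obtain y where y: "(inv g \<otimes> x, y) \<in> s" by blast
    then have "y = g \<otimes> (inv g \<otimes> x)" using lab by (simp add: has_label_def)
    also have "\<dots> = x" using gc[OF g(2)] P_carrier[OF g(1)] by (simp add: m_assoc[symmetric])
    finally show ?thesis using y lab s(1) by blast
  qed
  define K where "K = group_label G ` \<Sigma>"
  have K: "finite K" "K \<subseteq> carrier G"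
  proof -
    show "finite K" using \<Sigma>(2) by (simp add: K_def)
    show "K \<subseteq> carrier G"
    proof
      fix g assume "g \<in> K"
      then obtain s where s: "s \<in> \<Sigma>" "g = group_label G s" by (auto simp: K_def)
      obtain h where "has_label h s" using hull_label[OF \<Sigma>S(1)[OF s(1)]] by blast
      then show "g \<in> carrier G" using group_label_eq[OF _ \<Sigma>S[OF s(1)]] s(2) by (auto simp: has_label_def)
    qed
  qed
  have FK: "F g x = 0" if "g \<notin> K" for g x
  proof (rule ccontr)
    assume "F g x \<noteq> 0"
    then obtain s where s: "s \<in> \<Sigma>" "has_label g s" using supp by blast
    then have "g = group_label G s" using group_label_eq[OF s(2) \<Sigma>S[OF s(1)]] by simp
    then show False using that s(1) by (simp add: K_def)
  qed
  have one: "\<bar>(\<Sum>g\<in>K. F g x) - 1\<bar> < \<epsilon> / 2" if x: "x \<in> P" for x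
  proof -
    have "(\<Sum>\<^sub>\<infinity>g\<in>arrow_range x. f (g, point_char (inv g \<otimes> x))) = (\<Sum>\<^sub>\<infinity>g\<in>K. F g x)"
    proof (rule infsum_cong_neutral)
      show "F g x = 0" if "g \<in> K - arrow_range x" for g using that by (simp add: F_def)
      show "f (g, point_char (inv g \<otimes> x)) = 0" if "g \<in> arrow_range x - K" for g
        using that FK[of g x] x by (simp add: F_def)
      show "f (g, point_char (inv g \<otimes> x)) = F g x" if "g \<in> arrow_range x \<inter> K" for g
        using that x by (simp add: F_def)
    qed
    also have "\<dots> = (\<Sum>g\<in>K. F g x)" using K(1) by simp
    finally show ?thesis using sum1[OF points[OF x]] unfolding infsum_fibre by simp
  qed
  have inv_est: "(\<Sum>g\<in>K'. \<bar>F (h \<otimes> g) y - F g x\<bar>) \<le> \<epsilon> / 2"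
    if t: "(t, h) \<in> T" "(x, y) \<in> t" and K': "finite K'" "K' \<subseteq> carrier G" for t h x y K'
  proof -
    note tS = Tl[OF t(1)]
    have hc: "h \<in> carrier G" using tS(2) by (simp add: has_label_def)
    have xy: "x \<in> P" "y \<in> P" using hull_carrier[OF tS(1) t(2)] by auto
    have yx: "y = h \<otimes> x" using tS(2) t(2) by (simp add: has_label_def)
    \<comment> \<open>Left composition with the arrow of \<open>h\<close> at \<open>x\<close>
      carries the range fibre of \<open>x\<close> onto that of \<open>y\<close>; either direction is
      a product in the hull.\<close>
    have ar: "g \<in> arrow_range x \<longleftrightarrow> h \<otimes> g \<in> arrow_range y" if g: "g \<in> carrier G" for g
    proof
      assume "g \<in> arrow_range x"
      then obtain s where s: "s \<in> S" "has_label g s" "(inv g \<otimes> x, x) \<in> s" using range_source by blast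
      have "has_label (h \<otimes> g) (s O t)"
        unfolding has_label_def
      proof (intro conjI allI impI)
        show "h \<otimes> g \<in> carrier G" using hc g by simp
        fix u v assume "(u, v) \<in> s O t"
        then obtain w where w: "(u, w) \<in> s" "(w, v) \<in> t" by blast
        then show "v = h \<otimes> g \<otimes> u"
          using s(2) tS(2) hc g hull_carrier[OF s(1) w(1)] P_carrier by (auto simp: has_label_def m_assoc)
      qed
      moreover have "s O t \<in> S" by (rule hull_product[OF tS(1) s(1)])
      moreover have "y \<in> Range (s O t)" using relcompI[OF s(3) t(2)] by blast
      ultimately show "h \<otimes> g \<in> arrow_range y" by (auto simp: arrow_range_def)
    next
      assume "h \<otimes> g \<in> arrow_range y"
      then obtain s where s: "s \<in> S" "has_label (h \<otimes> g) s" "(inv (h \<otimes> g) \<otimes> y, y) \<in> s" using range_source by blast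
      have "has_label g (s O t\<inverse>)"
        unfolding has_label_def
      proof (intro conjI allI impI)
        show "g \<in> carrier G" by (rule g)
        fix u v assume "(u, v) \<in> s O t\<inverse>"
        then obtain w where w: "(u, w) \<in> s" "(v, w) \<in> t" by blast
        have uv: "u \<in> carrier G" "v \<in> carrier G"
          using hull_carrier[OF s(1) w(1)] hull_carrier[OF tS(1) w(2)] P_carrier by auto
        have "w = h \<otimes> g \<otimes> u" using s(2) w(1) by (simp add: has_label_def)
        moreover have "w = h \<otimes> v" using tS(2) w(2) by (simp add: has_label_def)
        ultimately have "h \<otimes> v = h \<otimes> (g \<otimes> u)" using hc g uv by (simp add: m_assoc)
        then show "v = g \<otimes> u" using hc g uv by simp
      qed
      moreover have "s O t\<inverse> \<in> S" by (rule hull_product[OF hull_converse[OF tS(1)] s(1)])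
      moreover have "x \<in> Range (s O t\<inverse>)" using relcompI[OF s(3), of x "t\<inverse>"] t(2) by blast
      ultimately show "g \<in> arrow_range x" by (auto simp: arrow_range_def)
    qed
    have shift_eq: "inv (h \<otimes> g) \<otimes> y = inv g \<otimes> x" if "g \<in> carrier G" for g
      using that hc P_carrier[OF xy(1)] by (simp add: yx inv_mult_group m_assoc) (simp add: m_assoc[symmetric])
    have Fh: "F (h \<otimes> g) y = f (h \<otimes> g, point_char (inv g \<otimes> x))" if "g \<in> arrow_range x" for g
      using ar[OF gc[OF that]] that xy shift_eq[OF gc[OF that]] by (simp add: F_def)
    have Fg: "F g x = f (g, point_char (inv g \<otimes> x))" if "g \<in> arrow_range x" for g
      using that xy by (simp add: F_def)
    let ?d = "\<lambda>g. \<bar>F (h \<otimes> g) y - F g x\<bar>"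
    have xt: "point_char x \<in> ZD t"
      using points[OF xy(1)] t(2) point_char_eq_1[OF hull_Domain_J[OF tS(1)], of x] by (auto simp: ZD_def)
    have mem: "(h, point_char x) \<in> KK" unfolding KK_def using t(1) xt by blast
    have "(\<Sum>\<^sub>\<infinity>g\<in>arrow_range x. \<bar>f (gcomp ?GG (h, point_char x) (g, point_char (inv g \<otimes> x))) - f (g, point_char (inv g \<otimes> x))\<bar>) < \<epsilon> / 2"
      using sum2[OF mem] unfolding src infsum_fibre .
    also have "(\<Sum>\<^sub>\<infinity>g\<in>arrow_range x. \<bar>f (gcomp ?GG (h, point_char x) (g, point_char (inv g \<otimes> x))) - f (g, point_char (inv g \<otimes> x))\<bar>) =
        (\<Sum>\<^sub>\<infinity>g\<in>arrow_range x. ?d g)"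
      by (rule infsum_cong) (simp only: comp Fh Fg)
    finally have lt: "(\<Sum>\<^sub>\<infinity>g\<in>arrow_range x. ?d g) < \<epsilon> / 2" .
    have fin: "finite {g \<in> arrow_range x. ?d g \<noteq> 0}"
    proof (rule finite_subset)
      show "{g \<in> arrow_range x. ?d g \<noteq> 0} \<subseteq> K \<union> (\<lambda>g. inv h \<otimes> g) ` K"
      proof
        fix g assume g: "g \<in> {g \<in> arrow_range x. ?d g \<noteq> 0}"
        then have "g \<in> carrier G" using gc by blast
        then have "g = inv h \<otimes> (h \<otimes> g)" using hc by (simp add: m_assoc[symmetric])
        moreover have "g \<in> K \<or> h \<otimes> g \<in> K"
        proof (rule ccontr)
          assume "\<not> ?thesis"
          then have "F g x = 0" "F (h \<otimes> g) y = 0" using FK by simp_all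
          then show False using g by simp
        qed
        ultimately show "g \<in> K \<union> (\<lambda>g. inv h \<otimes> g) ` K" by blast
      qed
    qed (use K(1) in simp)
    have summ: "?d summable_on arrow_range x" by (rule finite_nonzero_values_imp_summable_on[OF fin])
    have "(\<Sum>g\<in>K'. ?d g) = (\<Sum>g\<in>K' \<inter> arrow_range x. ?d g)"
    proof (rule sum.mono_neutral_right[OF K'(1)])
      show "\<forall>g\<in>K' - K' \<inter> arrow_range x. ?d g = 0"
      proof
        fix g assume g: "g \<in> K' - K' \<inter> arrow_range x"
        then have "g \<in> carrier G" using subsetD[OF K'(2)] by blast
        then show "?d g = 0" using ar[of g] g by (simp add: F_def)
      qed
    qed blast
    also have "\<dots> \<le> (\<Sum>\<^sub>\<infinity>g\<in>arrow_range x. ?d g)"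
      using K'(1) by (intro finite_sum_le_infsum[OF summ]) auto
    finally show ?thesis using lt by simp
  qed
  \<comment> \<open>Replacing both values of \<open>F\<close> affects at most card K terms each, at
    a total cost of 2 card K \<delta>. The 4 brings this below \<epsilon>/2, and the added 1 covers
    empty \<open>K\<close>.\<close>
  define \<delta> where "\<delta> = \<epsilon> / (4 * (real (card K) + 1))"
  have \<delta>: "0 < \<delta>" "2 * real (card K) * \<delta> \<le> \<epsilon> / 2"
    using \<epsilon> by (simp_all add: \<delta>_def field_simps)
  have "\<exists>F. finite F \<and> F \<subseteq> J \<and> (\<forall>\<omega>\<in>ZD s. \<forall>\<omega>'\<in>ZD s. (\<forall>X\<in>F. \<omega> X = \<omega>' X) \<longrightarrow>
      \<bar>f (group_label G s, \<omega>) - f (group_label G s, \<omega>')\<bar> < \<delta>)" if s: "s \<in> \<Sigma>" for s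
  proof -
    obtain g where g: "has_label g s" using hull_label[OF \<Sigma>S(1)[OF s]] by blast
    then have gl: "group_label G s = g" by (rule group_label_eq[OF _ \<Sigma>S[OF s]])
    have cont: "continuous_map (subtopology cube (ZD s)) euclideanreal (\<lambda>\<omega>. f (g, \<omega>))"
      using continuous_map_compose[OF embedZD[OF \<Sigma>S(1)[OF s] g] f(1)] by (simp add: comp_def)
    show ?thesis
    proof (rule uniform_on_cylinders[OF ZD(1)[OF \<Sigma>S(1)[OF s]] cont \<delta>(1)])
      fix F assume F: "finite F" "F \<subseteq> J"
        and c: "\<And>\<omega> \<omega>'. \<omega> \<in> ZD s \<Longrightarrow> \<omega>' \<in> ZD s \<Longrightarrow> (\<And>X. X \<in> F \<Longrightarrow> \<omega> X = \<omega>' X) \<Longrightarrow> \<bar>f (g, \<omega>) - f (g, \<omega>')\<bar> < \<delta>"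
      show ?thesis
        unfolding gl by (intro exI[of _ F] conjI F ballI impI c) simp_all
    qed
  qed
  then obtain \<F>0 where \<F>0: "\<And>s. s \<in> \<Sigma> \<Longrightarrow> finite (\<F>0 s)" "\<And>s. s \<in> \<Sigma> \<Longrightarrow> \<F>0 s \<subseteq> J"
    "\<And>s \<omega> \<omega>'. s \<in> \<Sigma> \<Longrightarrow> \<omega> \<in> ZD s \<Longrightarrow> \<omega>' \<in> ZD s \<Longrightarrow> \<forall>X\<in>\<F>0 s. \<omega> X = \<omega>' X \<Longrightarrow>
      \<bar>f (group_label G s, \<omega>) - f (group_label G s, \<omega>')\<bar> < \<delta>"
    by metis
  \<comment> \<open>Up to \<delta> the value of \<open>f\<close> depends on the source of the arrow
    only through the ideals in \<open>\<F>0 s\<close>. Their images under \<open>s\<close> express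
    the same conditions at the range, and the sets \<open>Range s\<close> decide which elements of
    \<open>\<Sigma>\<close> are available.\<close>
  define \<F> where "\<F> = Range ` \<Sigma> \<union> (\<Union>s\<in>\<Sigma>. (\<lambda>X. s `` X) ` \<F>0 s)"
  have \<F>: "finite \<F>" "\<F> \<subseteq> J"
  proof -
    show "finite \<F>" using \<Sigma>(2) \<F>0(1) by (simp add: \<F>_def)
    show "\<F> \<subseteq> J"
    proof
      fix X assume "X \<in> \<F>"
      then consider s where "s \<in> \<Sigma>" "X = Range s" | s Y where "s \<in> \<Sigma>" "Y \<in> \<F>0 s" "X = s `` Y"
        by (auto simp: \<F>_def)
      then show "X \<in> J"
      proof cases
        case 1
        then show ?thesis using hull_Range_J[OF \<Sigma>S(1)] by simp
      next
        case 2
        then show ?thesis using hull_image_J[OF \<Sigma>S(1)[OF 2(1)] subsetD[OF \<F>0(2)[OF 2(1)] 2(2)]] by simp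
      qed
    qed
  qed
  have close: "\<bar>F g x - F g y\<bar> \<le> \<delta>" if xy: "x \<in> P" "y \<in> P" and pat: "\<And>X. X \<in> \<F> \<Longrightarrow> x \<in> X \<longleftrightarrow> y \<in> X" for g x y
  proof (cases "\<exists>s\<in>\<Sigma>. has_label g s \<and> x \<in> Range s")
    case False
    moreover have "x \<in> Range s \<longleftrightarrow> y \<in> Range s" if "s \<in> \<Sigma>" for s
      using that by (intro pat) (simp add: \<F>_def)
    ultimately have "F g x = 0" "F g y = 0" using supp[of g x] supp[of g y] by blast+
    then show ?thesis using \<delta>(1) by simp
  next
    case True
    then obtain s where s: "s \<in> \<Sigma>" "has_label g s" "x \<in> Range s" by blast
    note sS = \<Sigma>S(1)[OF s(1)] and pb = partial_bijD[OF hull_partial_bij[OF \<Sigma>S(1)[OF s(1)]]]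
    have "y \<in> Range s" using s(1,3) pat[of "Range s"] by (simp add: \<F>_def)
    then obtain x0 y0 where x0: "(x0, x) \<in> s" and y0: "(y0, y) \<in> s" using s(3) by blast
    have ix: "inv g \<otimes> x = x0" "inv g \<otimes> y = y0" using source(1)[OF sS s(2)] x0 y0 by auto
    have P0: "x0 \<in> P" "y0 \<in> P" using source(2)[OF sS s(2)] x0 y0 by auto
    have "g \<in> arrow_range x" "g \<in> arrow_range y" using sS s(2) x0 y0 by (auto simp: arrow_range_def)
    then have F_eq: "F g x = f (g, point_char x0)" "F g y = f (g, point_char y0)" using xy ix by (simp_all add: F_def)
    have zd: "point_char x0 \<in> ZD s" "point_char y0 \<in> ZD s"
      using points P0 x0 y0 point_char_eq_1[OF hull_Domain_J[OF sS]] by (auto simp: ZD_def)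
    have "\<forall>X\<in>\<F>0 s. point_char x0 X = point_char y0 X"
    proof
      fix X assume X: "X \<in> \<F>0 s"
      have XJ: "X \<in> J" using subsetD[OF \<F>0(2)[OF s(1)] X] .
      have "x0 \<in> X \<longleftrightarrow> x \<in> s `` X" using x0 pb(4) by blast
      also have "\<dots> \<longleftrightarrow> y \<in> s `` X" using s(1) X by (intro pat) (auto simp: \<F>_def)
      also have "\<dots> \<longleftrightarrow> y0 \<in> X" using y0 pb(4) by blast
      finally show "point_char x0 X = point_char y0 X" by (simp add: point_char_at[OF XJ])
    qed
    from \<F>0(3)[OF s(1) zd this] show ?thesis
      unfolding F_eq group_label_eq[OF s(2) \<Sigma>S[OF s(1)]] by simp
  qed
  \<comment> \<open>Evaluation at the representative of the atom makes the functions exactly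
    measurable for \<open>\<F>\<close>; the price is \<delta>, and only for \<open>g\<close> in
    \<open>K\<close>.\<close>
  define F' where "F' g x = F g (atom_rep \<F> x)" for g x
  have F'_close: "\<bar>F' g x - F g x\<bar> \<le> (if g \<in> K then \<delta> else 0)" if x: "x \<in> P" for g x
  proof (cases "g \<in> K")
    case True
    then show ?thesis
      using close[OF atom_rep(1)[OF x, of \<F>] x atom_rep(2)[OF x], of g] by (simp add: F'_def)
  next
    case False
    then show ?thesis using FK by (simp add: F'_def)
  qed
  have "approx_mean T \<epsilon> K \<Sigma> \<F> F'"
    unfolding approx_mean_def
  proof (intro conjI allI impI ballI)
    show "finite K" "K \<subseteq> carrier G" "finite \<F>" "\<F> \<subseteq> J" "finite \<Sigma>" by (fact K \<F> \<Sigma>)+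
    show "\<Sigma> \<subseteq> S" using \<Sigma>S by blast
    show "0 \<le> F' g x" for g x by (simp add: F'_def F0)
    show "F' g x = 0" if "g \<notin> K" for g x using FK[OF that] by (simp add: F'_def)
    show "measurable_wrt \<F> (F' g)" for g
      using measurable_atom_rep[of \<F> "F g"] by (simp add: F'_def[abs_def])
    show "\<exists>s\<in>\<Sigma>. has_label g s \<and> x \<in> Range s" if xP: "x \<in> P" and nz: "F' g x \<noteq> 0" for g x
    proof -
      obtain s where s: "s \<in> \<Sigma>" "has_label g s" "atom_rep \<F> x \<in> Range s" using supp[OF nz[unfolded F'_def]] by blast
      have "Range s \<in> \<F>" using s(1) by (simp add: \<F>_def)
      then show ?thesis using s atom_rep(2)[OF xP] by blast
    qed
    show "\<bar>(\<Sum>g\<in>K. F' g x) - 1\<bar> \<le> \<epsilon>" if "x \<in> P" for x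
      using one[OF atom_rep(1)[OF that, of \<F>]] \<epsilon> by (simp add: F'_def)
    fix th assume th: "th \<in> T"
    obtain t h where th': "th = (t, h)" by (cases th)
    have tT: "(t, h) \<in> T" using th th' by simp
    note tS = Tl[OF tT]
    have hc: "h \<in> carrier G" using tS(2) by (simp add: has_label_def)
    have "(\<Sum>g\<in>K'. \<bar>F' (h \<otimes> g) y - F' g x\<bar>) \<le> \<epsilon>"
      if xy: "(x, y) \<in> t" and K': "finite K'" "K' \<subseteq> carrier G" for x y K'
    proof -
      have P: "x \<in> P" "y \<in> P" using hull_carrier[OF tS(1) xy] by auto
      have "(\<Sum>g\<in>K'. \<bar>F' (h \<otimes> g) y - F' g x\<bar>) \<le>
          (\<Sum>g\<in>K'. \<bar>F (h \<otimes> g) y - F g x\<bar> + (if h \<otimes> g \<in> K then \<delta> else 0) + (if g \<in> K then \<delta> else 0))"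
      proof (rule sum_mono)
        fix g
        show "\<bar>F' (h \<otimes> g) y - F' g x\<bar> \<le> \<bar>F (h \<otimes> g) y - F g x\<bar> + (if h \<otimes> g \<in> K then \<delta> else 0) + (if g \<in> K then \<delta> else 0)"
          using F'_close[OF P(2), of "h \<otimes> g"] F'_close[OF P(1), of g] by linarith
      qed
      also have "\<dots> = (\<Sum>g\<in>K'. \<bar>F (h \<otimes> g) y - F g x\<bar>) + (\<Sum>g\<in>K'. if h \<otimes> g \<in> K then \<delta> else 0) + (\<Sum>g\<in>K'. if g \<in> K then \<delta> else 0)"
        by (simp only: sum.distrib)
      also have "\<dots> \<le> \<epsilon> / 2 + real (card K) * \<delta> + real (card K) * \<delta>"
      proof (intro add_mono)
        show "(\<Sum>g\<in>K'. \<bar>F (h \<otimes> g) y - F g x\<bar>) \<le> \<epsilon> / 2" by (rule inv_est[OF tT xy K'])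
        \<comment> \<open>An injective map takes values in \<open>K\<close> for at most card K
          arguments, however large \<open>K'\<close> is; so the error is uniform in
          \<open>K'\<close>.\<close>
        have count: "(\<Sum>g\<in>K'. if m g \<in> K then \<delta> else 0) \<le> real (card K) * \<delta>" if inj: "inj_on m K'" for m
        proof -
          have "(\<Sum>g\<in>K'. if m g \<in> K then \<delta> else 0) = (\<Sum>g\<in>{g \<in> K'. m g \<in> K}. \<delta>)"
            by (rule sum.inter_filter[OF K'(1), symmetric])
          also have "\<dots> = real (card {g \<in> K'. m g \<in> K}) * \<delta>" by simp
          also have "\<dots> \<le> real (card K) * \<delta>"
          proof (rule mult_right_mono)
            have "card {g \<in> K'. m g \<in> K} = card (m ` {g \<in> K'. m g \<in> K})"
              by (rule card_image[symmetric]) (rule inj_on_subset[OF inj], blast)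
            also have "\<dots> \<le> card K" by (rule card_mono[OF K(1)]) blast
            finally show "real (card {g \<in> K'. m g \<in> K}) \<le> real (card K)" by simp
          qed (use \<delta> in simp)
          finally show ?thesis .
        qed
        show "(\<Sum>g\<in>K'. if h \<otimes> g \<in> K then \<delta> else 0) \<le> real (card K) * \<delta>"
        proof (rule count[of "\<lambda>g. h \<otimes> g"], rule inj_onI)
          fix a b assume ab: "a \<in> K'" "b \<in> K'" "h \<otimes> a = h \<otimes> b"
          have "a \<in> carrier G" "b \<in> carrier G" using subsetD[OF K'(2) ab(1)] subsetD[OF K'(2) ab(2)] by auto
          then show "a = b" using ab(3) hc by simp
        qed
        show "(\<Sum>g\<in>K'. if g \<in> K then \<delta> else 0) \<le> real (card K) * \<delta>"
          using count[of "\<lambda>g. g"] by simp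
      qed
      also have "\<dots> \<le> \<epsilon>" using \<delta>(2) by (simp only: mult.assoc)
      finally show ?thesis .
    qed
    then show "case th of (s, h) \<Rightarrow> \<forall>(x, y)\<in>s. \<forall>K'. finite K' \<longrightarrow> K' \<subseteq> carrier G \<longrightarrow> (\<Sum>g\<in>K'. \<bar>F' (h \<otimes> g) y - F' g x\<bar>) \<le> \<epsilon>"
      unfolding th' by auto
  qed
  then show "\<exists>K \<Sigma> \<F> F. approx_mean T \<epsilon> K \<Sigma> \<F> F" by blast
qed

lemma has_approx_means_character_space:
  assumes "etale_amenable (transformation_groupoid G (act_domain G P) (act G P) (character_space G P))"
  shows has_approx_means
  by (rule has_approx_means_if_amenable[OF closedin_characters])
    (use assms point_char_characters in \<open>auto simp: character_space_def\<close>)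

lemma has_approx_means_Omega_space:
  assumes "etale_amenable (transformation_groupoid G (act_domain G P) (act G P) (Omega_space G P))"
  shows has_approx_means
proof (rule has_approx_means_if_amenable[OF closedin_Omega])
  have "Omega_space G P = subtopology cube (characters G P \<inter> Omega_set)"
    by (simp add: Omega_space_def character_space_def subtopology_subtopology Omega_set_def)
  with assms show "etale_amenable (transformation_groupoid G (act_domain G P) (act G P) (subtopology cube (characters G P \<inter> Omega_set)))"
    by simp
qed (use point_char_characters point_char_Omega in auto)

end

theorem theorem3p14:
  fixes G :: "('g, 'b) monoid_scheme" and P :: "'g set"
  assumes "group G" and "countable (carrier G)" and "subsemigroup G P"
    and "etale_amenable
           (transformation_groupoid G (act_domain G P) (act G P) (character_space G P)) \<or>
         etale_amenable
           (transformation_groupoid G (act_domain G P) (act G P) (Omega_space G P))"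
  shows "star_iso (full_semigroup_cstar G P) (reduced_semigroup_cstar G P) (canonical_hom G P) \<longleftrightarrow>
         independent_semigroup G P"
proof -
  interpret countable_subsemigroup G P
    using assms(1-3)
    by (simp add: countable_subsemigroup_def countable_subsemigroup_axioms_def
        subsemigroup_of_group_def subsemigroup_of_group_axioms_def)
  show ?thesis
  proof
    assume "star_iso Full Red (canonical_hom G P)"
    then show "independent_semigroup G P"
      by (intro independent_if_injective) (simp add: star_iso_def bij_betw_def)
  next
    assume "independent_semigroup G P"
    moreover have has_approx_means
      using assms(4) has_approx_means_character_space has_approx_means_Omega_space by blast
    ultimately show "star_iso Full Red (canonical_hom G P)" by (rule star_iso_if_independent)
  qed
qed

end
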